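(* Let $L>0$, $n\ge 1$, $\gamma_1,\dots,\gamma_n>0$, and let $f_1,\dots,f_n$ be linear coupling terms $f_i(u_1,\dots,u_n)=\sum_{j=1}^n p^i_j\,\partial_x u_j+\sum_{j=1}^n q^i_j\,u_j$ satisfying the standing assumptions listed in the context. Let $I\subset\mathbb{R}$ be an open interval such that $\omega:= I\cap[0,L]\neq\emptyset$. Then for all $T>0$ large enough (i.e. there is $T_0>0$ such that for every $T\ge T_0$) the following holds: if $(u_1,\dots,u_n)$, with $u_i\in C([0,T];H^1_0(0,L))\cap C^1([0,T];L^2(0,L))$ for $i=1,\dots,n$, is a weak solution of the system $$\partial_t^2u_i-\gamma_i\,\partial_x^2u_i=f_i(u_1,\dots,u_n)\quad\text{in }(0,L)\times(0,T),\qquad i=1,\dots,n,$$ with boundary conditions $u_i(0,t)=u_i(L,t)=0$ and initial data $(u_i,\partial_tu_i)|_{t=0}=(u_i^0,u_i^1)$, $i=1,\dots,n$, and if $u_i=0$ in $\omega\times[0,T]$ for all $i=1,\dots,n$, then $u_i=0$ in $[0,L]\times[0,T]$ for all $i=1,\dots,n$.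
   Context: Standing assumptions on the coupling terms. The coefficients $p^i_j,q^i_j$ ($i,j=1,\dots,n$) are real-valued functions of $(x,t)\in(0,L)\times(0,\infty)$ with $p^i_j,q^i_j\in L^2(0,T;L^2(0,L))$ for every $T>0$. For $u=(u_1,\dots,u_n)$ with $u_i\in C([0,T];H^1_0(0,L))\cap C^1([0,T];L^2(0,L))$ one has $f_i(u_1,\dots,u_n)\in L^2(0,T;L^2(0,L))$, and for every $T>0$ there is a constant $C_T>0$ such that for all such $u$ and all $i$ $$\int_0^T\!\!\int_0^L|f_i(u_1,\dots,u_n)|^2\,dx\,dt\le C_T\int_0^TF_u(t)\,dt,$$ $$F_u(t)=\sum_{i=1}^n\int_0^L\big[|u_i|^2+\gamma_i|\partial_xu_i|^2+|\partial_tu_i|^2\big]dx .$$ A weak solution is a vector function $(u_1,\dots,u_n)$ with the stated regularity whose components satisfy the equations in variational form (tested against functions in $H^1_0(0,L)$) and attain the initial data $(u_i^0,u_i^1)\in H^1_0(0,L)\times L^2(0,L)$. *)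

theory Defs
  imports "HOL-Analysis.Analysis"
begin

text \<open>
  Elements of Lebesgue spaces are represented by functions; values outside the domain of interest
  and on null sets are irrelevant, so all norms below are seminorms on functions.
  A function of \<open>(x, t)\<close> is written as a map from time to functions of space, \<open>u t x\<close>.
\<close>

definition L2 :: "'a::euclidean_space set \<Rightarrow> ('a \<Rightarrow> real) set" where
  "L2 S = {v. v \<in> borel_measurable (lebesgue_on S) \<and> integrable (lebesgue_on S) (\<lambda>x. (v x)\<^sup>2)}"

definition L2_inner :: "real \<Rightarrow> (real \<Rightarrow> real) \<Rightarrow> (real \<Rightarrow> real) \<Rightarrow> real" where
  "L2_inner L v w = (LINT x|lebesgue_on {0<..<L}. v x * w x)"

definition L2_norm :: "real \<Rightarrow> (real \<Rightarrow> real) \<Rightarrow> real" where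
  "L2_norm L v = sqrt (L2_inner L v v)"

definition test_fun :: "real \<Rightarrow> real \<Rightarrow> (real \<Rightarrow> real) \<Rightarrow> bool" where
  "test_fun a b \<phi> \<longleftrightarrow>
     (\<forall>k x. (deriv ^^ k) \<phi> differentiable (at x)) \<and>
     (\<exists>K. compact K \<and> K \<subseteq> {a<..<b} \<and> (\<forall>x. x \<notin> K \<longrightarrow> \<phi> x = 0))"

definition is_weak_deriv :: "real \<Rightarrow> (real \<Rightarrow> real) \<Rightarrow> (real \<Rightarrow> real) \<Rightarrow> bool" where
  "is_weak_deriv L v g \<longleftrightarrow>
     g \<in> L2 {0<..<L} \<and> (\<forall>\<phi>. test_fun 0 L \<phi> \<longrightarrow> L2_inner L v (deriv \<phi>) = - L2_inner L g \<phi>)"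

text \<open>The weak derivative is determined only almost everywhere; \<open>dx\<close> picks one version.\<close>

definition dx :: "real \<Rightarrow> (real \<Rightarrow> real) \<Rightarrow> real \<Rightarrow> real" where
  "dx L v = (SOME g. is_weak_deriv L v g)"

definition H1 :: "real \<Rightarrow> (real \<Rightarrow> real) set" where
  "H1 L = {v \<in> L2 {0<..<L}. \<exists>g. is_weak_deriv L v g}"

definition H1_norm :: "real \<Rightarrow> (real \<Rightarrow> real) \<Rightarrow> real" where
  "H1_norm L v = sqrt ((L2_norm L v)\<^sup>2 + (L2_norm L (dx L v))\<^sup>2)"

text \<open>
  The closure of the test functions in \<open>H1\<close>. In one space dimension each class has exactly one
  representative that is continuous on \<open>[0, L]\<close>, and \<open>H10\<close> consists of these representatives, so
  that point values (in particular at \<open>0\<close> and \<open>L\<close>) are meaningful.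
\<close>

definition H10 :: "real \<Rightarrow> (real \<Rightarrow> real) set" where
  "H10 L = {v \<in> H1 L. continuous_on {0..L} v \<and>
     (\<exists>\<phi>. (\<forall>k::nat. test_fun 0 L (\<phi> k)) \<and> (\<lambda>k. H1_norm L (\<lambda>x. v x - \<phi> k x)) \<longlonglongrightarrow> 0)}"

definition norm_continuous ::
  "((real \<Rightarrow> real) \<Rightarrow> real) \<Rightarrow> real \<Rightarrow> (real \<Rightarrow> real \<Rightarrow> real) \<Rightarrow> bool" where
  "norm_continuous N T u \<longleftrightarrow>
     (\<forall>t\<in>{0..T}. ((\<lambda>s. N (\<lambda>x. u s x - u t x)) \<longlongrightarrow> 0) (at t within {0..T}))"

text \<open>The \<open>L2\<close>-valued time derivative (one-sided at \<open>0\<close> and \<open>T\<close>), again determined only almost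
  everywhere in space.\<close>

definition is_time_deriv ::
  "real \<Rightarrow> real \<Rightarrow> (real \<Rightarrow> real \<Rightarrow> real) \<Rightarrow> real \<Rightarrow> (real \<Rightarrow> real) \<Rightarrow> bool" where
  "is_time_deriv L T u t v \<longleftrightarrow> v \<in> L2 {0<..<L} \<and>
     ((\<lambda>s. L2_norm L (\<lambda>x. (u s x - u t x) / (s - t) - v x)) \<longlongrightarrow> 0) (at t within {0..T})"

definition dt :: "real \<Rightarrow> real \<Rightarrow> (real \<Rightarrow> real \<Rightarrow> real) \<Rightarrow> real \<Rightarrow> real \<Rightarrow> real" where
  "dt L T u t = (SOME v. is_time_deriv L T u t v)"

definition C0_H10 :: "real \<Rightarrow> real \<Rightarrow> (real \<Rightarrow> real \<Rightarrow> real) set" where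
  "C0_H10 L T = {u. (\<forall>t\<in>{0..T}. u t \<in> H10 L) \<and> norm_continuous (H1_norm L) T u}"

definition C1_L2 :: "real \<Rightarrow> real \<Rightarrow> (real \<Rightarrow> real \<Rightarrow> real) set" where
  "C1_L2 L T = {u. (\<forall>t\<in>{0..T}. u t \<in> L2 {0<..<L} \<and> (\<exists>v. is_time_deriv L T u t v)) \<and>
     norm_continuous (L2_norm L) T (dt L T u)}"

text \<open>
  The Bochner space \<open>L\<^sup>2(0,T;L\<^sup>2(0,L))\<close>, via its identification with the square integrable
  functions on the rectangle. Since \<open>dx\<close> chooses versions separately at each time, \<open>f\<close> itself need
  not be jointly measurable; it only has to agree, as a map into classes of functions, with a
  jointly measurable function.
\<close>

definition L2_L2 :: "real \<Rightarrow> real \<Rightarrow> (real \<Rightarrow> real \<Rightarrow> real) set" where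
  "L2_L2 L T = {f. \<exists>g \<in> L2 ({0<..<T} \<times> {0<..<L}).
     AE t in lebesgue_on {0<..<T}. AE x in lebesgue_on {0<..<L}. f t x = g (t, x)}"

definition coupling ::
  "real \<Rightarrow> ('n::finite \<Rightarrow> 'n \<Rightarrow> real \<Rightarrow> real \<Rightarrow> real) \<Rightarrow> ('n \<Rightarrow> 'n \<Rightarrow> real \<Rightarrow> real \<Rightarrow> real) \<Rightarrow>
   ('n \<Rightarrow> real \<Rightarrow> real \<Rightarrow> real) \<Rightarrow> 'n \<Rightarrow> real \<Rightarrow> real \<Rightarrow> real" where
  "coupling L p q u i t x =
     (\<Sum>j\<in>UNIV. p i j t x * dx L (u j t) x) + (\<Sum>j\<in>UNIV. q i j t x * u j t x)"

definition energy ::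
  "real \<Rightarrow> real \<Rightarrow> ('n::finite \<Rightarrow> real) \<Rightarrow> ('n \<Rightarrow> real \<Rightarrow> real \<Rightarrow> real) \<Rightarrow> real \<Rightarrow> real" where
  "energy L T \<gamma> u t = (\<Sum>i\<in>UNIV. LINT x|lebesgue_on {0<..<L}.
     \<bar>u i t x\<bar>\<^sup>2 + \<gamma> i * \<bar>dx L (u i t) x\<bar>\<^sup>2 + \<bar>dt L T (u i) t x\<bar>\<^sup>2)"

definition admissible_coupling ::
  "real \<Rightarrow> ('n::finite \<Rightarrow> real) \<Rightarrow> ('n \<Rightarrow> 'n \<Rightarrow> real \<Rightarrow> real \<Rightarrow> real) \<Rightarrow>
   ('n \<Rightarrow> 'n \<Rightarrow> real \<Rightarrow> real \<Rightarrow> real) \<Rightarrow> bool" where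
  "admissible_coupling L \<gamma> p q \<longleftrightarrow>
     (\<forall>T>0. \<forall>i j. p i j \<in> L2_L2 L T \<and> q i j \<in> L2_L2 L T) \<and>
     (\<forall>T>0. \<exists>C>0. \<forall>u. (\<forall>i. u i \<in> C0_H10 L T \<inter> C1_L2 L T) \<longrightarrow>
        (\<forall>i. coupling L p q u i \<in> L2_L2 L T \<and>
             (LINT t|lebesgue_on {0<..<T}. LINT x|lebesgue_on {0<..<L}. \<bar>coupling L p q u i t x\<bar>\<^sup>2)
               \<le> C * (LINT t|lebesgue_on {0<..<T}. energy L T \<gamma> u t)))"

text \<open>
  The variational equation says that for every \<open>\<phi>\<close> in \<open>H10\<close>,
  \<open>d/dt \<langle>\<partial>\<^sub>t u\<^sub>i, \<phi>\<rangle> + \<gamma>\<^sub>i \<langle>\<partial>\<^sub>x u\<^sub>i, \<partial>\<^sub>x \<phi>\<rangle> = \<langle>f\<^sub>i(u), \<phi>\<rangle>\<close> in the sense of distributions on \<open>(0, T)\<close>.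
  The boundary conditions are already implied by membership in \<open>H10\<close>.
\<close>

definition weak_solution ::
  "real \<Rightarrow> real \<Rightarrow> ('n::finite \<Rightarrow> real) \<Rightarrow> ('n \<Rightarrow> 'n \<Rightarrow> real \<Rightarrow> real \<Rightarrow> real) \<Rightarrow>
   ('n \<Rightarrow> 'n \<Rightarrow> real \<Rightarrow> real \<Rightarrow> real) \<Rightarrow> ('n \<Rightarrow> real \<Rightarrow> real) \<Rightarrow> ('n \<Rightarrow> real \<Rightarrow> real) \<Rightarrow>
   ('n \<Rightarrow> real \<Rightarrow> real \<Rightarrow> real) \<Rightarrow> bool" where
  "weak_solution L T \<gamma> p q u0 u1 u \<longleftrightarrow> (\<forall>i.
     u i \<in> C0_H10 L T \<inter> C1_L2 L T \<and>
     u0 i \<in> H10 L \<and> u1 i \<in> L2 {0<..<L} \<and>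
     (\<forall>\<phi>\<in>H10 L. \<forall>\<theta>. test_fun 0 T \<theta> \<longrightarrow>
        - (LINT t|lebesgue_on {0<..<T}. L2_inner L (dt L T (u i) t) \<phi> * deriv \<theta> t)
        + \<gamma> i * (LINT t|lebesgue_on {0<..<T}. L2_inner L (dx L (u i t)) (dx L \<phi>) * \<theta> t)
        = (LINT t|lebesgue_on {0<..<T}. L2_inner L (coupling L p q u i t) \<phi> * \<theta> t)) \<and>
     (\<forall>t\<in>{0..T}. u i t 0 = 0 \<and> u i t L = 0) \<and>
     (\<forall>x\<in>{0..L}. u i 0 x = u0 i x) \<and>
     (AE x in lebesgue_on {0<..<L}. dt L T (u i) 0 x = u1 i x))"

end

theory Submission
  imports Defs "HOL-Real_Asymp.Real_Asymp"
begin

text \<open>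
  Put \<open>\<psi> = (x - x0)\<^sup>2 + \<kappa> (t - T/2)\<^sup>2\<close> with \<open>x0\<close> the centre of an interval of half length \<open>\<delta>\<close> on which
  every component vanishes, and \<open>\<kappa> T \<le> \<delta> \<surd>\<gamma>\<close>. Outside that interval \<open>\<psi>\<close> decreases at rate at least
  \<open>\<delta> \<surd>\<gamma>\<close> along the characteristic that runs towards it. Hence d'Alembert's formula and Young's
  inequality give a Carleman estimate with weight \<open>exp (- lam \<psi>)\<close>: the weighted energy of a component
  on \<open>{\<psi> < M}\<close> is at most \<open>O(lam^(-2))\<close> times the weighted square norm of its right-hand side. The
  coupling is only controlled as an operator on whole vector functions, so the bound has to be
  applied to weighted solutions. Multiplying by \<open>exp (- lam \<psi>) sin (lam x)\<close> and by
  \<open>exp (- lam \<psi>) cos (lam x)\<close> allows to recover the weighted coupling of \<open>u\<close> itself, since a bounded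
  combination of the two results cancels the terms in which the weight is differentiated. For large
  \<open>lam\<close> the coupling is absorbed, and \<open>u\<close> vanishes for \<open>t\<close> near \<open>T/2\<close>. From there on the same absorption
  works with the purely temporal weight \<open>exp (- lam (t - T/2)\<^sup>2)\<close> and the energy inequality in place of
  the characteristics, in both time directions.
\<close>

subsection \<open>Smooth functions and test functions\<close>

text \<open>Since the bound on the coupling cannot be localized to {\<psi> < M}, the weighted
  solutions enter it with their energy on the whole rectangle. Outside {\<psi> < M} only the crude
  bound of the energy by its maximum in time is at hand; with the squared weight it costs a multiple
  of lam^2 exp (- 2 lam M). For t close to T/2 the squared weight is at least exp (- 3 lam L^2), so
  M = 2 L^2 leaves the factor exp (- lam L^2), which tends to 0. This also decides how large T must
  be: {\<psi> < M} has to lie in [T/4, 3T/4], and the crossing time L / sqrt \<gamma> has to be at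
  most T/4, so that a characteristic can be followed in either time direction within [0, T]. With
  \<kappa> T at most \<delta> sqrt \<gamma>, the first requirement forces T to be of order L^2 /
  (\<delta> sqrt \<gamma>). A second obstacle is low regularity: the time derivative of a weak
  solution is not an admissible test function, and neither the energy identity nor d'Alembert's
  formula follows by differentiation. Both are read off from one rule for functions of two times on
  the diagonal, \<open>diag_increment\<close>.\<close>

definition smooth_upto :: "nat \<Rightarrow> (real \<Rightarrow> real) \<Rightarrow> bool" where
  "smooth_upto n f \<longleftrightarrow> (\<forall>k\<le>n. \<forall>x. (deriv ^^ k) f differentiable (at x))"

definition smooth :: "(real \<Rightarrow> real) \<Rightarrow> bool" where
  "smooth f \<longleftrightarrow> (\<forall>k x. (deriv ^^ k) f differentiable (at x))"

lemma smooth_iff_upto: "smooth f \<longleftrightarrow> (\<forall>n. smooth_upto n f)"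
  unfolding smooth_def smooth_upto_def by auto

lemma smooth_upto_0: "smooth_upto 0 f \<longleftrightarrow> (\<forall>x. f differentiable (at x))"
  unfolding smooth_upto_def by simp

text \<open>Peeling off the innermost derivative gives a recursion on the order. All closure
  properties below are proved along it: differentiability of every order at once offers no
  induction, whereas a finite order drops by one after a product or chain rule.\<close>

lemma smooth_upto_Suc:
  "smooth_upto (Suc n) f \<longleftrightarrow> (\<forall>x. f differentiable (at x)) \<and> smooth_upto n (deriv f)"
proof -
  have "(\<forall>k\<le>Suc n. P k) \<longleftrightarrow> P 0 \<and> (\<forall>k\<le>n. P (Suc k))" for P :: "nat \<Rightarrow> bool"
    by (metis Suc_le_mono less_eq_nat.simps(1) not0_implies_Suc)
  then show ?thesis
    unfolding smooth_upto_def by (simp add: funpow_Suc_right del: funpow.simps(2))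
qed

lemma smooth_upto_SucD: "smooth_upto (Suc n) f \<Longrightarrow> smooth_upto n f"
  unfolding smooth_upto_def by auto

lemma smooth_upto_SucI:
  assumes "\<And>x. (f has_real_derivative f' x) (at x)" "smooth_upto n f'"
  shows "smooth_upto (Suc n) f"
proof -
  have "deriv f = f'" using assms(1) by (auto intro: DERIV_imp_deriv)
  then show ?thesis
    unfolding smooth_upto_Suc using assms by (auto simp: real_differentiable_def)
qed

lemma smooth_upto_diff: "smooth_upto n f \<Longrightarrow> f differentiable (at x)"
  unfolding smooth_upto_def by (metis funpow_0 zero_le)

lemma smooth_upto_DERIV: "smooth_upto n f \<Longrightarrow> (f has_real_derivative deriv f x) (at x)"
  using smooth_upto_diff by (simp add: DERIV_deriv_iff_real_differentiable)

lemma smooth_differentiable: "smooth f \<Longrightarrow> f differentiable (at x)"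
  unfolding smooth_def by (metis funpow_0)

lemma smooth_DERIV: "smooth f \<Longrightarrow> (f has_real_derivative deriv f x) (at x)"
  using smooth_differentiable by (simp add: DERIV_deriv_iff_real_differentiable)

lemma smooth_deriv: "smooth f \<Longrightarrow> smooth (deriv f)"
  unfolding smooth_def by (metis comp_apply funpow_Suc_right)

lemma smooth_isCont: "smooth f \<Longrightarrow> isCont f x"
  using smooth_DERIV DERIV_isCont by blast

lemma smooth_continuous_on: "smooth f \<Longrightarrow> continuous_on A f"
  by (simp add: continuous_at_imp_continuous_on smooth_isCont)

lemma smoothI:
  assumes "\<And>x. (f has_real_derivative f' x) (at x)" "smooth f'"
  shows "smooth f"
  unfolding smooth_iff_upto
proof
  fix n show "smooth_upto n f"
    using smooth_upto_SucI[OF assms(1)] assms(2) smooth_upto_SucD unfolding smooth_iff_upto by blast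
qed

lemma smooth_const: "smooth (\<lambda>x. c)"
proof -
  have "smooth_upto n (\<lambda>x. c)" for n c
    by (induction n arbitrary: c) (auto simp: smooth_upto_0 smooth_upto_Suc)
  then show ?thesis by (simp add: smooth_iff_upto)
qed

lemma smooth_ident: "smooth (\<lambda>x. x)"
  by (rule smoothI[where f' = "\<lambda>_. 1"]) (auto intro: smooth_const)

lemma smooth_upto_add: "smooth_upto n f \<Longrightarrow> smooth_upto n g \<Longrightarrow> smooth_upto n (\<lambda>x. f x + g x)"
proof (induction n arbitrary: f g)
  case 0 then show ?case by (simp add: smooth_upto_0)
next
  case (Suc n)
  have "smooth_upto n (\<lambda>x. deriv f x + deriv g x)"
    using Suc by (simp add: smooth_upto_Suc)
  then show ?case
    by (rule smooth_upto_SucI[rotated]) (intro derivative_intros smooth_upto_DERIV[OF Suc.prems(1)] smooth_upto_DERIV[OF Suc.prems(2)])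
qed

lemma smooth_add: "smooth f \<Longrightarrow> smooth g \<Longrightarrow> smooth (\<lambda>x. f x + g x)"
  by (simp add: smooth_iff_upto smooth_upto_add)

lemma smooth_upto_mult: "smooth_upto n f \<Longrightarrow> smooth_upto n g \<Longrightarrow> smooth_upto n (\<lambda>x. f x * g x)"
proof (induction n arbitrary: f g)
  case 0 then show ?case by (simp add: smooth_upto_0)
next
  case (Suc n)
  have "smooth_upto n (\<lambda>x. deriv f x * g x + deriv g x * f x)"
    by (intro smooth_upto_add Suc.IH) (use Suc.prems in \<open>auto simp: smooth_upto_Suc dest: smooth_upto_SucD intro: smooth_upto_SucD[of n f] smooth_upto_SucD[of n g]\<close>)
  then show ?case
    by (rule smooth_upto_SucI[rotated]) (intro DERIV_mult smooth_upto_DERIV[OF Suc.prems(1)] smooth_upto_DERIV[OF Suc.prems(2)])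
qed

lemma smooth_mult: "smooth f \<Longrightarrow> smooth g \<Longrightarrow> smooth (\<lambda>x. f x * g x)"
  by (simp add: smooth_iff_upto smooth_upto_mult)

lemma smooth_cmult: "smooth f \<Longrightarrow> smooth (\<lambda>x. c * f x)"
  by (intro smooth_mult smooth_const)

lemma smooth_uminus: "smooth f \<Longrightarrow> smooth (\<lambda>x. - f x)"
  using smooth_cmult[of f "-1"] by simp

lemma smooth_diff: "smooth f \<Longrightarrow> smooth g \<Longrightarrow> smooth (\<lambda>x. f x - g x)"
  using smooth_add[of f "\<lambda>x. - g x"] smooth_uminus by simp

text \<open>The derivative is the exponential itself times a smooth factor, so the induction
  hypothesis for the same function suffices.\<close>

lemma smooth_exp:
  assumes "smooth f" shows "smooth (\<lambda>x. exp (f x))"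
proof -
  have "smooth_upto n (\<lambda>x. exp (f x))" for n
  proof (induction n)
    case 0 then show ?case
      unfolding smooth_upto_0 real_differentiable_def
      by (metis DERIV_chain2 DERIV_exp assms smooth_DERIV)
  next
    case (Suc n)
    have "smooth_upto n (\<lambda>x. exp (f x) * deriv f x)"
      using smooth_upto_mult[OF Suc] assms smooth_deriv smooth_iff_upto by blast
    then show ?case
      by (rule smooth_upto_SucI[rotated]) (auto intro!: derivative_eq_intros smooth_DERIV assms)
  qed
  then show ?thesis by (simp add: smooth_iff_upto)
qed

lemma smooth_sin_cos: "smooth (\<lambda>x. sin (c * x))" "smooth (\<lambda>x. cos (c * x))"
proof -
  have "smooth_upto n (\<lambda>x. sin (c * x)) \<and> smooth_upto n (\<lambda>x. cos (c * x))" for n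
  proof (induction n)
    case 0
    have "((\<lambda>x. sin (c * x)) has_real_derivative c * cos (c * x)) (at x)"
      "((\<lambda>x. cos (c * x)) has_real_derivative (- c) * sin (c * x)) (at x)" for x
      by (auto intro!: derivative_eq_intros)
    then show ?case
      unfolding smooth_upto_0 real_differentiable_def by blast
  next
    case (Suc n)
    have k: "smooth_upto n (\<lambda>x. k)" for k using smooth_const smooth_iff_upto by blast
    show ?case
    proof
      show "smooth_upto (Suc n) (\<lambda>x. sin (c * x))"
      proof (rule smooth_upto_SucI)
        show "smooth_upto n (\<lambda>x. c * cos (c * x))" by (intro smooth_upto_mult k) (simp add: Suc)
      qed (auto intro!: derivative_eq_intros)
      show "smooth_upto (Suc n) (\<lambda>x. cos (c * x))"
      proof (rule smooth_upto_SucI)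
        show "smooth_upto n (\<lambda>x. (- c) * sin (c * x))" by (intro smooth_upto_mult k) (simp add: Suc)
      qed (auto intro!: derivative_eq_intros)
    qed
  qed
  then show "smooth (\<lambda>x. sin (c * x))" "smooth (\<lambda>x. cos (c * x))" by (auto simp: smooth_iff_upto)
qed

lemma smooth_affine:
  assumes "smooth f" shows "smooth (\<lambda>x. f (a * x + b))"
proof -
  have "smooth f \<Longrightarrow> smooth_upto n (\<lambda>x. f (a * x + b))" for n f
  proof (induction n arbitrary: f)
    case 0
    have "((\<lambda>x. f (a * x + b)) has_real_derivative deriv f (a * x + b) * a) (at x)" for x
      by (rule DERIV_chain2[OF smooth_DERIV[OF 0]]) (auto intro!: derivative_eq_intros)
    then show ?case
      unfolding smooth_upto_0 real_differentiable_def by blast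
  next
    case (Suc n)
    have "smooth_upto n (\<lambda>x. deriv f (a * x + b) * a)"
      using smooth_upto_mult[OF Suc.IH[OF smooth_deriv[OF Suc.prems]]] smooth_const smooth_iff_upto by blast
    moreover have "((\<lambda>x. f (a * x + b)) has_real_derivative deriv f (a * x + b) * a) (at x)" for x
      by (rule DERIV_chain2[OF smooth_DERIV[OF Suc.prems]]) (auto intro!: derivative_eq_intros)
    ultimately show ?case by (intro smooth_upto_SucI)
  qed
  then show ?thesis using assms by (simp add: smooth_iff_upto)
qed

lemma test_fun_iff: "test_fun a b \<phi> \<longleftrightarrow> smooth \<phi> \<and> (\<exists>K. compact K \<and> K \<subseteq> {a<..<b} \<and> (\<forall>x. x \<notin> K \<longrightarrow> \<phi> x = 0))"
  unfolding test_fun_def smooth_def ..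

lemma test_fun_smooth: "test_fun a b \<phi> \<Longrightarrow> smooth \<phi>"
  by (simp add: test_fun_iff)

lemma test_fun_outside: "test_fun a b \<phi> \<Longrightarrow> x \<notin> {a<..<b} \<Longrightarrow> \<phi> x = 0"
  by (auto simp: test_fun_iff)

lemma test_funI:
  assumes "smooth \<phi>" "\<And>x. x \<notin> {c..d} \<Longrightarrow> \<phi> x = 0" "a < c" "d < b"
  shows "test_fun a b \<phi>"
  unfolding test_fun_iff using assms by (intro conjI exI[of _ "{c..d}"]) auto

lemma test_funE:
  assumes "test_fun a b \<phi>" "a < b"
  obtains c d where "a < c" "c \<le> d" "d < b" "\<And>x. x \<notin> {c..d} \<Longrightarrow> \<phi> x = 0"
proof -
  obtain K where K: "compact K" "K \<subseteq> {a<..<b}" "\<And>x. x \<notin> K \<Longrightarrow> \<phi> x = 0"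
    using assms(1) by (auto simp: test_fun_iff)
  show thesis
  proof (cases "K = {}")
    case True then show thesis using that[of "(a+b)/2" "(a+b)/2"] K assms(2) by auto
  next
    case False
    obtain c d where "c \<in> K" "\<forall>x\<in>K. c \<le> x" "d \<in> K" "\<forall>x\<in>K. x \<le> d"
      using compact_attains_inf[OF K(1) False] compact_attains_sup[OF K(1) False] by metis
    then show thesis using that[of c d] K(2,3) by (metis greaterThanLessThan_iff atLeastAtMost_iff in_mono)
  qed
qed

lemma deriv_zero_outside:
  assumes "\<And>x. x \<notin> {c..d} \<Longrightarrow> \<phi> x = 0" "x \<notin> {c..d::real}"
  shows "deriv \<phi> x = (0::real)"
proof -
  have "(\<phi> has_real_derivative 0) (at x)"
  proof (rule has_field_derivative_transform_within_open[of "\<lambda>_. 0" _ _ "- {c..d}"])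
    show "x \<in> - {c..d}" using assms by simp
  qed (use assms(1) in auto)
  then show ?thesis by (rule DERIV_imp_deriv)
qed

lemma test_fun_deriv: "test_fun a b \<phi> \<Longrightarrow> a < b \<Longrightarrow> test_fun a b (deriv \<phi>)"
proof -
  assume "test_fun a b \<phi>" "a < b"
  then obtain c d where cd: "a < c" "d < b" and z: "\<And>x. x \<notin> {c..d} \<Longrightarrow> \<phi> x = 0"
    by (metis test_funE)
  show ?thesis
    by (rule test_funI[OF _ _ cd])
      (use z \<open>test_fun a b \<phi>\<close> in \<open>auto intro!: smooth_deriv deriv_zero_outside dest: test_fun_smooth\<close>)
qed

lemma test_fun_mult: "test_fun a b \<phi> \<Longrightarrow> smooth \<beta> \<Longrightarrow> test_fun a b (\<lambda>x. \<beta> x * \<phi> x)"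
  unfolding test_fun_iff by (auto intro: smooth_mult)

section \<open>Bump functions and plateaus\<close>

definition flat_step :: "nat \<Rightarrow> real \<Rightarrow> real" where
  "flat_step m x = (if x \<le> 0 then 0 else exp (- 1 / x) / x ^ m)"

text \<open>The factor \<open>1 / x ^ m\<close> closes the family around exp (- 1 / x) under
  differentiation up to linear combinations, so smoothness follows by induction on the order for all
  \<open>m\<close> together. At 0 the substitution y = 1 / x turns the difference quotient into y^(m
  + 1) / exp y.\<close>

lemma flat_step_DERIV:
  "(flat_step m has_real_derivative flat_step (m + 2) x - m * flat_step (m + 1) x) (at x)"
proof -
  consider "x < 0" | "x > 0" | "x = 0" by linarith
  then show ?thesis
  proof cases
    case 1
    have "((\<lambda>_. 0) has_real_derivative 0) (at x)" by simp
    then have "(flat_step m has_real_derivative 0) (at x)"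
      by (rule has_field_derivative_transform_within_open[of _ _ _ "{..<0}"])
        (use 1 in \<open>auto simp: flat_step_def\<close>)
    then show ?thesis using 1 by (simp add: flat_step_def)
  next
    case 2
    have "((\<lambda>x. exp (- 1 / x) / x ^ m) has_real_derivative flat_step (m + 2) x - m * flat_step (m + 1) x) (at x)"
    proof -
      have 1: "((\<lambda>x. exp (- 1 / x)) has_real_derivative exp (- 1 / x) * (1 / x\<^sup>2)) (at x)"
        using 2 by (auto intro!: derivative_eq_intros simp: power2_eq_square)
      have "((\<lambda>x. exp (- 1 / x) / x ^ m) has_real_derivative
          (exp (- 1 / x) * (1 / x\<^sup>2) * x ^ m - exp (- 1 / x) * (real m * x ^ (m - 1))) / (x ^ m * x ^ m)) (at x)"
        using 2 by (intro DERIV_divide 1) (auto intro!: derivative_eq_intros)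
      moreover have "(exp (- 1 / x) * (1 / x\<^sup>2) * x ^ m - exp (- 1 / x) * (real m * x ^ (m - 1))) / (x ^ m * x ^ m)
        = exp (- 1 / x) / x ^ (m + 2) - m * (exp (- 1 / x) / x ^ (m + 1))"
        using 2 by (cases m) (simp_all add: field_simps power2_eq_square)
      ultimately show ?thesis using 2 by (simp add: flat_step_def)
    qed
    then show ?thesis
      by (rule has_field_derivative_transform_within_open[of _ _ _ "{0<..}"])
        (use 2 in \<open>auto simp: flat_step_def\<close>)
  next
    case 3
    have r: "((\<lambda>x::real. exp (- 1 / x) / x ^ m / x) \<longlongrightarrow> 0) (at_right 0)"
    proof -
      have "((\<lambda>y::real. y ^ Suc m / exp y) \<longlongrightarrow> 0) at_top"
        by (rule tendsto_power_div_exp_0)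
      then have "((\<lambda>x::real. inverse x ^ Suc m / exp (inverse x)) \<longlongrightarrow> 0) (at_right 0)"
        by (rule filterlim_compose[OF _ filterlim_inverse_at_top_right])
      moreover have "inverse x ^ Suc m / exp (inverse x) = exp (- 1 / x) / x ^ m / x" for x :: real
        by (simp add: exp_minus field_simps)
      ultimately show ?thesis by (simp only:)
    qed
    have "((\<lambda>h. flat_step m h / h) \<longlongrightarrow> 0) (at_right 0)"
      by (rule Lim_transform_eventually[OF r])
        (auto simp: eventually_at_filter flat_step_def)
    moreover have "((\<lambda>h. flat_step m h / h) \<longlongrightarrow> 0) (at_left 0)"
      by (rule Lim_transform_eventually[of "\<lambda>_. 0"])
        (auto simp: eventually_at_filter flat_step_def)
    ultimately have "((\<lambda>h. flat_step m h / h) \<longlongrightarrow> 0) (at 0)"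
      using filterlim_split_at by blast
    then have "(flat_step m has_real_derivative 0) (at 0)"
      by (simp add: has_field_derivative_iff flat_step_def)
    then show ?thesis using 3 by (simp add: flat_step_def)
  qed
qed

lemma smooth_flat_step: "smooth (flat_step m)"
proof -
  have "smooth_upto n (flat_step m)" for n m
  proof (induction n arbitrary: m)
    case 0 then show ?case
      unfolding smooth_upto_0 real_differentiable_def using flat_step_DERIV by blast
  next
    case (Suc n)
    have c: "smooth_upto n (\<lambda>x. c)" for c using smooth_const smooth_iff_upto by blast
    have "smooth_upto n (\<lambda>x. flat_step (m + 2) x + (- real m) * flat_step (m + 1) x)"
      by (intro smooth_upto_add smooth_upto_mult Suc c)
    then show ?case
      by (intro smooth_upto_SucI[OF flat_step_DERIV]) simp
  qed
  then show ?thesis by (simp add: smooth_iff_upto)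
qed

text \<open>Inside (a, b) both arguments of \<open>flat_step 0\<close> tend to infinity with n,
  where exp (- 1 / y) tends to 1. So the plateaus converge pointwise to the indicator of (a, b) and
  stay between 0 and 1, ready for dominated convergence; the shift by 1 keeps the support at
  distance 1 / n from the endpoints.\<close>

definition plateau ::"real \<Rightarrow> real \<Rightarrow> real \<Rightarrow> real \<Rightarrow> real" where
  "plateau a b n x = flat_step 0 (n * (x - a) - 1) * flat_step 0 (n * (b - x) - 1)"

lemma smooth_plateau: "smooth (plateau a b n)"
proof -
  have "smooth (\<lambda>x. flat_step 0 (n * x + (- n * a - 1)))" "smooth (\<lambda>x. flat_step 0 ((-n) * x + (n * b - 1)))"
    by (intro smooth_affine smooth_flat_step)+
  from smooth_mult[OF this] show ?thesis
    by (simp add: plateau_def[abs_def] algebra_simps)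
qed

lemma flat_step_bounds: "0 \<le> flat_step 0 x" "flat_step 0 x \<le> 1"
  by (auto simp: flat_step_def)

lemma plateau_bounds: "0 \<le> plateau a b n x" "plateau a b n x \<le> 1"
  unfolding plateau_def by (auto intro!: mult_le_one simp: flat_step_bounds)

lemma plateau_outside: "n > 0 \<Longrightarrow> x \<notin> {a + 1 / n..b - 1 / n} \<Longrightarrow> plateau a b n x = 0"
  by (auto simp: plateau_def flat_step_def field_simps)

lemma test_fun_plateau: "n > 0 \<Longrightarrow> test_fun a b (plateau a b n)"
  by (rule test_funI[of _ "a + 1 / n" "b - 1 / n"]) (auto simp: smooth_plateau intro!: plateau_outside)

lemma plateau_tendsto: "(\<lambda>n. plateau a b (real (Suc n)) x) \<longlonglongrightarrow> indicator {a<..<b} x"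
proof (cases "x \<in> {a<..<b}")
  case True
  have *: "(\<lambda>n. flat_step 0 (real (Suc n) * y - 1)) \<longlonglongrightarrow> 1" if "y > 0" for y
  proof -
    have "(\<lambda>n. exp (- 1 / (real (Suc n) * y - 1))) \<longlonglongrightarrow> 1"
      using that by real_asymp
    moreover have "\<forall>\<^sub>F n in sequentially. 0 < real (Suc n) * y - 1"
      using that by real_asymp
    then have "\<forall>\<^sub>F n in sequentially. exp (- 1 / (real (Suc n) * y - 1)) = flat_step 0 (real (Suc n) * y - 1)"
      by eventually_elim (simp add: flat_step_def)
    ultimately show ?thesis by (simp add: tendsto_cong[symmetric])
  qed
  show ?thesis unfolding plateau_def
    using tendsto_mult[OF *[of "x - a"] *[of "b - x"]] True by simp
next
  case False
  have "plateau a b (real (Suc n)) x = 0" for n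
  proof (rule plateau_outside)
    have "0 < 1 / real (Suc n)" by simp
    with False show "x \<notin> {a + 1 / real (Suc n)..b - 1 / real (Suc n)}"
      unfolding atLeastAtMost_iff greaterThanLessThan_iff by linarith
  qed simp
  then show ?thesis using False by simp
qed

subsection \<open>The Hilbert space of square integrable classes\<close>

lemma L2_UNIV_iff: "f \<in> L2 UNIV \<longleftrightarrow> f \<in> borel_measurable lebesgue \<and> integrable lebesgue (\<lambda>x. (f x)\<^sup>2)"
  by (simp add: L2_def lebesgue_on_UNIV_eq)

lemma integrable_mult_L2:
  fixes f g :: "'a \<Rightarrow> real"
  assumes [measurable]: "f \<in> borel_measurable M" "g \<in> borel_measurable M"
    and "integrable M (\<lambda>x. (f x)\<^sup>2)" "integrable M (\<lambda>x. (g x)\<^sup>2)"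
  shows "integrable M (\<lambda>x. f x * g x)"
proof (rule Bochner_Integration.integrable_bound)
  show "integrable M (\<lambda>x. (f x)\<^sup>2 + (g x)\<^sup>2)" using assms by simp
  have "\<bar>f x * g x\<bar> \<le> (f x)\<^sup>2 + (g x)\<^sup>2" for x
    using sum_squares_bound[of "\<bar>f x\<bar>" "\<bar>g x\<bar>"] mult_nonneg_nonneg[of "\<bar>f x\<bar>" "\<bar>g x\<bar>"]
    unfolding abs_mult power2_abs by linarith
  then show "AE x in M. norm (f x * g x) \<le> norm ((f x)\<^sup>2 + (g x)\<^sup>2)"
    by (intro AE_I2) (simp add: order_trans[OF _ abs_ge_self])
qed measurable

lemma L2_mult_integrable: "f \<in> L2 S \<Longrightarrow> g \<in> L2 S \<Longrightarrow> integrable (lebesgue_on S) (\<lambda>x. f x * g x)"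
  unfolding L2_def by (auto intro: integrable_mult_L2)

lemma L2_add:
  assumes "f \<in> L2 S" "g \<in> L2 S" shows "(\<lambda>x. f x + g x) \<in> L2 S"
proof -
  have "integrable (lebesgue_on S) (\<lambda>x. (f x)\<^sup>2 + 2 * (f x * g x) + (g x)\<^sup>2)"
    using L2_mult_integrable[OF assms] assms by (auto simp: L2_def)
  then show ?thesis using assms by (auto simp: L2_def power2_sum algebra_simps)
qed

lemma L2_cmult: "f \<in> L2 S \<Longrightarrow> (\<lambda>x. c * f x) \<in> L2 S"
  by (auto simp: L2_def power_mult_distrib)

lemma L2_uminus: "f \<in> L2 S \<Longrightarrow> (\<lambda>x. - f x) \<in> L2 S"
  by (auto simp: L2_def)

lemma L2_diff: "f \<in> L2 S \<Longrightarrow> g \<in> L2 S \<Longrightarrow> (\<lambda>x. f x - g x) \<in> L2 S"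
  using L2_add[of f S "\<lambda>x. - g x"] L2_uminus[of g S] by simp

lemma L2_zero: "(\<lambda>x. 0) \<in> L2 S"
  by (simp add: L2_def)

lemma L2_bounded_mult:
  assumes "f \<in> L2 S" "\<beta> \<in> borel_measurable (lebesgue_on S)" "S \<in> sets lebesgue" "\<And>x. x \<in> S \<Longrightarrow> \<bar>\<beta> x\<bar> \<le> B"
  shows "(\<lambda>x. \<beta> x * f x) \<in> L2 S"
proof -
  have [measurable]: "f \<in> borel_measurable (lebesgue_on S)" "\<beta> \<in> borel_measurable (lebesgue_on S)"
    and i: "integrable (lebesgue_on S) (\<lambda>x. (f x)\<^sup>2)"
    using assms by (auto simp: L2_def)
  have "integrable (lebesgue_on S) (\<lambda>x. (\<beta> x * f x)\<^sup>2)"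
  proof (rule Bochner_Integration.integrable_bound)
    show "integrable (lebesgue_on S) (\<lambda>x. B\<^sup>2 * (f x)\<^sup>2)" using i by simp
    show "AE x in lebesgue_on S. norm ((\<beta> x * f x)\<^sup>2) \<le> norm (B\<^sup>2 * (f x)\<^sup>2)"
    proof (intro AE_I2)
      fix x assume "x \<in> space (lebesgue_on S)"
      then have "(\<beta> x)\<^sup>2 \<le> B\<^sup>2" using assms(4)[of x] by (simp add: abs_le_square_iff[symmetric] space_restrict_space)
      then show "norm ((\<beta> x * f x)\<^sup>2) \<le> norm (B\<^sup>2 * (f x)\<^sup>2)" by (simp add: power_mult_distrib mult_right_mono)
    qed
  qed measurable
  then show ?thesis by (simp add: L2_def)
qed

lemma L2_cong_AE:
  assumes "f \<in> L2 UNIV" "AE x in lebesgue. f x = g x"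
  shows "g \<in> L2 UNIV"
proof -
  have g[measurable]: "g \<in> borel_measurable lebesgue"
    using assms borel_measurable_AE by (auto simp: L2_UNIV_iff)
  have [measurable]: "f \<in> borel_measurable lebesgue" using assms by (auto simp: L2_UNIV_iff)
  have "integrable lebesgue (\<lambda>x. (f x)\<^sup>2) \<longleftrightarrow> integrable lebesgue (\<lambda>x. (g x)\<^sup>2)"
    by (rule integrable_cong_AE) (use assms(2) in auto)
  then show ?thesis using assms g by (simp add: L2_UNIV_iff)
qed

text \<open>A partial equivalence, reflexive only on square integrable functions. It lives on the
  whole line so that the resulting type does not depend on L; functions on (0, L) enter by zero
  extension. In the quotient the seminorm becomes a norm, so that continuity and differentiability
  in time become the standard notions for curves in an inner product space.\<close>

definition l2_rel :: "(real \<Rightarrow> real) \<Rightarrow> (real \<Rightarrow> real) \<Rightarrow> bool" where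
  "l2_rel f g \<longleftrightarrow> f \<in> L2 UNIV \<and> g \<in> L2 UNIV \<and> (AE x in lebesgue. f x = g x)"

quotient_type l2 = "real \<Rightarrow> real" / partial: l2_rel
proof (rule part_equivpI)
  show "\<exists>x. l2_rel x x" using L2_zero by (auto simp: l2_rel_def intro!: exI[of _ "\<lambda>x. 0"])
  show "symp l2_rel" by (auto simp: symp_def l2_rel_def)
  show "transp l2_rel"
    by (auto simp: transp_def l2_rel_def intro: AE_mp elim!: eventually_elim2)
qed

lemma l2_inner_cong:
  assumes "l2_rel f f'" "l2_rel g g'"
  shows "(LINT x|lebesgue. f x * g x) = (LINT x|lebesgue. f' x * g' x)"
proof (rule integral_cong_AE)
  show "AE x in lebesgue. f x * g x = f' x * g' x"
    using assms by (auto simp: l2_rel_def)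
qed (use assms in \<open>auto simp: l2_rel_def L2_UNIV_iff\<close>)

instantiation l2 :: real_inner
begin

lift_definition zero_l2 :: l2 is "\<lambda>x. 0" by (simp add: l2_rel_def L2_zero)
lift_definition plus_l2 :: "l2 \<Rightarrow> l2 \<Rightarrow> l2" is "\<lambda>f g x. f x + g x"
  by (auto simp: l2_rel_def L2_add)
lift_definition minus_l2 :: "l2 \<Rightarrow> l2 \<Rightarrow> l2" is "\<lambda>f g x. f x - g x"
  by (auto simp: l2_rel_def L2_diff)
lift_definition uminus_l2 :: "l2 \<Rightarrow> l2" is "\<lambda>f x. - f x"
  by (auto simp: l2_rel_def L2_uminus)
lift_definition scaleR_l2 :: "real \<Rightarrow> l2 \<Rightarrow> l2" is "\<lambda>c f x. c * f x"
  by (auto simp: l2_rel_def L2_cmult)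
lift_definition inner_l2 :: "l2 \<Rightarrow> l2 \<Rightarrow> real" is "\<lambda>f g. LINT x|lebesgue. f x * g x"
  by (rule l2_inner_cong)
definition norm_l2 :: "l2 \<Rightarrow> real" where "norm_l2 x = sqrt (inner x x)"
definition dist_l2 :: "l2 \<Rightarrow> l2 \<Rightarrow> real" where "dist_l2 x y = norm (x - y)"
definition sgn_l2 :: "l2 \<Rightarrow> l2" where "sgn_l2 x = scaleR (inverse (norm x)) x"
definition uniformity_l2 :: "(l2 \<times> l2) filter" where
  "uniformity_l2 = (INF e\<in>{0<..}. principal {(x, y). dist x y < e})"
definition open_l2 :: "l2 set \<Rightarrow> bool" where
  "open_l2 U \<longleftrightarrow> (\<forall>x\<in>U. eventually (\<lambda>(x', y). x' = x \<longrightarrow> y \<in> U) uniformity)"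

instance
proof
  fix x y z :: l2 and a b :: real
  show "x + y + z = x + (y + z)" by transfer (auto simp: l2_rel_def algebra_simps intro: L2_add)
  show "x + y = y + x" by transfer (auto simp: l2_rel_def algebra_simps intro: L2_add)
  show "0 + x = x" by transfer (auto simp: l2_rel_def)
  show "- x + x = 0" by transfer (auto simp: l2_rel_def intro: L2_zero)
  show "x - y = x + - y" by transfer (auto simp: l2_rel_def algebra_simps intro: L2_diff)
  show "a *\<^sub>R (x + y) = a *\<^sub>R x + a *\<^sub>R y" by transfer (auto simp: l2_rel_def algebra_simps intro!: L2_add L2_cmult)
  show "(a + b) *\<^sub>R x = a *\<^sub>R x + b *\<^sub>R x" by transfer (auto simp: l2_rel_def algebra_simps intro!: L2_add L2_cmult)
  show "a *\<^sub>R b *\<^sub>R x = (a * b) *\<^sub>R x" by transfer (auto simp: l2_rel_def algebra_simps intro!: L2_cmult)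
  show "1 *\<^sub>R x = x" by transfer (auto simp: l2_rel_def)
  show "inner x y = inner y x" by transfer (auto simp: algebra_simps)
  show "inner (x + y) z = inner x z + inner y z"
    by transfer (auto simp: l2_rel_def algebra_simps L2_UNIV_iff intro!: Bochner_Integration.integral_add integrable_mult_L2)
  show "inner (a *\<^sub>R x) y = a * inner x y"
    by transfer (auto simp: algebra_simps)
  show "0 \<le> inner x x" by transfer auto
  show "inner x x = 0 \<longleftrightarrow> x = 0"
  proof transfer
    fix f assume f: "l2_rel f f"
    have "(LINT x|lebesgue. f x * f x) = 0 \<longleftrightarrow> (AE x in lebesgue. f x * f x = 0)"
      by (rule integral_nonneg_eq_0_iff_AE) (use f in \<open>auto simp: l2_rel_def L2_UNIV_iff power2_eq_square\<close>)
    then show "(LINT x|lebesgue. f x * f x) = 0 \<longleftrightarrow> l2_rel f (\<lambda>x. 0)"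
      using f L2_zero[of UNIV] by (auto simp: l2_rel_def)
  qed
qed (auto simp: norm_l2_def dist_l2_def sgn_l2_def uniformity_l2_def open_l2_def)

end

definition zext :: "real \<Rightarrow> (real \<Rightarrow> real) \<Rightarrow> real \<Rightarrow> real" where
  "zext L v x = (if x \<in> {0<..<L} then v x else 0)"

definition l2c :: "real \<Rightarrow> (real \<Rightarrow> real) \<Rightarrow> l2" where
  "l2c L v = abs_l2 (zext L v)"

lemma integrable_zext: "integrable lebesgue (zext L v) \<longleftrightarrow> integrable (lebesgue_on {0<..<L}) v"
  unfolding zext_def by (rule Lebesgue_Measure.integrable_restrict_UNIV) auto

lemma integral_zext: "(LINT x|lebesgue. zext L v x) = (LINT x|lebesgue_on {0<..<L}. v x)"
  unfolding zext_def by (rule Lebesgue_Measure.integral_restrict_UNIV) auto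

lemma measurable_zext: "zext L v \<in> borel_measurable lebesgue \<longleftrightarrow> v \<in> borel_measurable (lebesgue_on {0<..<L})"
  unfolding zext_def by (rule borel_measurable_if) auto

lemma zext_mult: "zext L v x * zext L w x = zext L (\<lambda>x. v x * w x) x"
  by (simp add: zext_def)

lemma zext_L2: "zext L v \<in> L2 UNIV \<longleftrightarrow> v \<in> L2 {0<..<L}"
  unfolding L2_UNIV_iff by (simp add: L2_def measurable_zext power2_eq_square zext_mult integrable_zext)

lemma l2_rel_zext: "v \<in> L2 {0<..<L} \<Longrightarrow> l2_rel (zext L v) (zext L v)"
  by (simp add: l2_rel_def zext_L2)

lemma inner_abs_l2:
  "f \<in> L2 UNIV \<Longrightarrow> g \<in> L2 UNIV \<Longrightarrow> inner (abs_l2 f) (abs_l2 g) = (LINT x|lebesgue. f x * g x)"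
  by (rule inner_l2.abs_eq) (auto simp: l2_rel_def)

lemma inner_l2c:
  "v \<in> L2 {0<..<L} \<Longrightarrow> w \<in> L2 {0<..<L} \<Longrightarrow> inner (l2c L v) (l2c L w) = L2_inner L v w"
  by (simp add: l2c_def L2_inner_def inner_abs_l2 zext_L2 zext_mult integral_zext)

lemma norm_l2c: "v \<in> L2 {0<..<L} \<Longrightarrow> norm (l2c L v) = L2_norm L v"
  by (simp add: norm_eq_sqrt_inner inner_l2c L2_norm_def)

lemma l2c_add:
  assumes "v \<in> L2 {0<..<L}" "w \<in> L2 {0<..<L}" shows "l2c L (\<lambda>x. v x + w x) = l2c L v + l2c L w"
proof -
  have "zext L (\<lambda>x. v x + w x) = (\<lambda>x. zext L v x + zext L w x)" by (auto simp: zext_def)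
  then show ?thesis unfolding l2c_def using assms by (simp add: plus_l2.abs_eq l2_rel_zext)
qed

lemma l2c_diff:
  assumes "v \<in> L2 {0<..<L}" "w \<in> L2 {0<..<L}" shows "l2c L (\<lambda>x. v x - w x) = l2c L v - l2c L w"
proof -
  have "zext L (\<lambda>x. v x - w x) = (\<lambda>x. zext L v x - zext L w x)" by (auto simp: zext_def)
  then show ?thesis unfolding l2c_def using assms by (simp add: minus_l2.abs_eq l2_rel_zext)
qed

lemma l2c_scaleR:
  assumes "v \<in> L2 {0<..<L}" shows "l2c L (\<lambda>x. c * v x) = c *\<^sub>R l2c L v"
proof -
  have "zext L (\<lambda>x. c * v x) = (\<lambda>x. c * zext L v x)" by (auto simp: zext_def)
  then show ?thesis unfolding l2c_def using assms by (simp add: scaleR_l2.abs_eq l2_rel_zext)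
qed

lemma AE_zext: "(AE x in lebesgue_on {0<..<L::real}. P x) \<longleftrightarrow> (AE x in lebesgue. x \<in> {0<..<L} \<longrightarrow> P x)"
  by (subst AE_restrict_space_iff) auto

lemma AE_zext_eq: "(AE x in lebesgue. zext L v x = zext L w x) \<longleftrightarrow> (AE x in lebesgue_on {0<..<L}. v x = w x)"
  unfolding AE_zext by (intro AE_cong) (auto simp: zext_def)

lemma l2c_eq_iff:
  assumes "v \<in> L2 {0<..<L}" "w \<in> L2 {0<..<L}"
  shows "l2c L v = l2c L w \<longleftrightarrow> (AE x in lebesgue_on {0<..<L}. v x = w x)"
proof -
  have "l2c L v = l2c L w \<longleftrightarrow> l2_rel (zext L v) (zext L w)"
    unfolding l2c_def using Quotient3_rel[OF Quotient3_l2] assms l2_rel_zext by metis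
  also have "\<dots> \<longleftrightarrow> (AE x in lebesgue_on {0<..<L}. v x = w x)"
    unfolding l2_rel_def using assms by (simp add: zext_L2 AE_zext_eq)
  finally show ?thesis .
qed

lemma l2c_cong_AE:
  assumes "AE x in lebesgue_on {0<..<L}. v x = w x" "v \<in> L2 {0<..<L}"
  shows "w \<in> L2 {0<..<L}" "l2c L v = l2c L w"
proof -
  show "w \<in> L2 {0<..<L}"
    using L2_cong_AE[of "zext L v" "zext L w"] assms by (simp add: zext_L2 AE_zext_eq)
  then show "l2c L v = l2c L w" using l2c_eq_iff assms by blast
qed

lemma l2c_cong: "(\<And>x. x \<in> {0<..<L} \<Longrightarrow> v x = w x) \<Longrightarrow> l2c L v = l2c L w"
  unfolding l2c_def by (rule arg_cong[of _ _ abs_l2]) (auto simp: zext_def)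

section \<open>The fundamental lemma of the calculus of variations\<close>

lemma AE_zero_iff_integrals:
  fixes w :: "real \<Rightarrow> real"
  assumes w: "integrable lborel w" and z: "\<And>a. (LINT x|lborel. w x * indicator {a<..} x) = 0"
  shows "AE x in lborel. w x = 0"
proof -
  have [measurable]: "w \<in> borel_measurable borel" using borel_measurable_integrable[OF w] by simp
  let ?p = "\<lambda>x. ennreal (max 0 (w x))" and ?n = "\<lambda>x. ennreal (max 0 (- w x))"
  have ip: "integrable lborel (\<lambda>x. max 0 (w x) * indicator {a<..} x)" "integrable lborel (\<lambda>x. max 0 (- w x) * indicator {a<..} x)" for a
    by (rule Bochner_Integration.integrable_bound[OF w], measurable, rule AE_I2, simp add: abs_ge_self abs_ge_minus_self split: split_indicator)+
  have ep: "emeasure (density lborel ?p) {a<..} = ennreal (LINT x|lborel. max 0 (w x) * indicator {a<..} x)" for a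
  proof -
    have "emeasure (density lborel ?p) {a<..} = (\<integral>\<^sup>+x. ennreal (max 0 (w x) * indicator {a<..} x) \<partial>lborel)"
      by (subst emeasure_density) (auto intro!: nn_integral_cong split: split_indicator)
    also have "\<dots> = ennreal (LINT x|lborel. max 0 (w x) * indicator {a<..} x)"
      by (rule nn_integral_eq_integral[OF ip(1)]) (auto intro!: AE_I2)
    finally show ?thesis .
  qed
  have en: "emeasure (density lborel ?n) {a<..} = ennreal (LINT x|lborel. max 0 (- w x) * indicator {a<..} x)" for a
  proof -
    have "emeasure (density lborel ?n) {a<..} = (\<integral>\<^sup>+x. ennreal (max 0 (- w x) * indicator {a<..} x) \<partial>lborel)"
      by (subst emeasure_density) (auto intro!: nn_integral_cong split: split_indicator)
    also have "\<dots> = ennreal (LINT x|lborel. max 0 (- w x) * indicator {a<..} x)"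
      by (rule nn_integral_eq_integral[OF ip(2)]) (auto intro!: AE_I2)
    finally show ?thesis .
  qed
  \<comment> \<open>Half-lines are closed under intersection and generate the Borel sets, and both
    measures are finite on them. Equal measures have almost everywhere equal densities, and the
    positive and the negative part of a number agree only if both are 0.\<close>
  have "density lborel ?p = density lborel ?n"
  proof (rule measure_eqI_lessThan)
    fix a
    have "(LINT x|lborel. max 0 (w x) * indicator {a<..} x) - (LINT x|lborel. max 0 (- w x) * indicator {a<..} x)
       = (LINT x|lborel. w x * indicator {a<..} x)"
    proof -
      have "w x * indicator {a<..} x = max 0 (w x) * indicator {a<..} x - max 0 (- w x) * indicator {a<..} x" for x
        by (simp add: max_def split: split_indicator)
      then show ?thesis by (simp only: Bochner_Integration.integral_diff[OF ip])
    qed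
    then show "emeasure (density lborel ?p) {a<..} = emeasure (density lborel ?n) {a<..}"
      using z[of a] by (simp add: ep en)
    show "emeasure (density lborel ?p) {a<..} < \<infinity>" by (simp add: ep)
  qed auto
  then have "AE x in lborel. ?p x = ?n x"
    by (subst (asm) sigma_finite_measure.density_unique_iff[OF sigma_finite_lborel]) simp_all
  then show ?thesis
    by eventually_elim (simp add: max_def split: if_splits)
qed

lemma smooth_measurable: "smooth f \<Longrightarrow> f \<in> borel_measurable borel"
  using borel_measurable_continuous_onI smooth_continuous_on by blast

lemma measurable_lebesgue_borel: "f \<in> borel_measurable borel \<Longrightarrow> f \<in> borel_measurable lebesgue"
  by (rule measurable_completion) simp

lemma test_fun_mono: "test_fun a b \<phi> \<Longrightarrow> a' \<le> a \<Longrightarrow> b \<le> b' \<Longrightarrow> test_fun a' b' \<phi>"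
proof -
  assume t: "test_fun a b \<phi>" and "a' \<le> a" "b \<le> b'"
  then have "{a<..<b} \<subseteq> {a'<..<b'}" by auto
  with t show ?thesis unfolding test_fun_iff by blast
qed

text \<open>Plateaus on (max a p, q) are test functions on (p, q) and converge to the indicator, so
  dominated convergence makes the integrals of \<open>w\<close> over all half-lines vanish. Here
  \<open>w\<close> is a Borel version of \<open>v\<close>, cut off outside (p, q), because the
  comparison of measures takes place on \<open>lborel\<close>.\<close>

lemma FLCV:
  assumes v: "integrable lebesgue v" and z: "\<And>\<phi>. test_fun p q \<phi> \<Longrightarrow> (LINT x|lebesgue. v x * \<phi> x) = 0"
  shows "AE x in lebesgue. x \<in> {p<..<q} \<longrightarrow> v x = (0::real)"
proof -
  have [measurable]: "v \<in> borel_measurable lebesgue" using v by (rule borel_measurable_integrable)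
  obtain v' where [measurable]: "v' \<in> borel_measurable lborel" and vv': "AE x in lborel. v x = v' x"
    using completion_ex_borel_measurable_real[of v lborel] v by auto
  define w where "w = (\<lambda>x. v' x * indicator {p<..<q} x)"
  have [measurable]: "w \<in> borel_measurable borel" unfolding w_def by measurable
  have iv': "integrable lborel v'"
  proof -
    have "integrable lebesgue v'"
    proof (rule integrable_cong_AE[THEN iffD1, OF _ _ _ v])
      show "AE x in lebesgue. v x = v' x" by (rule AE_completion[OF vv'])
      show "v' \<in> borel_measurable lebesgue" by (rule measurable_completion) simp
    qed simp
    then show ?thesis by (simp add: integrable_completion)
  qed
  have iw: "integrable lborel w"
    unfolding w_def by (rule Bochner_Integration.integrable_bound[OF iv']) (auto simp: indicator_def)
  have "(LINT x|lborel. w x * indicator {a<..} x) = 0" for a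
  proof -
    let ?a = "max a p"
    have "(\<lambda>n. LINT x|lborel. w x * plateau ?a q (real (Suc n)) x) \<longlonglongrightarrow> (LINT x|lborel. w x * indicator {?a<..<q} x)"
    proof (rule integral_dominated_convergence[where w = "\<lambda>x. \<bar>w x\<bar>"])
      show "AE x in lborel. (\<lambda>n. w x * plateau ?a q (real (Suc n)) x) \<longlonglongrightarrow> w x * indicator {?a<..<q} x"
        by (intro AE_I2 tendsto_intros plateau_tendsto)
      show "AE x in lborel. norm (w x * plateau ?a q (real (Suc n)) x) \<le> \<bar>w x\<bar>" for n
        using plateau_bounds by (auto simp: abs_mult intro!: AE_I2 mult_left_le)
      show "(\<lambda>x. w x * plateau ?a q (real (Suc n)) x) \<in> borel_measurable lborel" for n
        by (simp add: borel_measurable_times smooth_measurable[OF smooth_plateau])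
    qed (use iw in auto)
    moreover have "(LINT x|lborel. w x * plateau ?a q (real (Suc n)) x) = 0" for n
    proof -
      have [measurable]: "plateau ?a q (real (Suc n)) \<in> borel_measurable borel"
        by (rule smooth_measurable[OF smooth_plateau])
      have t: "test_fun p q (plateau ?a q (real (Suc n)))"
        by (rule test_fun_mono[OF test_fun_plateau[of "real (Suc n)" ?a q]]) auto
      have "(LINT x|lborel. w x * plateau ?a q (real (Suc n)) x) = (LINT x|lebesgue. w x * plateau ?a q (real (Suc n)) x)"
        by (subst integral_completion) measurable
      also have "\<dots> = (LINT x|lebesgue. v x * plateau ?a q (real (Suc n)) x)"
      proof (rule integral_cong_AE)
        show "AE x in lebesgue. w x * plateau ?a q (real (Suc n)) x = v x * plateau ?a q (real (Suc n)) x"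
          using AE_completion[OF vv'] by eventually_elim (use test_fun_outside[OF t] in \<open>auto simp: w_def split: split_indicator\<close>)
        show "(\<lambda>x. w x * plateau ?a q (real (Suc n)) x) \<in> borel_measurable lebesgue"
          by (rule measurable_lebesgue_borel) measurable
        show "(\<lambda>x. v x * plateau ?a q (real (Suc n)) x) \<in> borel_measurable lebesgue"
          by (rule borel_measurable_times[OF _ measurable_lebesgue_borel]) measurable
      qed
      also have "\<dots> = 0" by (rule z[OF t])
      finally show ?thesis .
    qed
    ultimately have "(LINT x|lborel. w x * indicator {?a<..<q} x) = 0"
      by (simp add: LIMSEQ_const_iff)
    moreover have "w x * indicator {?a<..<q} x = w x * indicator {a<..} x" for x
      by (auto simp: w_def split: split_indicator)
    ultimately show ?thesis by simp
  qed
  from AE_zero_iff_integrals[OF iw this] have "AE x in lborel. w x = 0" .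
  with vv' have "AE x in lborel. x \<in> {p<..<q} \<longrightarrow> v x = 0"
    by eventually_elim (auto simp: w_def)
  then show ?thesis by (rule AE_completion)
qed

section \<open>Smooth steps and the fundamental theorem of calculus for weak derivatives\<close>

lemma smooth_step_exists:
  "\<exists>R. smooth R \<and> (\<forall>x\<le>0. R x = 0) \<and> (\<forall>x\<ge>1. R x = 1) \<and> (\<forall>x. 0 \<le> deriv R x) \<and> (\<forall>x. 0 \<le> R x \<and> R x \<le> 1)"
proof -
  let ?p = "plateau 0 1 4"
  have "\<exists>F. \<forall>x::real. - \<infinity> < ereal x \<longrightarrow> ereal x < \<infinity> \<longrightarrow> (F has_vector_derivative ?p x) (at x)"
    by (rule einterval_antiderivative) (auto intro: smooth_isCont smooth_plateau)
  then obtain F where F: "\<And>x. (F has_real_derivative ?p x) (at x)"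
    by (auto simp: has_real_derivative_iff_has_vector_derivative)
  have cF: "continuous_on S F" for S using F DERIV_isCont continuous_at_imp_continuous_on by blast
  have z: "?p x = 0" if "x \<le> 0 \<or> x \<ge> 1" for x using plateau_outside[of 4 x 0 1] that by auto
  have lo: "F x = F 0" if "x \<le> 0" for x
  proof (cases "x = 0")
    case False
    have "(F has_real_derivative 0) (at y)" if "y < 0" for y using F[of y] z[of y] that by simp
    then show ?thesis using False that by (intro DERIV_isconst_end[symmetric] cF) auto
  qed simp
  have hi: "F x = F 1" if "x \<ge> 1" for x
  proof (cases "x = 1")
    case False
    have "(F has_real_derivative 0) (at y)" if "y > 1" for y using F[of y] z[of y] that by simp
    then show ?thesis using False that by (intro DERIV_isconst_end cF) auto
  qed simp
  have mono: "F x \<le> F y" if "x \<le> y" for x y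
    using DERIV_nonneg_imp_nondecreasing[OF that] F plateau_bounds by blast
  \<comment> \<open>Otherwise the monotone antiderivative is constant on (0, 1), against the value
    of the plateau at 1/2, which is exp (- 1) squared. The parameter 4 places the support in
    [1/4, 3/4], so that this value is positive.\<close>
  have "F 0 < F 1"
  proof (rule ccontr)
    assume "\<not> F 0 < F 1"
    then have c: "F x = F 0" if "0 < x" "x < 1" for x
      using mono[of 0 x] mono[of x 1] that by linarith
    have "((\<lambda>_. F 0) has_real_derivative 0) (at (1/2))" by simp
    then have "(F has_real_derivative 0) (at (1/2))"
      by (rule has_field_derivative_transform_within_open[of _ _ _ "{0<..<1}"]) (use c in auto)
    then have "?p (1/2) = 0" using F DERIV_unique by blast
    then show False by (simp add: plateau_def flat_step_def)
  qed
  define k where "k = 1 / (F 1 - F 0)"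
  have k: "k > 0" using \<open>F 0 < F 1\<close> by (simp add: k_def)
  define R where "R x = k * (F x - F 0)" for x
  have D: "(R has_real_derivative k * ?p x) (at x)" for x
    unfolding R_def by (auto intro!: derivative_eq_intros F)
  have "smooth R" by (rule smoothI[OF D]) (intro smooth_cmult smooth_plateau)
  moreover have "R x = 0" if "x \<le> 0" for x using lo[OF that] by (simp add: R_def)
  moreover have R1: "R x = 1" if "x \<ge> 1" for x
    using hi[OF that] \<open>F 0 < F 1\<close> by (simp add: R_def k_def)
  moreover have "0 \<le> deriv R x" for x
    using DERIV_imp_deriv[OF D] k plateau_bounds by simp
  moreover have "0 \<le> R x" for x using mono[of 0 x] lo[of x] k by (cases "x \<ge> 0") (auto simp: R_def)
  moreover have "R x \<le> 1" for x
  proof -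
    have "R x \<le> R (max x 1)" unfolding R_def using mono[of x "max x 1"] k by simp
    then show ?thesis using R1[of "max x 1"] by simp
  qed
  ultimately show ?thesis by blast
qed

definition sstep :: "real \<Rightarrow> real" where
  "sstep = (SOME R. smooth R \<and> (\<forall>x\<le>0. R x = 0) \<and> (\<forall>x\<ge>1. R x = 1) \<and> (\<forall>x. 0 \<le> deriv R x) \<and> (\<forall>x. 0 \<le> R x \<and> R x \<le> 1))"

lemma sstep: "smooth sstep" "x \<le> 0 \<Longrightarrow> sstep x = 0" "x \<ge> 1 \<Longrightarrow> sstep x = 1" "0 \<le> deriv sstep x"
   "0 \<le> sstep x" "sstep x \<le> 1"
  using someI_ex[OF smooth_step_exists] unfolding sstep_def[symmetric] by blast+

lemma absolutely_integrable_open_real: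
  fixes f :: "real \<Rightarrow> real"
  shows "f absolutely_integrable_on {a<..<b} \<longleftrightarrow> f absolutely_integrable_on {a..b}"
  using absolutely_integrable_on_open_interval[where f = f and a = a and b = b] by (simp add: box_real cbox_interval)

lemma continuous_L2:
  assumes "continuous_on {0..L} v" shows "v \<in> L2 {0<..<L::real}"
proof -
  have c: "continuous_on {0..L} (\<lambda>x. (v x)\<^sup>2)" using assms by (intro continuous_intros)
  have "(\<lambda>x. (v x)\<^sup>2) absolutely_integrable_on {0..L}"
    using absolutely_integrable_continuous_real[OF c] .
  then have "(\<lambda>x. (v x)\<^sup>2) absolutely_integrable_on {0<..<L}"
    by (simp only: absolutely_integrable_open_real)
  then have "integrable (lebesgue_on {0<..<L}) (\<lambda>x. (v x)\<^sup>2)"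
    by (simp add: integrable_restrict_space set_integrable_def)
  moreover have "v \<in> borel_measurable (lebesgue_on {0<..<L})"
    by (rule continuous_imp_measurable_on_sets_lebesgue) (auto intro: continuous_on_subset[OF assms])
  ultimately show ?thesis by (simp add: L2_def)
qed

lemma smooth_L2: "smooth v \<Longrightarrow> v \<in> L2 {0<..<L::real}"
  by (intro continuous_L2 smooth_continuous_on)

lemma test_fun_L2: "test_fun a b v \<Longrightarrow> v \<in> L2 {0<..<L::real}"
  by (intro smooth_L2 test_fun_smooth)

lemma L2_absolutely_integrable:
  assumes "v \<in> L2 {0<..<L}" "w \<in> L2 {0<..<L}"
  shows "(\<lambda>x. v x * w x) absolutely_integrable_on {0..L}"
    and "L2_inner L v w = integral {0..L} (\<lambda>x. v x * w x)"
proof -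
  have i: "integrable (lebesgue_on {0<..<L}) (\<lambda>x. v x * w x)"
    using L2_mult_integrable[OF assms] .
  then have "(\<lambda>x. v x * w x) absolutely_integrable_on {0<..<L}"
    by (simp add: integrable_restrict_space set_integrable_def)
  then show "(\<lambda>x. v x * w x) absolutely_integrable_on {0..L}"
    by (simp only: absolutely_integrable_open_real)
  show "L2_inner L v w = integral {0..L} (\<lambda>x. v x * w x)"
    unfolding L2_inner_def using lebesgue_integral_eq_integral[OF i] by (simp add: integral_open_interval_real)
qed

lemma L2_absolutely_integrable1: "v \<in> L2 {0<..<L::real} \<Longrightarrow> v absolutely_integrable_on {0..L}"
  using L2_absolutely_integrable(1)[of v L "\<lambda>x. 1"] continuous_L2[of L "\<lambda>x. 1"] by simp

text \<open>The derivative of a step steepened by the factor n + 1 at \<open>s\<close> is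
  nonnegative, has integral 1 and is concentrated in [s, s + 1 / (n + 1)]. The mass sits to the
  right of \<open>s\<close>, which explains the asymmetric condition: \<open>s = a\<close> is
  allowed, \<open>s = b\<close> is not.\<close>

lemma approx_identity:
  assumes P: "continuous_on {a..b} P" and s: "a \<le> s" "s < b"
  shows "(\<lambda>n. integral {a..b} (\<lambda>x. P x * (real (Suc n) * deriv sstep (real (Suc n) * (x - s))))) \<longlonglongrightarrow> P s"
proof (rule LIMSEQ_I)
  fix e :: real assume e: "0 < e"
  obtain d where d: "d > 0" "\<And>x. x \<in> {a..b} \<Longrightarrow> dist x s < d \<Longrightarrow> dist (P x) (P s) < e/2"
    using P[unfolded continuous_on_iff, rule_format, of s "e/2"] s e by auto
  obtain N where N: "1 / real (Suc N) < min d (b - s)"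
    using nat_approx_posE[of "min d (b - s)"] d(1) s by auto
  show "\<exists>no. \<forall>n\<ge>no. norm (integral {a..b} (\<lambda>x. P x * (real (Suc n) * deriv sstep (real (Suc n) * (x - s)))) - P s) < e"
  proof (intro exI allI impI)
    fix n assume "N \<le> n"
    define k where "k = real (Suc n)"
    have k: "k > 0" by (simp add: k_def)
    have "1 / k \<le> 1 / real (Suc N)" using \<open>N \<le> n\<close> by (simp add: k_def frac_le)
    then have kd: "1 / k < d" "1 / k < b - s" using N by auto
    let ?g = "\<lambda>x. k * deriv sstep (k * (x - s))"
    have cg: "continuous_on S ?g" for S
      by (intro continuous_intros continuous_on_compose2[OF smooth_continuous_on[OF smooth_deriv[OF sstep(1)], of UNIV]]) auto
    have g0: "0 \<le> ?g x" for x using k sstep(4) by simp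
    have gz: "?g x = 0" if "x < s \<or> x > s + 1 / k" for x
    proof -
      have "deriv sstep y = 0" if "y < 0 \<or> y > 1" for y
      proof -
        have "((\<lambda>_. if y < 0 then 0 else 1) has_real_derivative 0) (at y)" by simp
        then have "(sstep has_real_derivative 0) (at y)"
          by (rule has_field_derivative_transform_within_open[of _ _ _ "if y < 0 then {..<0} else {1<..}"])
            (use that in \<open>auto simp: sstep split: if_splits\<close>)
        then show ?thesis by (rule DERIV_imp_deriv)
      qed
      then show ?thesis using that k by (simp add: field_simps mult_less_0_iff)
    qed
    have ig: "(?g has_integral 1) {a..b}"
    proof -
      have "((\<lambda>x. sstep (k * (x - s))) has_vector_derivative ?g x) (at x within {a..b})" for x
      proof -
        have "((\<lambda>x. sstep (k * (x - s))) has_real_derivative deriv sstep (k * (x - s)) * k) (at x)"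
          by (rule DERIV_chain2[OF smooth_DERIV[OF sstep(1)]]) (auto intro!: derivative_eq_intros)
        then show ?thesis
          by (simp add: has_real_derivative_iff_has_vector_derivative mult.commute has_vector_derivative_at_within)
      qed
      then have "(?g has_integral sstep (k * (b - s)) - sstep (k * (a - s))) {a..b}"
        using s by (intro fundamental_theorem_of_calculus) auto
      moreover have "sstep (k * (b - s)) = 1" using kd k by (intro sstep) (simp add: field_simps)
      moreover have "sstep (k * (a - s)) = 0" using s k by (intro sstep) (simp add: mult_le_0_iff)
      ultimately show ?thesis by simp
    qed
    have iS: "((\<lambda>x. P s * ?g x) has_integral P s) {a..b}" using has_integral_mult_right[OF ig, of "P s"] by simp
    have iP: "(\<lambda>x. P x * ?g x) integrable_on {a..b}"
      by (intro integrable_continuous_interval continuous_intros P cg)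
    have eq: "integral {a..b} (\<lambda>x. P x * ?g x) - P s = integral {a..b} (\<lambda>x. P x * ?g x - P s * ?g x)"
      using integral_unique[OF has_integral_diff[OF integrable_integral[OF iP] iS]] by simp
    have "norm (integral {a..b} (\<lambda>x. P x * ?g x - P s * ?g x)) \<le> integral {a..b} (\<lambda>x. e/2 * ?g x)"
    proof (rule integral_norm_bound_integral)
      show "(\<lambda>x. P x * ?g x - P s * ?g x) integrable_on {a..b}"
        by (intro integrable_continuous_interval continuous_intros P cg)
      show "(\<lambda>x. e/2 * ?g x) integrable_on {a..b}"
        by (intro integrable_continuous_interval continuous_intros cg)
      fix x assume x: "x \<in> {a..b}"
      show "norm (P x * ?g x - P s * ?g x) \<le> e/2 * ?g x"
      proof (cases "x < s \<or> x > s + 1 / k")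
        case True
        show ?thesis unfolding gz[OF True] by simp
      next
        case False
        then have "dist x s < d" using kd by (auto simp: dist_real_def)
        then have "\<bar>P x - P s\<bar> \<le> e/2" using d(2)[OF x] by (simp add: dist_real_def)
        then have "\<bar>P x - P s\<bar> * ?g x \<le> e/2 * ?g x" using g0 by (rule mult_right_mono)
        moreover have "norm (P x * ?g x - P s * ?g x) = \<bar>P x - P s\<bar> * ?g x"
          using g0[of x] by (simp only: real_norm_def left_diff_distrib[symmetric] abs_mult[of "P x - P s"] abs_of_nonneg)
        ultimately show ?thesis by simp
      qed
    qed
    also have "\<dots> = e/2" using integral_unique[OF has_integral_mult_right[OF ig, of "e/2"]] by simp
    also have "\<dots> < e" using e by simp
    finally show "norm (integral {a..b} (\<lambda>x. P x * (real (Suc n) * deriv sstep (real (Suc n) * (x - s)))) - P s) < e"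
      using eq by (simp add: k_def)
  qed
qed

text \<open>The test function is the smoothed indicator of (s, t], a difference of two steep steps.
  Against \<open>q\<close> it tends to the integral over (s, t]; its derivative is an approximate
  identity at \<open>s\<close> minus one at \<open>t\<close>, which turns the other side of the
  definition of the weak derivative into values of \<open>P\<close>.\<close>

lemma weak_deriv_FTC_interior:
  assumes w: "is_weak_deriv L P q" and P: "continuous_on {0..L} P" and st: "0 < s" "s < t" "t < L"
  shows "P t - P s = integral {s..t} q"
proof -
  define \<phi> where "\<phi> n x = sstep (real (Suc n) * (x - s)) - sstep (real (Suc n) * (x - t))" for n x
  have q: "q \<in> L2 {0<..<L}" using w by (simp add: is_weak_deriv_def)
  have D: "(\<phi> n has_real_derivative real (Suc n) * deriv sstep (real (Suc n) * (x - s)) - real (Suc n) * deriv sstep (real (Suc n) * (x - t))) (at x)" for n x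
  proof -
    have "((\<lambda>x. sstep (k * (x - s))) has_real_derivative deriv sstep (k * (x - s)) * k) (at x)" for k s x
      by (rule DERIV_chain2[OF smooth_DERIV[OF sstep(1)]]) (auto intro!: derivative_eq_intros)
    from DERIV_diff[OF this[of "real (Suc n)" s x] this[of "real (Suc n)" t x]]
    show ?thesis unfolding \<phi>_def[abs_def] by (simp add: mult.commute)
  qed
  have sm: "smooth (\<phi> n)" for n
  proof -
    have "smooth (\<lambda>x. sstep (real (Suc n) * x + (- real (Suc n) * s)) - sstep (real (Suc n) * x + (- real (Suc n) * t)))"
      by (intro smooth_diff smooth_affine sstep)
    then show ?thesis unfolding \<phi>_def[abs_def] by (simp add: algebra_simps)
  qed
  obtain N where N: "1 / real (Suc N) < L - t"
    using nat_approx_posE[of "L - t"] st by auto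
  have t: "test_fun 0 L (\<phi> n)" if "N \<le> n" for n
  proof (rule test_funI[OF sm])
    have k: "real (Suc n) > 0" by simp
    have "1 / real (Suc n) \<le> 1 / real (Suc N)" using that by (simp add: frac_le)
    then show "t + 1 / real (Suc n) < L" using N by simp
    show "\<phi> n x = 0" if "x \<notin> {s..t + 1 / real (Suc n)}" for x
    proof (cases "x < s")
      case True
      then have "real (Suc n) * (x - s) \<le> 0" "real (Suc n) * (x - t) \<le> 0"
        using st k by (auto intro!: mult_nonneg_nonpos simp del: of_nat_Suc)
      then show ?thesis by (simp add: \<phi>_def sstep)
    next
      case False
      then have "x > t + 1 / real (Suc n)" using that by auto
      then have "real (Suc n) * (x - t) \<ge> 1" using k by (simp add: field_simps del: of_nat_Suc)
      moreover have "real (Suc n) * (x - t) \<le> real (Suc n) * (x - s)"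
        using st k by (intro mult_left_mono) auto
      ultimately have "real (Suc n) * (x - s) \<ge> 1" "real (Suc n) * (x - t) \<ge> 1" by linarith+
      then show ?thesis by (simp add: \<phi>_def sstep del: of_nat_Suc)
    qed
  qed (use st in auto)
  have "(\<lambda>n. integral {0..L} (\<lambda>x. q x * \<phi> n x)) \<longlonglongrightarrow> integral {0..L} (\<lambda>x. q x * indicator {s<..t} x)"
  proof (rule dominated_convergence(2)[where h = "\<lambda>x. \<bar>q x\<bar>"])
    show "(\<lambda>x. \<bar>q x\<bar>) integrable_on {0..L}"
      using L2_absolutely_integrable1[OF q] by (simp add: absolutely_integrable_on_def)
    show "(\<lambda>x. q x * \<phi> n x) integrable_on {0..L}" for n
      by (rule set_lebesgue_integral_eq_integral(1)[OF L2_absolutely_integrable(1)[OF q smooth_L2[OF sm]]])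
    show "norm (q x * \<phi> n x) \<le> \<bar>q x\<bar>" for n x
    proof -
      have "\<bar>\<phi> n x\<bar> \<le> 1" using sstep(5,6)[of "real (Suc n) * (x - s)"] sstep(5,6)[of "real (Suc n) * (x - t)"]
        by (simp add: \<phi>_def abs_le_iff del: of_nat_Suc)
      then show ?thesis by (simp add: abs_mult mult_left_le)
    qed
    show "(\<lambda>n. q x * \<phi> n x) \<longlonglongrightarrow> q x * indicator {s<..t} x" for x
    proof (intro tendsto_intros)
      have *: "(\<lambda>n. sstep (real (Suc n) * y)) \<longlonglongrightarrow> (if y > 0 then 1 else 0)" for y
      proof (cases "y > 0")
        case True
        have "\<forall>\<^sub>F n in sequentially. real (Suc n) * y \<ge> 1" using True by real_asymp
        then have "\<forall>\<^sub>F n in sequentially. sstep (real (Suc n) * y) = 1"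
          by eventually_elim (rule sstep)
        then show ?thesis using True by (simp add: tendsto_eventually)
      next
        case False
        then have "sstep (real (Suc n) * y) = 0" for n
          by (intro sstep) (simp add: mult_nonneg_nonpos)
        then show ?thesis using False by simp
      qed
      have "(\<lambda>n. \<phi> n x) \<longlonglongrightarrow> (if x - s > 0 then 1 else 0) - (if x - t > 0 then 1 else 0)"
        unfolding \<phi>_def by (intro tendsto_diff *)
      then show "(\<lambda>n. \<phi> n x) \<longlonglongrightarrow> indicator {s<..t} x"
        using st by (auto simp: indicator_def split: if_splits)
    qed
  qed
  moreover have "integral {0..L} (\<lambda>x. q x * indicator {s<..t} x) = integral {s..t} q"
  proof -
    have "integral {0..L} (\<lambda>x. q x * indicator {s<..t} x) = integral {0..L} (\<lambda>x. if x \<in> {s<..t} then q x else 0)"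
      by (rule arg_cong[of _ _ "integral {0..L}"]) auto
    also have "\<dots> = integral ({0..L} \<inter> {s<..t}) q" 
      by (subst Henstock_Kurzweil_Integration.integral_restrict_Int) (simp only: Int_commute)
    also have "{0..L} \<inter> {s<..t} = {s<..t}" using st by auto
    also have "integral {s<..t} q = integral {s..t} q"
      by (rule integral_spike_set; rule negligible_subset[of "{s}"]) (use st in auto)
    finally show ?thesis .
  qed
  moreover have "\<forall>\<^sub>F n in sequentially. integral {0..L} (\<lambda>x. q x * \<phi> n x) = - integral {0..L} (\<lambda>x. P x * deriv (\<phi> n) x)"
    using eventually_ge_at_top[of N]
  proof eventually_elim
    case (elim n)
    have "L2_inner L P (deriv (\<phi> n)) = - L2_inner L q (\<phi> n)"
      using w t[OF elim] by (simp add: is_weak_deriv_def)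
    then show ?case
      using L2_absolutely_integrable(2)[OF q smooth_L2[OF sm]]
        L2_absolutely_integrable(2)[OF continuous_L2[OF P] smooth_L2[OF smooth_deriv[OF sm]]] by simp
  qed
  ultimately have 1: "(\<lambda>n. - integral {0..L} (\<lambda>x. P x * deriv (\<phi> n) x)) \<longlonglongrightarrow> integral {s..t} q"
    by (auto elim: Lim_transform_eventually)
  have "(\<lambda>n. - (integral {0..L} (\<lambda>x. P x * (real (Suc n) * deriv sstep (real (Suc n) * (x - s))))
      - integral {0..L} (\<lambda>x. P x * (real (Suc n) * deriv sstep (real (Suc n) * (x - t)))))) \<longlonglongrightarrow> - (P s - P t)"
    using st by (intro tendsto_intros approx_identity P) auto
  moreover have "integral {0..L} (\<lambda>x. P x * (real (Suc n) * deriv sstep (real (Suc n) * (x - s))))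
      - integral {0..L} (\<lambda>x. P x * (real (Suc n) * deriv sstep (real (Suc n) * (x - t))))
      = integral {0..L} (\<lambda>x. P x * deriv (\<phi> n) x)" for n
  proof -
    have c: "continuous_on S (\<lambda>x. deriv sstep (real (Suc n) * (x - s)))" for S s
      by (intro continuous_intros continuous_on_compose2[OF smooth_continuous_on[OF smooth_deriv[OF sstep(1)], of UNIV]]) auto
    have i: "(\<lambda>x. P x * (real (Suc n) * deriv sstep (real (Suc n) * (x - s)))) integrable_on {0..L}" for s
      by (intro integrable_continuous_interval continuous_on_mult continuous_on_const P c)
    show ?thesis unfolding DERIV_imp_deriv[OF D] Henstock_Kurzweil_Integration.integral_diff[OF i i, symmetric]
      by (intro arg_cong[of _ _ "integral {0..L}"] ext right_diff_distrib[symmetric])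
  qed
  ultimately have "(\<lambda>n. - integral {0..L} (\<lambda>x. P x * deriv (\<phi> n) x)) \<longlonglongrightarrow> - (P s - P t)" by (simp only:)
  then have "(\<lambda>n. - integral {0..L} (\<lambda>x. P x * deriv (\<phi> n) x)) \<longlonglongrightarrow> P t - P s" by simp
  with 1 show ?thesis using LIMSEQ_unique by blast
qed

text \<open>By the interior case \<open>P\<close> minus the primitive of \<open>q\<close> is
  constant on the open interval, and by continuity it is constant up to the endpoints.\<close>

lemma weak_deriv_FTC:
  assumes w: "is_weak_deriv L P q" and P: "continuous_on {0..L} P" and st: "0 \<le> s" "s \<le> t" "t \<le> L" "0 < L"
  shows "P t - P s = integral {s..t} q"
proof -
  have "q \<in> L2 {0<..<L}" using w by (simp add: is_weak_deriv_def)
  then have q: "q integrable_on {0..L}"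
    by (intro set_lebesgue_integral_eq_integral(1) L2_absolutely_integrable1)
  define Q where "Q x = P x - integral {0..x} q" for x
  have cQ: "continuous_on {0..L} Q"
    unfolding Q_def by (intro continuous_intros P indefinite_integral_continuous_1 q)
  have comb: "integral {0..s} q + integral {s..t} q = integral {0..t} q" if "0 \<le> s" "s \<le> t" "t \<le> L" for s t
    using that by (intro Henstock_Kurzweil_Integration.integral_combine) (auto intro: integrable_on_subinterval[OF q])
  have Qc: "Q x = Q (L/2)" if x: "x \<in> {0<..<L}" for x
  proof -
    have eq: "Q a = Q b" if "0 < a" "a < b" "b < L" for a b
      using weak_deriv_FTC_interior[OF w P that] comb[of a b] that unfolding Q_def by linarith
    consider "x < L/2" | "x = L/2" | "L/2 < x" by linarith
    then show ?thesis
    proof cases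
      case 1 then show ?thesis using x by (intro eq) auto
    next
      case 2 then show ?thesis by (rule arg_cong[of _ _ Q])
    next
      case 3 then show ?thesis using x by (intro eq[symmetric]) auto
    qed
  qed
  have cl: "closure {0<..<L} = {0..L}" using st by (simp add: closure_greaterThanLessThan)
  have cQ': "continuous_on (closure {0<..<L}) Q" using cQ by (simp only: cl)
  have "Q x = Q (L/2)" if "x \<in> {0..L}" for x
    by (rule continuous_constant_on_closure[OF cQ' Qc]) (simp_all only: cl that)
  from this[of s] this[of t] have "Q s = Q t" using st by simp
  moreover have "integral {0..s} q + integral {s..t} q = integral {0..t} q"
    by (rule comb) (use st in auto)
  ultimately show ?thesis unfolding Q_def by linarith
qed

subsection \<open>Weak derivatives\<close>

lemma is_weak_deriv_l2:
  assumes "v \<in> L2 {0<..<L}"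
  shows "is_weak_deriv L v g \<longleftrightarrow> g \<in> L2 {0<..<L} \<and>
    (\<forall>\<phi>. test_fun 0 L \<phi> \<longrightarrow> inner (l2c L v) (l2c L (deriv \<phi>)) = - inner (l2c L g) (l2c L \<phi>))"
proof -
  have "test_fun 0 L \<phi> \<Longrightarrow> \<phi> \<in> L2 {0<..<L} \<and> deriv \<phi> \<in> L2 {0<..<L}" for \<phi>
    using test_fun_smooth smooth_deriv smooth_L2 by blast
  then show ?thesis using assms by (auto simp: is_weak_deriv_def inner_l2c)
qed

lemma smooth_bounded: "smooth \<beta> \<Longrightarrow> \<exists>B\<ge>0. \<forall>x\<in>{0..L::real}. \<bar>\<beta> x\<bar> \<le> B"
proof -
  assume "smooth \<beta>"
  then have "bounded (\<beta> ` {0..L})"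
    by (intro compact_imp_bounded compact_continuous_image smooth_continuous_on) auto
  then obtain B where "\<forall>x\<in>{0..L}. \<bar>\<beta> x\<bar> \<le> B" by (auto simp: bounded_iff)
  then have "\<forall>x\<in>{0..L}. \<bar>\<beta> x\<bar> \<le> max B 0" by (meson max.coboundedI1)
  then show ?thesis by (intro exI[of _ "max B 0"]) auto
qed

lemma smooth_measurable_on: "smooth \<beta> \<Longrightarrow> \<beta> \<in> borel_measurable (lebesgue_on S)"
  by (intro measurable_restrict_space1 measurable_lebesgue_borel smooth_measurable)

lemma smooth_mult_L2: "smooth \<beta> \<Longrightarrow> v \<in> L2 {0<..<L} \<Longrightarrow> (\<lambda>x. \<beta> x * v x) \<in> L2 {0<..<L::real}"
  using smooth_bounded[of \<beta> L] by (auto intro!: L2_bounded_mult smooth_measurable_on)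

lemma norm_l2c_le:
  assumes "v \<in> L2 {0<..<L}" "w \<in> L2 {0<..<L}" "AE x in lebesgue_on {0<..<L}. \<bar>v x\<bar> \<le> \<bar>w x\<bar>"
  shows "norm (l2c L v) \<le> norm (l2c L w)"
proof -
  have "L2_inner L v v \<le> L2_inner L w w"
    unfolding L2_inner_def
  proof (rule integral_mono_AE)
    show "AE x in lebesgue_on {0<..<L}. v x * v x \<le> w x * w x"
      using assms(3) by eventually_elim (metis abs_le_square_iff power2_eq_square)
  qed (use assms L2_mult_integrable in auto)
  then show ?thesis using assms by (simp add: norm_eq_sqrt_inner inner_l2c)
qed

lemma norm_l2c_mult:
  assumes "v \<in> L2 {0<..<L}" "smooth \<beta>" "B \<ge> 0" "\<And>x. x \<in> {0..L} \<Longrightarrow> \<bar>\<beta> x\<bar> \<le> B"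
  shows "norm (l2c L (\<lambda>x. \<beta> x * v x)) \<le> B * norm (l2c L v)"
proof -
  have "norm (l2c L (\<lambda>x. \<beta> x * v x)) \<le> norm (l2c L (\<lambda>x. B * v x))"
  proof (intro norm_l2c_le AE_I2)
    fix x assume "x \<in> space (lebesgue_on {0<..<L})"
    then show "\<bar>\<beta> x * v x\<bar> \<le> \<bar>B * v x\<bar>"
      using assms(3) assms(4)[of x] by (simp add: abs_mult mult_right_mono)
  qed (use assms in \<open>auto intro: smooth_mult_L2 L2_cmult\<close>)
  then show ?thesis using assms by (simp add: l2c_scaleR)
qed

lemma weak_deriv_cmult:
  assumes "is_weak_deriv L v g" "v \<in> L2 {0<..<L}"
  shows "is_weak_deriv L (\<lambda>x. c * v x) (\<lambda>x. c * g x)"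
  using assms by (auto simp: is_weak_deriv_l2 L2_cmult l2c_scaleR)

lemma weak_deriv_diff:
  assumes "is_weak_deriv L v g" "is_weak_deriv L w h" "v \<in> L2 {0<..<L}" "w \<in> L2 {0<..<L}"
  shows "is_weak_deriv L (\<lambda>x. v x - w x) (\<lambda>x. g x - h x)"
  using assms by (auto simp: is_weak_deriv_l2 L2_diff l2c_diff inner_diff_left)

lemma L2_inner_move: "L2_inner L (\<lambda>x. \<beta> x * v x) w = L2_inner L v (\<lambda>x. \<beta> x * w x)"
  unfolding L2_inner_def by (simp add: mult.commute mult.left_commute)

lemma deriv_mult_smooth:
  "smooth \<beta> \<Longrightarrow> smooth \<phi> \<Longrightarrow> deriv (\<lambda>x. \<beta> x * \<phi> x) = (\<lambda>x. \<beta> x * deriv \<phi> x + deriv \<beta> x * \<phi> x)"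
  by (rule ext, rule DERIV_imp_deriv, rule derivative_eq_intros, erule smooth_DERIV, erule smooth_DERIV) simp

text \<open>With \<phi> also \<beta> \<phi> is a test function; the classical product rule for
  \<beta> \<phi>, tested against \<open>v\<close>, rearranges to the product rule for \<beta>
  \<open>v\<close>.\<close>

lemma weak_deriv_mult_smooth:
  assumes "is_weak_deriv L v g" "v \<in> L2 {0<..<L}" "smooth \<beta>"
  shows "is_weak_deriv L (\<lambda>x. \<beta> x * v x) (\<lambda>x. \<beta> x * g x + deriv \<beta> x * v x)"
proof -
  have g: "g \<in> L2 {0<..<L}" using assms(1) by (simp add: is_weak_deriv_def)
  have "L2_inner L (\<lambda>x. \<beta> x * v x) (deriv \<phi>) = - L2_inner L (\<lambda>x. \<beta> x * g x + deriv \<beta> x * v x) \<phi>"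
    if t: "test_fun 0 L \<phi>" for \<phi>
  proof -
    have s\<phi>: "smooth \<phi>" using t by (rule test_fun_smooth)
    have "inner (l2c L v) (l2c L (\<lambda>x. \<beta> x * deriv \<phi> x)) + inner (l2c L v) (l2c L (\<lambda>x. deriv \<beta> x * \<phi> x))
        = L2_inner L v (deriv (\<lambda>x. \<beta> x * \<phi> x))"
      using assms s\<phi> unfolding deriv_mult_smooth[OF assms(3) s\<phi>]
      by (subst inner_l2c[symmetric])
        (auto simp: l2c_add smooth_mult_L2 smooth_L2 smooth_deriv L2_add inner_add_right)
    also have "\<dots> = - L2_inner L g (\<lambda>x. \<beta> x * \<phi> x)"
      using assms(1) test_fun_mult[OF t assms(3)] by (simp add: is_weak_deriv_def)
    finally have "L2_inner L v (\<lambda>x. \<beta> x * deriv \<phi> x) + L2_inner L v (\<lambda>x. deriv \<beta> x * \<phi> x) = - L2_inner L g (\<lambda>x. \<beta> x * \<phi> x)"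
      using assms s\<phi> by (simp add: inner_l2c smooth_mult_L2 smooth_L2 smooth_deriv)
    moreover have "L2_inner L (\<lambda>x. \<beta> x * g x + deriv \<beta> x * v x) \<phi>
       = L2_inner L (\<lambda>x. \<beta> x * g x) \<phi> + L2_inner L (\<lambda>x. deriv \<beta> x * v x) \<phi>"
      using assms s\<phi> g by (simp add: inner_l2c[symmetric] l2c_add smooth_mult_L2 smooth_L2 smooth_deriv L2_add inner_add_left)
    ultimately show ?thesis by (simp add: L2_inner_move)
  qed
  then show ?thesis using assms g
    by (auto simp: is_weak_deriv_def intro!: L2_add smooth_mult_L2 smooth_deriv)
qed

lemma FLCV_L2:
  assumes "v \<in> L2 {0<..<L}" "\<And>\<phi>. test_fun p q \<phi> \<Longrightarrow> L2_inner L v \<phi> = 0"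
  shows "AE x in lebesgue_on {0<..<L}. x \<in> {p<..<q} \<longrightarrow> v x = 0"
proof -
  have "integrable (lebesgue_on {0<..<L}) v"
    using L2_mult_integrable[OF assms(1) continuous_L2[of L "\<lambda>x. 1"]] by simp
  then have "integrable lebesgue (zext L v)" by (simp add: integrable_zext)
  moreover have "(LINT x|lebesgue. zext L v x * \<phi> x) = 0" if "test_fun p q \<phi>" for \<phi>
  proof -
    have "zext L v x * \<phi> x = zext L (\<lambda>x. v x * \<phi> x) x" for x by (simp add: zext_def)
    then show ?thesis using assms(2)[OF that] by (simp add: integral_zext L2_inner_def)
  qed
  ultimately have "AE x in lebesgue. x \<in> {p<..<q} \<longrightarrow> zext L v x = 0" by (rule FLCV)
  then show ?thesis unfolding AE_zext by eventually_elim (auto simp: zext_def)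
qed

lemma weak_deriv_unique:
  assumes "is_weak_deriv L v g" "is_weak_deriv L v h"
  shows "AE x in lebesgue_on {0<..<L}. g x = h x"
proof -
  have gh: "g \<in> L2 {0<..<L}" "h \<in> L2 {0<..<L}" using assms by (auto simp: is_weak_deriv_def)
  have "AE x in lebesgue_on {0<..<L}. x \<in> {0<..<L} \<longrightarrow> g x - h x = 0"
  proof (rule FLCV_L2[OF L2_diff[OF gh]])
    fix \<phi> assume t: "test_fun 0 L \<phi>"
    then have "L2_inner L g \<phi> = L2_inner L h \<phi>" using assms by (auto simp: is_weak_deriv_def)
    then show "L2_inner L (\<lambda>x. g x - h x) \<phi> = 0"
      using gh test_fun_L2[OF t] by (simp add: inner_l2c[symmetric] L2_diff l2c_diff inner_diff_left)
  qed
  then show ?thesis by (simp add: AE_zext)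
qed

lemma dx_weak: "v \<in> H1 L \<Longrightarrow> is_weak_deriv L v (dx L v)"
  using someI_ex[of "is_weak_deriv L v"] by (auto simp: dx_def H1_def)

lemma H1_L2: "v \<in> H1 L \<Longrightarrow> v \<in> L2 {0<..<L}"
  by (simp add: H1_def)

lemma dx_L2: "v \<in> H1 L \<Longrightarrow> dx L v \<in> L2 {0<..<L}"
  using dx_weak by (auto simp: is_weak_deriv_def)

lemma H1I: "is_weak_deriv L v g \<Longrightarrow> v \<in> L2 {0<..<L} \<Longrightarrow> v \<in> H1 L"
  by (auto simp: H1_def)

lemma dx_AE:
  assumes "is_weak_deriv L v g" "v \<in> L2 {0<..<L}"
  shows "AE x in lebesgue_on {0<..<L}. dx L v x = g x"
  using weak_deriv_unique[OF dx_weak[OF H1I[OF assms]] assms(1)] .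

lemma l2c_dx:
  assumes "is_weak_deriv L v g" "v \<in> L2 {0<..<L}"
  shows "l2c L (dx L v) = l2c L g"
  by (rule l2c_cong_AE(2)[OF dx_AE[OF assms] dx_L2[OF H1I[OF assms]]])

text \<open>Test functions supported in (p, q) see only zero values of \<open>v\<close>. Vanishing
  can be claimed only almost everywhere, because \<open>dx\<close> is an arbitrary version.\<close>

lemma dx_zero_AE:
  assumes v: "v \<in> H1 L" and z: "\<And>x. x \<in> {p<..<q} \<Longrightarrow> v x = 0" and pq: "0 \<le> p" "q \<le> L" "p < q"
  shows "AE x in lebesgue_on {0<..<L}. x \<in> {p<..<q} \<longrightarrow> dx L v x = 0"
proof (rule FLCV_L2[OF dx_L2[OF v]])
  fix \<phi> assume t: "test_fun p q \<phi>"
  then have "test_fun 0 L \<phi>" by (rule test_fun_mono) (use pq in auto)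
  then have "L2_inner L (dx L v) \<phi> = - L2_inner L v (deriv \<phi>)"
    using dx_weak[OF v] by (simp add: is_weak_deriv_def)
  also have "v x * deriv \<phi> x = 0" for x
    using z[of x] test_fun_outside[OF test_fun_deriv[OF t pq(3)], of x] by (cases "x \<in> {p<..<q}") simp_all
  then have "L2_inner L v (deriv \<phi>) = 0" unfolding L2_inner_def by (simp only: Bochner_Integration.integral_zero)
  finally show "L2_inner L (dx L v) \<phi> = 0" by simp
qed

lemma H1_norm_l2c: "v \<in> H1 L \<Longrightarrow> H1_norm L v = sqrt ((norm (l2c L v))\<^sup>2 + (norm (l2c L (dx L v)))\<^sup>2)"
  by (simp add: H1_norm_def norm_l2c H1_L2 dx_L2)

lemma smooth_weak_deriv:
  assumes "smooth \<phi>" shows "is_weak_deriv L \<phi> (deriv \<phi>)" "\<phi> \<in> H1 L"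
proof -
  \<comment> \<open>Only the constant 1 needs an integration by parts;
    \<open>weak_deriv_mult_smooth\<close> with the factor \<phi> does the rest.\<close>
  have "is_weak_deriv L (\<lambda>x. 1) (\<lambda>x. 0)"
    unfolding is_weak_deriv_def
  proof (intro conjI allI impI)
    fix \<psi> assume t: "test_fun 0 L \<psi>"
    show "L2_inner L (\<lambda>x. 1) (deriv \<psi>) = - L2_inner L (\<lambda>x. 0) \<psi>"
    proof (cases "0 < L")
      case True
      have "(deriv \<psi> has_integral \<psi> L - \<psi> 0) {0..L}"
        by (rule fundamental_theorem_of_calculus)
          (use True smooth_DERIV[OF test_fun_smooth[OF t]] in \<open>auto simp: has_real_derivative_iff_has_vector_derivative has_vector_derivative_at_within\<close>)
      then have "integral {0..L} (deriv \<psi>) = 0"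
        using test_fun_outside[OF t, of 0] test_fun_outside[OF t, of L] by (simp add: integral_unique)
      then show ?thesis
        using L2_absolutely_integrable(2)[of "\<lambda>x. 1" L "deriv \<psi>"] t
        by (simp add: L2_inner_def continuous_L2 smooth_L2 smooth_deriv test_fun_smooth)
    qed (simp add: L2_inner_def)
  qed (rule L2_zero)
  from weak_deriv_mult_smooth[OF this continuous_L2 assms] show "is_weak_deriv L \<phi> (deriv \<phi>)" by simp
  then show "\<phi> \<in> H1 L" using smooth_L2[OF assms] by (rule H1I)
qed

lemma H10_H1: "v \<in> H10 L \<Longrightarrow> v \<in> H1 L"
  by (simp add: H10_def)

lemma H10_L2: "v \<in> H10 L \<Longrightarrow> v \<in> L2 {0<..<L}"
  using H10_H1 H1_L2 by blast

lemma H1_diff: "v \<in> H1 L \<Longrightarrow> w \<in> H1 L \<Longrightarrow> (\<lambda>x. v x - w x) \<in> H1 L"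
  by (intro H1I[OF weak_deriv_diff[OF dx_weak dx_weak]] L2_diff H1_L2)

lemma l2c_dx_diff: "v \<in> H1 L \<Longrightarrow> w \<in> H1 L \<Longrightarrow> l2c L (dx L (\<lambda>x. v x - w x)) = l2c L (dx L v) - l2c L (dx L w)"
  by (subst l2c_dx[OF weak_deriv_diff[OF dx_weak dx_weak]]) (auto simp: l2c_diff dx_L2 H1_L2 L2_diff)

lemma H1_mult: "v \<in> H1 L \<Longrightarrow> smooth \<beta> \<Longrightarrow> (\<lambda>x. \<beta> x * v x) \<in> H1 L"
  by (intro H1I[OF weak_deriv_mult_smooth[OF dx_weak]] smooth_mult_L2 H1_L2)

lemma l2c_dx_mult:
  "v \<in> H1 L \<Longrightarrow> smooth \<beta> \<Longrightarrow> l2c L (dx L (\<lambda>x. \<beta> x * v x)) = l2c L (\<lambda>x. \<beta> x * dx L v x) + l2c L (\<lambda>x. deriv \<beta> x * v x)"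
  by (subst l2c_dx[OF weak_deriv_mult_smooth[OF dx_weak]]) (auto simp: l2c_add dx_L2 H1_L2 smooth_mult_L2 smooth_deriv)

lemma H1_norm_mult_le:
  assumes \<beta>: "smooth \<beta>"
  shows "\<exists>C\<ge>0. \<forall>v\<in>H1 L. H1_norm L (\<lambda>x. \<beta> x * v x) \<le> C * H1_norm L v"
proof -
  obtain B where B: "B \<ge> 0" "\<And>x. x \<in> {0..L} \<Longrightarrow> \<bar>\<beta> x\<bar> \<le> B" using smooth_bounded[OF \<beta>] by blast
  obtain B' where B': "B' \<ge> 0" "\<And>x. x \<in> {0..L} \<Longrightarrow> \<bar>deriv \<beta> x\<bar> \<le> B'" using smooth_bounded[OF smooth_deriv[OF \<beta>]] by blast
  have "H1_norm L (\<lambda>x. \<beta> x * v x) \<le> (2 * B + B') * H1_norm L v" if v: "v \<in> H1 L" for v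
  proof -
    let ?N = "H1_norm L v"
    have n1: "norm (l2c L v) \<le> ?N" "norm (l2c L (dx L v)) \<le> ?N"
      by (auto simp: H1_norm_l2c[OF v] intro!: real_le_rsqrt)
    have "norm (l2c L (\<lambda>x. \<beta> x * v x)) \<le> B * norm (l2c L v)"
      by (rule norm_l2c_mult[OF H1_L2[OF v] \<beta> B])
    also have "\<dots> \<le> B * ?N" by (intro mult_left_mono n1 B)
    finally have a: "norm (l2c L (\<lambda>x. \<beta> x * v x)) \<le> B * ?N" .
    have "norm (l2c L (dx L (\<lambda>x. \<beta> x * v x))) \<le> norm (l2c L (\<lambda>x. \<beta> x * dx L v x)) + norm (l2c L (\<lambda>x. deriv \<beta> x * v x))"
      by (simp add: l2c_dx_mult[OF v \<beta>] norm_triangle_ineq)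
    also have "\<dots> \<le> B * norm (l2c L (dx L v)) + B' * norm (l2c L v)"
      by (intro add_mono norm_l2c_mult H1_L2[OF v] dx_L2[OF v] smooth_deriv \<beta> B B')
    also have "\<dots> \<le> B * ?N + B' * ?N" by (intro add_mono mult_left_mono n1 B B')
    finally have b: "norm (l2c L (dx L (\<lambda>x. \<beta> x * v x))) \<le> B * ?N + B' * ?N" .
    have "H1_norm L (\<lambda>x. \<beta> x * v x) \<le> norm (l2c L (\<lambda>x. \<beta> x * v x)) + norm (l2c L (dx L (\<lambda>x. \<beta> x * v x)))"
      by (simp add: H1_norm_l2c[OF H1_mult[OF v \<beta>]] sqrt_sum_squares_le_sum)
    also have "\<dots> \<le> (2 * B + B') * ?N" using a b by (simp add: algebra_simps)
    finally show ?thesis .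
  qed
  then show ?thesis using B B' by (intro exI[of _ "2 * B + B'"]) auto
qed

lemma test_fun_H10:
  assumes "test_fun 0 L \<phi>" shows "\<phi> \<in> H10 L"
proof -
  have "H1_norm L (\<lambda>x. \<phi> x - \<phi> x) = 0"
    using H1_norm_l2c[of "\<lambda>x. 0" L] smooth_weak_deriv(1)[OF smooth_const[of 0], where L=L] smooth_weak_deriv(2)[OF smooth_const[of 0], where L=L] l2c_dx[of L "\<lambda>x. 0" "\<lambda>x. 0"] L2_zero[of "{0<..<L}"]
      l2c_scaleR[of "\<lambda>x. 0" L 0] by simp
  then have "\<exists>\<psi>. (\<forall>k::nat. test_fun 0 L (\<psi> k)) \<and> (\<lambda>k. H1_norm L (\<lambda>x. \<phi> x - \<psi> k x)) \<longlonglongrightarrow> 0"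
    using assms by (intro exI[of _ "\<lambda>k. \<phi>"]) auto
  then show ?thesis using smooth_weak_deriv[OF test_fun_smooth[OF assms]] smooth_continuous_on[OF test_fun_smooth[OF assms]]
    by (simp add: H10_def)
qed

text \<open>Multiplication by a smooth function is bounded in the \<open>H1_norm\<close> and
  preserves test functions, hence also their closure.\<close>

lemma H10_mult:
  assumes v: "v \<in> H10 L" and \<beta>: "smooth \<beta>"
  shows "(\<lambda>x. \<beta> x * v x) \<in> H10 L"
proof -
  obtain \<phi> where \<phi>: "\<And>k::nat. test_fun 0 L (\<phi> k)" "(\<lambda>k. H1_norm L (\<lambda>x. v x - \<phi> k x)) \<longlonglongrightarrow> 0"
    using v by (auto simp: H10_def)
  obtain C where C: "C \<ge> 0" "\<And>v. v \<in> H1 L \<Longrightarrow> H1_norm L (\<lambda>x. \<beta> x * v x) \<le> C * H1_norm L v"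
    using H1_norm_mult_le[OF \<beta>] by blast
  have d: "(\<lambda>x. v x - \<phi> k x) \<in> H1 L" for k
    by (intro H1_diff H10_H1[OF v] smooth_weak_deriv test_fun_smooth[OF \<phi>(1)])
  have "(\<lambda>k. H1_norm L (\<lambda>x. \<beta> x * v x - \<beta> x * \<phi> k x)) \<longlonglongrightarrow> 0"
  proof (rule tendsto_sandwich[OF _ _ tendsto_const])
    show "\<forall>\<^sub>F k in sequentially. 0 \<le> H1_norm L (\<lambda>x. \<beta> x * v x - \<beta> x * \<phi> k x)"
      by (simp add: H1_norm_def)
    show "\<forall>\<^sub>F k in sequentially. H1_norm L (\<lambda>x. \<beta> x * v x - \<beta> x * \<phi> k x) \<le> C * H1_norm L (\<lambda>x. v x - \<phi> k x)"
      using C(2)[OF d] by (simp add: right_diff_distrib)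
    show "(\<lambda>k. C * H1_norm L (\<lambda>x. v x - \<phi> k x)) \<longlonglongrightarrow> 0" using tendsto_mult_right_zero[OF \<phi>(2)] by simp
  qed
  then have "\<exists>\<psi>. (\<forall>k::nat. test_fun 0 L (\<psi> k)) \<and> (\<lambda>k. H1_norm L (\<lambda>x. \<beta> x * v x - \<psi> k x)) \<longlonglongrightarrow> 0"
    using \<phi>(1) by (intro exI[of _ "\<lambda>k x. \<beta> x * \<phi> k x"]) (auto intro: test_fun_mult \<beta>)
  moreover have "continuous_on {0..L} (\<lambda>x. \<beta> x * v x)"
    using v by (intro continuous_on_mult smooth_continuous_on[OF \<beta>]) (simp add: H10_def)
  ultimately show ?thesis using H1_mult[OF H10_H1[OF v] \<beta>] by (simp add: H10_def)
qed

subsection \<open>Curves in function spaces\<close>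

lemma tendsto_within_bound:
  fixes f :: "real \<Rightarrow> 'a::real_normed_vector"
  assumes "\<And>s. s \<in> S \<Longrightarrow> s \<noteq> t \<Longrightarrow> norm (f s - l) \<le> g s" "(g \<longlongrightarrow> 0) (at t within S)"
  shows "(f \<longlongrightarrow> l) (at t within S)"
proof -
  have "((\<lambda>s. f s - l) \<longlongrightarrow> 0) (at t within S)"
    by (rule Lim_null_comparison[OF _ assms(2)]) (auto simp: eventually_at_filter assms(1))
  then show ?thesis by (simp add: Lim_null[symmetric])
qed

text \<open>Bridge between the difference quotients in \<open>is_time_deriv\<close> and
  differentiability of the curve of classes in \<open>l2\<close>.\<close>

lemma has_vector_derivative_quotient_iff:
  fixes U :: "real \<Rightarrow> 'a::real_normed_vector"
  shows "(U has_vector_derivative V) (at t within S) \<longleftrightarrow>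
    ((\<lambda>s. norm ((1 / (s - t)) *\<^sub>R (U s - U t) - V)) \<longlongrightarrow> 0) (at t within S)"
proof -
  have eq: "norm ((U s - U t - (s - t) *\<^sub>R V) /\<^sub>R norm (s - t)) = norm ((1 / (s - t)) *\<^sub>R (U s - U t) - V)" if "s \<noteq> t" for s
  proof -
    have "(1 / (s - t)) *\<^sub>R (U s - U t) - V = (1 / (s - t)) *\<^sub>R (U s - U t - (s - t) *\<^sub>R V)"
      using that by (simp add: scaleR_diff_right)
    then show ?thesis by (simp add: divide_inverse)
  qed
  have "(U has_vector_derivative V) (at t within S) \<longleftrightarrow>
      ((\<lambda>s. (U s - U t - (s - t) *\<^sub>R V) /\<^sub>R norm (s - t)) \<longlongrightarrow> 0) (at t within S)"
    unfolding has_vector_derivative_def has_derivative_within by (simp add: bounded_linear_scaleR_left diff_diff_eq inverse_eq_divide)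
  also have "\<dots> \<longleftrightarrow> ((\<lambda>s. norm ((U s - U t - (s - t) *\<^sub>R V) /\<^sub>R norm (s - t))) \<longlongrightarrow> 0) (at t within S)"
    by (simp only: tendsto_norm_zero_iff)
  also have "\<dots> \<longleftrightarrow> ((\<lambda>s. norm ((1 / (s - t)) *\<^sub>R (U s - U t) - V)) \<longlongrightarrow> 0) (at t within S)"
    by (rule filterlim_cong[OF refl refl]) (unfold eventually_at_filter, intro always_eventually allI impI eq)
  finally show ?thesis .
qed

lemma H1_norm_bounds:
  assumes "v \<in> H1 L"
  shows "norm (l2c L v) \<le> H1_norm L v" "norm (l2c L (dx L v)) \<le> H1_norm L v"
    "H1_norm L v \<le> norm (l2c L v) + norm (l2c L (dx L v))"
  by (auto simp: H1_norm_l2c[OF assms] sqrt_sum_squares_le_sum intro!: real_le_rsqrt)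

lemma C0_H10_H10: "u \<in> C0_H10 L T \<Longrightarrow> t \<in> {0..T} \<Longrightarrow> u t \<in> H10 L"
  by (simp add: C0_H10_def)

lemma C0_H10_H1: "u \<in> C0_H10 L T \<Longrightarrow> t \<in> {0..T} \<Longrightarrow> u t \<in> H1 L"
  using C0_H10_H10 H10_H1 by blast

lemma C0_H10_continuous:
  assumes u: "u \<in> C0_H10 L T"
  shows "continuous_on {0..T} (\<lambda>t. l2c L (u t))" "continuous_on {0..T} (\<lambda>t. l2c L (dx L (u t)))"
proof -
  have lim: "((\<lambda>s. H1_norm L (\<lambda>x. u s x - u t x)) \<longlongrightarrow> 0) (at t within {0..T})" if "t \<in> {0..T}" for t
    using u that by (auto simp: C0_H10_def norm_continuous_def)
  note h = C0_H10_H1[OF u]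
  show "continuous_on {0..T} (\<lambda>t. l2c L (u t))"
    unfolding continuous_on_def
  proof (intro ballI)
    fix t assume t: "t \<in> {0..T}"
    show "((\<lambda>t. l2c L (u t)) \<longlongrightarrow> l2c L (u t)) (at t within {0..T})"
    proof (rule tendsto_within_bound[OF _ lim[OF t]])
      fix s assume "s \<in> {0..T}"
      then show "norm (l2c L (u s) - l2c L (u t)) \<le> H1_norm L (\<lambda>x. u s x - u t x)"
        using H1_norm_bounds(1)[OF H1_diff[OF h h]] t by (simp add: l2c_diff H1_L2 h)
    qed
  qed
  show "continuous_on {0..T} (\<lambda>t. l2c L (dx L (u t)))"
    unfolding continuous_on_def
  proof (intro ballI)
    fix t assume t: "t \<in> {0..T}"
    show "((\<lambda>t. l2c L (dx L (u t))) \<longlongrightarrow> l2c L (dx L (u t))) (at t within {0..T})"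
    proof (rule tendsto_within_bound[OF _ lim[OF t]])
      fix s assume "s \<in> {0..T}"
      then show "norm (l2c L (dx L (u s)) - l2c L (dx L (u t))) \<le> H1_norm L (\<lambda>x. u s x - u t x)"
        using H1_norm_bounds(2)[OF H1_diff[OF h h]] t by (simp add: l2c_dx_diff h)
    qed
  qed
qed

lemma C0_H10I:
  assumes "\<And>t. t \<in> {0..T} \<Longrightarrow> u t \<in> H10 L"
    and c: "continuous_on {0..T} (\<lambda>t. l2c L (u t))" "continuous_on {0..T} (\<lambda>t. l2c L (dx L (u t)))"
  shows "u \<in> C0_H10 L T"
proof -
  have h: "u t \<in> H1 L" if "t \<in> {0..T}" for t using assms(1) that H10_H1 by blast
  have "((\<lambda>s. H1_norm L (\<lambda>x. u s x - u t x)) \<longlongrightarrow> 0) (at t within {0..T})" if t: "t \<in> {0..T}" for t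
  proof (rule tendsto_within_bound)
    show "norm (H1_norm L (\<lambda>x. u s x - u t x) - 0) \<le> norm (l2c L (u s) - l2c L (u t)) + norm (l2c L (dx L (u s)) - l2c L (dx L (u t)))"
      if "s \<in> {0..T}" for s
    proof -
      have "H1_norm L (\<lambda>x. u s x - u t x) \<ge> 0" by (simp add: H1_norm_def)
      then show ?thesis
        using H1_norm_bounds(3)[OF H1_diff[OF h[OF that] h[OF t]]] that t by (simp add: l2c_dx_diff l2c_diff H1_L2 h)
    qed
    have "((\<lambda>s. norm (l2c L (u s) - l2c L (u t)) + norm (l2c L (dx L (u s)) - l2c L (dx L (u t))))
        \<longlongrightarrow> norm (l2c L (u t) - l2c L (u t)) + norm (l2c L (dx L (u t)) - l2c L (dx L (u t)))) (at t within {0..T})"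
      using c t by (intro tendsto_intros) (auto simp: continuous_on_def)
    then show "((\<lambda>s. norm (l2c L (u s) - l2c L (u t)) + norm (l2c L (dx L (u s)) - l2c L (dx L (u t)))) \<longlongrightarrow> 0) (at t within {0..T})"
      by simp
  qed
  then show ?thesis using assms(1) by (simp add: C0_H10_def norm_continuous_def)
qed

lemma is_time_deriv_l2:
  assumes "\<And>s. s \<in> {0..T} \<Longrightarrow> u s \<in> L2 {0<..<L}" "t \<in> {0..T}" "v \<in> L2 {0<..<L}"
  shows "is_time_deriv L T u t v \<longleftrightarrow> ((\<lambda>s. l2c L (u s)) has_vector_derivative l2c L v) (at t within {0..T})"
proof -
  have "L2_norm L (\<lambda>x. (u s x - u t x) / (s - t) - v x) = norm ((1 / (s - t)) *\<^sub>R (l2c L (u s) - l2c L (u t)) - l2c L v)"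
    if s: "s \<in> {0..T}" for s
  proof -
    have d: "(\<lambda>x. u s x - u t x) \<in> L2 {0<..<L}" using assms s by (intro L2_diff) auto
    have "(\<lambda>x. (u s x - u t x) / (s - t) - v x) = (\<lambda>x. 1 / (s - t) * (u s x - u t x) - v x)" by auto
    moreover have "(\<lambda>x. 1 / (s - t) * (u s x - u t x) - v x) \<in> L2 {0<..<L}"
      by (intro L2_diff L2_cmult d assms)
    ultimately have "L2_norm L (\<lambda>x. (u s x - u t x) / (s - t) - v x) = norm (l2c L (\<lambda>x. 1 / (s - t) * (u s x - u t x) - v x))"
      by (simp only: norm_l2c)
    also have "l2c L (\<lambda>x. 1 / (s - t) * (u s x - u t x) - v x) = (1 / (s - t)) *\<^sub>R (l2c L (u s) - l2c L (u t)) - l2c L v"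
      using assms s d by (simp only: l2c_diff l2c_scaleR L2_cmult)
    finally show ?thesis .
  qed
  then have "((\<lambda>s. L2_norm L (\<lambda>x. (u s x - u t x) / (s - t) - v x)) \<longlongrightarrow> 0) (at t within {0..T}) \<longleftrightarrow>
      ((\<lambda>s. norm ((1 / (s - t)) *\<^sub>R (l2c L (u s) - l2c L (u t)) - l2c L v)) \<longlongrightarrow> 0) (at t within {0..T})"
    by (intro filterlim_cong) (auto simp: eventually_at_filter)
  then show ?thesis using assms by (simp add: is_time_deriv_def has_vector_derivative_quotient_iff)
qed

lemma C1_L2_L2: "u \<in> C1_L2 L T \<Longrightarrow> t \<in> {0..T} \<Longrightarrow> u t \<in> L2 {0<..<L}"
  by (simp add: C1_L2_def)

lemma dt_time_deriv: "u \<in> C1_L2 L T \<Longrightarrow> t \<in> {0..T} \<Longrightarrow> is_time_deriv L T u t (dt L T u t)"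
  using someI_ex[of "is_time_deriv L T u t"] by (auto simp: dt_def C1_L2_def)

lemma dt_L2: "u \<in> C1_L2 L T \<Longrightarrow> t \<in> {0..T} \<Longrightarrow> dt L T u t \<in> L2 {0<..<L}"
  using dt_time_deriv by (auto simp: is_time_deriv_def)

lemma C1_L2_deriv:
  "u \<in> C1_L2 L T \<Longrightarrow> t \<in> {0..T} \<Longrightarrow> ((\<lambda>s. l2c L (u s)) has_vector_derivative l2c L (dt L T u t)) (at t within {0..T})"
  using is_time_deriv_l2[of T u L t "dt L T u t"] dt_time_deriv dt_L2 C1_L2_L2 by blast

lemma C1_L2_continuous:
  assumes u: "u \<in> C1_L2 L T"
  shows "continuous_on {0..T} (\<lambda>t. l2c L (dt L T u t))"
  unfolding continuous_on_def
proof (intro ballI)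
  fix t assume t: "t \<in> {0..T}"
  show "((\<lambda>t. l2c L (dt L T u t)) \<longlongrightarrow> l2c L (dt L T u t)) (at t within {0..T})"
  proof (rule tendsto_within_bound)
    show "((\<lambda>s. L2_norm L (\<lambda>x. dt L T u s x - dt L T u t x)) \<longlongrightarrow> 0) (at t within {0..T})"
      using u t by (auto simp: C1_L2_def norm_continuous_def)
    fix s assume "s \<in> {0..T}"
    then show "norm (l2c L (dt L T u s) - l2c L (dt L T u t)) \<le> L2_norm L (\<lambda>x. dt L T u s x - dt L T u t x)"
      using dt_L2[OF u] t by (simp add: l2c_diff[symmetric] norm_l2c L2_diff)
  qed
qed

text \<open>As 0 < T, no point of [0, T] is isolated and the derivative is unique also at the two
  ends. The choice made by \<open>dt\<close> is therefore determined as a class.\<close>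

lemma l2c_dt_unique:
  assumes T: "0 < T" and t: "t \<in> {0..T}" and u: "\<And>s. s \<in> {0..T} \<Longrightarrow> u s \<in> L2 {0<..<L}"
    and v: "v \<in> L2 {0<..<L}" "((\<lambda>s. l2c L (u s)) has_vector_derivative l2c L v) (at t within {0..T})"
  shows "is_time_deriv L T u t (dt L T u t)" "l2c L (dt L T u t) = l2c L v"
proof -
  have "is_time_deriv L T u t v" using is_time_deriv_l2[of T u L t v] u t v by blast
  then show d: "is_time_deriv L T u t (dt L T u t)"
    using someI[of "is_time_deriv L T u t"] by (simp add: dt_def)
  then have "dt L T u t \<in> L2 {0<..<L}" by (simp add: is_time_deriv_def)
  then have "((\<lambda>s. l2c L (u s)) has_vector_derivative l2c L (dt L T u t)) (at t within {0..T})"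
    using is_time_deriv_l2[of T u L t "dt L T u t"] u t d by blast
  moreover have "at t within {0..T} \<noteq> bot"
    using T t by (simp add: trivial_limit_within islimpt_Icc)
  ultimately show "l2c L (dt L T u t) = l2c L v"
    using vector_derivative_unique_within v(2) by blast
qed

lemma C1_L2I:
  assumes T: "0 < T" and u: "\<And>s. s \<in> {0..T} \<Longrightarrow> u s \<in> L2 {0<..<L}"
    and v: "\<And>t. t \<in> {0..T} \<Longrightarrow> v t \<in> L2 {0<..<L}"
      "\<And>t. t \<in> {0..T} \<Longrightarrow> ((\<lambda>s. l2c L (u s)) has_vector_derivative l2c L (v t)) (at t within {0..T})"
    and c: "continuous_on {0..T} (\<lambda>t. l2c L (v t))"
  shows "u \<in> C1_L2 L T"
proof -
  have d: "is_time_deriv L T u t (dt L T u t)" "l2c L (dt L T u t) = l2c L (v t)" if "t \<in> {0..T}" for t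
    using l2c_dt_unique[OF T that u v(1)[OF that] v(2)[OF that]] by blast+
  have L: "dt L T u t \<in> L2 {0<..<L}" if "t \<in> {0..T}" for t
    using d(1)[OF that] by (simp add: is_time_deriv_def)
  have "((\<lambda>s. L2_norm L (\<lambda>x. dt L T u s x - dt L T u t x)) \<longlongrightarrow> 0) (at t within {0..T})" if t: "t \<in> {0..T}" for t
  proof (rule tendsto_within_bound)
    show "norm (L2_norm L (\<lambda>x. dt L T u s x - dt L T u t x) - 0) \<le> norm (l2c L (v s) - l2c L (v t))"
      if s: "s \<in> {0..T}" for s
      using L[OF s] L[OF t] d(2)[OF s] d(2)[OF t]
      by (simp add: norm_l2c[symmetric] L2_diff l2c_diff)
    have "((\<lambda>s. norm (l2c L (v s) - l2c L (v t))) \<longlongrightarrow> norm (l2c L (v t) - l2c L (v t))) (at t within {0..T})"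
      using c t by (intro tendsto_intros) (auto simp: continuous_on_def)
    then show "((\<lambda>s. norm (l2c L (v s) - l2c L (v t))) \<longlongrightarrow> 0) (at t within {0..T})" by simp
  qed
  then show ?thesis using u d(1) by (fastforce simp: C1_L2_def norm_continuous_def)
qed

lemma continuous_on_l2c_mult:
  fixes S :: "real set"
  assumes "continuous_on S (\<lambda>t. l2c L (v t))" "\<And>t. t \<in> S \<Longrightarrow> v t \<in> L2 {0<..<L}" "smooth \<beta>"
  shows "continuous_on S (\<lambda>t. l2c L (\<lambda>x. \<beta> x * v t x))"
proof -
  obtain B where B: "B \<ge> 0" "\<And>x. x \<in> {0..L} \<Longrightarrow> \<bar>\<beta> x\<bar> \<le> B" using smooth_bounded[OF assms(3)] by blast
  show ?thesis unfolding continuous_on_def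
  proof (intro ballI)
    fix t assume t: "t \<in> S"
    show "((\<lambda>t. l2c L (\<lambda>x. \<beta> x * v t x)) \<longlongrightarrow> l2c L (\<lambda>x. \<beta> x * v t x)) (at t within S)"
    proof (rule tendsto_within_bound)
      fix s assume s: "s \<in> S"
      have "l2c L (\<lambda>x. \<beta> x * v s x) - l2c L (\<lambda>x. \<beta> x * v t x) = l2c L (\<lambda>x. \<beta> x * (v s x - v t x))"
        using assms s t by (simp add: l2c_diff[symmetric] smooth_mult_L2 right_diff_distrib)
      then show "norm (l2c L (\<lambda>x. \<beta> x * v s x) - l2c L (\<lambda>x. \<beta> x * v t x)) \<le> B * norm (l2c L (v s) - l2c L (v t))"
        using norm_l2c_mult[OF L2_diff[OF assms(2)[OF s] assms(2)[OF t]] assms(3) B] assms(2) s t by (simp add: l2c_diff)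
    next
      have "((\<lambda>s. B * norm (l2c L (v s) - l2c L (v t))) \<longlongrightarrow> B * norm (l2c L (v t) - l2c L (v t))) (at t within S)"
        using assms(1) t by (intro tendsto_intros) (auto simp: continuous_on_def)
      then show "((\<lambda>s. B * norm (l2c L (v s) - l2c L (v t))) \<longlongrightarrow> 0) (at t within S)" by simp
    qed
  qed
qed

lemma has_vector_derivative_l2c_mult:
  assumes "((\<lambda>s. l2c L (u s)) has_vector_derivative l2c L v) (at t within S)" "t \<in> S"
    "\<And>t. t \<in> S \<Longrightarrow> u t \<in> L2 {0<..<L}" "v \<in> L2 {0<..<L}" "smooth \<beta>"
  shows "((\<lambda>s. l2c L (\<lambda>x. \<beta> x * u s x)) has_vector_derivative l2c L (\<lambda>x. \<beta> x * v x)) (at t within S)"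
proof -
  obtain B where B: "B \<ge> 0" "\<And>x. x \<in> {0..L} \<Longrightarrow> \<bar>\<beta> x\<bar> \<le> B" using smooth_bounded[OF assms(5)] by blast
  show ?thesis unfolding has_vector_derivative_quotient_iff
  proof (rule tendsto_within_bound)
    fix s assume s: "s \<in> S"
    have d: "(\<lambda>x. 1 / (s - t) * (u s x - u t x) - v x) \<in> L2 {0<..<L}"
      using assms s by (intro L2_diff L2_cmult) auto
    have "(1 / (s - t)) *\<^sub>R (l2c L (\<lambda>x. \<beta> x * u s x) - l2c L (\<lambda>x. \<beta> x * u t x)) - l2c L (\<lambda>x. \<beta> x * v x)
        = l2c L (\<lambda>x. 1 / (s - t) * (\<beta> x * u s x - \<beta> x * u t x) - \<beta> x * v x)"
      using assms s by (simp only: l2c_diff l2c_scaleR smooth_mult_L2 L2_diff L2_cmult)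
    also have "\<dots> = l2c L (\<lambda>x. \<beta> x * (1 / (s - t) * (u s x - u t x) - v x))"
      by (rule l2c_cong) (simp add: algebra_simps)
    finally have "norm (norm ((1 / (s - t)) *\<^sub>R (l2c L (\<lambda>x. \<beta> x * u s x) - l2c L (\<lambda>x. \<beta> x * u t x)) - l2c L (\<lambda>x. \<beta> x * v x)) - 0)
       \<le> B * norm (l2c L (\<lambda>x. 1 / (s - t) * (u s x - u t x) - v x))"
      using norm_l2c_mult[OF d assms(5) B] by simp
    also have "l2c L (\<lambda>x. 1 / (s - t) * (u s x - u t x) - v x) = (1 / (s - t)) *\<^sub>R (l2c L (u s) - l2c L (u t)) - l2c L v"
      using assms s by (simp only: l2c_diff l2c_scaleR L2_diff L2_cmult)
    finally show "norm (norm ((1 / (s - t)) *\<^sub>R (l2c L (\<lambda>x. \<beta> x * u s x) - l2c L (\<lambda>x. \<beta> x * u t x)) - l2c L (\<lambda>x. \<beta> x * v x)) - 0)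
       \<le> B * norm ((1 / (s - t)) *\<^sub>R (l2c L (u s) - l2c L (u t)) - l2c L v)" .
  next
    show "((\<lambda>s. B * norm ((1 / (s - t)) *\<^sub>R (l2c L (u s) - l2c L (u t)) - l2c L v)) \<longlongrightarrow> 0) (at t within S)"
      using assms(1) unfolding has_vector_derivative_quotient_iff by (rule tendsto_mult_right_zero)
  qed
qed

text \<open>The bound on the coupling is available only for functions of this class, so weighted
  solutions have to be shown to belong to it. Weights of product form are enough: both weights of
  the proof are Gaussian and factor into time and space. The product rules hold almost everywhere,
  since \<open>dx\<close> and \<open>dt\<close> pick versions.\<close>

lemma weighted_class:
  assumes u: "u \<in> C0_H10 L T \<inter> C1_L2 L T" and T: "0 < T" and \<beta>: "smooth \<beta>"
    and \<alpha>: "\<And>t. (\<alpha> has_real_derivative \<alpha>' t) (at t)" "continuous_on {0..T} \<alpha>'"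
  defines "w \<equiv> (\<lambda>t x. \<alpha> t * (\<beta> x * u t x))"
  shows "w \<in> C0_H10 L T \<inter> C1_L2 L T"
    and "\<And>t. t \<in> {0..T} \<Longrightarrow> AE x in lebesgue_on {0<..<L}. dx L (w t) x = \<alpha> t * (\<beta> x * dx L (u t) x + deriv \<beta> x * u t x)"
    and "\<And>t. t \<in> {0..T} \<Longrightarrow> AE x in lebesgue_on {0<..<L}. dt L T w t x = \<alpha>' t * (\<beta> x * u t x) + \<alpha> t * (\<beta> x * dt L T u t x)"
proof -
  have u0: "u \<in> C0_H10 L T" and u1: "u \<in> C1_L2 L T" using u by auto
  have H: "u t \<in> H10 L" "u t \<in> H1 L" "u t \<in> L2 {0<..<L}" "dx L (u t) \<in> L2 {0<..<L}" "dt L T u t \<in> L2 {0<..<L}"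
    if "t \<in> {0..T}" for t
    using C0_H10_H10[OF u0 that] C0_H10_H1[OF u0 that] H1_L2 dx_L2 dt_L2[OF u1 that] by blast+
  have c\<alpha>: "continuous_on S \<alpha>" for S
    using \<alpha>(1) DERIV_isCont continuous_at_imp_continuous_on by blast
  have wt: "w t = (\<lambda>x. \<alpha> t * (\<beta> x * u t x))" for t by (simp add: w_def)
  have wH10: "w t \<in> H10 L" if "t \<in> {0..T}" for t
    unfolding wt using H10_mult[OF H10_mult[OF H(1)[OF that] \<beta>] smooth_const] .
  have wd: "is_weak_deriv L (w t) (\<lambda>x. \<alpha> t * (\<beta> x * dx L (u t) x + deriv \<beta> x * u t x))" if "t \<in> {0..T}" for t
    unfolding wt using H[OF that] \<beta>
    by (intro weak_deriv_cmult weak_deriv_mult_smooth dx_weak smooth_mult_L2)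
  have wL2: "w t \<in> L2 {0<..<L}" if "t \<in> {0..T}" for t using wH10[OF that] H10_L2 by blast
  show "AE x in lebesgue_on {0<..<L}. dx L (w t) x = \<alpha> t * (\<beta> x * dx L (u t) x + deriv \<beta> x * u t x)" if "t \<in> {0..T}" for t
    using dx_AE[OF wd[OF that] wL2[OF that]] .
  have U: "l2c L (w t) = \<alpha> t *\<^sub>R l2c L (\<lambda>x. \<beta> x * u t x)" if "t \<in> {0..T}" for t
    unfolding wt using H[OF that] \<beta> by (simp add: l2c_scaleR smooth_mult_L2)
  have X: "l2c L (dx L (w t)) = \<alpha> t *\<^sub>R (l2c L (\<lambda>x. \<beta> x * dx L (u t) x) + l2c L (\<lambda>x. deriv \<beta> x * u t x))" if "t \<in> {0..T}" for t
    unfolding l2c_dx[OF wd[OF that] wL2[OF that]] using H[OF that] \<beta>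
    by (simp add: l2c_scaleR smooth_mult_L2 l2c_add smooth_deriv L2_add)
  have "w \<in> C0_H10 L T"
  proof (rule C0_H10I[OF wH10])
    show "continuous_on {0..T} (\<lambda>t. l2c L (w t))"
      by (subst continuous_on_cong[OF refl U], assumption)
        (intro continuous_on_scaleR c\<alpha> continuous_on_l2c_mult C0_H10_continuous u0 \<beta> H)
    show "continuous_on {0..T} (\<lambda>t. l2c L (dx L (w t)))"
      by (subst continuous_on_cong[OF refl X], assumption)
        (intro continuous_on_scaleR continuous_on_add c\<alpha> continuous_on_l2c_mult C0_H10_continuous u0 \<beta> H smooth_deriv)
  qed
  moreover
  define v where "v t = (\<lambda>x. \<alpha>' t * (\<beta> x * u t x) + \<alpha> t * (\<beta> x * dt L T u t x))" for t
  have vL2: "v t \<in> L2 {0<..<L}" if "t \<in> {0..T}" for t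
    unfolding v_def using H[OF that] \<beta> by (intro L2_add L2_cmult smooth_mult_L2)
  have V: "l2c L (v t) = \<alpha>' t *\<^sub>R l2c L (\<lambda>x. \<beta> x * u t x) + \<alpha> t *\<^sub>R l2c L (\<lambda>x. \<beta> x * dt L T u t x)" if "t \<in> {0..T}" for t
    unfolding v_def using H[OF that] \<beta> by (simp add: l2c_scaleR smooth_mult_L2 l2c_add L2_cmult)
  have wv: "((\<lambda>s. l2c L (w s)) has_vector_derivative l2c L (v t)) (at t within {0..T})" if t: "t \<in> {0..T}" for t
  proof -
    have "((\<lambda>s. \<alpha> s *\<^sub>R l2c L (\<lambda>x. \<beta> x * u s x)) has_vector_derivative
        (\<alpha> t *\<^sub>R l2c L (\<lambda>x. \<beta> x * dt L T u t x) + \<alpha>' t *\<^sub>R l2c L (\<lambda>x. \<beta> x * u t x))) (at t within {0..T})"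
      by (intro has_vector_derivative_scaleR has_vector_derivative_l2c_mult C1_L2_deriv u1 t \<beta> H has_field_derivative_at_within[OF \<alpha>(1)])
    then have "((\<lambda>s. \<alpha> s *\<^sub>R l2c L (\<lambda>x. \<beta> x * u s x)) has_vector_derivative l2c L (v t)) (at t within {0..T})"
      by (simp add: V[OF t] add.commute)
    then show ?thesis
      by (rule has_vector_derivative_transform[OF t U, rotated])
  qed
  have "continuous_on {0..T} (\<lambda>t. l2c L (v t))"
    by (subst continuous_on_cong[OF refl V], assumption)
      (intro continuous_on_scaleR continuous_on_add c\<alpha> \<alpha>(2) continuous_on_l2c_mult C0_H10_continuous u0 C1_L2_continuous u1 \<beta> H)
  then have "w \<in> C1_L2 L T" using C1_L2I[OF T wL2 vL2 wv] by blast
  ultimately show "w \<in> C0_H10 L T \<inter> C1_L2 L T" by blast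
  show "AE x in lebesgue_on {0<..<L}. dt L T w t x = \<alpha>' t * (\<beta> x * u t x) + \<alpha> t * (\<beta> x * dt L T u t x)" if t: "t \<in> {0..T}" for t
  proof -
    note d = l2c_dt_unique[OF T t wL2 vL2[OF t] wv[OF t]]
    have "dt L T w t \<in> L2 {0<..<L}" using d(1) by (simp add: is_time_deriv_def)
    then show ?thesis using d(2) l2c_eq_iff[OF _ vL2[OF t]] by (simp add: v_def)
  qed
qed

subsection \<open>Energy identity\<close>

text \<open>The fundamental theorem of calculus along the diagonal, for Q that is absolutely
  continuous in the first and continuously differentiable in the second variable. As
  \<open>q\<close> is merely integrable in time, no chain rule applies; instead a step from (t, t)
  to (t', t') is made first in the first variable with s = t and then in the second one at t'. The
  condition \<open>lip\<close> allows an integrable Lipschitz factor \<open>k\<close> plus an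
  arbitrarily small uniform error, so that \<open>q\<close> may contain terms that are only
  uniformly continuous in \<open>s\<close>.\<close>

lemma diag_increment:
  fixes Q q d :: "real \<Rightarrow> real \<Rightarrow> real"
  assumes ab: "a \<le> b"
    and Q: "\<And>s t1 t2. s \<in> {a..b} \<Longrightarrow> a \<le> t1 \<Longrightarrow> t1 \<le> t2 \<Longrightarrow> t2 \<le> b \<Longrightarrow> Q t2 s - Q t1 s = integral {t1..t2} (\<lambda>r. q r s)"
    and q: "\<And>s. s \<in> {a..b} \<Longrightarrow> (\<lambda>r. q r s) integrable_on {a..b}"
    and d: "\<And>t s. t \<in> {a..b} \<Longrightarrow> s \<in> {a..b} \<Longrightarrow> (Q t has_real_derivative d t s) (at s within {a..b})"
    and dc: "continuous_on ({a..b} \<times> {a..b}) (\<lambda>(t, s). d t s)"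
    and k: "k integrable_on {a..b}" and k0: "\<And>r. r \<in> {a..b} \<Longrightarrow> 0 \<le> k r"
    and lip: "\<And>e. 0 < e \<Longrightarrow> \<exists>\<delta>>0. \<forall>r s s'. r \<in> {a..b} \<and> s \<in> {a..b} \<and> s' \<in> {a..b} \<and> \<bar>s - s'\<bar> < \<delta> \<longrightarrow> \<bar>q r s - q r s'\<bar> \<le> k r * \<bar>s - s'\<bar> + e"
    and qd: "(\<lambda>r. q r r) integrable_on {a..b}"
  shows "Q b b - Q a a = integral {a..b} (\<lambda>r. q r r + d r r)"
proof -
  have cdd: "continuous_on {a..b} (\<lambda>r. d r r)"
    using continuous_on_compose[of "{a..b}" "\<lambda>r. (r, r)", OF _ continuous_on_subset[OF dc]]
    by (force simp: o_def intro!: continuous_intros)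
  have cdt: "continuous_on {a..b} (d t)" if "t \<in> {a..b}" for t
    using continuous_on_compose[of "{a..b}" "\<lambda>r. (t, r)", OF _ continuous_on_subset[OF dc]] that
    by (force simp: o_def intro!: continuous_intros)
  have i: "(\<lambda>r. q r r + d r r) integrable_on {a..b}"
    by (intro integrable_add qd integrable_continuous_interval cdd)
  define R where "R t = Q t t - integral {a..t} (\<lambda>r. q r r + d r r)" for t
  \<comment> \<open>Freezing the arguments costs e (t' - t) in the derivative \<open>d\<close>. In
    \<open>q\<close> it costs the integral of \<open>k\<close> times t' - t, with that integral at
    most e, and once more e (t' - t) for the uniform error.\<close>
  have est: "\<bar>R t' - R t\<bar> \<le> 3 * e * (t' - t)"
    if e: "0 < e" and t: "a \<le> t" "t \<le> t'" "t' \<le> b"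
      and u: "\<And>s. s \<in> {t..t'} \<Longrightarrow> \<bar>d t' s - d s s\<bar> \<le> e" and kk: "integral {t..t'} k \<le> e"
      and lp: "\<And>r. r \<in> {a..b} \<Longrightarrow> \<bar>q r t - q r r\<bar> \<le> k r * \<bar>t - r\<bar> + e \<or> r \<notin> {t..t'}" for e t t'
  proof -
    have sub: "{t..t'} \<subseteq> {a..b}" using t by auto
    have comb: "integral {a..t'} (\<lambda>r. q r r + d r r) = integral {a..t} (\<lambda>r. q r r + d r r) + integral {t..t'} (\<lambda>r. q r r + d r r)"
      by (rule Henstock_Kurzweil_Integration.integral_combine[symmetric]) (use t in \<open>auto intro: integrable_on_subinterval[OF i]\<close>)
    have split: "integral {t..t'} (\<lambda>r. q r r + d r r) = integral {t..t'} (\<lambda>r. q r r) + integral {t..t'} (\<lambda>r. d r r)"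
      by (rule Henstock_Kurzweil_Integration.integral_add)
         (auto intro: integrable_on_subinterval[OF qd sub] integrable_continuous_interval continuous_on_subset[OF cdd sub])
    have Q1: "Q t' t' - Q t' t = integral {t..t'} (d t')"
    proof (rule integral_unique[symmetric], rule fundamental_theorem_of_calculus)
      fix x assume "x \<in> {t..t'}"
      then show "(Q t' has_vector_derivative d t' x) (at x within {t..t'})"
        using d[of t' x] t sub unfolding has_real_derivative_iff_has_vector_derivative
        by (auto intro: has_vector_derivative_within_subset)
    qed (use t in auto)
    have Q2: "Q t' t - Q t t = integral {t..t'} (\<lambda>r. q r t)"
      by (rule Q) (use t in auto)
    have d1: "\<bar>integral {t..t'} (d t') - integral {t..t'} (\<lambda>r. d r r)\<bar> \<le> e * (t' - t)"
    proof -
      have i1: "d t' integrable_on {t..t'}" "(\<lambda>r. d r r) integrable_on {t..t'}"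
        using t by (auto intro!: integrable_continuous_interval continuous_on_subset[OF cdd sub] continuous_on_subset[OF cdt sub])
      have "norm (integral {t..t'} (\<lambda>r. d t' r - d r r)) \<le> integral {t..t'} (\<lambda>r. e)"
        by (rule integral_norm_bound_integral) (use u i1 in \<open>auto intro: integrable_diff\<close>)
      then show ?thesis using t by (simp add: Henstock_Kurzweil_Integration.integral_diff[OF i1] mult.commute)
    qed
    have d2: "\<bar>integral {t..t'} (\<lambda>r. q r t) - integral {t..t'} (\<lambda>r. q r r)\<bar> \<le> 2 * e * (t' - t)"
    proof -
      have i2: "(\<lambda>r. q r t) integrable_on {t..t'}" "(\<lambda>r. q r r) integrable_on {t..t'}"
        using t by (auto intro!: integrable_on_subinterval[OF qd sub] integrable_on_subinterval[OF q sub])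
      have ik: "((\<lambda>r. k r * (t' - t) + e) has_integral integral {t..t'} k * (t' - t) + (t' - t) * e) {t..t'}"
        using has_integral_add[OF has_integral_mult_left[OF integrable_integral[OF integrable_on_subinterval[OF k sub]]] has_integral_const_real[of e]] t
        by simp
      have "norm (integral {t..t'} (\<lambda>r. q r t - q r r)) \<le> integral {t..t'} (\<lambda>r. k r * (t' - t) + e)"
      proof (rule integral_norm_bound_integral[OF integrable_diff[OF i2] has_integral_integrable[OF ik]])
        fix r assume r: "r \<in> {t..t'}"
        have rab: "r \<in> {a..b}" using r sub by auto
        have "\<bar>q r t - q r r\<bar> \<le> k r * \<bar>t - r\<bar> + e" using lp[OF rab] r by auto
        also have "k r * \<bar>t - r\<bar> \<le> k r * (t' - t)"
          using r k0[OF rab] by (intro mult_left_mono) auto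
        finally show "norm (q r t - q r r) \<le> k r * (t' - t) + e" by simp
      qed
      also have "\<dots> = integral {t..t'} k * (t' - t) + (t' - t) * e" using ik by (rule integral_unique)
      also have "\<dots> \<le> e * (t' - t) + (t' - t) * e" using kk t by (intro add_right_mono mult_right_mono) auto
      finally show ?thesis by (simp add: Henstock_Kurzweil_Integration.integral_diff[OF i2] algebra_simps)
    qed
    have "R t' - R t = (integral {t..t'} (d t') - integral {t..t'} (\<lambda>r. d r r)) + (integral {t..t'} (\<lambda>r. q r t) - integral {t..t'} (\<lambda>r. q r r))"
      using comb split Q1 Q2 unfolding R_def by linarith
    then show ?thesis using d1 d2 by linarith
  qed
  have ucd: "uniformly_continuous_on ({a..b} \<times> {a..b}) (\<lambda>(t, s). d t s)"
    by (intro compact_uniformly_continuous dc compact_Times) auto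
  have uck: "uniformly_continuous_on {a..b} (\<lambda>t. integral {a..t} k)"
    by (intro compact_uniformly_continuous indefinite_integral_continuous_1 k) auto
  have unif: "\<exists>\<delta>>0. \<forall>t t'. a \<le> t \<and> t \<le> t' \<and> t' \<le> b \<and> t' - t < \<delta> \<longrightarrow> \<bar>R t' - R t\<bar> \<le> 3 * e * (t' - t)" if e: "0 < e" for e
  proof -
    obtain \<delta>1 where \<delta>1: "\<delta>1 > 0" "\<And>x y. x \<in> {a..b} \<times> {a..b} \<Longrightarrow> y \<in> {a..b} \<times> {a..b} \<Longrightarrow> dist y x < \<delta>1 \<Longrightarrow> dist (case y of (t, s) \<Rightarrow> d t s) (case x of (t, s) \<Rightarrow> d t s) < e"
      using ucd e unfolding uniformly_continuous_on_def by meson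
    obtain \<delta>2 where \<delta>2: "\<delta>2 > 0" "\<And>x y. x \<in> {a..b} \<Longrightarrow> y \<in> {a..b} \<Longrightarrow> dist y x < \<delta>2 \<Longrightarrow> dist (integral {a..y} k) (integral {a..x} k) < e"
      using uck e unfolding uniformly_continuous_on_def by meson
    obtain \<delta>3 where \<delta>3: "\<delta>3 > 0" "\<And>r s s'. r \<in> {a..b} \<and> s \<in> {a..b} \<and> s' \<in> {a..b} \<and> \<bar>s - s'\<bar> < \<delta>3 \<Longrightarrow> \<bar>q r s - q r s'\<bar> \<le> k r * \<bar>s - s'\<bar> + e"
      using lip[OF e] by meson
    show ?thesis
    proof (intro exI[of _ "min \<delta>3 (min \<delta>1 \<delta>2)"] conjI allI impI)
      fix t t' assume t: "a \<le> t \<and> t \<le> t' \<and> t' \<le> b \<and> t' - t < min \<delta>3 (min \<delta>1 \<delta>2)"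
      show "\<bar>R t' - R t\<bar> \<le> 3 * e * (t' - t)"
      proof (rule est[OF e])
        fix s assume s: "s \<in> {t..t'}"
        have "dist (t', s) (s, s) < \<delta>1" using s t by (simp add: dist_Pair_Pair dist_real_def)
        then show "\<bar>d t' s - d s s\<bar> \<le> e"
          using \<delta>1(2)[of "(s, s)" "(t', s)"] s t by (auto simp: dist_real_def)
      next
        have "integral {a..t} k + integral {t..t'} k = integral {a..t'} k"
          by (rule Henstock_Kurzweil_Integration.integral_combine) (use t in \<open>auto intro: integrable_on_subinterval[OF k]\<close>)
        moreover have "dist (integral {a..t'} k) (integral {a..t} k) < e"
          using t by (intro \<delta>2(2)) (auto simp: dist_real_def)
        ultimately show "integral {t..t'} k \<le> e" by (simp add: dist_real_def)
      next
        fix r assume "r \<in> {a..b}"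
        then show "\<bar>q r t - q r r\<bar> \<le> k r * \<bar>t - r\<bar> + e \<or> r \<notin> {t..t'}"
          using \<delta>3(2)[of r t r] t by auto
      qed (use t in auto)
    qed (use \<delta>1 \<delta>2 \<delta>3 in auto)
  qed
  \<comment> \<open>By \<open>unif\<close> the increments of R are small compared with the step
    length, so R has derivative 0 everywhere.\<close>
  have "\<exists>c. \<forall>x\<in>{a..b}. R x = c"
  proof (rule has_field_derivative_zero_constant)
    fix x assume x: "x \<in> {a..b}"
    show "(R has_field_derivative 0) (at x within {a..b})"
      unfolding has_field_derivative_def has_derivative_within_alt
    proof (intro conjI allI impI)
      fix e :: real assume e: "0 < e"
      obtain \<delta> where \<delta>: "\<delta> > 0" "\<And>t t'. a \<le> t \<Longrightarrow> t \<le> t' \<Longrightarrow> t' \<le> b \<Longrightarrow> t' - t < \<delta> \<Longrightarrow> \<bar>R t' - R t\<bar> \<le> 3 * (e/3) * (t' - t)"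
        using unif[of "e/3"] e by auto
      show "\<exists>\<delta>>0. \<forall>y\<in>{a..b}. norm (y - x) < \<delta> \<longrightarrow> norm (R y - R x - 0 * (y - x)) \<le> e * norm (y - x)"
      proof (intro exI[of _ \<delta>] conjI ballI impI \<delta>(1))
        fix y assume y: "y \<in> {a..b}" "norm (y - x) < \<delta>"
        show "norm (R y - R x - 0 * (y - x)) \<le> e * norm (y - x)"
          using \<delta>(2)[of x y] \<delta>(2)[of y x] x y by (cases "x \<le> y") (auto simp: abs_minus_commute)
      qed
    qed (rule bounded_linear_mult_right)
  qed auto
  then have "R b = R a" using ab by auto
  then show ?thesis by (simp add: R_def)
qed

lemma average_tendsto:
  fixes k :: "real \<Rightarrow> real"
  assumes k: "\<And>h. 0 < h \<Longrightarrow> h < h0 \<Longrightarrow> continuous_on {b - h..b} (\<lambda>\<tau>. g h \<tau>)" and h0: "0 < h0"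
    and lim: "\<And>e. 0 < e \<Longrightarrow> \<exists>\<delta>>0. \<forall>h \<tau>. 0 < h \<and> h < \<delta> \<and> b - h \<le> \<tau> \<and> \<tau> \<le> b \<longrightarrow> \<bar>g h \<tau> - l\<bar> \<le> (e::real)"
  shows "((\<lambda>h. integral {b - h..b} (g h) / h) \<longlongrightarrow> l) (at_right 0)"
proof (rule tendstoI)
  fix e :: real assume e: "0 < e"
  obtain \<delta> where \<delta>: "\<delta> > 0" "\<And>h \<tau>. 0 < h \<Longrightarrow> h < \<delta> \<Longrightarrow> b - h \<le> \<tau> \<Longrightarrow> \<tau> \<le> b \<Longrightarrow> \<bar>g h \<tau> - l\<bar> \<le> e/2"
    using lim[of "e/2"] e by auto
  have "dist (integral {b - h..b} (g h) / h) l < e" if h: "0 < h" "h < min \<delta> h0" for h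
  proof -
    have i: "g h integrable_on {b - h..b}" using h by (intro integrable_continuous_interval k) auto
    have "norm (integral {b - h..b} (\<lambda>\<tau>. g h \<tau> - l)) \<le> integral {b - h..b} (\<lambda>\<tau>. e/2)"
      using h \<delta>(2)[of h] by (intro integral_norm_bound_integral integrable_diff i) auto
    moreover have "integral {b - h..b} (\<lambda>\<tau>. g h \<tau> - l) = integral {b - h..b} (g h) - l * h"
      using integral_unique[OF has_integral_diff[OF integrable_integral[OF i] has_integral_const_real[of l]]] h by simp
    ultimately have "\<bar>integral {b - h..b} (g h) - l * h\<bar> \<le> e/2 * h"
      using h by (simp add: mult.commute)
    then have "\<bar>integral {b - h..b} (g h) - l * h\<bar> / h \<le> e/2" using h by (simp add: pos_divide_le_eq)
    moreover have "\<bar>integral {b - h..b} (g h) - l * h\<bar> / h = \<bar>integral {b - h..b} (g h) / h - l\<bar>"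
    proof -
      have "integral {b - h..b} (g h) / h - l = (integral {b - h..b} (g h) - l * h) / h" using h by (simp add: field_simps)
      then show ?thesis using h by simp
    qed
    ultimately show ?thesis using e by (simp add: dist_real_def)
  qed
  then show "\<forall>\<^sub>F h in at_right 0. dist (integral {b - h..b} (g h) / h) l < e"
    using \<delta>(1) h0 unfolding eventually_at_right_field by (intro exI[of _ "min \<delta> h0"]) auto
qed


lemma step_integrable:
  fixes g :: "real \<Rightarrow> real"
  assumes "g integrable_on {a..b}" "a \<le> c" "d \<le> b"
  shows "(\<lambda>s. if s \<in> {c..<d} then g s else 0) integrable_on {a..b}"
proof -
  have "g integrable_on {c..d}" using assms by (intro integrable_on_subinterval[OF assms(1)]) auto
  then have "g integrable_on {c..<d}"
    by (rule integrable_spike_set) (rule negligible_subset[of "{d}"], simp, force)+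
  moreover have "{c..<d} \<inter> {a..b} = {c..<d}" using assms by auto
  ultimately show ?thesis unfolding integrable_restrict_Int by simp
qed

text \<open>F is controlled only through its norm and through its inner products with the fixed
  vectors \<open>W t\<close>, so the product along the curve needs an argument of its own. W is
  frozen at left grid points, which gives finite sums of integrable pieces; these are dominated by
  \<open>norm (F s)\<close> times a bound of W.\<close>

lemma inner_curve_integrable:
  fixes F W :: "real \<Rightarrow> 'h::real_inner"
  assumes W: "continuous_on {a..b} W" and ab: "a < b"
    and F: "\<And>t. t \<in> {a..b} \<Longrightarrow> (\<lambda>s. inner (F s) (W t)) integrable_on {a..b}"
    and n: "(\<lambda>s. norm (F s)) integrable_on {a..b}"
  shows "(\<lambda>s. inner (F s) (W s)) integrable_on {a..b}"
proof -
  define \<Delta> where "\<Delta> n = (b - a) / real (Suc n)" for n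
  have \<Delta>: "0 < \<Delta> n" "real (Suc n) * \<Delta> n = b - a" for n using ab by (auto simp: \<Delta>_def simp del: of_nat_Suc)
  \<comment> \<open>The left end of the grid cell that contains \<open>s\<close>, for cells of
    length \<open>\<Delta> n\<close>.\<close>
  define p where "p n s = a + \<Delta> n * real_of_int \<lfloor>(s - a) / \<Delta> n\<rfloor>" for n s
  have p: "p n s \<le> s" "s - \<Delta> n < p n s" for n s
  proof -
    have f: "real_of_int \<lfloor>(s - a) / \<Delta> n\<rfloor> \<le> (s - a) / \<Delta> n" "(s - a) / \<Delta> n < real_of_int \<lfloor>(s - a) / \<Delta> n\<rfloor> + 1"
      by linarith+
    have "\<Delta> n * real_of_int \<lfloor>(s - a) / \<Delta> n\<rfloor> \<le> s - a" "s - a < \<Delta> n * (real_of_int \<lfloor>(s - a) / \<Delta> n\<rfloor> + 1)"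
      using mult_left_mono[OF f(1), of "\<Delta> n"] mult_strict_left_mono[OF f(2), of "\<Delta> n"] \<Delta>(1)[of n] by simp_all
    then show "p n s \<le> s" "s - \<Delta> n < p n s" by (simp_all add: p_def algebra_simps)
  qed
  have pa: "p n s \<in> {a..b}" if "s \<in> {a..b}" for n s
  proof -
    have "0 \<le> real_of_int \<lfloor>(s - a) / \<Delta> n\<rfloor>" using that \<Delta>(1)[of n] by simp
    then have "a \<le> p n s" using \<Delta>(1)[of n] by (simp add: p_def)
    then show ?thesis using p(1)[of n s] that by auto
  qed
  \<comment> \<open>The right end is left out: at s = b the cell index would be n + 1, one more than
    the last summand.\<close>
  have step: "(\<lambda>s. inner (F s) (W (p n s))) integrable_on {a..<b}" for n
  proof -
    let ?a = "\<lambda>k. a + \<Delta> n * real k"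
    let ?f = "\<lambda>s. \<Sum>k\<le>n. if s \<in> {?a k..<?a (Suc k)} then inner (F s) (W (?a k)) else 0"
    have "?f integrable_on {a..b}"
    proof (rule integrable_sum)
      fix k assume k: "k \<in> {..n}"
      have "\<Delta> n * real (Suc k) \<le> real (Suc n) * \<Delta> n" using k \<Delta>(1)[of n] by (simp add: mult.commute)
      then have le: "?a (Suc k) \<le> b" using \<Delta>(2)[of n] by simp
      moreover have "?a k \<le> ?a (Suc k)" using \<Delta>(1)[of n] by simp
      moreover have "a \<le> ?a k" using \<Delta>(1)[of n] by simp
      ultimately show "(\<lambda>s. if s \<in> {?a k..<?a (Suc k)} then inner (F s) (W (?a k)) else 0) integrable_on {a..b}"
        by (intro step_integrable F) auto
    qed simp
    then have "?f integrable_on {a..<b}"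
      by (rule integrable_spike_set) (rule negligible_subset[of "{b}"], simp, force)+
    moreover have "?f s = inner (F s) (W (p n s))" if s: "s \<in> {a..<b}" for s
    proof -
      define m where "m = nat \<lfloor>(s - a) / \<Delta> n\<rfloor>"
      have m0: "real m = real_of_int \<lfloor>(s - a) / \<Delta> n\<rfloor>" using s \<Delta>(1)[of n] by (simp add: m_def)
      then have pm: "p n s = ?a m" by (simp add: p_def)
      have mem: "s \<in> {?a k..<?a (Suc k)} \<longleftrightarrow> k = m" for k
      proof
        assume "s \<in> {?a k..<?a (Suc k)}"
        then have "real k \<le> (s - a) / \<Delta> n" "(s - a) / \<Delta> n < real k + 1"
          using \<Delta>(1)[of n] by (auto simp: field_simps)
        then have "\<lfloor>(s - a) / \<Delta> n\<rfloor> = int k" by linarith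
        then show "k = m" by (simp add: m_def)
      next
        assume "k = m"
        then show "s \<in> {?a k..<?a (Suc k)}"
          using p(1)[of n s] p(2)[of s n] pm by (auto simp: algebra_simps)
      qed
      have "real m * \<Delta> n \<le> s - a" using p(1)[of n s] pm by (simp add: mult.commute)
      also have "\<dots> < real (Suc n) * \<Delta> n" using s \<Delta>(2)[of n] by simp
      finally have "m \<le> n" using \<Delta>(1)[of n] by simp
      then show ?thesis unfolding mem pm by simp
    qed
    ultimately show ?thesis by (rule integrable_eq)
  qed
  have "(\<lambda>s. inner (F s) (W s)) integrable_on {a..<b}"
  proof -
    have "compact (W ` {a..b})" by (intro compact_continuous_image W) auto
    then obtain B where B: "\<And>t. t \<in> {a..b} \<Longrightarrow> norm (W t) \<le> B"
      by (metis compact_imp_bounded bounded_iff imageI)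
    have nb: "(\<lambda>s. norm (F s)) integrable_on {a..<b}"
      by (rule integrable_spike_set[OF n]) (rule negligible_subset[of "{b}"], simp, force)+
    show ?thesis
    proof (rule dominated_convergence(1)[OF step, where h = "\<lambda>s. norm (F s) * B"])
      show "(\<lambda>s. norm (F s) * B) integrable_on {a..<b}" by (rule integrable_on_mult_left[OF nb])
      fix n s assume s: "s \<in> {a..<b}"
      have "\<bar>inner (F s) (W (p n s))\<bar> \<le> norm (F s) * norm (W (p n s))" by (rule Cauchy_Schwarz_ineq2)
      also have "\<dots> \<le> norm (F s) * B" using pa[of s n] s by (intro mult_left_mono B) auto
      finally show "norm (inner (F s) (W (p n s))) \<le> norm (F s) * B" by simp
    next
      fix s assume s: "s \<in> {a..<b}"
      have "\<Delta> \<longlonglongrightarrow> 0"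
        unfolding \<Delta>_def[abs_def] using LIMSEQ_Suc[OF lim_const_over_n[of "b - a"]] by simp
      then have "(\<lambda>n. s - \<Delta> n) \<longlonglongrightarrow> s - 0"
        by (rule tendsto_diff[OF tendsto_const])
      then have "(\<lambda>n. s - \<Delta> n) \<longlonglongrightarrow> s" by simp
      then have lim: "(\<lambda>n. p n s) \<longlonglongrightarrow> s"
        by (rule tendsto_sandwich[OF _ _ _ tendsto_const[of s], rotated 2])
          (auto intro!: always_eventually p(1) less_imp_le[OF p(2)])
      have "(\<lambda>n. W (p n s)) \<longlonglongrightarrow> W s"
        by (rule continuous_on_tendsto_compose[OF W lim]) (use s pa[of s] in \<open>auto intro!: always_eventually\<close>)
      then show "(\<lambda>n. inner (F s) (W (p n s))) \<longlonglongrightarrow> inner (F s) (W s)" by (rule tendsto_inner[OF tendsto_const])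
    qed
  qed
  then show ?thesis
    by (rule integrable_spike_set) (rule negligible_subset[of "{b}"], simp, force)+
qed

lemma vector_mean_value_bound:
  fixes U :: "real \<Rightarrow> 'h::real_normed_vector"
  assumes "\<And>x. x \<in> {a..b} \<Longrightarrow> (U has_vector_derivative V x) (at x within {a..b})"
    "\<And>x. x \<in> {a..b} \<Longrightarrow> norm (V x) \<le> B" "a \<le> b"
  shows "norm (U b - U a) \<le> B * (b - a)"
proof -
  have "norm (U b - U a) \<le> B * norm (b - a)"
  proof (rule differentiable_bound)
    show "(U has_derivative (\<lambda>h. h *\<^sub>R V x)) (at x within {a..b})" if "x \<in> {a..b}" for x
      using assms(1)[OF that] by (simp add: has_vector_derivative_def)
    show "onorm (\<lambda>h. h *\<^sub>R V x) \<le> B" if "x \<in> {a..b}" for x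
      using assms(2)[OF that] onorm_scaleR_left[OF bounded_linear_ident, of "V x"] onorm_id_le[where 'a = real]
      by (simp add: onorm_id)
  qed (use assms in auto)
  then show ?thesis using assms(3) by simp
qed

text \<open>By symmetry k r (r - h) is k (r - h) r, that is the first term shifted by h. The two
  integrals overlap except for slabs of length h at both ends. This cancellation is the reason for
  working with central differences in the energy identity.\<close>

lemma symmetric_difference_integral:
  fixes k :: "real \<Rightarrow> real \<Rightarrow> real"
  assumes sym: "\<And>s r. k s r = k r s" and ab: "a \<le> b" and h: "0 < h"
    and c: "continuous_on {a - h..b} (\<lambda>\<tau>. k \<tau> (\<tau> + h))"
  shows "((\<lambda>r. k r (r + h) - k r (r - h)) has_integral
    integral {b - h..b} (\<lambda>\<tau>. k \<tau> (\<tau> + h)) - integral {a - h..a} (\<lambda>\<tau>. k \<tau> (\<tau> + h))) {a..b}"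
proof -
  let ?j = "\<lambda>\<tau>. k \<tau> (\<tau> + h)"
  have i: "?j integrable_on {a - h..b}" by (rule integrable_continuous_interval[OF c])
  have 1: "(?j has_integral integral {a..b} ?j) {a..b}"
    using h by (intro integrable_integral integrable_on_subinterval[OF i]) auto
  have "(?j has_integral integral {a - h..b - h} ?j) {a - h..b - h}"
    using h by (intro integrable_integral integrable_on_subinterval[OF i]) auto
  then have "((?j \<circ> (+) (- h)) has_integral integral {a - h..b - h} ?j) {a..b}"
    by (simp add: has_integral_shift_Icc_real)
  moreover have "?j \<circ> (+) (- h) = (\<lambda>r. k r (r - h))" using sym by (auto simp: o_def)
  ultimately have 2: "((\<lambda>r. k r (r - h)) has_integral integral {a - h..b - h} ?j) {a..b}" by simp
  have "integral {a - h..a} ?j + integral {a..b} ?j = integral {a - h..b} ?j"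
    by (rule Henstock_Kurzweil_Integration.integral_combine) (use h ab i in auto)
  moreover have "integral {a - h..b - h} ?j + integral {b - h..b} ?j = integral {a - h..b} ?j"
    by (rule Henstock_Kurzweil_Integration.integral_combine) (use h ab i in auto)
  ultimately have "integral {a..b} ?j - integral {a - h..b - h} ?j = integral {b - h..b} ?j - integral {a - h..a} ?j"
    by linarith
  then show ?thesis using has_integral_diff[OF 1 2] by simp
qed

lemma inner_average_tendsto:
  fixes V :: "real \<Rightarrow> 'h::real_inner"
  assumes V: "continuous_on {0..T} V" and b: "0 < b" "b < T"
  shows "((\<lambda>h. integral {b - h..b} (\<lambda>\<tau>. inner (V \<tau>) (V (\<tau> + h))) / h) \<longlongrightarrow> inner (V b) (V b)) (at_right 0)"
proof (rule average_tendsto[where ?h0.0 = "min b (T - b)"])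
  show "continuous_on {b - h..b} (\<lambda>\<tau>. inner (V \<tau>) (V (\<tau> + h)))" if "0 < h" "h < min b (T - b)" for h
    using that by (intro continuous_on_inner continuous_on_subset[OF V] continuous_on_compose2[OF V]) (auto intro!: continuous_intros)
  fix e :: real assume e: "0 < e"
  have "continuous_on ({0..T} \<times> {0..T}) (\<lambda>(s, r). inner (V s) (V r))"
    unfolding split_beta
    by (intro continuous_on_inner continuous_on_compose2[OF V]) (auto intro!: continuous_intros)
  then obtain \<delta> where \<delta>: "\<delta> > 0" "\<And>y. y \<in> {0..T} \<times> {0..T} \<Longrightarrow> dist y (b, b) < \<delta> \<Longrightarrow>
      dist (case y of (s, r) \<Rightarrow> inner (V s) (V r)) (inner (V b) (V b)) < e"
    using e b unfolding continuous_on_iff by (force dest: bspec[of _ _ "(b, b)"])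
  show "\<exists>\<delta>>0. \<forall>h \<tau>. 0 < h \<and> h < \<delta> \<and> b - h \<le> \<tau> \<and> \<tau> \<le> b \<longrightarrow> \<bar>inner (V \<tau>) (V (\<tau> + h)) - inner (V b) (V b)\<bar> \<le> e"
  proof (intro exI[of _ "min (\<delta>/2) (min b (T - b))"] conjI allI impI)
    fix h \<tau> assume *: "0 < h \<and> h < min (\<delta>/2) (min b (T - b)) \<and> b - h \<le> \<tau> \<and> \<tau> \<le> b"
    have "dist (\<tau>, \<tau> + h) (b, b) \<le> dist \<tau> b + dist (\<tau> + h) b"
      unfolding dist_Pair_Pair by (rule sqrt_sum_squares_le_sum) auto
    also have "\<dots> < \<delta>" using * by (auto simp: dist_real_def)
    finally have "dist (inner (V \<tau>) (V (\<tau> + h))) (inner (V b) (V b)) < e"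
      using \<delta>(2)[of "(\<tau>, \<tau> + h)"] * by auto
    then show "\<bar>inner (V \<tau>) (V (\<tau> + h)) - inner (V b) (V b)\<bar> \<le> e" by (simp add: dist_real_def)
  qed (use \<delta> b in auto)
qed (use b in auto)

text \<open>Formally the equation is tested with V, but only values of U may serve as test vectors
  (\<open>eq\<close>). The central difference U (r + h) - U (r - h) replaces 2 h V. Its symmetry
  reduces the terms in X and in V to slabs of width h at \<open>a\<close> and \<open>b\<close>.
  After division by h the end terms contribute 2 |V|^2, the slabs remove one |V|^2 and add |X|^2,
  and the source is bounded by 2 S times the integral of |F|. The condition that \<open>a\<close>
  and \<open>b\<close> are interior leaves room for the shifts.\<close>

lemma energy_increment:
  fixes U V X F :: "real \<Rightarrow> 'h::real_inner"
  assumes U: "\<And>t. t \<in> {0..T} \<Longrightarrow> (U has_vector_derivative V t) (at t within {0..T})"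
    and V: "continuous_on {0..T} V" and X: "continuous_on {0..T} X"
    and n: "(\<lambda>s. norm (F s)) integrable_on {0..T}"
    and F: "\<And>t. t \<in> {0..T} \<Longrightarrow> (\<lambda>s. inner (F s) (U t)) integrable_on {0..T}"
    and eq: "\<And>r t1 t2. r \<in> {0..T} \<Longrightarrow> 0 \<le> t1 \<Longrightarrow> t1 \<le> t2 \<Longrightarrow> t2 \<le> T \<Longrightarrow>
       inner (V t2) (U r) - inner (V t1) (U r) = integral {t1..t2} (\<lambda>s. inner (F s) (U r) - inner (X s) (X r))"
    and ab: "0 < a" "a < b" "b < T" and S: "\<And>s. s \<in> {a..b} \<Longrightarrow> norm (V s) \<le> S"
  shows "\<bar>((norm (V b))\<^sup>2 + (norm (X b))\<^sup>2) - ((norm (V a))\<^sup>2 + (norm (X a))\<^sup>2)\<bar> \<le> 2 * S * integral {a..b} (\<lambda>s. norm (F s))"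
proof -
  define N where "N = integral {a..b} (\<lambda>s. norm (F s))"
  have nab: "(\<lambda>s. norm (F s)) integrable_on {a..b}" using ab by (intro integrable_on_subinterval[OF n]) auto
  have N0: "0 \<le> N" unfolding N_def by (rule integral_nonneg[OF nab]) auto
  define h0 where "h0 = min a (T - b)"
  have h0: "0 < h0" using ab by (simp add: h0_def)
  have cU: "continuous_on {0..T} U"
    using U has_vector_derivative_continuous continuous_on_eq_continuous_within by blast
  define I where "I h = integral {a..b} (\<lambda>r. inner (F r) (U (r + h) - U (r - h)))" for h
  \<comment> \<open>The diagonal rule for <V t, W s>: by \<open>eq\<close> the derivative in t is
    <F, W> - <X, Y>, and the derivative in s is <V, Z>. The last two terms then shrink to
    slabs.\<close>
  have key: "inner (V b) (U (b + h) - U (b - h)) - inner (V a) (U (a + h) - U (a - h)) =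
      I h - (integral {b - h..b} (\<lambda>\<tau>. inner (X \<tau>) (X (\<tau> + h))) - integral {a - h..a} (\<lambda>\<tau>. inner (X \<tau>) (X (\<tau> + h))))
        + (integral {b - h..b} (\<lambda>\<tau>. inner (V \<tau>) (V (\<tau> + h))) - integral {a - h..a} (\<lambda>\<tau>. inner (V \<tau>) (V (\<tau> + h))))"
    if h: "0 < h" "h < h0" for h
  proof -
    have in0T: "s + h \<in> {0..T}" "s - h \<in> {0..T}" "s \<in> {0..T}" "s + h \<in> {0<..<T}" "s - h \<in> {0<..<T}" if "s \<in> {a..b}" for s
      using that h ab by (auto simp: h0_def)
    define W where "W s = U (s + h) - U (s - h)" for s
    define Y where "Y s = X (s + h) - X (s - h)" for s
    define Z where "Z s = V (s + h) - V (s - h)" for s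
    have c3: "continuous_on {a..b} (\<lambda>s. A (s + h) - A (s - h))" if "continuous_on {0..T} A" for A :: "real \<Rightarrow> 'h"
      by (intro continuous_on_diff continuous_on_compose2[OF that]) (use h ab in \<open>auto intro!: continuous_intros simp: h0_def\<close>)
    have sub: "{a..b} \<subseteq> {0..T}" using ab by auto
    have cW: "continuous_on {a..b} W" and cY: "continuous_on {a..b} Y" and cZ: "continuous_on {a..b} Z"
      unfolding W_def Y_def Z_def by (intro c3 cU X V)+
    have cXab: "continuous_on {a..b} X" and cVab: "continuous_on {a..b} V" using continuous_on_subset[OF X sub] continuous_on_subset[OF V sub] .
    have Wd: "(W has_vector_derivative Z s) (at s within {a..b})" if s: "s \<in> {a..b}" for s
    proof -
      have at: "(U has_vector_derivative V t) (at t)" if "t \<in> {0<..<T}" for t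
        using U[of t] that at_within_interior[of t "{0..T}"] by auto
      have "((\<lambda>s. U (s + c)) has_vector_derivative 1 *\<^sub>R V (s + c)) (at s within {a..b})" if "s + c \<in> {0<..<T}" for c
      proof -
        have "((\<lambda>s. s + c) has_vector_derivative 1) (at s within {a..b})"
          by (auto intro!: derivative_eq_intros)
        from vector_diff_chain_within[OF this has_vector_derivative_at_within[OF at[OF that]]]
        show ?thesis by (simp add: o_def)
      qed
      from has_vector_derivative_diff[OF this[of h] this[of "- h"]] show ?thesis
        using in0T[OF s] by (simp add: W_def[abs_def] Z_def)
    qed
    have Fab: "(\<lambda>s. inner (F s) (U t)) integrable_on {a..b}" if "t \<in> {0..T}" for t
      by (rule integrable_on_subinterval[OF F[OF that] sub])
    have FW: "(\<lambda>r. inner (F r) (W s)) integrable_on {a..b}" if "s \<in> {a..b}" for s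
      unfolding W_def inner_diff_right by (intro integrable_diff Fab in0T that)
    have FWd: "(\<lambda>r. inner (F r) (W r)) integrable_on {a..b}"
      by (rule inner_curve_integrable[OF cW ab(2) FW nab])
    have cXY: "(\<lambda>r. inner (X r) (Y s)) integrable_on {a..b}" for s
      by (intro integrable_continuous_interval continuous_intros cXab)
    have cXYd: "(\<lambda>r. inner (X r) (Y r)) integrable_on {a..b}"
      by (intro integrable_continuous_interval continuous_on_inner cXab cY)
    have cVZd: "(\<lambda>r. inner (V r) (Z r)) integrable_on {a..b}"
      by (intro integrable_continuous_interval continuous_on_inner cVab cZ)
    obtain B where B: "B > 0" "\<And>s. s \<in> {0..T} \<Longrightarrow> norm (V s) \<le> B" "\<And>s. s \<in> {0..T} \<Longrightarrow> norm (X s) \<le> B"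
    proof -
      have "bounded (V ` {0..T})" "bounded (X ` {0..T})"
        using V X by (auto intro!: compact_imp_bounded compact_continuous_image)
      then obtain B1 B2 where "B1 > 0" "\<forall>x\<in>V ` {0..T}. norm x \<le> B1" "B2 > 0" "\<forall>x\<in>X ` {0..T}. norm x \<le> B2"
        unfolding bounded_pos by blast
      then show thesis by (intro that[of "max B1 B2"]) (auto simp: le_max_iff_disj)
    qed
    have "inner (V b) (W b) - inner (V a) (W a) =
        integral {a..b} (\<lambda>r. (inner (F r) (W r) - inner (X r) (Y r)) + inner (V r) (Z r))"
    proof (rule diag_increment[where Q = "\<lambda>t s. inner (V t) (W s)" and q = "\<lambda>r s. inner (F r) (W s) - inner (X r) (Y s)"
          and d = "\<lambda>t s. inner (V t) (Z s)" and k = "\<lambda>r. norm (F r) * (2 * B)"])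
      fix s t1 t2 assume s: "s \<in> {a..b}" and t: "a \<le> t1" "t1 \<le> t2" "t2 \<le> b"
      have t': "0 \<le> t1" "t2 \<le> T" and sub': "{t1..t2} \<subseteq> {0..T}" using t ab by auto
      have i: "(\<lambda>r. inner (F r) (U x) - inner (X r) (X x)) integrable_on {t1..t2}" if "x \<in> {0..T}" for x
        by (intro integrable_diff integrable_on_subinterval[OF F[OF that] sub'] integrable_continuous_interval
            continuous_on_inner continuous_on_subset[OF X sub'] continuous_on_const)
      have "inner (V t2) (W s) - inner (V t1) (W s) =
          integral {t1..t2} (\<lambda>r. inner (F r) (U (s + h)) - inner (X r) (X (s + h)))
          - integral {t1..t2} (\<lambda>r. inner (F r) (U (s - h)) - inner (X r) (X (s - h)))"
        using eq[OF in0T(1)[OF s] t'(1) t(2) t'(2)] eq[OF in0T(2)[OF s] t'(1) t(2) t'(2)]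
        by (simp add: W_def inner_diff_right)
      also have "\<dots> = integral {t1..t2} (\<lambda>r. (inner (F r) (U (s + h)) - inner (X r) (X (s + h))) - (inner (F r) (U (s - h)) - inner (X r) (X (s - h))))"
        by (rule Henstock_Kurzweil_Integration.integral_diff[OF i i, symmetric]) (use in0T[OF s] in auto)
      also have "\<dots> = integral {t1..t2} (\<lambda>r. inner (F r) (W s) - inner (X r) (Y s))"
        by (rule arg_cong[of _ _ "integral {t1..t2}"]) (auto simp: W_def Y_def inner_diff_right)
      finally show "inner (V t2) (W s) - inner (V t1) (W s) = integral {t1..t2} (\<lambda>r. inner (F r) (W s) - inner (X r) (Y s))" .
    next
      show "(\<lambda>r. inner (F r) (W s) - inner (X r) (Y s)) integrable_on {a..b}" if "s \<in> {a..b}" for s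
        by (intro integrable_diff FW cXY that)
      show "(\<lambda>r. inner (F r) (W r) - inner (X r) (Y r)) integrable_on {a..b}"
        by (intro integrable_diff FWd cXYd)
      show "((\<lambda>s. inner (V t) (W s)) has_real_derivative inner (V t) (Z s)) (at s within {a..b})" if "s \<in> {a..b}" for t s
        using bounded_linear.has_vector_derivative[OF bounded_linear_inner_right Wd[OF that]]
        by (simp add: has_real_derivative_iff_has_vector_derivative)
      show "continuous_on ({a..b} \<times> {a..b}) (\<lambda>(t, s). inner (V t) (Z s))"
        unfolding split_beta
        by (intro continuous_on_inner continuous_on_compose2[OF cVab] continuous_on_compose2[OF cZ]) (auto intro!: continuous_intros)
      show "(\<lambda>r. norm (F r) * (2 * B)) integrable_on {a..b}" by (intro integrable_on_mult_left nab)
      \<comment> \<open>W is Lipschitz with constant 2 B, which yields the integrable factor 2 B |F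
        r|. Y is merely uniformly continuous and is paid for by the additive e.\<close>
      show "\<exists>\<delta>>0. \<forall>r s s'. r \<in> {a..b} \<and> s \<in> {a..b} \<and> s' \<in> {a..b} \<and> \<bar>s - s'\<bar> < \<delta> \<longrightarrow>
          \<bar>inner (F r) (W s) - inner (X r) (Y s) - (inner (F r) (W s') - inner (X r) (Y s'))\<bar> \<le> norm (F r) * (2 * B) * \<bar>s - s'\<bar> + e"
        if e: "0 < e" for e
      proof -
        have "uniformly_continuous_on {a..b} Y" by (intro compact_uniformly_continuous cY) auto
        then obtain \<delta> where \<delta>: "\<delta> > 0" "\<And>s s'. s \<in> {a..b} \<Longrightarrow> s' \<in> {a..b} \<Longrightarrow> dist s' s < \<delta> \<Longrightarrow> dist (Y s') (Y s) < e / B"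
          using divide_pos_pos[OF e B(1)] unfolding uniformly_continuous_on_def by meson
        have lipW: "norm (W s - W s') \<le> 2 * B * \<bar>s - s'\<bar>" if "s \<in> {a..b}" "s' \<in> {a..b}" for s s'
        proof -
          have Zb: "norm (Z x) \<le> 2 * B" if "x \<in> {a..b}" for x
            using norm_triangle_ineq4[of "V (x + h)" "V (x - h)"] B(2)[OF in0T(1)[OF that]] B(2)[OF in0T(2)[OF that]]
            by (simp add: Z_def)
          have *: "norm (W y - W x) \<le> 2 * B * (y - x)" if "x \<in> {a..b}" "y \<in> {a..b}" "x \<le> y" for x y
          proof (rule vector_mean_value_bound[where V = Z])
            fix z assume "z \<in> {x..y}"
            then have "z \<in> {a..b}" using that by auto
            then show "norm (Z z) \<le> 2 * B" "(W has_vector_derivative Z z) (at z within {x..y})"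
              using that by (auto intro: Zb has_vector_derivative_within_subset[OF Wd])
          qed fact
          show ?thesis using *[of s s'] *[of s' s] that by (cases "s \<le> s'") (auto simp: norm_minus_commute)
        qed
        show ?thesis
        proof (intro exI[of _ \<delta>] conjI allI impI \<delta>(1))
          fix r s s' assume A: "r \<in> {a..b} \<and> s \<in> {a..b} \<and> s' \<in> {a..b} \<and> \<bar>s - s'\<bar> < \<delta>"
          have "\<bar>inner (F r) (W s - W s')\<bar> \<le> norm (F r) * (2 * B * \<bar>s - s'\<bar>)"
            using Cauchy_Schwarz_ineq2[of "F r" "W s - W s'"] mult_left_mono[OF lipW[of s s'], of "norm (F r)"] A by force
          moreover have "\<bar>inner (X r) (Y s - Y s')\<bar> \<le> e"
          proof -
            have "\<bar>inner (X r) (Y s - Y s')\<bar> \<le> norm (X r) * norm (Y s - Y s')" by (rule Cauchy_Schwarz_ineq2)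
            also have "\<dots> \<le> B * (e / B)"
              using \<delta>(2)[of s' s] A B(3)[OF in0T(3)] B(1) by (intro mult_mono) (auto simp: dist_norm)
            finally show ?thesis using B(1) by simp
          qed
          ultimately show "\<bar>inner (F r) (W s) - inner (X r) (Y s) - (inner (F r) (W s') - inner (X r) (Y s'))\<bar> \<le> norm (F r) * (2 * B) * \<bar>s - s'\<bar> + e"
            by (simp add: inner_diff_right mult.assoc)
        qed
      qed
    qed (use ab B in auto)
    also have "\<dots> = integral {a..b} (\<lambda>r. inner (F r) (W r)) - integral {a..b} (\<lambda>r. inner (X r) (Y r)) + integral {a..b} (\<lambda>r. inner (V r) (Z r))"
      by (simp add: Henstock_Kurzweil_Integration.integral_add[OF integrable_diff[OF FWd cXYd] cVZd]
          Henstock_Kurzweil_Integration.integral_diff[OF FWd cXYd])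
    also have "integral {a..b} (\<lambda>r. inner (X r) (Y r)) = integral {b - h..b} (\<lambda>\<tau>. inner (X \<tau>) (X (\<tau> + h))) - integral {a - h..a} (\<lambda>\<tau>. inner (X \<tau>) (X (\<tau> + h)))"
      unfolding Y_def inner_diff_right
    proof (rule integral_unique[OF symmetric_difference_integral[where k = "\<lambda>s r. inner (X s) (X r)"]])
      show "continuous_on {a - h..b} (\<lambda>\<tau>. inner (X \<tau>) (X (\<tau> + h)))"
        using h ab by (intro continuous_on_inner continuous_on_subset[OF X] continuous_on_compose2[OF X]) (auto intro!: continuous_intros simp: h0_def)
    qed (use h ab in \<open>auto simp: inner_commute\<close>)
    also have "integral {a..b} (\<lambda>r. inner (V r) (Z r)) = integral {b - h..b} (\<lambda>\<tau>. inner (V \<tau>) (V (\<tau> + h))) - integral {a - h..a} (\<lambda>\<tau>. inner (V \<tau>) (V (\<tau> + h)))"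
      unfolding Z_def inner_diff_right
    proof (rule integral_unique[OF symmetric_difference_integral[where k = "\<lambda>s r. inner (V s) (V r)"]])
      show "continuous_on {a - h..b} (\<lambda>\<tau>. inner (V \<tau>) (V (\<tau> + h)))"
        using h ab by (intro continuous_on_inner continuous_on_subset[OF V] continuous_on_compose2[OF V]) (auto intro!: continuous_intros simp: h0_def)
    qed (use h ab in \<open>auto simp: inner_commute\<close>)
    finally show ?thesis unfolding W_def I_def .
  qed
  \<comment> \<open>The mean value inequality bounds the central difference by 2 h (S + e). The e is
    needed because [r - h, r + h] may leave [a, b], where S is a bound; uniform continuity of V
    covers the excess.\<close>
  have Ubound: "\<exists>\<delta>>0. \<forall>h. 0 < h \<and> h < \<delta> \<longrightarrow> \<bar>I h\<bar> \<le> 2 * h * (S + e) * N" if e: "0 < e" for e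
  proof -
    have "uniformly_continuous_on {0..T} V" by (intro compact_uniformly_continuous V) auto
    then obtain \<delta> where \<delta>: "\<delta> > 0" "\<And>s s'. s \<in> {0..T} \<Longrightarrow> s' \<in> {0..T} \<Longrightarrow> dist s' s < \<delta> \<Longrightarrow> dist (V s') (V s) < e"
      using e unfolding uniformly_continuous_on_def by meson
    show ?thesis
    proof (intro exI[of _ "min \<delta> h0"] conjI allI impI)
      fix h assume h: "0 < h \<and> h < min \<delta> h0"
      have W: "norm (U (r + h) - U (r - h)) \<le> (S + e) * (2 * h)" if r: "r \<in> {a..b}" for r
      proof -
        have "norm (U (r + h) - U (r - h)) \<le> (S + e) * ((r + h) - (r - h))"
        proof (rule vector_mean_value_bound[where V = V])
          fix x assume x: "x \<in> {r - h..r + h}"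
          have x0: "x \<in> {0..T}" "{r - h..r + h} \<subseteq> {0..T}" using x h r ab by (auto simp: h0_def)
          show "(U has_vector_derivative V x) (at x within {r - h..r + h})"
            using has_vector_derivative_within_subset[OF U[OF x0(1)] x0(2)] .
          have "dist (V x) (V r) < e" using x x0 h r ab by (intro \<delta>) (auto simp: dist_real_def)
          then have "norm (V x - V r) < e" by (simp add: dist_norm)
          then show "norm (V x) \<le> S + e" using S[OF r] norm_triangle_sub[of "V x" "V r"] by linarith
        qed (use h in auto)
        then show ?thesis by simp
      qed
      have cW: "continuous_on {a..b} (\<lambda>s. U (s + h) - U (s - h))"
        using h ab by (intro continuous_on_diff continuous_on_compose2[OF cU]) (auto intro!: continuous_intros simp: h0_def)
      have "(\<lambda>r. inner (F r) (U (r + h) - U (r - h))) integrable_on {a..b}"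
      proof (rule inner_curve_integrable[OF cW ab(2) _ nab])
        show "(\<lambda>s. inner (F s) (U (t + h) - U (t - h))) integrable_on {a..b}" if "t \<in> {a..b}" for t
          unfolding inner_diff_right using that h ab
          by (intro integrable_diff integrable_on_subinterval[OF F]) (auto simp: h0_def)
      qed
      then have "norm (I h) \<le> integral {a..b} (\<lambda>r. norm (F r) * ((S + e) * (2 * h)))"
        unfolding I_def
      proof (rule integral_norm_bound_integral)
        show "(\<lambda>r. norm (F r) * ((S + e) * (2 * h))) integrable_on {a..b}" by (rule integrable_on_mult_left[OF nab])
        fix r assume r: "r \<in> {a..b}"
        show "norm (inner (F r) (U (r + h) - U (r - h))) \<le> norm (F r) * ((S + e) * (2 * h))"
          using Cauchy_Schwarz_ineq2[of "F r" "U (r + h) - U (r - h)"] mult_left_mono[OF W[OF r], of "norm (F r)"] by simp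
      qed
      also have "\<dots> = N * ((S + e) * (2 * h))" unfolding N_def by simp
      finally show "\<bar>I h\<bar> \<le> 2 * h * (S + e) * N" by (simp add: mult_ac)
    qed (use \<delta> h0 in auto)
  qed
  \<comment> \<open>The forward and the backward difference quotient both tend to V, hence the
    factor 2.\<close>
  have Ulim: "((\<lambda>h. inner (V c) (U (c + h) - U (c - h)) / h) \<longlongrightarrow> 2 * inner (V c) (V c)) (at_right 0)" if c: "c \<in> {a..b}" for c
  proof -
    have c0: "0 < c" "c < T" using c ab by auto
    have "(U has_vector_derivative V c) (at c)"
      using U[of c] c0 at_within_interior[of c "{0..T}"] by auto
    then have d: "((\<lambda>s. (1 / (s - c)) *\<^sub>R (U s - U c)) \<longlongrightarrow> V c) (at c)"
      using has_vector_derivative_quotient_iff[of U "V c" c UNIV] tendsto_norm_zero_iff[of "\<lambda>s. (1 / (s - c)) *\<^sub>R (U s - U c) - V c" "at c"]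
      by (simp add: Lim_null[symmetric] del: tendsto_norm_zero_iff)
    have "filterlim (\<lambda>h. c + h) (at c) (at_right 0)" "filterlim (\<lambda>h. c - h) (at c) (at_right 0)"
      by (auto simp: filterlim_at eventually_at_filter intro!: tendsto_eq_intros)
    then have "((\<lambda>h. (1 / h) *\<^sub>R (U (c + h) - U c)) \<longlongrightarrow> V c) (at_right 0)" "((\<lambda>h. (- 1 / h) *\<^sub>R (U (c - h) - U c)) \<longlongrightarrow> V c) (at_right 0)"
      using filterlim_compose[OF d] by fastforce+
    then have "((\<lambda>h. inner (V c) ((1 / h) *\<^sub>R (U (c + h) - U c)) + inner (V c) ((- 1 / h) *\<^sub>R (U (c - h) - U c))) \<longlongrightarrow> inner (V c) (V c) + inner (V c) (V c)) (at_right 0)"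
      by (intro tendsto_intros)
    moreover have "inner (V c) ((1 / h) *\<^sub>R (U (c + h) - U c)) + inner (V c) ((- 1 / h) *\<^sub>R (U (c - h) - U c)) = inner (V c) (U (c + h) - U (c - h)) / h" for h
      by (simp add: inner_diff_right diff_divide_distrib)
    ultimately show ?thesis by simp
  qed
  let ?e = "\<lambda>t. inner (V t) (V t) + inner (X t) (X t)"
  have lim: "((\<lambda>h. I h / h) \<longlongrightarrow> ?e b - ?e a) (at_right 0)"
  proof -
    have "((\<lambda>h. (inner (V b) (U (b + h) - U (b - h)) / h - inner (V a) (U (a + h) - U (a - h)) / h)
        + (integral {b - h..b} (\<lambda>\<tau>. inner (X \<tau>) (X (\<tau> + h))) / h - integral {a - h..a} (\<lambda>\<tau>. inner (X \<tau>) (X (\<tau> + h))) / h)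
        - (integral {b - h..b} (\<lambda>\<tau>. inner (V \<tau>) (V (\<tau> + h))) / h - integral {a - h..a} (\<lambda>\<tau>. inner (V \<tau>) (V (\<tau> + h))) / h))
      \<longlongrightarrow> (2 * inner (V b) (V b) - 2 * inner (V a) (V a)) + (inner (X b) (X b) - inner (X a) (X a)) - (inner (V b) (V b) - inner (V a) (V a))) (at_right 0)"
      using ab by (intro tendsto_diff tendsto_add Ulim inner_average_tendsto[OF V] inner_average_tendsto[OF X]) auto
    moreover have "\<forall>\<^sub>F h in at_right 0. (inner (V b) (U (b + h) - U (b - h)) / h - inner (V a) (U (a + h) - U (a - h)) / h)
        + (integral {b - h..b} (\<lambda>\<tau>. inner (X \<tau>) (X (\<tau> + h))) / h - integral {a - h..a} (\<lambda>\<tau>. inner (X \<tau>) (X (\<tau> + h))) / h)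
        - (integral {b - h..b} (\<lambda>\<tau>. inner (V \<tau>) (V (\<tau> + h))) / h - integral {a - h..a} (\<lambda>\<tau>. inner (V \<tau>) (V (\<tau> + h))) / h) = I h / h"
      unfolding eventually_at_right_field
    proof (intro exI[of _ h0] conjI allI impI h0)
      fix h assume "0 < h" "h < h0"
      from key[OF this] have "I h = (inner (V b) (U (b + h) - U (b - h)) - inner (V a) (U (a + h) - U (a - h)))
        + (integral {b - h..b} (\<lambda>\<tau>. inner (X \<tau>) (X (\<tau> + h))) - integral {a - h..a} (\<lambda>\<tau>. inner (X \<tau>) (X (\<tau> + h))))
        - (integral {b - h..b} (\<lambda>\<tau>. inner (V \<tau>) (V (\<tau> + h))) - integral {a - h..a} (\<lambda>\<tau>. inner (V \<tau>) (V (\<tau> + h))))" by linarith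
      then show "(inner (V b) (U (b + h) - U (b - h)) / h - inner (V a) (U (a + h) - U (a - h)) / h)
        + (integral {b - h..b} (\<lambda>\<tau>. inner (X \<tau>) (X (\<tau> + h))) / h - integral {a - h..a} (\<lambda>\<tau>. inner (X \<tau>) (X (\<tau> + h))) / h)
        - (integral {b - h..b} (\<lambda>\<tau>. inner (V \<tau>) (V (\<tau> + h))) / h - integral {a - h..a} (\<lambda>\<tau>. inner (V \<tau>) (V (\<tau> + h))) / h) = I h / h"
        by (simp only: diff_divide_distrib add_divide_distrib)
    qed
    ultimately have "((\<lambda>h. I h / h) \<longlongrightarrow> (2 * inner (V b) (V b) - 2 * inner (V a) (V a)) + (inner (X b) (X b) - inner (X a) (X a)) - (inner (V b) (V b) - inner (V a) (V a))) (at_right 0)"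
      by (rule Lim_transform_eventually)
    moreover have "(2 * inner (V b) (V b) - 2 * inner (V a) (V a)) + (inner (X b) (X b) - inner (X a) (X a)) - (inner (V b) (V b) - inner (V a) (V a)) = ?e b - ?e a"
      by simp
    ultimately show ?thesis by (simp only:)
  qed
  have lim_le: "\<bar>?e b - ?e a\<bar> \<le> 2 * (S + e) * N" if e: "0 < e" for e
  proof (rule tendsto_upperbound[OF tendsto_rabs[OF lim]])
    obtain \<delta> where \<delta>: "\<delta> > 0" "\<And>h. 0 < h \<Longrightarrow> h < \<delta> \<Longrightarrow> \<bar>I h\<bar> \<le> 2 * h * (S + e) * N" using Ubound[OF e] by blast
    show "\<forall>\<^sub>F h in at_right 0. \<bar>I h / h\<bar> \<le> 2 * (S + e) * N"
      unfolding eventually_at_right_field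
      using \<delta> by (intro exI[of _ \<delta>]) (auto simp: divide_le_eq mult_ac)
  qed simp
  have "\<bar>?e b - ?e a\<bar> \<le> 2 * S * N"
  proof (rule field_le_epsilon)
    fix d :: real assume d: "0 < d"
    define e where "e = d / (2 * N + 1)"
    have e: "0 < e" "2 * N * e \<le> d" using N0 d by (simp_all add: e_def field_simps)
    have "2 * (S + e) * N = 2 * S * N + 2 * N * e" by (simp add: algebra_simps)
    then show "\<bar>?e b - ?e a\<bar> \<le> 2 * S * N + d" using lim_le[OF e(1)] e(2) by linarith
  qed
  then show ?thesis by (simp add: N_def power2_norm_eq_inner)
qed

subsection \<open>A single component\<close>

lemma borel_L2:
  fixes g :: "real \<Rightarrow> real"
  assumes "g \<in> borel_measurable borel" "integrable lborel (\<lambda>x. (g x)\<^sup>2)"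
  shows "g \<in> L2 {0<..<L}"
proof -
  have "integrable lebesgue (\<lambda>x. (g x)\<^sup>2)"
    using assms by (subst integrable_completion) auto
  then have "integrable (lebesgue_on {0<..<L}) (\<lambda>x. (g x)\<^sup>2)"
    by (rule integrable_restrict_space[THEN iffD2, OF _ integrable_mult_indicator, rotated 2]) auto
  then show ?thesis
    using assms(1) by (auto simp: L2_def intro!: measurable_restrict_space1 measurable_lebesgue_borel)
qed

lemma L2_dominated:
  assumes "g \<in> L2 S" "f \<in> borel_measurable (lebesgue_on S)" "\<And>x. x \<in> S \<Longrightarrow> \<bar>f x\<bar> \<le> \<bar>g x\<bar>"
  shows "f \<in> L2 S"
proof -
  have "integrable (lebesgue_on S) (\<lambda>x. (f x)\<^sup>2)"
  proof (rule Bochner_Integration.integrable_bound)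
    show "integrable (lebesgue_on S) (\<lambda>x. (g x)\<^sup>2)" using assms(1) by (simp add: L2_def)
    show "(\<lambda>x. (f x)\<^sup>2) \<in> borel_measurable (lebesgue_on S)" using assms(2) by simp
    show "AE x in lebesgue_on S. norm ((f x)\<^sup>2) \<le> norm ((g x)\<^sup>2)"
      using assms(3) by (intro AE_I2) (simp add: space_restrict_space abs_le_square_iff)
  qed
  then show ?thesis using assms(2) by (simp add: L2_def)
qed

lemma borel_version:
  assumes "v \<in> L2 {0<..<L}"
  obtains w where "w \<in> borel_measurable borel" "\<And>x. x \<notin> {0<..<L} \<Longrightarrow> w x = 0"
    "AE x in lebesgue_on {0<..<L}. v x = w x" "w \<in> L2 {0<..<L}" "l2c L v = l2c L w"
proof -
  have "zext L v \<in> borel_measurable lebesgue" using assms by (simp add: measurable_zext L2_def)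
  then obtain v' where v': "v' \<in> borel_measurable lborel" "AE x in lborel. zext L v x = v' x"
    using completion_ex_borel_measurable_real by blast
  define w where "w x = v' x * indicator {0<..<L} x" for x
  have 1: "w \<in> borel_measurable borel" using v'(1) unfolding w_def by measurable
  have 2: "w x = 0" if "x \<notin> {0<..<L}" for x using that by (simp add: w_def)
  have 3: "AE x in lebesgue_on {0<..<L}. v x = w x"
    unfolding AE_zext using AE_completion[OF v'(2)] by eventually_elim (auto simp: w_def zext_def)
  show thesis using that[OF 1 2 3] l2c_cong_AE[OF 3 assms] by blast
qed

lemma L2_inner_borel:
  assumes "g \<in> borel_measurable borel" "w \<in> borel_measurable borel" "\<And>x. x \<notin> {0<..<L} \<Longrightarrow> g x = 0"
  shows "L2_inner L g w = (LINT x|lborel. g x * w x)"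
proof -
  have "zext L (\<lambda>x. g x * w x) = (\<lambda>x. g x * w x)" using assms(3) by (auto simp: zext_def)
  then have "L2_inner L g w = (LINT x|lebesgue. g x * w x)"
    unfolding L2_inner_def integral_zext[symmetric] by simp
  also have "\<dots> = (LINT x|lborel. g x * w x)"
    using assms by (intro integral_completion) simp
  finally show ?thesis .
qed

text \<open>Compact support bounds the second derivative of \<zeta> globally, so the Taylor
  remainder is at most a constant times the square of the shift, uniformly in x. Multiplied by
  \<eta> this is an estimate in \<open>l2\<close>.\<close>

lemma translate_has_vector_derivative:
  assumes \<eta>: "smooth \<eta>" and \<zeta>: "smooth \<zeta>" "\<And>x. x \<notin> {\<alpha>..\<beta>} \<Longrightarrow> \<zeta> x = 0"
  shows "((\<lambda>s. l2c L (\<lambda>x. \<eta> x * \<zeta> (x + c * s))) has_vector_derivative c *\<^sub>R l2c L (\<lambda>x. \<eta> x * deriv \<zeta> (x + c * s))) (at s within S)"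
proof -
  have z2: "deriv (deriv \<zeta>) x = 0" if "x \<notin> {\<alpha>..\<beta>}" for x
    by (rule deriv_zero_outside[OF _ that], rule deriv_zero_outside[OF \<zeta>(2)])
  have "bounded (deriv (deriv \<zeta>) ` {\<alpha>..\<beta>})"
    by (intro compact_imp_bounded compact_continuous_image smooth_continuous_on smooth_deriv \<zeta>) auto
  then obtain B0 where B0: "\<And>x. x \<in> {\<alpha>..\<beta>} \<Longrightarrow> \<bar>deriv (deriv \<zeta>) x\<bar> \<le> B0" unfolding bounded_iff real_norm_def by blast
  define B where "B = max B0 0"
  have B: "\<bar>deriv (deriv \<zeta>) x\<bar> \<le> B" "0 \<le> B" for x
    using B0[of x] z2[of x] by (cases "x \<in> {\<alpha>..\<beta>}") (auto simp: B_def)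
  have lip: "\<bar>deriv \<zeta> y - deriv \<zeta> x\<bar> \<le> B * \<bar>y - x\<bar>" for x y
  proof -
    have "norm (deriv \<zeta> y - deriv \<zeta> x) \<le> B * norm (y - x)"
      by (rule field_differentiable_bound[of UNIV _ "deriv (deriv \<zeta>)"])
        (use B smooth_DERIV[OF smooth_deriv[OF \<zeta>(1)]] in auto)
    then show ?thesis by simp
  qed
  have taylor: "\<bar>\<zeta> (y + k) - \<zeta> y - k * deriv \<zeta> y\<bar> \<le> B * \<bar>k\<bar> * \<bar>k\<bar>" for y k
  proof -
    have "norm ((\<zeta> (y + k) - (y + k) * deriv \<zeta> y) - (\<zeta> y - y * deriv \<zeta> y)) \<le> (B * \<bar>k\<bar>) * norm ((y + k) - y)"
    proof (rule field_differentiable_bound[of "{y - \<bar>k\<bar>..y + \<bar>k\<bar>}" _ "\<lambda>z. deriv \<zeta> z - deriv \<zeta> y"])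
      fix z assume z: "z \<in> {y - \<bar>k\<bar>..y + \<bar>k\<bar>}"
      show "((\<lambda>z. \<zeta> z - z * deriv \<zeta> y) has_field_derivative deriv \<zeta> z - deriv \<zeta> y) (at z within {y - \<bar>k\<bar>..y + \<bar>k\<bar>})"
        by (rule has_field_derivative_at_within) (auto intro!: derivative_eq_intros smooth_DERIV \<zeta>)
      have "\<bar>deriv \<zeta> z - deriv \<zeta> y\<bar> \<le> B * \<bar>z - y\<bar>" by (rule lip)
      also have "\<dots> \<le> B * \<bar>k\<bar>" using z B(2) by (intro mult_left_mono) auto
      finally show "norm (deriv \<zeta> z - deriv \<zeta> y) \<le> B * \<bar>k\<bar>" by simp
    qed auto
    then show ?thesis by (simp add: algebra_simps)
  qed
  have sh: "smooth (\<lambda>x. \<zeta> (x + c * s))" "smooth (\<lambda>x. deriv \<zeta> (x + c * s))" for s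
    using smooth_affine[OF \<zeta>(1), of 1 "c * s"] smooth_affine[OF smooth_deriv[OF \<zeta>(1)], of 1 "c * s"] by simp_all
  have L2: "(\<lambda>x. \<eta> x * \<zeta> (x + c * s)) \<in> L2 {0<..<L}" "(\<lambda>x. \<eta> x * deriv \<zeta> (x + c * s)) \<in> L2 {0<..<L}" for s
    by (intro smooth_L2 smooth_mult \<eta> sh)+
  show ?thesis unfolding has_vector_derivative_quotient_iff
  proof (rule tendsto_within_bound)
    fix r assume r: "r \<noteq> s"
    have "(1 / (r - s)) *\<^sub>R (l2c L (\<lambda>x. \<eta> x * \<zeta> (x + c * r)) - l2c L (\<lambda>x. \<eta> x * \<zeta> (x + c * s))) - c *\<^sub>R l2c L (\<lambda>x. \<eta> x * deriv \<zeta> (x + c * s))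
      = l2c L (\<lambda>x. 1 / (r - s) * (\<eta> x * \<zeta> (x + c * r) - \<eta> x * \<zeta> (x + c * s)) - c * (\<eta> x * deriv \<zeta> (x + c * s)))"
      using L2 by (simp only: l2c_diff l2c_scaleR L2_diff L2_cmult)
    moreover have "norm (l2c L (\<lambda>x. 1 / (r - s) * (\<eta> x * \<zeta> (x + c * r) - \<eta> x * \<zeta> (x + c * s)) - c * (\<eta> x * deriv \<zeta> (x + c * s))))
       \<le> norm (l2c L (\<lambda>x. (B * c\<^sup>2 * \<bar>r - s\<bar>) * \<eta> x))"
    proof (rule norm_l2c_le[OF L2_diff[OF L2_cmult[OF L2_diff[OF L2(1) L2(1)]] L2_cmult[OF L2(2)]] L2_cmult[OF smooth_L2[OF \<eta>]]], rule AE_I2)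
      fix x
      define k where "k = c * (r - s)"
      have k: "x + c * r = (x + c * s) + k" by (simp add: k_def algebra_simps)
      have "1 / (r - s) * (\<eta> x * \<zeta> (x + c * r) - \<eta> x * \<zeta> (x + c * s)) - c * (\<eta> x * deriv \<zeta> (x + c * s))
         = \<eta> x * (\<zeta> ((x + c * s) + k) - \<zeta> (x + c * s) - k * deriv \<zeta> (x + c * s)) / (r - s)"
        using r unfolding k by (simp add: k_def field_simps)
      also have "\<bar>\<dots>\<bar> = \<bar>\<eta> x\<bar> * \<bar>\<zeta> ((x + c * s) + k) - \<zeta> (x + c * s) - k * deriv \<zeta> (x + c * s)\<bar> / \<bar>r - s\<bar>"
        by (simp add: abs_mult)
      also have "\<dots> \<le> \<bar>\<eta> x\<bar> * (B * \<bar>k\<bar> * \<bar>k\<bar>) / \<bar>r - s\<bar>"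
        by (intro divide_right_mono mult_left_mono taylor) auto
      also have "\<dots> = (B * c\<^sup>2 * \<bar>r - s\<bar>) * \<bar>\<eta> x\<bar>"
        using r by (simp add: k_def abs_mult power2_eq_square)
      also have "\<dots> \<le> \<bar>(B * c\<^sup>2 * \<bar>r - s\<bar>) * \<eta> x\<bar>" by (simp add: abs_mult mult_right_mono)
      finally show "\<bar>1 / (r - s) * (\<eta> x * \<zeta> (x + c * r) - \<eta> x * \<zeta> (x + c * s)) - c * (\<eta> x * deriv \<zeta> (x + c * s))\<bar> \<le> \<bar>(B * c\<^sup>2 * \<bar>r - s\<bar>) * \<eta> x\<bar>" .
    qed
    moreover have "\<dots> = B * c\<^sup>2 * \<bar>r - s\<bar> * norm (l2c L \<eta>)"
      using B by (simp add: l2c_scaleR smooth_L2 \<eta>)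
    ultimately show "norm (norm ((1 / (r - s)) *\<^sub>R (l2c L (\<lambda>x. \<eta> x * \<zeta> (x + c * r)) - l2c L (\<lambda>x. \<eta> x * \<zeta> (x + c * s))) - c *\<^sub>R l2c L (\<lambda>x. \<eta> x * deriv \<zeta> (x + c * s))) - 0) \<le> B * c\<^sup>2 * \<bar>r - s\<bar> * norm (l2c L \<eta>)"
      by simp
  next
    have "((\<lambda>r. B * c\<^sup>2 * \<bar>r - s\<bar> * norm (l2c L \<eta>)) \<longlongrightarrow> B * c\<^sup>2 * \<bar>s - s\<bar> * norm (l2c L \<eta>)) (at s within S)"
      by (rule tendsto_mult[OF tendsto_mult[OF tendsto_const tendsto_rabs[OF tendsto_diff[OF tendsto_ident_at tendsto_const]]] tendsto_const])
    then show "((\<lambda>r. B * c\<^sup>2 * \<bar>r - s\<bar> * norm (l2c L \<eta>)) \<longlongrightarrow> 0) (at s within S)" by simp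
  qed
qed

lemma inner_l2c_zero_product:
  assumes "v \<in> L2 {0<..<L}" "w \<in> L2 {0<..<L}" "AE x in lebesgue_on {0<..<L}. v x * w x = 0"
  shows "inner (l2c L v) (l2c L w) = 0"
proof -
  have "(LINT x|lebesgue_on {0<..<L}. v x * w x) = (LINT x|lebesgue_on {0<..<L}. 0)"
    by (rule integral_cong_AE) (use assms in \<open>auto simp: L2_def\<close>)
  then show ?thesis using assms by (simp add: inner_l2c L2_inner_def)
qed

text \<open>One scalar wave equation with a given source. The coupling, which need not be jointly
  measurable, is represented by a Borel function G that vanishes off the rectangle and whose
  sections are square integrable for every t, not just for almost every t. So \<open>F t\<close> is
  a meaningful class at each time and Tonelli's theorem applies to G.\<close>

locale wave_component =
  fixes L T \<gamma> :: real and u :: "real \<Rightarrow> real \<Rightarrow> real" and G :: "real \<times> real \<Rightarrow> real"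
  assumes L0: "0 < L" and T0: "0 < T" and \<gamma>0: "0 < \<gamma>"
    and u0: "u \<in> C0_H10 L T" and u1: "u \<in> C1_L2 L T"
    and G_meas[measurable]: "G \<in> borel_measurable borel"
    and G_zero: "\<And>t x. t \<notin> {0<..<T} \<or> x \<notin> {0<..<L} \<Longrightarrow> G (t, x) = 0"
    and G_sec: "\<And>t. integrable lborel (\<lambda>x. (G (t, x))\<^sup>2)"
    and G_L2: "integrable lborel (\<lambda>t. LINT x|lborel. (G (t, x))\<^sup>2)"
    and weak: "\<And>\<phi> \<theta>. \<phi> \<in> H10 L \<Longrightarrow> test_fun 0 T \<theta> \<Longrightarrow>
      - (LINT t|lebesgue_on {0<..<T}. L2_inner L (dt L T u t) \<phi> * deriv \<theta> t)
      + \<gamma> * (LINT t|lebesgue_on {0<..<T}. L2_inner L (dx L (u t)) (dx L \<phi>) * \<theta> t)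
      = (LINT t|lebesgue_on {0<..<T}. L2_inner L (\<lambda>x. G (t, x)) \<phi> * \<theta> t)"
begin

definition "U t = l2c L (u t)"
definition "V t = l2c L (dt L T u t)"
definition "X t = l2c L (dx L (u t))"
definition "F t = l2c L (\<lambda>x. G (t, x))"

lemma G_section_borel[measurable]: "(\<lambda>x. G (t, x)) \<in> borel_measurable borel"
  by measurable

lemma G_section_L2: "(\<lambda>x. G (t, x)) \<in> L2 {0<..<L}"
  by (rule borel_L2[OF G_section_borel G_sec])

lemma U_deriv: "t \<in> {0..T} \<Longrightarrow> (U has_vector_derivative V t) (at t within {0..T})"
  unfolding U_def[abs_def] V_def by (rule C1_L2_deriv[OF u1])

lemma U_cont: "continuous_on {0..T} U" and V_cont: "continuous_on {0..T} V" and X_cont: "continuous_on {0..T} X"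
  unfolding U_def[abs_def] V_def[abs_def] X_def[abs_def]
  by (rule C0_H10_continuous[OF u0] C1_L2_continuous[OF u1])+

lemma u_H1: "t \<in> {0..T} \<Longrightarrow> u t \<in> H1 L" using C0_H10_H1[OF u0] .
lemma u_L2: "t \<in> {0..T} \<Longrightarrow> u t \<in> L2 {0<..<L}" using H1_L2[OF u_H1] .
lemma dx_u_L2: "t \<in> {0..T} \<Longrightarrow> dx L (u t) \<in> L2 {0<..<L}" using dx_L2[OF u_H1] .
lemma dt_u_L2: "t \<in> {0..T} \<Longrightarrow> dt L T u t \<in> L2 {0<..<L}" using dt_L2[OF u1] .

lemma norm_F: "(norm (F t))\<^sup>2 = (LINT x|lborel. (G (t, x))\<^sup>2)"
proof -
  have "(norm (F t))\<^sup>2 = L2_inner L (\<lambda>x. G (t, x)) (\<lambda>x. G (t, x))"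
    unfolding F_def power2_norm_eq_inner by (rule inner_l2c[OF G_section_L2 G_section_L2])
  also have "\<dots> = (LINT x|lborel. G (t, x) * G (t, x))"
    by (rule L2_inner_borel[OF G_section_borel G_section_borel]) (auto intro: G_zero)
  finally show ?thesis by (simp add: power2_eq_square)
qed

lemma norm_F_measurable: "(\<lambda>t. norm (F t)) \<in> borel_measurable borel"
proof -
  have "(\<lambda>t. LINT x|lborel. (G (t, x))\<^sup>2) \<in> borel_measurable borel" by measurable
  then have "(\<lambda>t. sqrt ((norm (F t))\<^sup>2)) \<in> borel_measurable borel" unfolding norm_F by measurable
  then show ?thesis by simp
qed

lemma norm_F_L2: "(\<lambda>t. norm (F t)) \<in> L2 {0<..<T'}"
  by (rule borel_L2[OF norm_F_measurable]) (simp add: norm_F G_L2)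

lemma inner_F_measurable:
  assumes "w \<in> L2 {0<..<L}"
  shows "(\<lambda>t. inner (F t) (l2c L w)) \<in> borel_measurable borel"
proof -
  obtain w' where w': "w' \<in> borel_measurable borel" "w' \<in> L2 {0<..<L}" "l2c L w = l2c L w'"
    using borel_version[OF assms] by metis
  note [measurable] = w'(1)
  have "inner (F t) (l2c L w) = (LINT x|lborel. G (t, x) * w' x)" for t
  proof -
    have "inner (F t) (l2c L w) = L2_inner L (\<lambda>x. G (t, x)) w'"
      unfolding F_def w'(3) by (rule inner_l2c[OF G_section_L2 w'(2)])
    also have "\<dots> = (LINT x|lborel. G (t, x) * w' x)"
      by (rule L2_inner_borel[OF G_section_borel w'(1)]) (auto intro: G_zero)
    finally show ?thesis .
  qed
  moreover have "(\<lambda>t. LINT x|lborel. G (t, x) * w' x) \<in> borel_measurable borel" by measurable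
  ultimately show ?thesis by simp
qed

lemma inner_F_L2:
  assumes "w \<in> L2 {0<..<L}"
  shows "(\<lambda>t. inner (F t) (l2c L w)) \<in> L2 {0<..<T'}"
proof (rule L2_dominated[OF L2_cmult[OF norm_F_L2, of "norm (l2c L w)"]])
  show "(\<lambda>t. inner (F t) (l2c L w)) \<in> borel_measurable (lebesgue_on {0<..<T'})"
    by (intro measurable_restrict_space1 measurable_lebesgue_borel inner_F_measurable assms)
  show "\<bar>inner (F t) (l2c L w)\<bar> \<le> \<bar>norm (l2c L w) * norm (F t)\<bar>" for t
    using Cauchy_Schwarz_ineq2[of "F t" "l2c L w"] by (simp add: abs_mult mult.commute)
qed

lemma inner_F_integrable: "w \<in> L2 {0<..<L} \<Longrightarrow> (\<lambda>t. inner (F t) (l2c L w)) integrable_on {0..T}"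
  by (rule set_lebesgue_integral_eq_integral(1)[OF L2_absolutely_integrable1[OF inner_F_L2]])

lemma norm_F_integrable: "(\<lambda>t. norm (F t)) integrable_on {0..T}"
  by (rule set_lebesgue_integral_eq_integral(1)[OF L2_absolutely_integrable1[OF norm_F_L2]])

text \<open>The distributional equation in time says that <V t, \<phi>> has a weak derivative on (0,
  T). The function is continuous, so the fundamental theorem for weak derivatives, now with T in
  place of L, holds between any two times.\<close>

lemma weak_increment:
  assumes \<phi>: "\<phi> \<in> H10 L" and t: "0 \<le> t1" "t1 \<le> t2" "t2 \<le> T"
  shows "inner (V t2) (l2c L \<phi>) - inner (V t1) (l2c L \<phi>) =
    integral {t1..t2} (\<lambda>s. inner (F s) (l2c L \<phi>) - \<gamma> * inner (X s) (l2c L (dx L \<phi>)))"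
proof -
  have \<phi>2: "\<phi> \<in> L2 {0<..<L}" "dx L \<phi> \<in> L2 {0<..<L}" using H10_L2[OF \<phi>] dx_L2[OF H10_H1[OF \<phi>]] .
  have cV: "continuous_on {0..T} (\<lambda>t. inner (V t) (l2c L \<phi>))" and cX: "continuous_on {0..T} (\<lambda>t. inner (X t) (l2c L (dx L \<phi>)))"
    by (intro continuous_on_inner V_cont X_cont continuous_on_const)+
  let ?q = "\<lambda>t. inner (F t) (l2c L \<phi>) - \<gamma> * inner (X t) (l2c L (dx L \<phi>))"
  have q: "?q \<in> L2 {0<..<T}"
    by (intro L2_diff L2_cmult inner_F_L2 \<phi>2 continuous_L2 cX)
  have "is_weak_deriv T (\<lambda>t. inner (V t) (l2c L \<phi>)) ?q"
    unfolding is_weak_deriv_def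
  proof (intro conjI q allI impI)
    fix \<theta> assume \<theta>: "test_fun 0 T \<theta>"
    have \<theta>2: "\<theta> \<in> L2 {0<..<T}" by (rule test_fun_L2[OF \<theta>])
    have 1: "(LINT t|lebesgue_on {0<..<T}. L2_inner L (dt L T u t) \<phi> * deriv \<theta> t) = L2_inner T (\<lambda>t. inner (V t) (l2c L \<phi>)) (deriv \<theta>)"
      unfolding L2_inner_def[of T] by (rule Bochner_Integration.integral_cong) (auto simp: V_def inner_l2c \<phi>2 dt_u_L2 space_restrict_space)
    have 2: "(LINT t|lebesgue_on {0<..<T}. L2_inner L (dx L (u t)) (dx L \<phi>) * \<theta> t) = L2_inner T (\<lambda>t. inner (X t) (l2c L (dx L \<phi>))) \<theta>"
      unfolding L2_inner_def[of T] by (rule Bochner_Integration.integral_cong) (auto simp: X_def inner_l2c \<phi>2 dx_u_L2 space_restrict_space)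
    have 3: "(LINT t|lebesgue_on {0<..<T}. L2_inner L (\<lambda>x. G (t, x)) \<phi> * \<theta> t) = L2_inner T (\<lambda>t. inner (F t) (l2c L \<phi>)) \<theta>"
      unfolding L2_inner_def[of T] by (rule Bochner_Integration.integral_cong) (auto simp: F_def inner_l2c \<phi>2 G_section_L2 space_restrict_space)
    have "L2_inner T ?q \<theta> = L2_inner T (\<lambda>t. inner (F t) (l2c L \<phi>)) \<theta> - \<gamma> * L2_inner T (\<lambda>t. inner (X t) (l2c L (dx L \<phi>))) \<theta>"
      using inner_F_L2[OF \<phi>2(1), of T] continuous_L2[OF cX] \<theta>2 q
      by (simp add: inner_l2c[symmetric] l2c_diff L2_cmult l2c_scaleR inner_diff_left)
    then show "L2_inner T (\<lambda>t. inner (V t) (l2c L \<phi>)) (deriv \<theta>) = - L2_inner T ?q \<theta>"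
      using weak[OF \<phi> \<theta>] unfolding 1 2 3 by linarith
  qed
  from weak_deriv_FTC[OF this cV t T0] show ?thesis .
qed

lemma component_energy_increment:
  assumes "0 < a" "a < b" "b < T" "\<And>s. s \<in> {a..b} \<Longrightarrow> norm (V s) \<le> S"
  shows "\<bar>((norm (V b))\<^sup>2 + \<gamma> * (norm (X b))\<^sup>2) - ((norm (V a))\<^sup>2 + \<gamma> * (norm (X a))\<^sup>2)\<bar> \<le> 2 * S * integral {a..b} (\<lambda>s. norm (F s))"
proof -
  have "\<bar>((norm (V b))\<^sup>2 + (norm (sqrt \<gamma> *\<^sub>R X b))\<^sup>2) - ((norm (V a))\<^sup>2 + (norm (sqrt \<gamma> *\<^sub>R X a))\<^sup>2)\<bar> \<le> 2 * S * integral {a..b} (\<lambda>s. norm (F s))"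
  proof (rule energy_increment[OF U_deriv V_cont _ norm_F_integrable _ _ assms])
    show "continuous_on {0..T} (\<lambda>t. sqrt \<gamma> *\<^sub>R X t)" by (intro continuous_on_scaleR continuous_on_const X_cont)
    show "(\<lambda>s. inner (F s) (U t)) integrable_on {0..T}" if "t \<in> {0..T}" for t
      unfolding U_def by (rule inner_F_integrable[OF u_L2[OF that]])
    show "inner (V t2) (U r) - inner (V t1) (U r) = integral {t1..t2} (\<lambda>s. inner (F s) (U r) - inner (sqrt \<gamma> *\<^sub>R X s) (sqrt \<gamma> *\<^sub>R X r))"
      if "r \<in> {0..T}" "0 \<le> t1" "t1 \<le> t2" "t2 \<le> T" for r t1 t2
      using weak_increment[OF C0_H10_H10[OF u0 that(1)] that(2-4)] \<gamma>0 by (simp add: U_def X_def mult.assoc[symmetric])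
  qed auto
  then show ?thesis using \<gamma>0 by (simp add: power_mult_distrib)
qed

text \<open>V + c X is the Riemann invariant that is transported along x + c t = const when there is
  no source. Tested with a profile moving along these lines, it changes only through F. The cutoff
  \<eta> is fixed in space and would spoil the transport, but its derivative lives where
  \<open>u\<close> vanishes.\<close>

lemma char_increment:
  assumes c: "c\<^sup>2 = \<gamma>" and \<eta>: "smooth \<eta>" and \<zeta>: "smooth \<zeta>" "\<And>x. x \<notin> {\<alpha>..\<beta>} \<Longrightarrow> \<zeta> x = 0"
    and pq: "0 \<le> p" "p < q" "q \<le> L" and \<eta>pq: "\<And>x. x \<notin> {p<..<q} \<Longrightarrow> deriv \<eta> x = 0"
    and uz: "\<And>t x. t \<in> {0..T} \<Longrightarrow> x \<in> {p<..<q} \<Longrightarrow> u t x = 0"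
    and t: "0 \<le> t1" "t1 \<le> t2" "t2 \<le> T"
    and test: "\<And>s. s \<in> {t1..t2} \<Longrightarrow> test_fun 0 L (\<lambda>x. \<eta> x * \<zeta> (x + c * s))"
  shows "inner (V t2 + c *\<^sub>R X t2) (l2c L (\<lambda>x. \<eta> x * \<zeta> (x + c * t2))) - inner (V t1 + c *\<^sub>R X t1) (l2c L (\<lambda>x. \<eta> x * \<zeta> (x + c * t1)))
    = integral {t1..t2} (\<lambda>r. inner (F r) (l2c L (\<lambda>x. \<eta> x * \<zeta> (x + c * r))))"
proof -
  define Z where "Z s = l2c L (\<lambda>x. \<eta> x * \<zeta> (x + c * s))" for s
  define Z1 where "Z1 s = l2c L (\<lambda>x. \<eta> x * deriv \<zeta> (x + c * s))" for s
  define Z2 where "Z2 s = l2c L (\<lambda>x. \<eta> x * deriv (deriv \<zeta>) (x + c * s))" for s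
  define A where "A s = V s + c *\<^sub>R X s" for s
  have \<zeta>1: "smooth (deriv \<zeta>)" "\<And>x. x \<notin> {\<alpha>..\<beta>} \<Longrightarrow> deriv \<zeta> x = 0"
    using smooth_deriv[OF \<zeta>(1)] deriv_zero_outside[of \<alpha> \<beta> \<zeta>] \<zeta>(2) by blast+
  have Zd: "(Z has_vector_derivative c *\<^sub>R Z1 s) (at s within S)" for s S
    unfolding Z_def[abs_def] Z1_def by (rule translate_has_vector_derivative[OF \<eta> \<zeta>])
  have Z1d: "(Z1 has_vector_derivative c *\<^sub>R Z2 s) (at s within S)" for s S
    unfolding Z1_def[abs_def] Z2_def by (rule translate_has_vector_derivative[OF \<eta> \<zeta>1])
  have \<zeta>2: "smooth (deriv (deriv \<zeta>))" "\<And>x. x \<notin> {\<alpha>..\<beta>} \<Longrightarrow> deriv (deriv \<zeta>) x = 0"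
    using smooth_deriv[OF \<zeta>1(1)] deriv_zero_outside[of \<alpha> \<beta> "deriv \<zeta>"] \<zeta>1(2) by blast+
  have Z2d: "(Z2 has_vector_derivative c *\<^sub>R l2c L (\<lambda>x. \<eta> x * deriv (deriv (deriv \<zeta>)) (x + c * s))) (at s within S)" for s S
    unfolding Z2_def[abs_def] by (rule translate_has_vector_derivative[OF \<eta> \<zeta>2])
  have vc: "continuous_on S W" if "\<And>s. (W has_vector_derivative W' s) (at s within S)" for S and W W' :: "real \<Rightarrow> l2"
    unfolding continuous_on_eq_continuous_within using has_vector_derivative_continuous[OF that] by simp
  have cZ: "continuous_on S Z" and cZ1: "continuous_on S Z1" and cZ2: "continuous_on S Z2" for S
    by (rule vc[OF Zd] vc[OF Z1d] vc[OF Z2d])+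
  have sub: "{t1..t2} \<subseteq> {0..T}" using t by auto
  have cV: "continuous_on {t1..t2} V" and cX: "continuous_on {t1..t2} X"
    using continuous_on_subset[OF V_cont sub] continuous_on_subset[OF X_cont sub] .
  have cA: "continuous_on {t1..t2} A"
    unfolding A_def[abs_def] by (intro continuous_on_add continuous_on_scaleR continuous_on_const cV cX)
  have sh: "smooth (\<lambda>x. g (x + c * s))" if "smooth g" for g s
    using smooth_affine[OF that, of 1 "c * s"] by simp
  have L2Z: "(\<lambda>x. \<eta> x * \<zeta> (x + c * s)) \<in> L2 {0<..<L}" "(\<lambda>x. \<eta> x * deriv \<zeta> (x + c * s)) \<in> L2 {0<..<L}" for s
    by (intro smooth_L2 smooth_mult \<eta> sh \<zeta> \<zeta>1)+
  have dsh: "deriv (\<lambda>x. \<zeta> (x + c * s)) = (\<lambda>x. deriv \<zeta> (x + c * s))" for s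
  proof (rule ext, rule DERIV_imp_deriv)
    fix x show "((\<lambda>x. \<zeta> (x + c * s)) has_real_derivative deriv \<zeta> (x + c * s)) (at x)"
      using DERIV_shift[of \<zeta> "deriv \<zeta> (x + c * s)" x "c * s"] smooth_DERIV[OF \<zeta>(1), of "x + c * s"] by simp
  qed
  have dphi: "deriv (\<lambda>x. \<eta> x * \<zeta> (x + c * s)) = (\<lambda>x. \<eta> x * deriv \<zeta> (x + c * s) + deriv \<eta> x * \<zeta> (x + c * s))" for s
    unfolding deriv_mult_smooth[OF \<eta> sh[OF \<zeta>(1)]] dsh ..
  have L2e: "(\<lambda>x. deriv \<eta> x * \<zeta> (x + c * s)) \<in> L2 {0<..<L}" for s
    by (intro smooth_L2 smooth_mult smooth_deriv \<eta> sh \<zeta>)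
  have l2dphi: "l2c L (deriv (\<lambda>x. \<eta> x * \<zeta> (x + c * s))) = Z1 s + l2c L (\<lambda>x. deriv \<eta> x * \<zeta> (x + c * s))" for s
    unfolding dphi Z1_def by (rule l2c_add[OF L2Z(2) L2e])
  have dxphi: "l2c L (dx L (\<lambda>x. \<eta> x * \<zeta> (x + c * s))) = Z1 s + l2c L (\<lambda>x. deriv \<eta> x * \<zeta> (x + c * s))" for s
    unfolding l2dphi[symmetric] by (rule l2c_dx[OF smooth_weak_deriv(1)]) (intro smooth_mult \<eta> sh \<zeta> smooth_L2)+
  \<comment> \<open>All terms with the derivative of the cutoff drop out: wherever it is nonzero,
    \<open>u\<close> and almost everywhere \<open>dx L u\<close> are 0.\<close>
  have X0: "inner (X r) (l2c L (\<lambda>x. deriv \<eta> x * \<zeta> (x + c * s))) = 0" if "r \<in> {0..T}" for r s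
    unfolding X_def
  proof (rule inner_l2c_zero_product[OF dx_u_L2[OF that] L2e])
    have "AE x in lebesgue_on {0<..<L}. x \<in> {p<..<q} \<longrightarrow> dx L (u r) x = 0"
      by (rule dx_zero_AE[OF u_H1[OF that] _ pq(1,3,2)]) (rule uz[OF that])
    then show "AE x in lebesgue_on {0<..<L}. dx L (u r) x * (deriv \<eta> x * \<zeta> (x + c * s)) = 0"
      by eventually_elim (use \<eta>pq in auto)
  qed
  have U0: "inner (U r) (l2c L (\<lambda>x. deriv \<eta> x * \<zeta> (x + c * s))) = 0" if "r \<in> {0..T}" for r s
    unfolding U_def
    by (rule inner_l2c_zero_product[OF u_L2[OF that] L2e], rule AE_I2) (use \<eta>pq uz that in fastforce)
  \<comment> \<open>Integration by parts in space; it is legitimate since the product of \<eta> and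
    the moving profile is a test function for the times considered.\<close>
  have XZ: "inner (X r) (Z s) = - inner (U r) (Z1 s)" if r: "r \<in> {0..T}" and s: "s \<in> {t1..t2}" for r s
  proof -
    have "L2_inner L (u r) (deriv (\<lambda>x. \<eta> x * \<zeta> (x + c * s))) = - L2_inner L (dx L (u r)) (\<lambda>x. \<eta> x * \<zeta> (x + c * s))"
      using dx_weak[OF u_H1[OF r]] test[OF s] by (simp add: is_weak_deriv_def)
    moreover have "deriv (\<lambda>x. \<eta> x * \<zeta> (x + c * s)) \<in> L2 {0<..<L}"
      by (intro smooth_L2 smooth_deriv smooth_mult \<eta> sh \<zeta>)
    ultimately have "inner (U r) (l2c L (deriv (\<lambda>x. \<eta> x * \<zeta> (x + c * s)))) = - inner (X r) (Z s)"
      unfolding U_def X_def Z_def using u_L2[OF r] dx_u_L2[OF r] L2Z by (simp add: inner_l2c)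
    then show ?thesis using U0[OF r] by (simp add: l2dphi inner_add_right)
  qed
  have FZ: "(\<lambda>r. inner (F r) (Z s)) integrable_on {t1..t2}" for s
    unfolding Z_def by (rule integrable_on_subinterval[OF inner_F_integrable[OF L2Z(1)] sub])
  have nF: "(\<lambda>r. norm (F r)) integrable_on {t1..t2}" by (rule integrable_on_subinterval[OF norm_F_integrable sub])
  have AZ: "(\<lambda>r. c * inner (A r) (Z1 s)) integrable_on {t1..t2}" for s
    by (intro integrable_continuous_interval continuous_on_mult continuous_on_inner continuous_on_const cA)
  have AZd: "(\<lambda>r. c * inner (A r) (Z1 r)) integrable_on {t1..t2}"
    by (intro integrable_continuous_interval continuous_on_mult continuous_on_inner continuous_on_const cA cZ1)
  show ?thesis
  proof (cases "t1 = t2")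
    case False
    then have t12: "t1 < t2" using t by simp
    have FZd: "(\<lambda>r. inner (F r) (Z r)) integrable_on {t1..t2}"
      by (rule inner_curve_integrable[OF cZ t12 FZ nF])
    obtain B where B: "B \<ge> 0" "\<And>s. s \<in> {t1..t2} \<Longrightarrow> norm (c *\<^sub>R Z1 s) \<le> B" "\<And>s. s \<in> {t1..t2} \<Longrightarrow> norm (c *\<^sub>R Z2 s) \<le> B" "\<And>s. s \<in> {t1..t2} \<Longrightarrow> norm (A s) \<le> B"
    proof -
      have "bounded ((\<lambda>s. c *\<^sub>R Z1 s) ` {t1..t2})" "bounded ((\<lambda>s. c *\<^sub>R Z2 s) ` {t1..t2})" "bounded (A ` {t1..t2})"
        by (intro compact_imp_bounded compact_continuous_image continuous_on_scaleR continuous_on_const cZ1 cZ2 cA compact_Icc)+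
      then obtain B1 B2 B3 where "\<forall>s\<in>{t1..t2}. norm (c *\<^sub>R Z1 s) \<le> B1" "\<forall>s\<in>{t1..t2}. norm (c *\<^sub>R Z2 s) \<le> B2" "\<forall>s\<in>{t1..t2}. norm (A s) \<le> B3"
        unfolding bounded_iff by (metis imageI)
      then show thesis by (intro that[of "max (max B1 B2) (max B3 0)"]) (auto simp: le_max_iff_disj)
    qed
    have lip: "norm (W s - W s') \<le> B * \<bar>s - s'\<bar>"
      if W: "\<And>s S. (W has_vector_derivative W' s) (at s within S)" "\<And>s. s \<in> {t1..t2} \<Longrightarrow> norm (W' s) \<le> B" and s: "s \<in> {t1..t2}" "s' \<in> {t1..t2}" for W W' :: "real \<Rightarrow> l2" and s s'
    proof -
      have *: "norm (W y - W x) \<le> B * (y - x)" if "x \<in> {t1..t2}" "y \<in> {t1..t2}" "x \<le> y" for x y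
        by (rule vector_mean_value_bound[OF W(1) W(2)]) (use that in auto)
      show ?thesis using *[of s s'] *[of s' s] s by (cases "s \<le> s'") (auto simp: norm_minus_commute)
    qed
    \<comment> \<open>At a fixed test function the equation gives <F, Z> - c <A, Z1>: the part with
      X uses \<gamma> = c^2, the part with V comes from moving the space derivative of U to the test
      function. Translation of the test function gives + c <A, Z1>. On the diagonal the two cancel
      and only the source remains.\<close>
    have "inner (A t2) (Z t2) - inner (A t1) (Z t1) = integral {t1..t2} (\<lambda>r. (inner (F r) (Z r) - c * inner (A r) (Z1 r)) + c * inner (A r) (Z1 r))"
    proof (rule diag_increment[where Q = "\<lambda>t s. inner (A t) (Z s)" and q = "\<lambda>r s. inner (F r) (Z s) - c * inner (A r) (Z1 s)"
          and d = "\<lambda>t s. c * inner (A t) (Z1 s)" and k = "\<lambda>r. norm (F r) * B + \<bar>c\<bar> * B * B"])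
      fix s r1 r2 assume s: "s \<in> {t1..t2}" and r: "t1 \<le> r1" "r1 \<le> r2" "r2 \<le> t2"
      have r': "0 \<le> r1" "r2 \<le> T" and subr: "{r1..r2} \<subseteq> {0..T}" "{r1..r2} \<subseteq> {t1..t2}" using r t by auto
      have i1: "(\<lambda>r. inner (F r) (Z s) - \<gamma> * inner (X r) (Z1 s)) integrable_on {r1..r2}"
        by (intro integrable_diff integrable_on_subinterval[OF FZ subr(2)] integrable_continuous_interval
            continuous_on_mult continuous_on_inner continuous_on_const continuous_on_subset[OF cX subr(2)])
      have i2: "(\<lambda>r. inner (V r) (Z1 s)) integrable_on {r1..r2}"
        by (intro integrable_continuous_interval continuous_on_inner continuous_on_const continuous_on_subset[OF cV subr(2)])
      have "inner (V r2) (Z s) - inner (V r1) (Z s) = integral {r1..r2} (\<lambda>r. inner (F r) (Z s) - \<gamma> * inner (X r) (l2c L (dx L (\<lambda>x. \<eta> x * \<zeta> (x + c * s)))))"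
        unfolding Z_def by (rule weak_increment[OF test_fun_H10[OF test[OF s]] r'(1) r(2) r'(2)])
      also have "\<dots> = integral {r1..r2} (\<lambda>r. inner (F r) (Z s) - \<gamma> * inner (X r) (Z1 s))"
        by (rule Henstock_Kurzweil_Integration.integral_cong) (use subr X0 in \<open>auto simp: dxphi inner_add_right\<close>)
      finally have v: "inner (V r2) (Z s) - inner (V r1) (Z s) = integral {r1..r2} (\<lambda>r. inner (F r) (Z s) - \<gamma> * inner (X r) (Z1 s))" .
      have "((\<lambda>r. inner (V r) (Z1 s)) has_integral inner (U r2) (Z1 s) - inner (U r1) (Z1 s)) {r1..r2}"
      proof (rule fundamental_theorem_of_calculus[OF r(2)])
        fix x assume x: "x \<in> {r1..r2}"
        have "(U has_vector_derivative V x) (at x within {r1..r2})"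
          using x subr by (intro has_vector_derivative_within_subset[OF U_deriv]) auto
        from bounded_linear.has_vector_derivative[OF bounded_linear_inner_left this]
        show "((\<lambda>r. inner (U r) (Z1 s)) has_vector_derivative inner (V x) (Z1 s)) (at x within {r1..r2})" .
      qed
      then have uu: "inner (U r2) (Z1 s) - inner (U r1) (Z1 s) = integral {r1..r2} (\<lambda>r. inner (V r) (Z1 s))"
        by (simp add: integral_unique)
      have "inner (A r2) (Z s) - inner (A r1) (Z s) = (inner (V r2) (Z s) - inner (V r1) (Z s)) - c * (inner (U r2) (Z1 s) - inner (U r1) (Z1 s))"
        using XZ[of r2 s] XZ[of r1 s] s subr r by (simp add: A_def inner_add_left algebra_simps)
      also have "\<dots> = integral {r1..r2} (\<lambda>r. (inner (F r) (Z s) - \<gamma> * inner (X r) (Z1 s)) - c * inner (V r) (Z1 s))"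
        unfolding v uu using Henstock_Kurzweil_Integration.integral_diff[OF i1 integrable_on_mult_right[OF i2]] by simp
      also have "\<dots> = integral {r1..r2} (\<lambda>r. inner (F r) (Z s) - c * inner (A r) (Z1 s))"
        by (rule arg_cong[of _ _ "integral {r1..r2}"]) (auto simp: A_def inner_add_left c[symmetric] power2_eq_square algebra_simps)
      finally show "inner (A r2) (Z s) - inner (A r1) (Z s) = integral {r1..r2} (\<lambda>r. inner (F r) (Z s) - c * inner (A r) (Z1 s))" .
    next
      show "(\<lambda>r. inner (F r) (Z s) - c * inner (A r) (Z1 s)) integrable_on {t1..t2}" for s
        by (rule integrable_diff[OF FZ AZ])
      show "(\<lambda>r. inner (F r) (Z r) - c * inner (A r) (Z1 r)) integrable_on {t1..t2}"
        by (rule integrable_diff[OF FZd AZd])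
      show "((\<lambda>s. inner (A t) (Z s)) has_real_derivative c * inner (A t) (Z1 s)) (at s within {t1..t2})" for t s
        using bounded_linear.has_vector_derivative[OF bounded_linear_inner_right Zd[of s "{t1..t2}"], of "A t"]
        by (simp add: has_real_derivative_iff_has_vector_derivative)
      show "continuous_on ({t1..t2} \<times> {t1..t2}) (\<lambda>(t, s). c * inner (A t) (Z1 s))"
        unfolding split_beta
        by (intro continuous_on_mult continuous_on_const continuous_on_inner continuous_on_compose2[OF cA] continuous_on_compose2[OF cZ1[of UNIV]])
          (auto intro!: continuous_intros)
      show "(\<lambda>r. norm (F r) * B + \<bar>c\<bar> * B * B) integrable_on {t1..t2}"
        by (intro integrable_add integrable_on_mult_left nF integrable_const_ivl)
      show "\<exists>\<delta>>0. \<forall>r s s'. r \<in> {t1..t2} \<and> s \<in> {t1..t2} \<and> s' \<in> {t1..t2} \<and> \<bar>s - s'\<bar> < \<delta> \<longrightarrow>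
          \<bar>inner (F r) (Z s) - c * inner (A r) (Z1 s) - (inner (F r) (Z s') - c * inner (A r) (Z1 s'))\<bar> \<le> (norm (F r) * B + \<bar>c\<bar> * B * B) * \<bar>s - s'\<bar> + e"
        if e: "0 < e" for e
      proof (intro exI[of _ 1] conjI allI impI)
        fix r s s' assume a: "r \<in> {t1..t2} \<and> s \<in> {t1..t2} \<and> s' \<in> {t1..t2} \<and> \<bar>s - s'\<bar> < 1"
        have "\<bar>inner (F r) (Z s - Z s')\<bar> \<le> norm (F r) * (B * \<bar>s - s'\<bar>)"
          using Cauchy_Schwarz_ineq2[of "F r" "Z s - Z s'"] mult_left_mono[OF lip[OF Zd B(2), of s s'], of "norm (F r)"] a by force
        moreover have "\<bar>c * inner (A r) (Z1 s - Z1 s')\<bar> \<le> \<bar>c\<bar> * (B * (B * \<bar>s - s'\<bar>))"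
        proof -
          have "\<bar>inner (A r) (Z1 s - Z1 s')\<bar> \<le> norm (A r) * norm (Z1 s - Z1 s')" by (rule Cauchy_Schwarz_ineq2)
          also have "\<dots> \<le> B * (B * \<bar>s - s'\<bar>)"
            using a B(1) B(4)[of r] lip[OF Z1d B(3), of s s'] by (intro mult_mono) auto
          finally show ?thesis by (simp add: abs_mult mult_left_mono)
        qed
        ultimately show "\<bar>inner (F r) (Z s) - c * inner (A r) (Z1 s) - (inner (F r) (Z s') - c * inner (A r) (Z1 s'))\<bar> \<le> (norm (F r) * B + \<bar>c\<bar> * B * B) * \<bar>s - s'\<bar> + e"
          using e by (simp add: inner_diff_right algebra_simps)
      qed simp
    qed (use t B in auto)
    then show ?thesis by (simp add: A_def Z_def)
  qed simp
qed

end

section \<open>Damping along rays and d'Alembert's formula\<close>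

lemma nn_integral_exp_decay:
  assumes "0 < \<mu>"
  shows "(\<integral>\<^sup>+s. indicator {0..} s * ennreal (exp (- \<mu> * s)) \<partial>lborel) = ennreal (1 / \<mu>)"
proof -
  have "(\<integral>\<^sup>+s. ennreal (exp (- \<mu> * s)) * indicator {0..} s \<partial>lborel) = ennreal (0 - (- exp (- \<mu> * 0) / \<mu>))"
  proof (rule nn_integral_FTC_atLeast[where F = "\<lambda>s. - exp (- \<mu> * s) / \<mu>"])
    show "((\<lambda>s. - exp (- \<mu> * s) / \<mu>) has_real_derivative exp (- \<mu> * x)) (at x)" for x
      using assms by (auto intro!: derivative_eq_intros)
    show "((\<lambda>s. - exp (- \<mu> * s) / \<mu>) \<longlongrightarrow> 0) at_top" using assms by real_asymp
  qed auto
  then show ?thesis by (simp add: mult.commute)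
qed

lemma nn_integral_lborel_shift:
  fixes f :: "'a::euclidean_space \<Rightarrow> ennreal"
  assumes [measurable]: "f \<in> borel_measurable borel"
  shows "(\<integral>\<^sup>+z. f (z + c) \<partial>lborel) = (\<integral>\<^sup>+z. f z \<partial>lborel)"
proof -
  have "(\<integral>\<^sup>+z. f z \<partial>lborel) = (\<integral>\<^sup>+z. f z \<partial>(distr lborel borel ((+) c)))" by (simp add: lborel_distr_plus)
  also have "\<dots> = (\<integral>\<^sup>+z. f (c + z) \<partial>lborel)" by (rule nn_integral_distr) measurable
  finally show ?thesis by (simp add: add.commute)
qed

text \<open>The inner integral is a convolution along \<open>v\<close> with a one-sided exponential
  of total mass 1 / \<mu>, so its norm on square integrable functions is at most 1 / \<mu>. The
  Cauchy-Schwarz inequality produces one factor 1 / \<mu>, Tonelli's theorem and translation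
  invariance the other. The space is left general because the bound serves in the plane along
  characteristics, on a line in space and on the time axis.\<close>

lemma exp_young:
  fixes H :: "'a::euclidean_space \<Rightarrow> ennreal"
  assumes H[measurable]: "H \<in> borel_measurable borel" and \<mu>: "0 < \<mu>"
  shows "(\<integral>\<^sup>+z. (\<integral>\<^sup>+s. indicator {0..} s * ennreal (exp (- \<mu> * s)) * H (z + s *\<^sub>R v) \<partial>lborel)\<^sup>2 \<partial>lborel)
    \<le> ennreal (1 / \<mu>\<^sup>2) * (\<integral>\<^sup>+z. (H z)\<^sup>2 \<partial>lborel)"
proof -
  define w where "w s = indicator {0..} s * ennreal (exp (- \<mu> * s))" for s
  \<comment> \<open>The square root of the kernel, so that one copy can be kept with H in the
    Cauchy-Schwarz inequality.\<close>
  define r where "r s = indicator {0..} s * ennreal (exp (- \<mu> * s / 2))" for s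
  have [measurable]: "w \<in> borel_measurable borel" "r \<in> borel_measurable borel"
    unfolding w_def[abs_def] r_def[abs_def] by measurable
  have rw: "r s * r s = w s" for s
    by (simp add: r_def w_def ennreal_mult[symmetric] exp_add[symmetric] split: split_indicator)
  have mH[measurable]: "(\<lambda>s. H (z + s *\<^sub>R v)) \<in> borel_measurable borel" for z by measurable
  have "(\<integral>\<^sup>+s. w s * H (z + s *\<^sub>R v) \<partial>lborel)\<^sup>2 \<le> ennreal (1 / \<mu>) * (\<integral>\<^sup>+s. w s * (H (z + s *\<^sub>R v))\<^sup>2 \<partial>lborel)" for z
  proof -
    have "(\<integral>\<^sup>+s. w s * H (z + s *\<^sub>R v) \<partial>lborel) = (\<integral>\<^sup>+s. r s * (r s * H (z + s *\<^sub>R v)) \<partial>lborel)"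
      by (simp add: rw[symmetric] mult.assoc)
    also have "\<dots>\<^sup>2 \<le> (\<integral>\<^sup>+s. (r s)\<^sup>2 \<partial>lborel) * (\<integral>\<^sup>+s. (r s * H (z + s *\<^sub>R v))\<^sup>2 \<partial>lborel)"
      by (rule Cauchy_Schwarz_nn_integral) measurable
    also have "(\<integral>\<^sup>+s. (r s)\<^sup>2 \<partial>lborel) = ennreal (1 / \<mu>)"
      unfolding power2_eq_square rw w_def by (rule nn_integral_exp_decay[OF \<mu>])
    also have "(\<lambda>s. (r s * H (z + s *\<^sub>R v))\<^sup>2) = (\<lambda>s. w s * (H (z + s *\<^sub>R v))\<^sup>2)"
      by (simp add: rw[symmetric] power2_eq_square mult_ac)
    finally show ?thesis .
  qed
  then have "(\<integral>\<^sup>+z. (\<integral>\<^sup>+s. w s * H (z + s *\<^sub>R v) \<partial>lborel)\<^sup>2 \<partial>lborel)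
      \<le> (\<integral>\<^sup>+z. ennreal (1 / \<mu>) * (\<integral>\<^sup>+s. w s * (H (z + s *\<^sub>R v))\<^sup>2 \<partial>lborel) \<partial>lborel)"
    by (intro nn_integral_mono) auto
  also have "\<dots> = ennreal (1 / \<mu>) * (\<integral>\<^sup>+z. (\<integral>\<^sup>+s. w s * (H (z + s *\<^sub>R v))\<^sup>2 \<partial>lborel) \<partial>lborel)"
    by (rule nn_integral_cmult) measurable
  also have "(\<integral>\<^sup>+z. (\<integral>\<^sup>+s. w s * (H (z + s *\<^sub>R v))\<^sup>2 \<partial>lborel) \<partial>lborel) = (\<integral>\<^sup>+s. (\<integral>\<^sup>+z. w s * (H (z + s *\<^sub>R v))\<^sup>2 \<partial>lborel) \<partial>lborel)"
    by (rule lborel_pair.Fubini') measurable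
  also have "\<dots> = (\<integral>\<^sup>+s. w s * (\<integral>\<^sup>+z. (H z)\<^sup>2 \<partial>lborel) \<partial>lborel)"
  proof (rule nn_integral_cong)
    fix s :: real
    have "(\<integral>\<^sup>+z. w s * (H (z + s *\<^sub>R v))\<^sup>2 \<partial>lborel) = w s * (\<integral>\<^sup>+z. (H (z + s *\<^sub>R v))\<^sup>2 \<partial>lborel)"
      by (rule nn_integral_cmult) measurable
    also have "(\<integral>\<^sup>+z. (H (z + s *\<^sub>R v))\<^sup>2 \<partial>lborel) = (\<integral>\<^sup>+z. (H z)\<^sup>2 \<partial>lborel)"
      by (rule nn_integral_lborel_shift[of "\<lambda>z. (H z)\<^sup>2"]) measurable
    finally show "(\<integral>\<^sup>+z. w s * (H (z + s *\<^sub>R v))\<^sup>2 \<partial>lborel) = w s * (\<integral>\<^sup>+z. (H z)\<^sup>2 \<partial>lborel)" .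
  qed
  also have "\<dots> = (\<integral>\<^sup>+s. w s \<partial>lborel) * (\<integral>\<^sup>+z. (H z)\<^sup>2 \<partial>lborel)"
    by (rule nn_integral_multc) measurable
  also have "(\<integral>\<^sup>+s. w s \<partial>lborel) = ennreal (1 / \<mu>)"
    unfolding w_def by (rule nn_integral_exp_decay[OF \<mu>])
  finally have "(\<integral>\<^sup>+z. (\<integral>\<^sup>+s. w s * H (z + s *\<^sub>R v) \<partial>lborel)\<^sup>2 \<partial>lborel) \<le> ennreal (1 / \<mu>) * (ennreal (1 / \<mu>) * (\<integral>\<^sup>+z. (H z)\<^sup>2 \<partial>lborel))" .
  also have "\<dots> = ennreal (1 / \<mu>\<^sup>2) * (\<integral>\<^sup>+z. (H z)\<^sup>2 \<partial>lborel)"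
    using \<mu> by (simp add: mult.assoc[symmetric] ennreal_mult[symmetric] power2_eq_square)
  finally show ?thesis unfolding w_def .
qed

lemma integrable_indicator_Icc: "integrable lborel (indicator {a..b::real} :: real \<Rightarrow> real)"
  by (rule integrable_real_indicator) (auto simp: emeasure_lborel_Icc_eq)

lemma lborel_integrable_shift:
  fixes f :: "real \<Rightarrow> real"
  assumes "integrable lborel f"
  shows "integrable lborel (\<lambda>x. f (x + c))" "(LINT x|lborel. f (x + c)) = (LINT x|lborel. f x)"
  using lborel_integrable_real_affine[OF assms, of 1 c] lborel_integral_real_affine[of 1 f c]
  by (simp_all add: add.commute)

context wave_component
begin

lemma G_section_integrable: "integrable lborel (\<lambda>x. G (t, x))"
proof (rule Bochner_Integration.integrable_bound)
  show "integrable lborel (\<lambda>x. indicator {0..L} x + (G (t, x))\<^sup>2)"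
    by (intro Bochner_Integration.integrable_add G_sec integrable_indicator_Icc)
  show "AE x in lborel. norm (G (t, x)) \<le> norm (indicator {0..L} x + (G (t, x))\<^sup>2)"
  proof (rule AE_I2)
    fix x
    have "\<bar>G (t, x)\<bar> \<le> 1 + (G (t, x))\<^sup>2" using sum_squares_bound[of "\<bar>G (t, x)\<bar>" 1] by simp
    then show "norm (G (t, x)) \<le> norm (indicator {0..L} x + (G (t, x))\<^sup>2)"
      using G_zero[of t x] by (cases "x \<in> {0..L}") auto
  qed
qed measurable

lemma G_norm_integrable: "integrable lborel (\<lambda>t. LINT x|lborel. \<bar>G (t, x)\<bar>)"
proof (rule Bochner_Integration.integrable_bound)
  show "integrable lborel (\<lambda>t. indicator {0..T} t * L + (LINT x|lborel. (G (t, x))\<^sup>2))"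
    by (intro Bochner_Integration.integrable_add G_L2 integrable_mult_left integrable_indicator_Icc)
  show "AE t in lborel. norm (LINT x|lborel. \<bar>G (t, x)\<bar>) \<le> norm (indicator {0..T} t * L + (LINT x|lborel. (G (t, x))\<^sup>2))"
  proof (rule AE_I2)
    fix t
    show "norm (LINT x|lborel. \<bar>G (t, x)\<bar>) \<le> norm (indicator {0..T} t * L + (LINT x|lborel. (G (t, x))\<^sup>2))"
    proof (cases "t \<in> {0..T}")
      case False
      then have "G (t, x) = 0" for x using G_zero[of t x] by auto
      then show ?thesis by simp
    next
      case True
      have "(LINT x|lborel. \<bar>G (t, x)\<bar>) \<le> (LINT x|lborel. indicator {0..L} x + (G (t, x))\<^sup>2)"
      proof (rule integral_mono)
        show "integrable lborel (\<lambda>x. indicator {0..L} x + (G (t, x))\<^sup>2)"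
          by (intro Bochner_Integration.integrable_add G_sec integrable_indicator_Icc)
        show "integrable lborel (\<lambda>x. \<bar>G (t, x)\<bar>)" using G_section_integrable by (rule integrable_abs)
        fix x
        have "\<bar>G (t, x)\<bar> \<le> 1 + (G (t, x))\<^sup>2" using sum_squares_bound[of "\<bar>G (t, x)\<bar>" 1] by simp
        then show "\<bar>G (t, x)\<bar> \<le> indicator {0..L} x + (G (t, x))\<^sup>2"
          using G_zero[of t x] by (cases "x \<in> {0..L}") auto
      qed
      also have "\<dots> = L + (LINT x|lborel. (G (t, x))\<^sup>2)"
        using L0 by (subst Bochner_Integration.integral_add[OF integrable_indicator_Icc G_sec]) simp
      finally show ?thesis using True by (simp add: integral_nonneg_AE)
    qed
  qed
  show "(\<lambda>t. LINT x|lborel. \<bar>G (t, x)\<bar>) \<in> borel_measurable lborel" by measurable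
qed

text \<open>The transport identity is tested with all \<zeta> and read back almost everywhere by
  \<open>FLCV\<close>. \<sigma> is the direction of time and S the time to cross (0, L). By the side
  condition the characteristic runs towards (p, q) and \<eta> vanishes on the far side, so the
  moving test function stays away from the boundary and is 0 after time S. Hence neither reflections
  nor values at the other end of the characteristic enter.\<close>

lemma char_formula:
  assumes c: "c\<^sup>2 = \<gamma>" and \<sigma>: "\<sigma> = 1 \<or> \<sigma> = - 1" and S: "S = L / \<bar>c\<bar>"
    and \<eta>: "smooth \<eta>" "\<And>x. \<bar>\<eta> x\<bar> \<le> 1" and pq: "0 < p" "p < q" "q < L" and \<eta>pq: "\<And>x. x \<notin> {p<..<q} \<Longrightarrow> deriv \<eta> x = 0"
    and uz: "\<And>t x. t \<in> {0..T} \<Longrightarrow> x \<in> {p<..<q} \<Longrightarrow> u t x = 0"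
    and side: "\<sigma> * c > 0 \<Longrightarrow> (\<forall>x\<le>p. \<eta> x = 0)" "\<sigma> * c < 0 \<Longrightarrow> (\<forall>x\<ge>q. \<eta> x = 0)"
    and t: "t \<in> {0..T}" "t + \<sigma> * S \<in> {0..T}"
  shows "AE x in lebesgue_on {0<..<L}. (dt L T u t x + c * dx L (u t) x) * \<eta> x =
    - \<sigma> * (LINT s|lborel. indicator {0<..<S} s * (G (t + \<sigma> * s, x - c * \<sigma> * s) * \<eta> (x - c * \<sigma> * s)))"
proof -
  have c0: "c \<noteq> 0" using c \<gamma>0 by auto
  have S0: "0 < S" using S c0 L0 by simp
  have \<sigma>c: "\<sigma> * c \<noteq> 0" using \<sigma> c0 by auto
  have [measurable]: "\<eta> \<in> borel_measurable borel" by (rule smooth_measurable[OF \<eta>(1)])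
  define K where "K x s = indicator {0<..<S} s * (G (t + \<sigma> * s, x - c * \<sigma> * s) * \<eta> (x - c * \<sigma> * s))" for x s
  have K_meas[measurable]: "case_prod K \<in> borel_measurable (lborel \<Otimes>\<^sub>M lborel)"
    unfolding K_def by measurable
  have Gs: "integrable lborel (\<lambda>x. G (t + \<sigma> * s, x - c * \<sigma> * s))" for s
    using lborel_integrable_shift(1)[OF G_section_integrable[of "t + \<sigma> * s"], of "- c * \<sigma> * s"] by simp
  have K_sec: "integrable lborel (\<lambda>x. K x s)" for s
  proof (rule Bochner_Integration.integrable_bound[OF Gs[of s]])
    show "(\<lambda>x. K x s) \<in> borel_measurable lborel" unfolding K_def by measurable
    show "AE x in lborel. norm (K x s) \<le> norm (G (t + \<sigma> * s, x - c * \<sigma> * s))"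
      using \<eta>(2) by (intro AE_I2) (auto simp: K_def abs_mult mult_left_le split: split_indicator)
  qed
  have K_int: "integrable (lborel \<Otimes>\<^sub>M lborel) (\<lambda>(s, x). K x s)"
  proof (rule lborel_pair.Fubini_integrable)
    show "(\<lambda>(s, x). K x s) \<in> borel_measurable (lborel \<Otimes>\<^sub>M lborel)"
      unfolding K_def by measurable
    have "integrable lborel (\<lambda>s. LINT x|lborel. \<bar>G (t + \<sigma> * s, x)\<bar>)"
      using lborel_integrable_real_affine[OF G_norm_integrable, of \<sigma> t] \<sigma> by auto
    then show "integrable lborel (\<lambda>s. LINT x|lborel. norm (case (s, x) of (s, x) \<Rightarrow> K x s))"
    proof (rule Bochner_Integration.integrable_bound)
      show "AE s in lborel. norm (LINT x|lborel. norm (case (s, x) of (s, x) \<Rightarrow> K x s)) \<le> norm (LINT x|lborel. \<bar>G (t + \<sigma> * s, x)\<bar>)"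
      proof (rule AE_I2)
        fix s
        have "(LINT x|lborel. \<bar>K x s\<bar>) \<le> (LINT x|lborel. \<bar>G (t + \<sigma> * s, x - c * \<sigma> * s)\<bar>)"
        proof (rule integral_mono)
          show "integrable lborel (\<lambda>x. \<bar>K x s\<bar>)" by (rule integrable_abs[OF K_sec])
          show "integrable lborel (\<lambda>x. \<bar>G (t + \<sigma> * s, x - c * \<sigma> * s)\<bar>)" by (rule integrable_abs[OF Gs])
          show "\<bar>K x s\<bar> \<le> \<bar>G (t + \<sigma> * s, x - c * \<sigma> * s)\<bar>" for x
            using \<eta>(2) by (auto simp: K_def abs_mult mult_left_le split: split_indicator)
        qed
        also have "\<dots> = (LINT x|lborel. \<bar>G (t + \<sigma> * s, x)\<bar>)"
          using lborel_integrable_shift(2)[OF integrable_abs[OF G_section_integrable[of "t + \<sigma> * s"]], of "- c * \<sigma> * s"] by simp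
        finally show "norm (LINT x|lborel. norm (case (s, x) of (s, x) \<Rightarrow> K x s)) \<le> norm (LINT x|lborel. \<bar>G (t + \<sigma> * s, x)\<bar>)"
          by (simp add: integral_nonneg_AE)
      qed
      show "(\<lambda>s. LINT x|lborel. norm (case (s, x) of (s, x) \<Rightarrow> K x s)) \<in> borel_measurable lborel"
        unfolding K_def by measurable
    qed
    show "AE s in lborel. integrable lborel (\<lambda>x. case (s, x) of (s, x) \<Rightarrow> K x s)"
      using K_sec by simp
  qed
  define A where "A x = (LINT s|lborel. K x s)" for x
  have A_int: "integrable lborel A"
    using lborel_pair.integrable_snd[OF K_int] by (simp add: A_def[abs_def])
  define a where "a x = dt L T u t x + c * dx L (u t) x" for x
  have aL2: "a \<in> L2 {0<..<L}" unfolding a_def using t by (intro L2_add L2_cmult dt_u_L2 dx_u_L2)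
  have a_l2: "l2c L a = V t + c *\<^sub>R X t"
    unfolding a_def[abs_def] V_def X_def using t by (simp add: l2c_add l2c_scaleR L2_cmult dt_u_L2 dx_u_L2)
  \<comment> \<open>The formula in dual form; Fubini's theorem moves the integral over s inside the
    pairing with \<zeta>.\<close>
  have key: "L2_inner L (\<lambda>x. \<eta> x * a x) \<zeta> = (LINT x|lborel. (- \<sigma> * A x) * \<zeta> x)" if \<zeta>: "test_fun 0 L \<zeta>" for \<zeta>
  proof -
    obtain \<alpha> \<beta> where \<alpha>\<beta>: "0 < \<alpha>" "\<alpha> \<le> \<beta>" "\<beta> < L" "\<And>x. x \<notin> {\<alpha>..\<beta>} \<Longrightarrow> \<zeta> x = 0"
      by (rule test_funE[OF \<zeta> L0]) (rule that)
    have s\<zeta>: "smooth \<zeta>" by (rule test_fun_smooth[OF \<zeta>])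
    have [measurable]: "\<zeta> \<in> borel_measurable borel" by (rule smooth_measurable[OF s\<zeta>])
    \<comment> \<open>A shift of \<zeta>, so that the profile moving with speed c is \<zeta> itself
      at time \<open>t\<close>.\<close>
    define \<zeta>' where "\<zeta>' x = \<zeta> (x - c * t)" for x
    have s\<zeta>': "smooth \<zeta>'" using smooth_affine[OF s\<zeta>, of 1 "- c * t"] by (simp add: \<zeta>'_def[abs_def])
    have \<zeta>'0: "\<zeta>' x = 0" if "x \<notin> {\<alpha> + c * t..\<beta> + c * t}" for x
      unfolding \<zeta>'_def by (rule \<alpha>\<beta>(4)) (use that in auto)
    have \<zeta>'_eq: "\<zeta>' (x + c * (t + \<sigma> * s)) = \<zeta> (x + c * \<sigma> * s)" for x s
      by (simp add: \<zeta>'_def algebra_simps)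
    have cS: "\<bar>c\<bar> * S = L" using S c0 by simp
    have test: "test_fun 0 L (\<lambda>x. \<eta> x * \<zeta> (x + c * \<sigma> * s))" if s: "s \<in> {0..S}" for s
    proof -
      have sm: "smooth (\<lambda>x. \<eta> x * \<zeta> (x + c * \<sigma> * s))"
        using smooth_mult[OF \<eta>(1) smooth_affine[OF s\<zeta>, of 1 "c * \<sigma> * s"]] by simp
      consider "\<sigma> * c > 0" | "\<sigma> * c < 0" using linorder_less_linear[of "\<sigma> * c" 0] \<sigma>c by blast
      then show ?thesis
      proof cases
        case 1
        then have nn: "0 \<le> c * \<sigma> * s" using s by (simp add: mult.commute)
        show ?thesis
        proof (rule test_funI[OF sm _ pq(1) \<alpha>\<beta>(3)])
          fix x assume "x \<notin> {p..\<beta>}"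
          then show "\<eta> x * \<zeta> (x + c * \<sigma> * s) = 0"
            using side(1)[OF 1] \<alpha>\<beta>(4)[of "x + c * \<sigma> * s"] nn by (cases "x \<le> p") auto
        qed
      next
        case 2
        then have nn: "c * \<sigma> * s \<le> 0" using s mult_nonpos_nonneg[of "\<sigma> * c" s] by (simp add: mult.commute)
        show ?thesis
        proof (rule test_funI[OF sm _ \<alpha>\<beta>(1) pq(3)])
          fix x assume "x \<notin> {\<alpha>..q}"
          then show "\<eta> x * \<zeta> (x + c * \<sigma> * s) = 0"
            using side(2)[OF 2] \<alpha>\<beta>(4)[of "x + c * \<sigma> * s"] nn by (cases "x \<ge> q") auto
        qed
      qed
    qed
    \<comment> \<open>After the crossing time the support of \<zeta> has moved by the whole length
      L, and inside (0, L) nothing of it is left on the side where \<eta> is nonzero.\<close>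
    have end0: "\<eta> x * \<zeta> (x + c * \<sigma> * S) = 0" for x
    proof -
      consider "\<sigma> * c > 0" | "\<sigma> * c < 0" using linorder_less_linear[of "\<sigma> * c" 0] \<sigma>c by blast
      then show ?thesis
      proof cases
        case 1
        then have "c * \<sigma> = \<bar>c\<bar>" using \<sigma> by auto
        then have "c * \<sigma> * S = L" using cS by simp
        then show ?thesis using side(1)[OF 1] \<alpha>\<beta> pq by (cases "x \<le> p") auto
      next
        case 2
        then have "c * \<sigma> = - \<bar>c\<bar>" using \<sigma> by auto
        then have "c * \<sigma> * S = - L" using cS by simp
        then show ?thesis using side(2)[OF 2] \<alpha>\<beta> pq by (cases "x \<ge> q") auto
      qed
    qed
    define \<Phi> where "\<Phi> s = inner (F (t + \<sigma> * s)) (l2c L (\<lambda>x. \<eta> x * \<zeta> (x + c * \<sigma> * s)))" for s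
    have l2\<eta>\<zeta>: "(\<lambda>x. \<eta> x * \<zeta> (x + c * \<sigma> * s)) \<in> L2 {0<..<L}" for s
      using smooth_L2[OF smooth_mult[OF \<eta>(1) smooth_affine[OF s\<zeta>, of 1 "c * \<sigma> * s"]]] by simp
    have \<Phi>_eq: "indicator {0<..<S} s * \<Phi> s = (LINT x|lborel. K x s * \<zeta> x)" for s
    proof (cases "s \<in> {0<..<S}")
      case True
      have [measurable]: "(\<lambda>x. \<eta> x * \<zeta> (x + c * \<sigma> * s)) \<in> borel_measurable borel" by measurable
      have "\<Phi> s = L2_inner L (\<lambda>x. G (t + \<sigma> * s, x)) (\<lambda>x. \<eta> x * \<zeta> (x + c * \<sigma> * s))"
        unfolding \<Phi>_def F_def by (rule inner_l2c[OF G_section_L2 l2\<eta>\<zeta>])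
      also have "\<dots> = (LINT x|lborel. G (t + \<sigma> * s, x) * (\<eta> x * \<zeta> (x + c * \<sigma> * s)))"
        by (rule L2_inner_borel) (auto intro: G_zero)
      also have "\<dots> = (LINT x|lborel. G (t + \<sigma> * s, x - c * \<sigma> * s) * (\<eta> (x - c * \<sigma> * s) * \<zeta> x))"
        using lborel_integral_real_affine[of 1 "\<lambda>x. G (t + \<sigma> * s, x) * (\<eta> x * \<zeta> (x + c * \<sigma> * s))" "- c * \<sigma> * s"] by (simp add: add.commute)
      finally show ?thesis using True by (simp add: K_def mult.assoc)
    qed (simp add: K_def)
    have iK: "integrable (lborel \<Otimes>\<^sub>M lborel) (\<lambda>(s, x). K x s * \<zeta> x)"
    proof -
      have "bounded (\<zeta> ` {\<alpha>..\<beta>})"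
        by (intro compact_imp_bounded compact_continuous_image smooth_continuous_on s\<zeta>) auto
      then obtain B0 where B0: "\<And>x. x \<in> {\<alpha>..\<beta>} \<Longrightarrow> \<bar>\<zeta> x\<bar> \<le> B0" unfolding bounded_iff real_norm_def by blast
      have B: "\<bar>\<zeta> x\<bar> \<le> max B0 0" for x using B0[of x] \<alpha>\<beta>(4)[of x] by (cases "x \<in> {\<alpha>..\<beta>}") auto
      show ?thesis
      proof (rule Bochner_Integration.integrable_bound[OF integrable_mult_right[OF K_int, of "max B0 0"]])
        show "(\<lambda>(s, x). K x s * \<zeta> x) \<in> borel_measurable (lborel \<Otimes>\<^sub>M lborel)" unfolding K_def by measurable
        show "AE z in lborel \<Otimes>\<^sub>M lborel. norm (case z of (s, x) \<Rightarrow> K x s * \<zeta> x) \<le> norm (max B0 0 * (case z of (s, x) \<Rightarrow> K x s))"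
          using B by (intro AE_I2) (auto simp: abs_mult mult.commute intro!: mult_right_mono)
      qed
    qed
    have "inner (V t + c *\<^sub>R X t) (l2c L (\<lambda>x. \<eta> x * \<zeta> x)) = - \<sigma> * integral {0..S} \<Phi>"
    proof -
      define t1 t2 where "t1 = min t (t + \<sigma> * S)" and "t2 = max t (t + \<sigma> * S)"
      have t12: "0 \<le> t1" "t1 \<le> t2" "t2 \<le> T" using t by (auto simp: t1_def t2_def)
      have rep: "\<exists>s\<in>{0..S}. r = t + \<sigma> * s" if "r \<in> {t1..t2}" for r
        using that \<sigma> S0 by (intro bexI[of _ "\<sigma> * (r - t)"]) (auto simp: t1_def t2_def min_def max_def split: if_splits)
      have inc: "inner (V t2 + c *\<^sub>R X t2) (l2c L (\<lambda>x. \<eta> x * \<zeta>' (x + c * t2))) - inner (V t1 + c *\<^sub>R X t1) (l2c L (\<lambda>x. \<eta> x * \<zeta>' (x + c * t1)))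
          = integral {t1..t2} (\<lambda>r. inner (F r) (l2c L (\<lambda>x. \<eta> x * \<zeta>' (x + c * r))))"
      proof (rule char_increment[OF c \<eta>(1) s\<zeta>' \<zeta>'0 _ pq(2) _ \<eta>pq uz t12])
        fix s assume "s \<in> {t1..t2}"
        then obtain s' where s': "s' \<in> {0..S}" "s = t + \<sigma> * s'" using rep by blast
        show "test_fun 0 L (\<lambda>x. \<eta> x * \<zeta>' (x + c * s))"
          unfolding s'(2) \<zeta>'_eq by (rule test[OF s'(1)])
      qed (use pq in auto)
      have att: "l2c L (\<lambda>x. \<eta> x * \<zeta>' (x + c * t)) = l2c L (\<lambda>x. \<eta> x * \<zeta> x)"
        using \<zeta>'_eq[of _ 0] by simp
      have atS: "l2c L (\<lambda>x. \<eta> x * \<zeta>' (x + c * (t + \<sigma> * S))) = 0"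
        unfolding \<zeta>'_eq end0 using l2c_scaleR[of "\<lambda>x. 0" L 0] L2_zero[of "{0<..<L}"] by simp
      have \<Phi>': "inner (F (t + \<sigma> * s)) (l2c L (\<lambda>x. \<eta> x * \<zeta>' (x + c * (t + \<sigma> * s)))) = \<Phi> s" for s
        unfolding \<zeta>'_eq \<Phi>_def ..
      from \<sigma> show ?thesis
      proof
        assume \<sigma>1: "\<sigma> = 1"
        then have tt: "t1 = t" "t2 = t + S" using S0 by (auto simp: t1_def t2_def)
        have "integral {t..t + S} (\<lambda>r. inner (F r) (l2c L (\<lambda>x. \<eta> x * \<zeta>' (x + c * r)))) = integral {0..S} \<Phi>"
          using integral_shift_Icc_real[of 0 S "\<lambda>r. inner (F r) (l2c L (\<lambda>x. \<eta> x * \<zeta>' (x + c * r)))" t] \<Phi>' \<sigma>1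
          by (simp add: o_def add.commute)
        then show ?thesis using inc atS att unfolding tt by (simp add: \<sigma>1)
      next
        assume \<sigma>1: "\<sigma> = - 1"
        then have tt: "t1 = t - S" "t2 = t" using S0 by (auto simp: t1_def t2_def)
        have "integral {t - S..t} (\<lambda>r. inner (F r) (l2c L (\<lambda>x. \<eta> x * \<zeta>' (x + c * r)))) = integral {- S..0} (\<lambda>s. inner (F (t + s)) (l2c L (\<lambda>x. \<eta> x * \<zeta>' (x + c * (t + s)))))"
          using integral_shift_Icc_real[of "- S" 0 "\<lambda>r. inner (F r) (l2c L (\<lambda>x. \<eta> x * \<zeta>' (x + c * r)))" t]
          by (simp add: o_def)
        also have "\<dots> = integral {0..S} (\<lambda>s. inner (F (t + - s)) (l2c L (\<lambda>x. \<eta> x * \<zeta>' (x + c * (t + - s)))))"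
          using Henstock_Kurzweil_Integration.integral_reflect_real[of S 0 "\<lambda>s. inner (F (t + - s)) (l2c L (\<lambda>x. \<eta> x * \<zeta>' (x + c * (t + - s))))"] by simp
        also have "\<dots> = integral {0..S} \<Phi>" using \<Phi>' \<sigma>1 by simp
        finally show ?thesis using inc atS att unfolding tt by (simp add: \<sigma>1)
      qed
    qed
    moreover have "integral {0..S} \<Phi> = (LINT s|lborel. indicator {0<..<S} s * \<Phi> s)"
    proof -
      have 1: "integrable lborel (\<lambda>s. indicator {0<..<S} s * \<Phi> s)"
        unfolding \<Phi>_eq using lborel_pair.integrable_fst[OF iK] by simp
      have "((\<lambda>s. indicator {0<..<S} s * \<Phi> s) has_integral (LINT s|lborel. indicator {0<..<S} s * \<Phi> s)) UNIV"
        by (rule has_integral_integral_lborel[OF 1])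
      then have "((\<lambda>s. if s \<in> {0<..<S} then \<Phi> s else 0) has_integral (LINT s|lborel. indicator {0<..<S} s * \<Phi> s)) UNIV"
        by (rule has_integral_eq[rotated]) (auto split: split_indicator)
      then have "(\<Phi> has_integral (LINT s|lborel. indicator {0<..<S} s * \<Phi> s)) {0<..<S}"
        by (simp only: has_integral_restrict_UNIV)
      then have "integral {0<..<S} \<Phi> = (LINT s|lborel. indicator {0<..<S} s * \<Phi> s)" by (rule integral_unique)
      then have 2: "integral {0..S} \<Phi> = (LINT s|lborel. indicator {0<..<S} s * \<Phi> s)"
        by (simp add: integral_open_interval_real)
      show ?thesis by (rule 2)
    qed
    moreover have "(LINT s|lborel. indicator {0<..<S} s * \<Phi> s) = (LINT x|lborel. A x * \<zeta> x)"
    proof -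
      have "(LINT s|lborel. indicator {0<..<S} s * \<Phi> s) = (LINT s|lborel. LINT x|lborel. K x s * \<zeta> x)"
        unfolding \<Phi>_eq ..
      also have "\<dots> = (LINT x|lborel. LINT s|lborel. K x s * \<zeta> x)"
        using lborel_pair.Fubini_integral[of "\<lambda>s x. K x s * \<zeta> x"] iK by simp
      also have "\<dots> = (LINT x|lborel. A x * \<zeta> x)" by (simp add: A_def)
      finally show ?thesis .
    qed
    moreover have "inner (V t + c *\<^sub>R X t) (l2c L (\<lambda>x. \<eta> x * \<zeta> x)) = L2_inner L (\<lambda>x. \<eta> x * a x) \<zeta>"
    proof -
      have "(\<lambda>x. \<eta> x * \<zeta> x) \<in> L2 {0<..<L}" by (intro smooth_L2 smooth_mult \<eta> s\<zeta>)
      then show ?thesis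
        unfolding a_l2[symmetric] by (subst inner_l2c[OF aL2]) (auto simp: L2_inner_move)
    qed
    ultimately show ?thesis by (simp add: mult.assoc)
  qed
  have \<eta>a: "(\<lambda>x. \<eta> x * a x) \<in> L2 {0<..<L}" by (intro smooth_mult_L2 \<eta> aL2)
  have i1: "integrable lebesgue (zext L (\<lambda>x. \<eta> x * a x))"
    unfolding integrable_zext using L2_mult_integrable[OF \<eta>a continuous_L2[of L "\<lambda>x. 1"]] by simp
  have i2: "integrable lebesgue (\<lambda>x. - \<sigma> * A x)"
    using A_int by (subst integrable_completion) auto
  have "AE x in lebesgue. x \<in> {0<..<L} \<longrightarrow> zext L (\<lambda>x. \<eta> x * a x) x - (- \<sigma> * A x) = 0"
  proof (rule FLCV)
    show "integrable lebesgue (\<lambda>x. zext L (\<lambda>x. \<eta> x * a x) x - (- \<sigma> * A x))"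
      by (rule Bochner_Integration.integrable_diff[OF i1 i2])
    fix \<zeta> assume \<zeta>: "test_fun 0 L \<zeta>"
    have s\<zeta>: "smooth \<zeta>" by (rule test_fun_smooth[OF \<zeta>])
    have [measurable]: "\<zeta> \<in> borel_measurable borel" by (rule smooth_measurable[OF s\<zeta>])
    have z: "zext L (\<lambda>x. \<eta> x * a x) x * \<zeta> x = zext L (\<lambda>x. (\<eta> x * a x) * \<zeta> x) x" for x by (simp add: zext_def)
    have j1: "integrable lebesgue (\<lambda>x. zext L (\<lambda>x. \<eta> x * a x) x * \<zeta> x)"
      unfolding z integrable_zext by (rule L2_mult_integrable[OF \<eta>a smooth_L2[OF s\<zeta>]])
    obtain B where B: "\<And>x. \<bar>\<zeta> x\<bar> \<le> B"
    proof -
      obtain B0 where "\<forall>x\<in>{0..L}. \<bar>\<zeta> x\<bar> \<le> B0" "B0 \<ge> 0" using smooth_bounded[OF s\<zeta>] by blast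
      then show thesis using test_fun_outside[OF \<zeta>] by (intro that[of B0]) (metis abs_zero atLeastAtMost_iff greaterThanLessThan_iff less_eq_real_def)
    qed
    have jl: "integrable lborel (\<lambda>x. (- \<sigma> * A x) * \<zeta> x)"
    proof (rule Bochner_Integration.integrable_bound[OF integrable_mult_right[OF A_int, of B]])
      show "(\<lambda>x. - \<sigma> * A x * \<zeta> x) \<in> borel_measurable lborel"
        using borel_measurable_integrable[OF A_int] by measurable
      show "AE x in lborel. norm (- \<sigma> * A x * \<zeta> x) \<le> norm (B * A x)"
      proof (rule AE_I2)
        fix x
        have "\<bar>\<sigma>\<bar> = 1" using \<sigma> by auto
        then have "norm (- \<sigma> * A x * \<zeta> x) = \<bar>\<zeta> x\<bar> * \<bar>A x\<bar>" by (simp add: abs_mult)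
        also have "\<dots> \<le> B * \<bar>A x\<bar>" using B by (intro mult_right_mono) auto
        also have "\<dots> \<le> norm (B * A x)" by (simp add: abs_mult mult_right_mono)
        finally show "norm (- \<sigma> * A x * \<zeta> x) \<le> norm (B * A x)" .
      qed
    qed
    then have mj: "(\<lambda>x. (- \<sigma> * A x) * \<zeta> x) \<in> borel_measurable borel" using borel_measurable_integrable by auto
    have j2: "integrable lebesgue (\<lambda>x. (- \<sigma> * A x) * \<zeta> x)"
      using jl mj by (subst integrable_completion) simp_all
    have "(LINT x|lebesgue. zext L (\<lambda>x. \<eta> x * a x) x * \<zeta> x) = L2_inner L (\<lambda>x. \<eta> x * a x) \<zeta>"
      unfolding z integral_zext L2_inner_def ..
    also have "\<dots> = (LINT x|lborel. (- \<sigma> * A x) * \<zeta> x)" by (rule key[OF \<zeta>])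
    also have "\<dots> = (LINT x|lebesgue. (- \<sigma> * A x) * \<zeta> x)" using mj by (subst integral_completion) simp_all
    finally show "(LINT x|lebesgue. (zext L (\<lambda>x. \<eta> x * a x) x - (- \<sigma> * A x)) * \<zeta> x) = 0"
      unfolding left_diff_distrib by (subst Bochner_Integration.integral_diff[OF j1 j2]) simp
  qed
  then show ?thesis
    unfolding AE_zext
    by eventually_elim (auto simp: zext_def a_def A_def K_def mult.commute)
qed

end

subsection \<open>Carleman estimate along characteristics\<close>

definition psi :: "real \<Rightarrow> real \<Rightarrow> real \<Rightarrow> real \<times> real \<Rightarrow> real" where
  "psi x0 \<kappa> t0 z = (snd z - x0)\<^sup>2 + \<kappa> * (fst z - t0)\<^sup>2"

lemma psi_measurable[measurable]: "psi x0 \<kappa> t0 \<in> borel_measurable borel"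
  unfolding psi_def[abs_def] by (intro borel_measurable_continuous_onI continuous_intros)

lemma nn_integral_lborel_pair:
  fixes f :: "real \<times> real \<Rightarrow> ennreal"
  assumes [measurable]: "f \<in> borel_measurable borel"
  shows "(\<integral>\<^sup>+t. (\<integral>\<^sup>+x. f (t, x) \<partial>lborel) \<partial>lborel) = (\<integral>\<^sup>+z. f z \<partial>lborel)"
proof -
  have "(\<integral>\<^sup>+z. f z \<partial>lborel) = (\<integral>\<^sup>+z. f z \<partial>(lborel \<Otimes>\<^sub>M lborel))" by (simp add: lborel_prod)
  also have "\<dots> = (\<integral>\<^sup>+t. (\<integral>\<^sup>+x. f (t, x) \<partial>lborel) \<partial>lborel)"
    by (rule lborel.nn_integral_fst[symmetric]) (simp add: lborel_prod)
  finally show ?thesis ..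
qed

lemma ennreal_norm_integral_le:
  fixes f :: "'a \<Rightarrow> real"
  shows "ennreal \<bar>integral\<^sup>L N f\<bar> \<le> (\<integral>\<^sup>+x. ennreal \<bar>f x\<bar> \<partial>N)"
proof (cases "integrable N f")
  case True then show ?thesis using integral_norm_bound_ennreal[OF True] by simp
qed (simp add: not_integrable_integral_eq)

lemma half_sum_le:
  fixes e a b p1 p2 q1 q2 :: real
  assumes "e = (a + b) / 2" "a \<le> 2 * (p1 + p2)" "b \<le> 2 * (q1 + q2)"
  shows "e \<le> p1 + q1 + p2 + q2"
  using add_mono[OF assms(2,3)] unfolding assms(1) by simp

text \<open>The inequalities tie the weight to the geometry. \<open>\<kappa>\<delta>\<close> limits
  the growth of the temporal part of \<psi> to half the decay of its spatial part along a
  characteristic. \<open>\<kappa>M\<close> places {\<psi> < M} in the middle half of the time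
  interval, and \<open>TL\<close> makes a characteristic cross (0, L) within a quarter of it.
  Together they keep every characteristic that starts in D inside [0, T], forwards and
  backwards.\<close>

locale wave_vanish = wave_component +
  fixes x0 \<delta> \<kappa> M :: real
  assumes \<delta>0: "0 < \<delta>" and x0: "0 < x0 - \<delta>" "x0 + \<delta> < L"
    and uz: "\<And>t x. t \<in> {0..T} \<Longrightarrow> x \<in> {x0 - \<delta><..<x0 + \<delta>} \<Longrightarrow> u t x = 0"
    and Gz: "\<And>t x. x \<in> {x0 - \<delta><..<x0 + \<delta>} \<Longrightarrow> G (t, x) = 0"
    and \<kappa>0: "0 < \<kappa>" and \<kappa>\<delta>: "\<kappa> * T \<le> \<delta> * sqrt \<gamma>" and \<kappa>M: "M \<le> \<kappa> * (T / 4)\<^sup>2" and TL: "L / sqrt \<gamma> \<le> T / 4"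
begin

definition "\<psi> = psi x0 \<kappa> (T / 2)"
definition "D = {z::real \<times> real. snd z \<in> {0<..<L} \<and> \<psi> z < M}"
definition "m lam z = exp (- lam * \<psi> z)"
definition "En lam t = (\<integral>\<^sup>+x. indicator D (t, x) * ennreal ((m lam (t, x))\<^sup>2 * ((dt L T u t x)\<^sup>2 + \<gamma> * (dx L (u t) x)\<^sup>2)) \<partial>lebesgue)"
definition "Zn lam t = (\<integral>\<^sup>+x. indicator D (t, x) * ennreal ((m lam (t, x))\<^sup>2 * (u t x)\<^sup>2) \<partial>lebesgue)"

lemma \<psi>_measurable[measurable]: "\<psi> \<in> borel_measurable borel"
  unfolding \<psi>_def by measurable

lemma D_measurable[measurable]: "D \<in> sets borel"
proof -
  have "open D"
    unfolding D_def \<psi>_def psi_def greaterThanLessThan_iff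
    by (intro open_Collect_conj open_Collect_less continuous_intros)
  then show ?thesis by (rule borel_open)
qed

lemma m_measurable[measurable]: "m lam \<in> borel_measurable borel"
  unfolding m_def[abs_def] by measurable

lemma D_time:
  assumes "(t, x) \<in> D" shows "t \<in> {T / 4..3 * T / 4}"
proof -
  have "(x - x0)\<^sup>2 + \<kappa> * (t - T / 2)\<^sup>2 < M" using assms by (simp add: D_def \<psi>_def psi_def)
  then have "\<kappa> * (t - T / 2)\<^sup>2 < \<kappa> * (T / 4)\<^sup>2"
    using \<kappa>M zero_le_power2[of "x - x0"] by linarith
  then have "(t - T / 2)\<^sup>2 < (T / 4)\<^sup>2" using \<kappa>0 by simp
  then have "\<bar>t - T / 2\<bar> < \<bar>T / 4\<bar>" using abs_le_square_iff[of "T / 4" "t - T / 2"] by linarith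
  then have "\<bar>t - T / 2\<bar> < T / 4" using T0 by simp
  then show ?thesis unfolding abs_less_iff by auto
qed

text \<open>What becomes of d'Alembert's integral from z along the ray \<open>v\<close> once the
  weight at z is traded for the weight along the ray times an exponential decay.\<close>

definition "Y lam v z = (\<integral>\<^sup>+s. indicator {0..} s * ennreal (exp (- (lam * \<delta> * sqrt \<gamma>) * s)) *
    (indicator D (z + s *\<^sub>R v) * ennreal (m lam (z + s *\<^sub>R v) * \<bar>G (z + s *\<^sub>R v)\<bar>)) \<partial>lborel)"

lemma Y_measurable[measurable]: "Y lam v \<in> borel_measurable borel"
proof -
  have "(\<lambda>z. \<integral>\<^sup>+s. indicator {0..} s * ennreal (exp (- (lam * \<delta> * sqrt \<gamma>) * s)) *
    (indicator D (z + s *\<^sub>R v) * ennreal (m lam (z + s *\<^sub>R v) * \<bar>G (z + s *\<^sub>R v)\<bar>)) \<partial>lborel) \<in> borel_measurable borel"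
    by measurable
  then show ?thesis by (simp add: Y_def[abs_def])
qed

lemma Y_bound:
  assumes "0 < lam"
  shows "(\<integral>\<^sup>+t. (\<integral>\<^sup>+x. (Y lam v (t, x))\<^sup>2 \<partial>lborel) \<partial>lborel)
    \<le> ennreal (1 / (lam * \<delta> * sqrt \<gamma>)\<^sup>2) * (\<integral>\<^sup>+z. indicator D z * ennreal ((m lam z)\<^sup>2 * (G z)\<^sup>2) \<partial>lborel)"
proof -
  have \<mu>: "0 < lam * \<delta> * sqrt \<gamma>" using assms \<delta>0 \<gamma>0 by simp
  have "(\<integral>\<^sup>+t. (\<integral>\<^sup>+x. (Y lam v (t, x))\<^sup>2 \<partial>lborel) \<partial>lborel) = (\<integral>\<^sup>+z. (Y lam v z)\<^sup>2 \<partial>lborel)"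
    by (rule nn_integral_lborel_pair) measurable
  also have "\<dots> \<le> ennreal (1 / (lam * \<delta> * sqrt \<gamma>)\<^sup>2) * (\<integral>\<^sup>+z. (indicator D z * ennreal (m lam z * \<bar>G z\<bar>))\<^sup>2 \<partial>lborel)"
    unfolding Y_def by (rule exp_young[OF _ \<mu>]) measurable
  also have "(\<lambda>z. (indicator D z * ennreal (m lam z * \<bar>G z\<bar>))\<^sup>2) = (\<lambda>z. indicator D z * ennreal ((m lam z)\<^sup>2 * (G z)\<^sup>2))"
    by (rule ext) (auto simp: m_def ennreal_power[symmetric] ennreal_power power_mult_distrib split: split_indicator)
  finally show ?thesis .
qed

text \<open>A point with nonzero source lies inside the rectangle and at distance at least \<delta>
  from x0; the side condition says on which side. On the way there the spatial part of \<psi> drops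
  by at least 2 \<delta> sqrt \<gamma> s, while the temporal part grows by at most \<kappa> T s,
  which is at most \<delta> sqrt \<gamma> s. As \<psi> decreases, the point stays in D.\<close>

lemma weight_decay:
  assumes c: "c\<^sup>2 = \<gamma>" and \<sigma>: "\<sigma> = 1 \<or> \<sigma> = - 1" and z: "(t, x) \<in> D" and s: "0 \<le> s"
    and G: "G (t + \<sigma> * s, x - c * \<sigma> * s) \<noteq> 0"
    and side: "\<sigma> * c > 0 \<Longrightarrow> x0 - \<delta> < x - c * \<sigma> * s" "\<sigma> * c < 0 \<Longrightarrow> x - c * \<sigma> * s < x0 + \<delta>"
  shows "\<psi> (t + \<sigma> * s, x - c * \<sigma> * s) \<le> \<psi> (t, x) - \<delta> * sqrt \<gamma> * s" "(t + \<sigma> * s, x - c * \<sigma> * s) \<in> D"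
proof -
  define x' where "x' = x - c * \<sigma> * s"
  define t' where "t' = t + \<sigma> * s"
  have ac: "\<bar>c\<bar> = sqrt \<gamma>" using c by (metis real_sqrt_abs)
  have c0: "c \<noteq> 0" using c \<gamma>0 by auto
  have G': "G (t', x') \<noteq> 0" using G by (simp add: x'_def t'_def)
  have x'L: "x' \<in> {0<..<L}" and t'T: "t' \<in> {0<..<T}" using G' G_zero by blast+
  have nd: "x' \<notin> {x0 - \<delta><..<x0 + \<delta>}" using G' Gz by blast
  have tT: "t \<in> {0..T}" using D_time[OF z] T0 by auto
  have xx: "c * \<sigma> * s * (x' - x0) \<ge> sqrt \<gamma> * s * \<delta>"
  proof -
    consider "\<sigma> * c > 0" | "\<sigma> * c < 0" using linorder_less_linear[of "\<sigma> * c" 0] \<sigma> c0 by auto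
    then show ?thesis
    proof cases
      case 1
      then have e: "c * \<sigma> = sqrt \<gamma>" using \<sigma> ac by auto
      have "x' - x0 \<ge> \<delta>" using side(1)[OF 1] nd by (auto simp: x'_def)
      then show ?thesis unfolding e using s \<gamma>0 by (intro mult_left_mono) auto
    next
      case 2
      then have e: "c * \<sigma> = - sqrt \<gamma>" using \<sigma> ac by auto
      have "x0 - x' \<ge> \<delta>" using side(2)[OF 2] nd by (auto simp: x'_def)
      then have "sqrt \<gamma> * s * \<delta> \<le> sqrt \<gamma> * s * (x0 - x')" using s \<gamma>0 by (intro mult_left_mono) auto
      then show ?thesis unfolding e by (simp add: algebra_simps)
    qed
  qed
  have 1: "(x - x0)\<^sup>2 - (x' - x0)\<^sup>2 \<ge> 2 * (sqrt \<gamma> * s * \<delta>)"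
  proof -
    have "(x - x0)\<^sup>2 - (x' - x0)\<^sup>2 = 2 * (c * \<sigma> * s * (x' - x0)) + (c * \<sigma> * s)\<^sup>2"
      by (simp add: x'_def power2_eq_square algebra_simps)
    then show ?thesis using xx zero_le_power2[of "c * \<sigma> * s"] by linarith
  qed
  have 2: "\<kappa> * (t - T / 2)\<^sup>2 - \<kappa> * (t' - T / 2)\<^sup>2 \<ge> - (\<delta> * sqrt \<gamma> * s)"
  proof -
    have e: "\<kappa> * (t - T / 2)\<^sup>2 - \<kappa> * (t' - T / 2)\<^sup>2 = - (\<kappa> * s) * (\<sigma> * (t + t' - T))"
      by (simp add: t'_def power2_eq_square algebra_simps)
    have "\<sigma> * (t + t' - T) \<le> T" using \<sigma> tT t'T by auto
    then have "(\<kappa> * s) * (\<sigma> * (t + t' - T)) \<le> (\<kappa> * s) * T" using \<kappa>0 s by (intro mult_left_mono) auto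
    also have "\<dots> \<le> \<delta> * sqrt \<gamma> * s" using mult_right_mono[OF \<kappa>\<delta> s] by (simp add: mult_ac)
    finally show ?thesis using e by simp
  qed
  have "\<psi> (t', x') \<le> \<psi> (t, x) - \<delta> * sqrt \<gamma> * s"
    using 1 2 by (simp add: \<psi>_def psi_def algebra_simps)
  then show A: "\<psi> (t + \<sigma> * s, x - c * \<sigma> * s) \<le> \<psi> (t, x) - \<delta> * sqrt \<gamma> * s" by (simp add: t'_def x'_def)
  have "0 \<le> \<delta> * sqrt \<gamma> * s" using \<delta>0 \<gamma>0 s by simp
  then have "\<psi> (t', x') < M" using A z by (simp add: D_def t'_def x'_def)
  then show "(t + \<sigma> * s, x - c * \<sigma> * s) \<in> D" using x'L by (simp add: D_def t'_def x'_def)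
qed

text \<open>Multiplied by the weight at its starting point, d'Alembert's integral is dominated by an
  integral with the weight at the running point and a kernel decaying at rate lam \<delta> sqrt
  \<gamma>. This is the form to which \<open>exp_young\<close> applies.\<close>

lemma char_weighted:
  assumes lam: "0 < lam" and c: "c\<^sup>2 = \<gamma>" and \<sigma>: "\<sigma> = 1 \<or> \<sigma> = - 1"
    and \<eta>: "smooth \<eta>" "\<And>x. \<bar>\<eta> x\<bar> \<le> 1" and \<eta>pq: "\<And>x. x \<notin> {x0 - \<delta><..<x0 + \<delta>} \<Longrightarrow> deriv \<eta> x = 0"
    and side: "\<sigma> * c > 0 \<Longrightarrow> (\<forall>x\<le>x0 - \<delta>. \<eta> x = 0)" "\<sigma> * c < 0 \<Longrightarrow> (\<forall>x\<ge>x0 + \<delta>. \<eta> x = 0)"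
    and t: "t \<in> {T / 4..3 * T / 4}"
  shows "AE x in lebesgue. (t, x) \<in> D \<longrightarrow> ennreal (m lam (t, x) * \<bar>(dt L T u t x + c * dx L (u t) x) * \<eta> x\<bar>) \<le> Y lam (\<sigma>, - c * \<sigma>) (t, x)"
proof -
  have ac: "\<bar>c\<bar> = sqrt \<gamma>" using c by (metis real_sqrt_abs)
  have S4: "L / \<bar>c\<bar> \<le> T / 4" using TL ac by simp
  have S0: "0 \<le> L / \<bar>c\<bar>" using L0 by simp
  have tS: "t + \<sigma> * S \<in> {0..T}" if "S \<le> T / 4" "0 \<le> S" for S
    using t T0 \<sigma> that by auto
  have t1: "t \<in> {0..T}" "t + \<sigma> * (L / \<bar>c\<bar>) \<in> {0..T}" using t T0 tS[OF S4 S0] by simp_all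
  have "AE x in lebesgue_on {0<..<L}. (dt L T u t x + c * dx L (u t) x) * \<eta> x =
    - \<sigma> * (LINT s|lborel. indicator {0<..<L / \<bar>c\<bar>} s * (G (t + \<sigma> * s, x - c * \<sigma> * s) * \<eta> (x - c * \<sigma> * s)))"
    by (rule char_formula[OF c \<sigma> refl \<eta> _ _ _ \<eta>pq uz side t1]) (use \<delta>0 x0 in auto)
  then have "AE x in lebesgue. x \<in> {0<..<L} \<longrightarrow> (dt L T u t x + c * dx L (u t) x) * \<eta> x =
    - \<sigma> * (LINT s|lborel. indicator {0<..<L / \<bar>c\<bar>} s * (G (t + \<sigma> * s, x - c * \<sigma> * s) * \<eta> (x - c * \<sigma> * s)))"
    by (simp only: AE_zext)
  then show ?thesis
  proof eventually_elim
    case (elim x)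
    show ?case
    proof
      assume D: "(t, x) \<in> D"
      let ?z = "\<lambda>s. (t + \<sigma> * s, x - c * \<sigma> * s)"
      let ?K = "\<lambda>s. indicator {0<..<L / \<bar>c\<bar>} s * (G (?z s) * \<eta> (x - c * \<sigma> * s))"
      have "x \<in> {0<..<L}" using D by (simp add: D_def)
      with elim have "\<bar>(dt L T u t x + c * dx L (u t) x) * \<eta> x\<bar> = \<bar>LINT s|lborel. ?K s\<bar>" using \<sigma> by auto
      then have "ennreal (m lam (t, x) * \<bar>(dt L T u t x + c * dx L (u t) x) * \<eta> x\<bar>) = ennreal (m lam (t, x)) * ennreal \<bar>LINT s|lborel. ?K s\<bar>"
        by (simp add: ennreal_mult m_def)
      also have "\<dots> \<le> ennreal (m lam (t, x)) * (\<integral>\<^sup>+s. ennreal \<bar>?K s\<bar> \<partial>lborel)"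
        by (intro mult_left_mono ennreal_norm_integral_le) auto
      also have "\<dots> = (\<integral>\<^sup>+s. ennreal (m lam (t, x)) * ennreal \<bar>?K s\<bar> \<partial>lborel)"
      proof (rule nn_integral_cmult[symmetric])
        have [measurable]: "\<eta> \<in> borel_measurable borel" by (rule smooth_measurable[OF \<eta>(1)])
        show "(\<lambda>s. ennreal \<bar>?K s\<bar>) \<in> borel_measurable lborel" by measurable
      qed
      also have "\<dots> \<le> Y lam (\<sigma>, - c * \<sigma>) (t, x)"
        unfolding Y_def
      proof (rule nn_integral_mono)
        fix s
        have zz: "(t, x) + s *\<^sub>R (\<sigma>, - c * \<sigma>) = ?z s" by (simp add: mult_ac)
        show "ennreal (m lam (t, x)) * ennreal \<bar>?K s\<bar> \<le> indicator {0..} s * ennreal (exp (- (lam * \<delta> * sqrt \<gamma>) * s)) *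
          (indicator D ((t, x) + s *\<^sub>R (\<sigma>, - c * \<sigma>)) * ennreal (m lam ((t, x) + s *\<^sub>R (\<sigma>, - c * \<sigma>)) * \<bar>G ((t, x) + s *\<^sub>R (\<sigma>, - c * \<sigma>))\<bar>))"
          unfolding zz
        proof (cases "?K s = 0")
          case False
          \<comment> \<open>A nonzero integrand supplies all that \<open>weight_decay\<close> needs:
            a nonzero source, and a nonzero cutoff, which puts the point on the required
            side.\<close>
          then have s: "0 \<le> s" and Gn: "G (?z s) \<noteq> 0" and \<eta>n: "\<eta> (x - c * \<sigma> * s) \<noteq> 0" by (auto split: split_indicator_asm)
          have sd: "\<sigma> * c > 0 \<Longrightarrow> x0 - \<delta> < x - c * \<sigma> * s" "\<sigma> * c < 0 \<Longrightarrow> x - c * \<sigma> * s < x0 + \<delta>"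
            using side \<eta>n by (meson not_le)+
          note w = weight_decay[OF c \<sigma> D s Gn sd]
          have "m lam (t, x) \<le> exp (- (lam * \<delta> * sqrt \<gamma>) * s) * m lam (?z s)"
          proof -
            have "lam * \<psi> (?z s) \<le> lam * (\<psi> (t, x) - \<delta> * sqrt \<gamma> * s)" using w(1) lam by (intro mult_left_mono) auto
            then show ?thesis by (simp add: m_def exp_add[symmetric] algebra_simps)
          qed
          moreover have "\<bar>?K s\<bar> \<le> \<bar>G (?z s)\<bar>" using \<eta>(2)[of "x - c * \<sigma> * s"]
            by (auto simp: abs_mult mult_left_le split: split_indicator)
          ultimately have "m lam (t, x) * \<bar>?K s\<bar> \<le> (exp (- (lam * \<delta> * sqrt \<gamma>) * s) * m lam (?z s)) * \<bar>G (?z s)\<bar>"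
            by (intro mult_mono) (auto simp: m_def)
          then have "ennreal (m lam (t, x) * \<bar>?K s\<bar>) \<le> ennreal (exp (- (lam * \<delta> * sqrt \<gamma>) * s) * (m lam (?z s) * \<bar>G (?z s)\<bar>))"
            by (intro ennreal_leI) (simp add: mult.assoc)
          then show "ennreal (m lam (t, x)) * ennreal \<bar>?K s\<bar> \<le> indicator {0..} s * ennreal (exp (- (lam * \<delta> * sqrt \<gamma>) * s)) *
            (indicator D (?z s) * ennreal (m lam (?z s) * \<bar>G (?z s)\<bar>))"
            using s w(2) by (simp add: ennreal_mult[symmetric] m_def)
        next
          case True
          show "ennreal (m lam (t, x)) * ennreal \<bar>?K s\<bar> \<le> indicator {0..} s * ennreal (exp (- (lam * \<delta> * sqrt \<gamma>) * s)) *
            (indicator D (?z s) * ennreal (m lam (?z s) * \<bar>G (?z s)\<bar>))"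
            unfolding True by simp
        qed
      qed
      finally show "ennreal (m lam (t, x) * \<bar>(dt L T u t x + c * dx L (u t) x) * \<eta> x\<bar>) \<le> Y lam (\<sigma>, - c * \<sigma>) (t, x)" .
    qed
  qed
qed

lemma cutoff_exists:
  "\<exists>\<eta>. smooth \<eta> \<and> (\<forall>x. 0 \<le> \<eta> x \<and> \<eta> x \<le> 1) \<and> (\<forall>x\<le>x0 - \<delta>. \<eta> x = 0) \<and> (\<forall>x\<ge>x0 + \<delta>. \<eta> x = 1) \<and> (\<forall>x. x \<notin> {x0 - \<delta><..<x0 + \<delta>} \<longrightarrow> deriv \<eta> x = 0)"
proof -
  define \<eta> where "\<eta> x = sstep ((x - (x0 - \<delta>)) / (2 * \<delta>))" for x
  have "1 / (2 * \<delta>) * x + (- (x0 - \<delta>) / (2 * \<delta>)) = (x - (x0 - \<delta>)) / (2 * \<delta>)" for x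
    by (simp only: times_divide_eq_left mult_1 add_divide_distrib[symmetric] diff_conv_add_uminus)
  then have sm: "smooth \<eta>"
    using smooth_affine[OF sstep(1), of "1 / (2 * \<delta>)" "- (x0 - \<delta>) / (2 * \<delta>)"]
    unfolding \<eta>_def[abs_def] by (simp only:)
  have 0: "\<eta> x = 0" if "x \<le> x0 - \<delta>" for x unfolding \<eta>_def using that \<delta>0 by (intro sstep(2)) (simp add: divide_le_0_iff)
  have 1: "\<eta> x = 1" if "x \<ge> x0 + \<delta>" for x unfolding \<eta>_def using that \<delta>0 by (intro sstep(3)) (simp add: le_divide_eq)
  have b: "0 \<le> \<eta> x \<and> \<eta> x \<le> 1" for x by (simp add: \<eta>_def sstep)
  \<comment> \<open>The claim includes the two transition points, near which the cutoff need not be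
    constant; there it attains its minimum 0 or its maximum 1.\<close>
  have d: "deriv \<eta> x = 0" if xx: "x \<notin> {x0 - \<delta><..<x0 + \<delta>}" for x
  proof -
    have "(\<eta> has_real_derivative deriv \<eta> x) (at x)" by (rule smooth_DERIV[OF sm])
    consider "x \<le> x0 - \<delta>" | "x \<ge> x0 + \<delta>" using xx by fastforce
    then show ?thesis
    proof cases
      case 1
      show ?thesis
        by (rule DERIV_local_min[OF smooth_DERIV[OF sm], of 1]) (use 0[OF 1] b in auto)
    next
      case 2
      show ?thesis
        by (rule DERIV_local_max[OF smooth_DERIV[OF sm], of 1]) (use 1[OF 2] b in auto)
    qed
  qed
  show ?thesis using sm 0 1 b d by blast
qed

text \<open>Both Riemann invariants are traced separately on each side of the vanishing interval,
  which gives four rays and the factor 4. The Borel function B stands in for \<open>En lam\<close>,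
  whose measurability in time is not established; a measurable majorant is all that integration
  requires.\<close>

lemma En_bound:
  assumes lam: "0 < lam"
  shows "\<exists>B. B \<in> borel_measurable borel \<and> (\<forall>t. En lam t \<le> B t) \<and>
    (\<integral>\<^sup>+t. B t \<partial>lborel) \<le> ennreal (4 / (lam * \<delta> * sqrt \<gamma>)\<^sup>2) * (\<integral>\<^sup>+z. indicator D z * ennreal ((m lam z)\<^sup>2 * (G z)\<^sup>2) \<partial>lborel)"
proof -
  let ?c = "sqrt \<gamma>"
  have c: "?c\<^sup>2 = \<gamma>" "(- ?c)\<^sup>2 = \<gamma>" and cp: "0 < ?c" using \<gamma>0 by auto
  obtain \<eta> where \<eta>: "smooth \<eta>" "\<And>x. 0 \<le> \<eta> x \<and> \<eta> x \<le> 1" "\<And>x. x \<le> x0 - \<delta> \<Longrightarrow> \<eta> x = 0" "\<And>x. x \<ge> x0 + \<delta> \<Longrightarrow> \<eta> x = 1"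
      "\<And>x. x \<notin> {x0 - \<delta><..<x0 + \<delta>} \<Longrightarrow> deriv \<eta> x = 0" using cutoff_exists by blast
  define \<eta>' where "\<eta>' x = 1 - \<eta> x" for x
  have \<eta>': "smooth \<eta>'" unfolding \<eta>'_def[abs_def] by (intro smooth_diff smooth_const \<eta>)
  have \<eta>d': "deriv \<eta>' x = 0" if "x \<notin> {x0 - \<delta><..<x0 + \<delta>}" for x
  proof -
    have "(\<eta>' has_real_derivative 0 - deriv \<eta> x) (at x)"
      unfolding \<eta>'_def[abs_def] by (intro DERIV_diff DERIV_const smooth_DERIV \<eta>)
    then show ?thesis using \<eta>(5)[OF that] by (simp add: DERIV_imp_deriv)
  qed
  have ab: "\<bar>\<eta> x\<bar> \<le> 1" "\<bar>\<eta>' x\<bar> \<le> 1" for x using \<eta>(2)[of x] by (auto simp: \<eta>'_def)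
  \<comment> \<open>On either side the ray points towards the interval, so one invariant is followed
    forwards and the other backwards in time. The cutoff \<eta> selects the right side, 1 - \<eta>
    the left one.\<close>
  let ?Y = "\<lambda>z. (Y lam (1, - ?c) z)\<^sup>2 + (Y lam (- 1, - ?c) z)\<^sup>2 + (Y lam (- 1, ?c) z)\<^sup>2 + (Y lam (1, ?c) z)\<^sup>2"
  have pt: "En lam t \<le> (\<integral>\<^sup>+x. ?Y (t, x) \<partial>lborel)" for t
  proof (cases "t \<in> {T / 4..3 * T / 4}")
    case False
    then have "indicator D (t, x) = (0::ennreal)" for x using D_time by (auto simp: indicator_def)
    then have "En lam t = 0" by (simp add: En_def)
    then show ?thesis by simp
  next
    case t: True
    have 1: "AE x in lebesgue. (t, x) \<in> D \<longrightarrow> ennreal (m lam (t, x) * \<bar>(dt L T u t x + ?c * dx L (u t) x) * \<eta> x\<bar>) \<le> Y lam (1, - ?c) (t, x)"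
      using char_weighted[OF lam c(1) _ \<eta>(1) ab(1) \<eta>(5) _ _ t, of 1] \<eta>(3) cp by simp
    have 2: "AE x in lebesgue. (t, x) \<in> D \<longrightarrow> ennreal (m lam (t, x) * \<bar>(dt L T u t x + (- ?c) * dx L (u t) x) * \<eta> x\<bar>) \<le> Y lam (- 1, - ?c) (t, x)"
      using char_weighted[OF lam c(2) _ \<eta>(1) ab(1) \<eta>(5) _ _ t, of "- 1"] \<eta>(3) cp by simp
    have 3: "AE x in lebesgue. (t, x) \<in> D \<longrightarrow> ennreal (m lam (t, x) * \<bar>(dt L T u t x + ?c * dx L (u t) x) * \<eta>' x\<bar>) \<le> Y lam (- 1, ?c) (t, x)"
      using char_weighted[OF lam c(1) _ \<eta>' ab(2) \<eta>d' _ _ t, of "- 1"] \<eta>(4) cp by (simp add: \<eta>'_def)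
    have 4: "AE x in lebesgue. (t, x) \<in> D \<longrightarrow> ennreal (m lam (t, x) * \<bar>(dt L T u t x + (- ?c) * dx L (u t) x) * \<eta>' x\<bar>) \<le> Y lam (1, ?c) (t, x)"
      using char_weighted[OF lam c(2) _ \<eta>' ab(2) \<eta>d' _ _ t, of 1] \<eta>(4) cp by (simp add: \<eta>'_def)
    have "AE x in lebesgue. indicator D (t, x) * ennreal ((m lam (t, x))\<^sup>2 * ((dt L T u t x)\<^sup>2 + \<gamma> * (dx L (u t) x)\<^sup>2)) \<le> ?Y (t, x)"
      using 1 2 3 4
    proof eventually_elim
      case (elim x)
      show ?case
      proof (cases "(t, x) \<in> D")
        case True
        let ?a = "dt L T u t x + ?c * dx L (u t) x" and ?b = "dt L T u t x + (- ?c) * dx L (u t) x"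
        have sq: "(p + q)\<^sup>2 \<le> 2 * (p\<^sup>2 + q\<^sup>2)" for p q :: real
          using sum_squares_bound[of p q] by (simp add: power2_sum)
        have "(dt L T u t x)\<^sup>2 + \<gamma> * (dx L (u t) x)\<^sup>2 = (?a\<^sup>2 + ?b\<^sup>2) / 2"
          using \<gamma>0 by (simp add: power2_eq_square algebra_simps)
        moreover have "?a\<^sup>2 \<le> 2 * ((?a * \<eta> x)\<^sup>2 + (?a * \<eta>' x)\<^sup>2)" using sq[of "?a * \<eta> x" "?a * \<eta>' x"] by (simp add: \<eta>'_def algebra_simps)
        moreover have "?b\<^sup>2 \<le> 2 * ((?b * \<eta> x)\<^sup>2 + (?b * \<eta>' x)\<^sup>2)" using sq[of "?b * \<eta> x" "?b * \<eta>' x"] by (simp add: \<eta>'_def algebra_simps)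
        ultimately have "(dt L T u t x)\<^sup>2 + \<gamma> * (dx L (u t) x)\<^sup>2 \<le> (?a * \<eta> x)\<^sup>2 + (?b * \<eta> x)\<^sup>2 + (?a * \<eta>' x)\<^sup>2 + (?b * \<eta>' x)\<^sup>2"
          by (rule half_sum_le)
        then have "(m lam (t, x))\<^sup>2 * ((dt L T u t x)\<^sup>2 + \<gamma> * (dx L (u t) x)\<^sup>2) \<le> (m lam (t, x))\<^sup>2 * ((?a * \<eta> x)\<^sup>2 + (?b * \<eta> x)\<^sup>2 + (?a * \<eta>' x)\<^sup>2 + (?b * \<eta>' x)\<^sup>2)"
          by (intro mult_left_mono) auto
        also have "\<dots> = (m lam (t, x) * \<bar>?a * \<eta> x\<bar>)\<^sup>2 + (m lam (t, x) * \<bar>?b * \<eta> x\<bar>)\<^sup>2 + (m lam (t, x) * \<bar>?a * \<eta>' x\<bar>)\<^sup>2 + (m lam (t, x) * \<bar>?b * \<eta>' x\<bar>)\<^sup>2"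
          by (simp add: power_mult_distrib distrib_left)
        finally have le: "(m lam (t, x))\<^sup>2 * ((dt L T u t x)\<^sup>2 + \<gamma> * (dx L (u t) x)\<^sup>2) \<le> \<dots>" .
        have "ennreal ((m lam (t, x))\<^sup>2 * ((dt L T u t x)\<^sup>2 + \<gamma> * (dx L (u t) x)\<^sup>2))
           \<le> (ennreal (m lam (t, x) * \<bar>?a * \<eta> x\<bar>))\<^sup>2 + (ennreal (m lam (t, x) * \<bar>?b * \<eta> x\<bar>))\<^sup>2 + (ennreal (m lam (t, x) * \<bar>?a * \<eta>' x\<bar>))\<^sup>2 + (ennreal (m lam (t, x) * \<bar>?b * \<eta>' x\<bar>))\<^sup>2"
          using ennreal_leI[OF le] by (simp add: ennreal_power m_def)
        also have "\<dots> \<le> ?Y (t, x)"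
          using elim True by (intro add_mono power_mono) auto
        finally show ?thesis using True by simp
      qed simp
    qed
    then have "En lam t \<le> (\<integral>\<^sup>+x. ?Y (t, x) \<partial>lebesgue)"
      unfolding En_def by (rule nn_integral_mono_AE)
    also have "\<dots> = (\<integral>\<^sup>+x. ?Y (t, x) \<partial>lborel)"
      by (rule nn_integral_completion)
    finally show ?thesis .
  qed
  have mY: "(\<lambda>x. (Y lam v (t, x))\<^sup>2) \<in> borel_measurable lborel" "(\<lambda>t. \<integral>\<^sup>+x. (Y lam v (t, x))\<^sup>2 \<partial>lborel) \<in> borel_measurable lborel" for v t
    by measurable
  have "(\<integral>\<^sup>+t. (\<integral>\<^sup>+x. ?Y (t, x) \<partial>lborel) \<partial>lborel) = (\<integral>\<^sup>+t. (\<integral>\<^sup>+x. (Y lam (1, - ?c) (t, x))\<^sup>2 \<partial>lborel) \<partial>lborel) + (\<integral>\<^sup>+t. (\<integral>\<^sup>+x. (Y lam (- 1, - ?c) (t, x))\<^sup>2 \<partial>lborel) \<partial>lborel)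
     + (\<integral>\<^sup>+t. (\<integral>\<^sup>+x. (Y lam (- 1, ?c) (t, x))\<^sup>2 \<partial>lborel) \<partial>lborel) + (\<integral>\<^sup>+t. (\<integral>\<^sup>+x. (Y lam (1, ?c) (t, x))\<^sup>2 \<partial>lborel) \<partial>lborel)"
    by (simp add: nn_integral_add mY borel_measurable_add)
  also have "\<dots> \<le> (let B = ennreal (1 / (lam * \<delta> * sqrt \<gamma>)\<^sup>2) * (\<integral>\<^sup>+z. indicator D z * ennreal ((m lam z)\<^sup>2 * (G z)\<^sup>2) \<partial>lborel) in B + B + B + B)"
    unfolding Let_def by (intro add_mono Y_bound lam)
  also have "\<dots> = ennreal (4 / (lam * \<delta> * sqrt \<gamma>)\<^sup>2) * (\<integral>\<^sup>+z. indicator D z * ennreal ((m lam z)\<^sup>2 * (G z)\<^sup>2) \<partial>lborel)"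
  proof -
    have "ennreal k + ennreal k + ennreal k + ennreal k = ennreal (4 * k)" if "0 \<le> k" for k
      using that by (simp add: ennreal_plus[symmetric] del: ennreal_plus)
    from this[of "1 / (lam * \<delta> * sqrt \<gamma>)\<^sup>2"] show ?thesis
      by (simp add: Let_def distrib_right[symmetric])
  qed
  finally have "(\<integral>\<^sup>+t. (\<integral>\<^sup>+x. ?Y (t, x) \<partial>lborel) \<partial>lborel)
    \<le> ennreal (4 / (lam * \<delta> * sqrt \<gamma>)\<^sup>2) * (\<integral>\<^sup>+z. indicator D z * ennreal ((m lam z)\<^sup>2 * (G z)\<^sup>2) \<partial>lborel)" .
  moreover have "(\<lambda>t. \<integral>\<^sup>+x. ?Y (t, x) \<partial>lborel) \<in> borel_measurable borel" by measurable
  ultimately show ?thesis using pt by (intro exI[of _ "\<lambda>t. \<integral>\<^sup>+x. ?Y (t, x) \<partial>lborel"]) blast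
qed

text \<open>A weighted Poincare inequality at fixed time: \<open>u\<close> is the integral of its
  space derivative from x0, where it vanishes. The derivative is 0 within distance \<delta> of x0,
  so the weight gains exp (- 2 lam \<delta> s) on the way, and \<open>exp_young\<close> on the line
  yields 1 / (2 lam \<delta>)^2. The factor 1 / lam^2 pays for derivatives that fall on the
  weight.\<close>

lemma Zn_bound:
  assumes lam: "0 < lam" and t: "t \<in> {0..T}"
  shows "Zn lam t \<le> ennreal (1 / (4 * lam\<^sup>2 * \<delta>\<^sup>2 * \<gamma>)) * En lam t"
proof -
  obtain g0 where g0: "g0 \<in> borel_measurable borel" "\<And>x. x \<notin> {0<..<L} \<Longrightarrow> g0 x = 0"
    "AE x in lebesgue_on {0<..<L}. dx L (u t) x = g0 x"
    using borel_version[OF dx_u_L2[OF t]] by metis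
  define N where "N = {x0 - \<delta><..<x0 + \<delta>}"
  define g where "g x = g0 x * indicator (- N) x" for x
  have [measurable]: "g \<in> borel_measurable borel" using g0(1) unfolding g_def N_def by measurable
  have z: "AE x in lebesgue_on {0<..<L}. x \<in> N \<longrightarrow> dx L (u t) x = 0"
    unfolding N_def by (rule dx_zero_AE[OF u_H1[OF t] uz[OF t]]) (use \<delta>0 x0 in auto)
  have gAE: "AE x in lebesgue_on {0<..<L}. dx L (u t) x = g x"
    using g0(3) z by eventually_elim (auto simp: g_def split: split_indicator)
  then have gAE': "AE x in lebesgue. x \<in> {0<..<L} \<longrightarrow> dx L (u t) x = g x" by (simp only: AE_zext)
  have gN: "g x = 0" if "x \<in> N" for x using that by (simp add: g_def)
  have H10: "u t \<in> H10 L" by (rule C0_H10_H10[OF u0 t])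
  have cu: "continuous_on {0..L} (u t)" using H10 by (simp add: H10_def)
  have ux0: "u t x0 = 0" by (rule uz[OF t]) (use \<delta>0 in auto)
  \<comment> \<open>Restricted to one side of x0, selected by the sign \<open>sg\<close>. The
    contributions of both sides then add up to a single copy of the energy; at x0 itself
    \<open>g\<close> is 0.\<close>
  define H where "H sg y = indicator D (t, y) * indicator {y. 0 \<le> sg * (y - x0)} y * ennreal (m lam (t, y) * \<bar>g y\<bar>)" for sg y :: real
  have Hm[measurable]: "H sg \<in> borel_measurable borel" for sg unfolding H_def by measurable
  have \<mu>: "0 < 2 * lam * \<delta>" using lam \<delta>0 by simp
  define Z where "Z sg x = (\<integral>\<^sup>+s. indicator {0..} s * ennreal (exp (- (2 * lam * \<delta>) * s)) * H sg (x + s *\<^sub>R (- sg)) \<partial>lborel)" for sg x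
  have Zm[measurable]: "Z sg \<in> borel_measurable borel" for sg unfolding Z_def by measurable
  \<comment> \<open>\<open>s\<close> is the distance travelled from x towards x0, for either
    sign.\<close>
  have absu: "ennreal \<bar>u t x\<bar> \<le> (\<integral>\<^sup>+s. indicator {0..sg * (x - x0)} s * ennreal \<bar>g (x - sg * s)\<bar> \<partial>lborel)"
    if x: "x \<in> {0<..<L}" and sg: "sg = 1 \<or> sg = - 1" and sx: "0 \<le> sg * (x - x0)" for x sg
  proof -
    define a b where "a = min x x0" and "b = max x x0"
    have ab: "0 \<le> a" "a \<le> b" "b \<le> L" "0 < a" "b < L" using x x0 \<delta>0 by (auto simp: a_def b_def)
    have "\<bar>u t x\<bar> = \<bar>u t b - u t a\<bar>" using ux0 by (auto simp: a_def b_def min_def max_def)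
    also have "u t b - u t a = integral {a..b} (dx L (u t))"
      by (rule weak_deriv_FTC[OF dx_weak[OF u_H1[OF t]] cu ab(1-3) L0])
    also have "\<dots> = (LINT y|lebesgue. indicator {a..b} y * dx L (u t) y)"
    proof -
      have "dx L (u t) absolutely_integrable_on {0..L}" by (rule L2_absolutely_integrable1[OF dx_u_L2[OF t]])
      then have "dx L (u t) absolutely_integrable_on {a..b}"
        by (rule absolutely_integrable_on_subinterval) (use ab in auto)
      from set_lebesgue_integral_eq_integral(2)[OF this] show ?thesis by (simp add: set_lebesgue_integral_def)
    qed
    finally have "ennreal \<bar>u t x\<bar> \<le> (\<integral>\<^sup>+y. ennreal \<bar>indicator {a..b} y * dx L (u t) y\<bar> \<partial>lebesgue)"
      by (simp add: ennreal_norm_integral_le)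
    also have "\<dots> = (\<integral>\<^sup>+y. indicator {a..b} y * ennreal \<bar>g y\<bar> \<partial>lebesgue)"
      by (rule nn_integral_cong_AE, use gAE' in eventually_elim) (use ab in \<open>auto split: split_indicator\<close>)
    also have "\<dots> = (\<integral>\<^sup>+y. indicator {a..b} y * ennreal \<bar>g y\<bar> \<partial>lborel)" by (rule nn_integral_completion)
    also have "\<dots> = \<bar>- sg\<bar> * (\<integral>\<^sup>+s. indicator {a..b} (x + (- sg) * s) * ennreal \<bar>g (x + (- sg) * s)\<bar> \<partial>lborel)"
      by (rule nn_integral_real_affine) (use sg in auto)
    also have "\<dots> = (\<integral>\<^sup>+s. indicator {a..b} (x + (- sg) * s) * ennreal \<bar>g (x + (- sg) * s)\<bar> \<partial>lborel)"
      using sg by auto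
    also have "\<dots> = (\<integral>\<^sup>+s. indicator {0..sg * (x - x0)} s * ennreal \<bar>g (x - sg * s)\<bar> \<partial>lborel)"
    proof (rule nn_integral_cong)
      fix s
      have "x + (- sg) * s \<in> {a..b} \<longleftrightarrow> s \<in> {0..sg * (x - x0)}"
        using sg sx by (auto simp: a_def b_def)
      then show "indicator {a..b} (x + (- sg) * s) * ennreal \<bar>g (x + (- sg) * s)\<bar> = indicator {0..sg * (x - x0)} s * ennreal \<bar>g (x - sg * s)\<bar>"
        by (simp add: indicator_def)
    qed
    finally show ?thesis .
  qed
  have pt: "ennreal (m lam (t, x) * \<bar>u t x\<bar>) \<le> Z sg x"
    if D: "(t, x) \<in> D" and sg: "sg = 1 \<or> sg = - 1" and sx: "0 \<le> sg * (x - x0)" for x sg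
  proof -
    have x: "x \<in> {0<..<L}" using D by (simp add: D_def)
    have "ennreal (m lam (t, x) * \<bar>u t x\<bar>) = ennreal (m lam (t, x)) * ennreal \<bar>u t x\<bar>" by (simp add: ennreal_mult m_def)
    also have "\<dots> \<le> ennreal (m lam (t, x)) * (\<integral>\<^sup>+s. indicator {0..sg * (x - x0)} s * ennreal \<bar>g (x - sg * s)\<bar> \<partial>lborel)"
      by (intro mult_left_mono absu[OF x sg sx]) auto
    also have "\<dots> = (\<integral>\<^sup>+s. ennreal (m lam (t, x)) * (indicator {0..sg * (x - x0)} s * ennreal \<bar>g (x - sg * s)\<bar>) \<partial>lborel)"
      by (rule nn_integral_cmult[symmetric]) measurable
    also have "\<dots> \<le> Z sg x"
      unfolding Z_def
    proof (rule nn_integral_mono)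
      fix s
      show "ennreal (m lam (t, x)) * (indicator {0..sg * (x - x0)} s * ennreal \<bar>g (x - sg * s)\<bar>)
        \<le> indicator {0..} s * ennreal (exp (- (2 * lam * \<delta>) * s)) * H sg (x + s *\<^sub>R (- sg))"
      proof (cases "s \<in> {0..sg * (x - x0)} \<and> g (x - sg * s) \<noteq> 0")
        case True
        define y where "y = x - sg * s"
        have s: "0 \<le> s" and ge: "0 \<le> sg * (y - x0)" using True sg by (auto simp: y_def algebra_simps)
        have "y \<notin> N" using True gN by (auto simp: y_def)
        then have y\<delta>: "\<delta> \<le> sg * (y - x0)" using sg ge by (auto simp: N_def)
        have "(x - x0)\<^sup>2 - (y - x0)\<^sup>2 = 2 * s * (sg * (y - x0)) + s\<^sup>2"
          using sg by (auto simp: y_def power2_eq_square algebra_simps)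
        moreover have "2 * s * \<delta> \<le> 2 * s * (sg * (y - x0))" using y\<delta> s by (intro mult_left_mono) auto
        moreover have "q2 + b \<le> p2" if "p2 - q2 = a + r" "b \<le> a" "0 \<le> r" for p2 q2 a b r :: real using that by linarith
        ultimately have "(y - x0)\<^sup>2 + 2 * s * \<delta> \<le> (x - x0)\<^sup>2" using zero_le_power2[of s] by blast
        then have dec: "\<psi> (t, y) + 2 * s * \<delta> \<le> \<psi> (t, x)" by (simp add: \<psi>_def psi_def)
        have yL: "y \<in> {0<..<L}"
        proof (rule ccontr)
          assume "y \<notin> {0<..<L}" then show False using True g0(2) by (simp add: g_def y_def)
        qed
        have yD: "(t, y) \<in> D" 
        proof -
          have "0 \<le> 2 * s * \<delta>" using s \<delta>0 by simp
          moreover have "\<psi> (t, x) < M" using D by (simp add: D_def)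
          ultimately have "\<psi> (t, y) < M" using dec by linarith
          then show ?thesis using yL by (simp add: D_def)
        qed
        have "lam * (\<psi> (t, y) + 2 * s * \<delta>) \<le> lam * \<psi> (t, x)" using dec lam by (intro mult_left_mono) auto
        then have "m lam (t, x) \<le> exp (- (2 * lam * \<delta>) * s) * m lam (t, y)"
          by (simp add: m_def exp_add[symmetric] algebra_simps)
        then have "m lam (t, x) * \<bar>g y\<bar> \<le> exp (- (2 * lam * \<delta>) * s) * m lam (t, y) * \<bar>g y\<bar>"
          by (intro mult_right_mono) auto
        from ennreal_leI[OF this] show ?thesis
          using True s yD ge by (simp add: H_def y_def[symmetric] ennreal_mult[symmetric] m_def mult.assoc mult.commute[of s sg])
      qed auto
    qed
    finally show ?thesis .
  qed
  have "Zn lam t \<le> (\<integral>\<^sup>+x. (Z 1 x)\<^sup>2 + (Z (- 1) x)\<^sup>2 \<partial>lebesgue)"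
    unfolding Zn_def
  proof (rule nn_integral_mono)
    fix x
    show "indicator D (t, x) * ennreal ((m lam (t, x))\<^sup>2 * (u t x)\<^sup>2) \<le> (Z 1 x)\<^sup>2 + (Z (- 1) x)\<^sup>2"
    proof (cases "(t, x) \<in> D")
      case True
      have e: "ennreal ((m lam (t, x))\<^sup>2 * (u t x)\<^sup>2) = (ennreal (m lam (t, x) * \<bar>u t x\<bar>))\<^sup>2"
        by (simp add: ennreal_power m_def power_mult_distrib)
      consider "0 \<le> x - x0" | "0 \<le> - 1 * (x - x0)" by fastforce
      then show ?thesis
      proof cases
        case 1
        have "(ennreal (m lam (t, x) * \<bar>u t x\<bar>))\<^sup>2 \<le> (Z 1 x)\<^sup>2" by (rule power_mono[OF pt[OF True]]) (use 1 in auto)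
        also have "\<dots> \<le> (Z 1 x)\<^sup>2 + (Z (- 1) x)\<^sup>2" by simp
        finally show ?thesis using True e by simp
      next
        case 2
        have "(ennreal (m lam (t, x) * \<bar>u t x\<bar>))\<^sup>2 \<le> (Z (- 1) x)\<^sup>2" by (rule power_mono[OF pt[OF True]]) (use 2 in auto)
        also have "\<dots> \<le> (Z 1 x)\<^sup>2 + (Z (- 1) x)\<^sup>2" by simp
        finally show ?thesis using True e by simp
      qed
    qed simp
  qed
  also have "\<dots> = (\<integral>\<^sup>+x. (Z 1 x)\<^sup>2 \<partial>lborel) + (\<integral>\<^sup>+x. (Z (- 1) x)\<^sup>2 \<partial>lborel)"
    unfolding nn_integral_completion by (rule nn_integral_add) measurable
  also have "\<dots> \<le> ennreal (1 / (2 * lam * \<delta>)\<^sup>2) * (\<integral>\<^sup>+x. (H 1 x)\<^sup>2 \<partial>lborel) + ennreal (1 / (2 * lam * \<delta>)\<^sup>2) * (\<integral>\<^sup>+x. (H (- 1) x)\<^sup>2 \<partial>lborel)"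
    unfolding Z_def by (intro add_mono exp_young \<mu> Hm)
  also have "\<dots> = ennreal (1 / (2 * lam * \<delta>)\<^sup>2) * (\<integral>\<^sup>+x. (H 1 x)\<^sup>2 + (H (- 1) x)\<^sup>2 \<partial>lborel)"
    by (subst nn_integral_add) (auto simp: distrib_left)
  also have "(\<integral>\<^sup>+x. (H 1 x)\<^sup>2 + (H (- 1) x)\<^sup>2 \<partial>lborel) \<le> (\<integral>\<^sup>+x. indicator D (t, x) * ennreal ((m lam (t, x))\<^sup>2 * (g x)\<^sup>2) \<partial>lborel)"
  proof (rule nn_integral_mono)
    fix x
    show "(H 1 x)\<^sup>2 + (H (- 1) x)\<^sup>2 \<le> indicator D (t, x) * ennreal ((m lam (t, x))\<^sup>2 * (g x)\<^sup>2)"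
    proof (cases "x = x0")
      case True
      then have "g x = 0" using gN \<delta>0 by (simp add: N_def)
      then show ?thesis by (simp add: H_def)
    next
      case False
      then show ?thesis
        by (cases "x0 < x") (auto simp: H_def ennreal_power m_def power_mult_distrib indicator_def)
    qed
  qed
  also have "(\<integral>\<^sup>+x. indicator D (t, x) * ennreal ((m lam (t, x))\<^sup>2 * (g x)\<^sup>2) \<partial>lborel) = (\<integral>\<^sup>+x. indicator D (t, x) * ennreal ((m lam (t, x))\<^sup>2 * (g x)\<^sup>2) \<partial>lebesgue)"
    by (rule nn_integral_completion[symmetric])
  also have "\<dots> \<le> (\<integral>\<^sup>+x. ennreal (1 / \<gamma>) * (indicator D (t, x) * ennreal ((m lam (t, x))\<^sup>2 * ((dt L T u t x)\<^sup>2 + \<gamma> * (dx L (u t) x)\<^sup>2))) \<partial>lebesgue)"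
  proof (rule nn_integral_mono_AE, use gAE' in eventually_elim)
    case (elim x)
    show ?case
    proof (cases "(t, x) \<in> D")
      case True
      then have gx: "g x = dx L (u t) x" using elim by (simp add: D_def)
      have "(m lam (t, x))\<^sup>2 * (g x)\<^sup>2 \<le> 1 / \<gamma> * ((m lam (t, x))\<^sup>2 * ((dt L T u t x)\<^sup>2 + \<gamma> * (dx L (u t) x)\<^sup>2))"
        unfolding gx using \<gamma>0 by (simp add: field_simps)
      from ennreal_leI[OF this] show ?thesis using True \<gamma>0 by (simp add: ennreal_mult[symmetric])
    qed simp
  qed
  also have "\<dots> = ennreal (1 / \<gamma>) * En lam t"
    unfolding En_def
  proof (rule nn_integral_cmult)
    have "zext L (dt L T u t) \<in> borel_measurable lebesgue" "zext L (dx L (u t)) \<in> borel_measurable lebesgue"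
      using dt_u_L2[OF t] dx_u_L2[OF t] by (auto simp: measurable_zext L2_def)
    moreover have "(\<lambda>x. indicator D (t, x) * ennreal ((m lam (t, x))\<^sup>2)) \<in> borel_measurable lebesgue"
    proof -
      have "(\<lambda>x. indicator D (t, x) * ennreal ((m lam (t, x))\<^sup>2)) \<in> borel_measurable borel" by measurable
      then show ?thesis by (intro measurable_completion) simp
    qed
    ultimately have "(\<lambda>x. (indicator D (t, x) * ennreal ((m lam (t, x))\<^sup>2)) * ennreal ((zext L (dt L T u t) x)\<^sup>2 + \<gamma> * (zext L (dx L (u t)) x)\<^sup>2)) \<in> borel_measurable lebesgue"
      by measurable
    moreover have "(indicator D (t, x) * ennreal ((m lam (t, x))\<^sup>2)) * ennreal ((zext L (dt L T u t) x)\<^sup>2 + \<gamma> * (zext L (dx L (u t)) x)\<^sup>2)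
       = indicator D (t, x) * ennreal ((m lam (t, x))\<^sup>2 * ((dt L T u t x)\<^sup>2 + \<gamma> * (dx L (u t) x)\<^sup>2))" for x
      using \<gamma>0 by (auto simp: D_def zext_def ennreal_mult split: split_indicator)
    ultimately show "(\<lambda>x. indicator D (t, x) * ennreal ((m lam (t, x))\<^sup>2 * ((dt L T u t x)\<^sup>2 + \<gamma> * (dx L (u t) x)\<^sup>2))) \<in> borel_measurable lebesgue"
      by simp
  qed
  finally have "Zn lam t \<le> ennreal (1 / (2 * lam * \<delta>)\<^sup>2) * (ennreal (1 / \<gamma>) * En lam t)"
    by (simp add: mult_left_mono)
  also have "\<dots> = ennreal (1 / (4 * lam\<^sup>2 * \<delta>\<^sup>2 * \<gamma>)) * En lam t"
    using \<gamma>0 by (simp add: mult.assoc[symmetric] ennreal_mult[symmetric] power_mult_distrib)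
  finally show ?thesis .
qed

end

subsection \<open>The coupling terms\<close>

lemma nn_lebesgue_on: "S \<in> sets lebesgue \<Longrightarrow> (\<integral>\<^sup>+x. f x \<partial>lebesgue_on S) = (\<integral>\<^sup>+x. indicator S x * f x \<partial>lborel)"
  by (subst nn_integral_restrict_space) (simp_all add: nn_integral_completion mult.commute)

lemma integral_cong_AE_lebesgue_on:
  fixes f g :: "real \<Rightarrow> real"
  assumes "AE x in lebesgue_on {a<..<b}. f x = g x" "g \<in> borel_measurable (lebesgue_on {a<..<b})"
  shows "(LINT x|lebesgue_on {a<..<b}. f x) = (LINT x|lebesgue_on {a<..<b}. g x)"
    and "f \<in> borel_measurable (lebesgue_on {a<..<b})"
proof -
  let ?r = "\<lambda>h x. if x \<in> {a<..<b} then h x else (0::real)"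
  have S: "{a<..<b} \<in> sets lebesgue" by simp
  have g: "?r g \<in> borel_measurable lebesgue" using assms(2) borel_measurable_if[OF S, of g] by blast
  have "AE x in lebesgue. x \<in> {a<..<b} \<longrightarrow> f x = g x"
    using assms(1) by (subst (asm) AE_restrict_space_iff) auto
  then have ae: "AE x in lebesgue. ?r g x = ?r f x" by eventually_elim auto
  have f: "?r f \<in> borel_measurable lebesgue" by (rule borel_measurable_AE[OF g ae])
  then show "f \<in> borel_measurable (lebesgue_on {a<..<b})" using borel_measurable_if[OF S, of f] by blast
  then show "(LINT x|lebesgue_on {a<..<b}. f x) = (LINT x|lebesgue_on {a<..<b}. g x)"
    by (intro integral_cong_AE assms)
qed

lemma ae_zero_continuous:
  fixes f :: "real \<Rightarrow> real"
  assumes ab: "a < b" and c: "continuous_on {a..b} f" and ae: "AE x in lborel. x \<in> {a<..<b} \<longrightarrow> f x = 0"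
  shows "\<forall>x\<in>{a..b}. f x = 0"
proof -
  have int: "f x = 0" if x: "x \<in> {a<..<b}" for x
  proof (rule ccontr)
    assume n: "f x \<noteq> 0"
    have "isCont f x" using continuous_on_interior[OF c, of x] x by simp
    then obtain d where d: "d > 0" "\<And>y. dist x y < d \<Longrightarrow> f y \<noteq> 0"
      using continuous_at_avoid[of x f 0] \<open>isCont f x\<close> n by blast
    define l r where "l = max a (x - d)" and "r = min b (x + d)"
    have lr: "l < r" using x d(1) by (auto simp: l_def r_def)
    have "AE y in lborel. y \<notin> {l<..<r}"
      using ae
    proof eventually_elim
      case (elim y)
      show ?case
      proof
        assume "y \<in> {l<..<r}"
        then have "y \<in> {a<..<b}" "dist x y < d" by (auto simp: l_def r_def dist_real_def)
        then show False using d(2) elim by blast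
      qed
    qed
    then have "{l<..<r} \<in> null_sets lborel" by (subst AE_iff_null_sets) auto
    then show False using lr by (simp add: null_sets_def)
  qed
  have cl: "closure {a<..<b} = {a..b}" using ab by (rule closure_greaterThanLessThan)
  have c': "continuous_on (closure {a<..<b}) f" using c by (simp only: cl)
  show ?thesis
  proof
    fix x assume "x \<in> {a..b}"
    then show "f x = 0" using continuous_constant_on_closure[OF c' int, of x] by (simp only: cl)
  qed
qed

lemma nn_zero_continuous:
  fixes g :: "real \<Rightarrow> real"
  assumes ab: "a < b" and c: "continuous_on {a..b} g" and nn: "\<And>t. t \<in> {a..b} \<Longrightarrow> 0 \<le> g t"
    and z: "(\<integral>\<^sup>+t. indicator {a<..<b} t * ennreal (g t) \<partial>lborel) = 0"
  shows "\<forall>t\<in>{a..b}. g t = 0"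
proof (rule ae_zero_continuous[OF ab c])
  have m: "(\<lambda>t. indicator {a<..<b} t *\<^sub>R g t) \<in> borel_measurable borel"
    by (rule borel_measurable_continuous_on_indicator) (auto intro: continuous_on_subset[OF c])
  have "(\<lambda>t. indicator {a<..<b} t * ennreal (g t)) = (\<lambda>t. ennreal (indicator {a<..<b} t *\<^sub>R g t))"
    by (rule ext) (auto split: split_indicator)
  then have "(\<lambda>t. indicator {a<..<b} t * ennreal (g t)) \<in> borel_measurable lborel" using m by simp
  then have "AE t in lborel. indicator {a<..<b} t * ennreal (g t) = 0"
    using z by (simp add: nn_integral_0_iff_AE)
  then show "AE t in lborel. t \<in> {a<..<b} \<longrightarrow> g t = 0"
  proof eventually_elim
    case (elim t)
    show ?case
    proof
      assume t: "t \<in> {a<..<b}"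
      then have "g t \<le> 0" using elim by (simp add: ennreal_eq_0_iff)
      then show "g t = 0" using nn[of t] t by simp
    qed
  qed
qed

lemma nn_integral_L2:
  assumes v: "v \<in> L2 {0<..<L}"
  shows "(\<integral>\<^sup>+x. indicator {0<..<L} x * ennreal ((v x)\<^sup>2) \<partial>lborel) = ennreal ((norm (l2c L v))\<^sup>2)"
proof -
  have i: "integrable (lebesgue_on {0<..<L}) (\<lambda>x. (v x)\<^sup>2)" using v by (simp add: L2_def)
  have "(\<integral>\<^sup>+x. indicator {0<..<L} x * ennreal ((v x)\<^sup>2) \<partial>lborel) = (\<integral>\<^sup>+x. ennreal ((v x)\<^sup>2) \<partial>lebesgue_on {0<..<L})"
    by (rule nn_lebesgue_on[symmetric]) simp
  also have "\<dots> = ennreal (LINT x|lebesgue_on {0<..<L}. (v x)\<^sup>2)"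
    by (rule nn_integral_eq_integral[OF i]) simp
  also have "(LINT x|lebesgue_on {0<..<L}. (v x)\<^sup>2) = (norm (l2c L v))\<^sup>2"
    unfolding power2_norm_eq_inner inner_l2c[OF v v] by (simp add: L2_inner_def power2_eq_square)
  finally show ?thesis .
qed

text \<open>The version is corrected on null sets in three ways: it is made Borel, set to 0 off the
  rectangle and on N0, and set to 0 on every time slice with infinite norm. The last correction
  makes all sections, not just almost all, square integrable.\<close>

lemma L2_L2_borel:
  assumes f: "f \<in> L2_L2 L T" and N0: "N0 \<in> sets (borel :: (real \<times> real) measure)"
    and z: "AE t in lebesgue_on {0<..<T}. AE x in lebesgue_on {0<..<L}. (t, x) \<in> N0 \<longrightarrow> f t x = 0"
  obtains G where "G \<in> borel_measurable borel" "\<And>t x. t \<notin> {0<..<T} \<or> x \<notin> {0<..<L} \<Longrightarrow> G (t, x) = 0"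
    "\<And>w. w \<in> N0 \<Longrightarrow> G w = 0" "\<And>t. integrable lborel (\<lambda>x. (G (t, x))\<^sup>2)"
    "integrable lborel (\<lambda>t. LINT x|lborel. (G (t, x))\<^sup>2)"
    "AE t in lebesgue_on {0<..<T}. AE x in lebesgue_on {0<..<L}. f t x = G (t, x)"
proof -
  define R where "R = {0<..<T} \<times> {0<..<L}"
  have R: "R \<in> sets borel" unfolding R_def by (intro borel_open open_Times) auto
  then have RL: "R \<in> sets lebesgue" by simp
  obtain g where g: "g \<in> L2 R" "AE t in lebesgue_on {0<..<T}. AE x in lebesgue_on {0<..<L}. f t x = g (t, x)"
    using f by (auto simp: L2_L2_def R_def)
  let ?g = "\<lambda>w. if w \<in> R then g w else 0"
  have g1: "?g \<in> borel_measurable lebesgue"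
    using g(1) borel_measurable_if[OF RL, of g] by (auto simp: L2_def)
  have "integrable lebesgue (\<lambda>w. if w \<in> R then (g w)\<^sup>2 else 0)"
    using g(1) Lebesgue_Measure.integrable_restrict_UNIV[OF RL, of "\<lambda>w. (g w)\<^sup>2"] by (simp add: L2_def)
  from nn_integral_eq_integral[OF this]
  have "(\<integral>\<^sup>+w. ennreal (if w \<in> R then (g w)\<^sup>2 else 0) \<partial>lebesgue) = ennreal (LINT w|lebesgue. (if w \<in> R then (g w)\<^sup>2 else 0))"
    by simp
  then have gfin: "(\<integral>\<^sup>+w. ennreal (if w \<in> R then (g w)\<^sup>2 else 0) \<partial>lborel) < \<infinity>"
    unfolding nn_integral_completion by simp
  obtain g2 where g2[measurable]: "g2 \<in> borel_measurable lborel" and g2e: "AE w in lborel. ?g w = g2 w"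
    using completion_ex_borel_measurable_real[OF g1] by blast
  define G3 where "G3 w = g2 w * indicator (R - N0) w" for w
  have [measurable]: "R - N0 \<in> sets borel" using R N0 by blast
  have G3m[measurable]: "G3 \<in> borel_measurable borel" unfolding G3_def by measurable
  have G3fin: "(\<integral>\<^sup>+w. ennreal ((G3 w)\<^sup>2) \<partial>lborel) < \<infinity>"
  proof -
    have "(\<integral>\<^sup>+w. ennreal ((G3 w)\<^sup>2) \<partial>lborel) \<le> (\<integral>\<^sup>+w. ennreal (if w \<in> R then (g w)\<^sup>2 else 0) \<partial>lborel)"
      by (rule nn_integral_mono_AE, use g2e in eventually_elim) (auto simp: G3_def split: split_indicator)
    then show ?thesis using gfin by (rule le_less_trans)
  qed
  define n where "n t = (\<integral>\<^sup>+x. ennreal ((G3 (t, x))\<^sup>2) \<partial>lborel)" for t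
  have nm[measurable]: "n \<in> borel_measurable borel" unfolding n_def by measurable
  have nint: "(\<integral>\<^sup>+t. n t \<partial>lborel) = (\<integral>\<^sup>+w. ennreal ((G3 w)\<^sup>2) \<partial>lborel)"
    unfolding n_def by (rule nn_integral_lborel_pair[of "\<lambda>w. ennreal ((G3 w)\<^sup>2)"]) measurable
  have nfin: "AE t in lborel. n t \<noteq> \<infinity>"
    by (rule nn_integral_PInf_AE) (use nint G3fin in auto)
  \<comment> \<open>Slices with infinite norm form a null set of times, since the integral of
    \<open>n\<close> over time is finite.\<close>
  define G where "G w = (if n (fst w) = \<infinity> then 0 else G3 w)" for w
  have fstm: "(fst :: real \<times> real \<Rightarrow> real) \<in> borel_measurable borel"
    by (intro borel_measurable_continuous_onI continuous_intros)
  have nfst[measurable]: "(\<lambda>w::real \<times> real. n (fst w)) \<in> borel_measurable borel"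
    by (rule measurable_compose[OF fstm nm])
  have Gm: "G \<in> borel_measurable borel"
    unfolding G_def by measurable
  note [measurable] = Gm
  have Gn: "(\<integral>\<^sup>+x. ennreal ((G (t, x))\<^sup>2) \<partial>lborel) = (if n t = \<infinity> then 0 else n t)" for t
    by (simp add: G_def n_def)
  have sec: "integrable lborel (\<lambda>x. (G (t, x))\<^sup>2)" for t
    by (rule integrableI_bounded) (use Gn[of t] in \<open>auto simp: less_top split: if_splits\<close>)
  have secn: "ennreal (LINT x|lborel. (G (t, x))\<^sup>2) = (if n t = \<infinity> then 0 else n t)" for t
    using nn_integral_eq_integral[OF sec[of t]] Gn[of t] by simp
  have "integrable lborel (\<lambda>t. LINT x|lborel. (G (t, x))\<^sup>2)"
  proof (rule integrableI_bounded)
    show "(\<lambda>t. LINT x|lborel. (G (t, x))\<^sup>2) \<in> borel_measurable lborel" by measurable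
    have "(\<integral>\<^sup>+t. ennreal (norm (LINT x|lborel. (G (t, x))\<^sup>2)) \<partial>lborel) \<le> (\<integral>\<^sup>+t. n t \<partial>lborel)"
      by (rule nn_integral_mono) (auto simp: integral_nonneg_AE secn)
    then show "(\<integral>\<^sup>+t. ennreal (norm (LINT x|lborel. (G (t, x))\<^sup>2)) \<partial>lborel) < \<infinity>"
      using nint G3fin by (simp add: le_less_trans)
  qed
  moreover have "AE t in lebesgue_on {0<..<T}. AE x in lebesgue_on {0<..<L}. f t x = G (t, x)"
  proof -
    have "AE w in lborel \<Otimes>\<^sub>M lborel. ?g w = g2 w" using g2e by (simp only: lborel_prod)
    then have "AE t in lborel. AE x in lborel. ?g (t, x) = g2 (t, x)" by (rule lborel_pair.AE_pair)
    then have 1: "AE t in lebesgue. AE x in lborel. ?g (t, x) = g2 (t, x)" by (rule AE_completion)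
    have 2: "AE t in lebesgue. n t \<noteq> \<infinity>" by (rule AE_completion[OF nfin])
    have 3: "AE t in lebesgue. t \<in> {0<..<T} \<longrightarrow> (AE x in lebesgue_on {0<..<L}. f t x = g (t, x))" using g(2) by (simp only: AE_zext)
    have 4: "AE t in lebesgue. t \<in> {0<..<T} \<longrightarrow> (AE x in lebesgue_on {0<..<L}. (t, x) \<in> N0 \<longrightarrow> f t x = 0)" using z by (simp only: AE_zext)
    show ?thesis unfolding AE_zext using 1 2 3 4
    proof eventually_elim
      case (elim t)
      show ?case
      proof
        assume t: "t \<in> {0<..<T}"
        have "AE x in lebesgue. ?g (t, x) = g2 (t, x)" by (rule AE_completion[OF elim(1)])
        moreover have "AE x in lebesgue. x \<in> {0<..<L} \<longrightarrow> f t x = g (t, x)" "AE x in lebesgue. x \<in> {0<..<L} \<longrightarrow> (t, x) \<in> N0 \<longrightarrow> f t x = 0"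
          using elim(3,4) t by (auto simp only: AE_zext)
        ultimately show "AE x in lebesgue. x \<in> {0<..<L} \<longrightarrow> f t x = G (t, x)"
          by eventually_elim (use t elim(2) in \<open>auto simp: G_def G3_def R_def split: split_indicator\<close>)
      qed
    qed
  qed
  ultimately show thesis
    by (intro that[OF Gm _ _ sec]) (auto simp: G_def G3_def R_def)
qed

lemma L2_inner_section_measurable:
  assumes [measurable]: "G \<in> borel_measurable (borel :: (real \<times> real) measure)"
    and z: "\<And>t x. x \<notin> {0<..<L} \<Longrightarrow> G (t, x) = 0" and sec: "\<And>t. integrable lborel (\<lambda>x. (G (t, x))\<^sup>2)"
    and w: "w \<in> L2 {0<..<L}"
  shows "(\<lambda>t. L2_inner L (\<lambda>x. G (t, x)) w) \<in> borel_measurable borel"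
proof -
  obtain w' where w': "w' \<in> borel_measurable borel" "w' \<in> L2 {0<..<L}" "l2c L w = l2c L w'"
    using borel_version[OF w] by metis
  note [measurable] = w'(1)
  have Gb: "(\<lambda>x. G (t, x)) \<in> borel_measurable borel" for t by measurable
  have GL: "(\<lambda>x. G (t, x)) \<in> L2 {0<..<L}" for t by (rule borel_L2[OF Gb sec])
  have "L2_inner L (\<lambda>x. G (t, x)) w = (LINT x|lborel. G (t, x) * w' x)" for t
  proof -
    have "L2_inner L (\<lambda>x. G (t, x)) w = L2_inner L (\<lambda>x. G (t, x)) w'"
      using inner_l2c[OF GL w] inner_l2c[OF GL w'(2)] w'(3) by simp
    also have "\<dots> = (LINT x|lborel. G (t, x) * w' x)"
      by (rule L2_inner_borel[OF Gb w'(1)]) (rule z)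
    finally show ?thesis .
  qed
  moreover have "(\<lambda>t. LINT x|lborel. G (t, x) * w' x) \<in> borel_measurable borel" by measurable
  ultimately show ?thesis by simp
qed

text \<open>The variational equation sees the coupling only under integrals over almost all times
  and points, so its Borel version may take its place.\<close>

lemma weak_solution_component:
  assumes L0: "0 < L" and T0: "0 < T" and \<gamma>: "0 < \<gamma> i" and sol: "weak_solution L T \<gamma> p q u0 u1 u"
    and G: "G \<in> borel_measurable borel" "\<And>t x. t \<notin> {0<..<T} \<or> x \<notin> {0<..<L} \<Longrightarrow> G (t, x) = 0"
      "\<And>t. integrable lborel (\<lambda>x. (G (t, x))\<^sup>2)" "integrable lborel (\<lambda>t. LINT x|lborel. (G (t, x))\<^sup>2)"
      "AE t in lebesgue_on {0<..<T}. AE x in lebesgue_on {0<..<L}. coupling L p q u i t x = G (t, x)"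
  shows "wave_component L T (\<gamma> i) (u i) G"
proof
  have s: "u i \<in> C0_H10 L T \<inter> C1_L2 L T"
    "\<forall>\<phi>\<in>H10 L. \<forall>\<theta>. test_fun 0 T \<theta> \<longrightarrow>
        - (LINT t|lebesgue_on {0<..<T}. L2_inner L (dt L T (u i) t) \<phi> * deriv \<theta> t)
        + \<gamma> i * (LINT t|lebesgue_on {0<..<T}. L2_inner L (dx L (u i t)) (dx L \<phi>) * \<theta> t)
        = (LINT t|lebesgue_on {0<..<T}. L2_inner L (coupling L p q u i t) \<phi> * \<theta> t)"
    using sol unfolding weak_solution_def by blast+
  show "u i \<in> C0_H10 L T" "u i \<in> C1_L2 L T" using s(1) by auto
  fix \<phi> \<theta> assume \<phi>: "\<phi> \<in> H10 L" and \<theta>: "test_fun 0 T \<theta>"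
  have \<phi>2: "\<phi> \<in> L2 {0<..<L}" by (rule H10_L2[OF \<phi>])
  have Gb: "(\<lambda>x. G (t, x)) \<in> borel_measurable borel" for t using G(1) by measurable
  have "AE t in lebesgue_on {0<..<T}. L2_inner L (coupling L p q u i t) \<phi> * \<theta> t = L2_inner L (\<lambda>x. G (t, x)) \<phi> * \<theta> t"
    using G(5)
  proof eventually_elim
    case (elim t)
    have "L2_inner L (coupling L p q u i t) \<phi> = L2_inner L (\<lambda>x. G (t, x)) \<phi>"
      unfolding L2_inner_def
    proof (rule integral_cong_AE_lebesgue_on(1))
      show "AE x in lebesgue_on {0<..<L}. coupling L p q u i t x * \<phi> x = G (t, x) * \<phi> x"
        using elim by eventually_elim simp
      show "(\<lambda>x. G (t, x) * \<phi> x) \<in> borel_measurable (lebesgue_on {0<..<L})"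
        using \<phi>2 by (intro borel_measurable_times[OF measurable_restrict_space1[OF measurable_lebesgue_borel[OF Gb]]]) (simp add: L2_def)
    qed
    then show ?case by simp
  qed
  then have "(LINT t|lebesgue_on {0<..<T}. L2_inner L (coupling L p q u i t) \<phi> * \<theta> t) = (LINT t|lebesgue_on {0<..<T}. L2_inner L (\<lambda>x. G (t, x)) \<phi> * \<theta> t)"
  proof (rule integral_cong_AE_lebesgue_on(1))
    show "(\<lambda>t. L2_inner L (\<lambda>x. G (t, x)) \<phi> * \<theta> t) \<in> borel_measurable (lebesgue_on {0<..<T})"
      by (intro borel_measurable_times smooth_measurable_on[OF test_fun_smooth[OF \<theta>]] measurable_restrict_space1 measurable_lebesgue_borel
          L2_inner_section_measurable[OF G(1) _ G(3) \<phi>2]) (use G(2) in auto)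
  qed
  then show "- (LINT t|lebesgue_on {0<..<T}. L2_inner L (dt L T (u i) t) \<phi> * deriv \<theta> t)
      + \<gamma> i * (LINT t|lebesgue_on {0<..<T}. L2_inner L (dx L (u i t)) (dx L \<phi>) * \<theta> t)
      = (LINT t|lebesgue_on {0<..<T}. L2_inner L (\<lambda>x. G (t, x)) \<phi> * \<theta> t)"
    using s(2) \<phi> \<theta> by auto
qed (use assms in auto)

text \<open>A Lebesgue integral of a non-integrable function has the default value 0, and a bound on
  it would say nothing. Membership in \<open>L2_L2\<close> excludes this: the iterated integral
  equals the finite one of the Borel version, so the hypothesis on the coupling becomes a bound for
  nonnegative integrals.\<close>

lemma L2_L2_nn_integral:
  assumes f: "f \<in> L2_L2 L T"
  shows "(\<integral>\<^sup>+t. indicator {0<..<T} t * (\<integral>\<^sup>+x. indicator {0<..<L} x * ennreal ((f t x)\<^sup>2) \<partial>lborel) \<partial>lborel)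
    \<le> ennreal (LINT t|lebesgue_on {0<..<T}. LINT x|lebesgue_on {0<..<L}. \<bar>f t x\<bar>\<^sup>2)"
proof -
  obtain G where G: "G \<in> borel_measurable borel" "\<And>t x. t \<notin> {0<..<T} \<or> x \<notin> {0<..<L} \<Longrightarrow> G (t, x) = 0"
    "\<And>t. integrable lborel (\<lambda>x. (G (t, x))\<^sup>2)" "integrable lborel (\<lambda>t. LINT x|lborel. (G (t, x))\<^sup>2)"
    "AE t in lebesgue_on {0<..<T}. AE x in lebesgue_on {0<..<L}. f t x = G (t, x)"
    by (rule L2_L2_borel[OF f, of "{}"]) (simp, simp, rule that)
  note [measurable] = G(1)
  have Gb: "(\<lambda>x. (G (t, x))\<^sup>2) \<in> borel_measurable borel" for t by measurable
  have Gt: "(\<lambda>t. LINT x|lborel. (G (t, x))\<^sup>2) \<in> borel_measurable borel" by measurable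
  have ae: "AE t in lebesgue. t \<in> {0<..<T} \<longrightarrow> (AE x in lebesgue. x \<in> {0<..<L} \<longrightarrow> f t x = G (t, x))"
    using G(5) by (simp only: AE_zext)
  have rest: "(LINT x|lebesgue_on {0<..<L}. h x) = (LINT x|lborel. h x)"
    if "h \<in> borel_measurable borel" "\<And>x. x \<notin> {0<..<L} \<Longrightarrow> h x = 0" for h :: "real \<Rightarrow> real" and L
  proof -
    have "zext L h = h" using that(2) by (auto simp: zext_def)
    then show ?thesis using integral_zext[of L h] that(1) by (simp add: integral_completion)
  qed
  have in1: "(LINT x|lebesgue_on {0<..<L}. (f t x)\<^sup>2) = (LINT x|lborel. (G (t, x))\<^sup>2)"
    if "AE x in lebesgue_on {0<..<L}. f t x = G (t, x)" for t
  proof -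
    have "(LINT x|lebesgue_on {0<..<L}. (f t x)\<^sup>2) = (LINT x|lebesgue_on {0<..<L}. (G (t, x))\<^sup>2)"
      by (rule integral_cong_AE_lebesgue_on(1), use that in eventually_elim)
        (auto intro!: measurable_restrict_space1 measurable_lebesgue_borel Gb)
    also have "\<dots> = (LINT x|lborel. (G (t, x))\<^sup>2)" by (rule rest[OF Gb]) (use G(2) in auto)
    finally show ?thesis .
  qed
  have "(LINT t|lebesgue_on {0<..<T}. LINT x|lebesgue_on {0<..<L}. \<bar>f t x\<bar>\<^sup>2) = (LINT t|lebesgue_on {0<..<T}. LINT x|lborel. (G (t, x))\<^sup>2)"
    by (rule integral_cong_AE_lebesgue_on(1), use G(5) in eventually_elim)
      (auto intro!: in1 measurable_restrict_space1 measurable_lebesgue_borel Gt)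
  also have "\<dots> = (LINT t|lborel. LINT x|lborel. (G (t, x))\<^sup>2)"
    by (rule rest[OF Gt]) (use G(2) in auto)
  finally have R: "(LINT t|lebesgue_on {0<..<T}. LINT x|lebesgue_on {0<..<L}. \<bar>f t x\<bar>\<^sup>2) = (LINT t|lborel. LINT x|lborel. (G (t, x))\<^sup>2)" .
  have "(\<integral>\<^sup>+t. indicator {0<..<T} t * (\<integral>\<^sup>+x. indicator {0<..<L} x * ennreal ((f t x)\<^sup>2) \<partial>lborel) \<partial>lborel)
     = (\<integral>\<^sup>+t. indicator {0<..<T} t * (\<integral>\<^sup>+x. indicator {0<..<L} x * ennreal ((f t x)\<^sup>2) \<partial>lborel) \<partial>lebesgue)"
    by (simp add: nn_integral_completion)
  also have "\<dots> \<le> (\<integral>\<^sup>+t. ennreal (LINT x|lborel. (G (t, x))\<^sup>2) \<partial>lebesgue)"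
  proof (rule nn_integral_mono_AE, use ae in eventually_elim)
    case (elim t)
    show ?case
    proof (cases "t \<in> {0<..<T}")
      case True
      have "(\<integral>\<^sup>+x. indicator {0<..<L} x * ennreal ((f t x)\<^sup>2) \<partial>lborel) = (\<integral>\<^sup>+x. indicator {0<..<L} x * ennreal ((f t x)\<^sup>2) \<partial>lebesgue)"
        by (simp add: nn_integral_completion)
      also have "\<dots> \<le> (\<integral>\<^sup>+x. ennreal ((G (t, x))\<^sup>2) \<partial>lebesgue)"
        by (rule nn_integral_mono_AE, use elim[rule_format, OF True] in eventually_elim) (auto split: split_indicator)
      also have "\<dots> = ennreal (LINT x|lborel. (G (t, x))\<^sup>2)"
        unfolding nn_integral_completion by (rule nn_integral_eq_integral[OF G(3)]) simp
      finally show ?thesis using True by simp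
    qed simp
  qed
  also have "\<dots> = ennreal (LINT t|lborel. LINT x|lborel. (G (t, x))\<^sup>2)"
    unfolding nn_integral_completion by (rule nn_integral_eq_integral[OF G(4)]) (simp add: integral_nonneg_AE)
  finally show ?thesis by (simp only: R)
qed

text \<open>True without any integrability: the default value 0 of the integrals in
  \<open>energy\<close> only makes the left-hand side smaller.\<close>

lemma energy_nn:
  "ennreal (energy L T \<gamma> w t) \<le> (\<Sum>i\<in>UNIV. \<integral>\<^sup>+x. indicator {0<..<L} x * ennreal ((w i t x)\<^sup>2 + \<gamma> i * (dx L (w i t) x)\<^sup>2 + (dt L T (w i) t x)\<^sup>2) \<partial>lborel)"
  if \<gamma>: "\<And>i. 0 < \<gamma> i"
proof -
  let ?d = "\<lambda>i x. \<bar>w i t x\<bar>\<^sup>2 + \<gamma> i * \<bar>dx L (w i t) x\<bar>\<^sup>2 + \<bar>dt L T (w i) t x\<bar>\<^sup>2"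
  have nn: "0 \<le> ?d i x" for i x using less_imp_le[OF \<gamma>[of i]] by simp
  have "ennreal (energy L T \<gamma> w t) = (\<Sum>i\<in>UNIV. ennreal (LINT x|lebesgue_on {0<..<L}. ?d i x))"
    unfolding energy_def by (rule sum_ennreal[symmetric]) (intro integral_nonneg_AE AE_I2 nn)
  also have "\<dots> \<le> (\<Sum>i\<in>UNIV. \<integral>\<^sup>+x. ennreal (?d i x) \<partial>lebesgue_on {0<..<L})"
  proof (rule sum_mono)
    fix i
    have "ennreal (LINT x|lebesgue_on {0<..<L}. ?d i x) \<le> ennreal \<bar>LINT x|lebesgue_on {0<..<L}. ?d i x\<bar>" by (intro ennreal_leI) simp
    also have "\<dots> \<le> (\<integral>\<^sup>+x. ennreal \<bar>?d i x\<bar> \<partial>lebesgue_on {0<..<L})" by (rule ennreal_norm_integral_le)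
    finally show "ennreal (LINT x|lebesgue_on {0<..<L}. ?d i x) \<le> (\<integral>\<^sup>+x. ennreal (?d i x) \<partial>lebesgue_on {0<..<L})"
      using nn by (simp add: abs_of_nonneg)
  qed
  also have "\<dots> = (\<Sum>i\<in>UNIV. \<integral>\<^sup>+x. indicator {0<..<L} x * ennreal (?d i x) \<partial>lborel)"
    by (simp add: nn_lebesgue_on)
  finally show ?thesis by simp
qed

lemma coupling_bound:
  fixes \<gamma> :: "'n::finite \<Rightarrow> real"
  assumes adm: "admissible_coupling L \<gamma> p q" and T0: "0 < T" and \<gamma>: "\<And>i. 0 < \<gamma> i"
  obtains C where "0 < C" "\<And>w i. (\<And>j. w j \<in> C0_H10 L T \<inter> C1_L2 L T) \<Longrightarrow> coupling L p q w i \<in> L2_L2 L T"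
    "\<And>w i. (\<And>j. w j \<in> C0_H10 L T \<inter> C1_L2 L T) \<Longrightarrow>
      (\<integral>\<^sup>+t. indicator {0<..<T} t * (\<integral>\<^sup>+x. indicator {0<..<L} x * ennreal ((coupling L p q w i t x)\<^sup>2) \<partial>lborel) \<partial>lborel)
      \<le> ennreal C * (\<integral>\<^sup>+t. indicator {0<..<T} t * ennreal (energy L T \<gamma> w t) \<partial>lborel)"
proof -
  obtain C where C: "0 < C" "\<And>w i. (\<And>j. w j \<in> C0_H10 L T \<inter> C1_L2 L T) \<Longrightarrow> coupling L p q w i \<in> L2_L2 L T"
    "\<And>w i. (\<And>j. w j \<in> C0_H10 L T \<inter> C1_L2 L T) \<Longrightarrow> (LINT t|lebesgue_on {0<..<T}. LINT x|lebesgue_on {0<..<L}. \<bar>coupling L p q w i t x\<bar>\<^sup>2)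
               \<le> C * (LINT t|lebesgue_on {0<..<T}. energy L T \<gamma> w t)"
    using adm T0 unfolding admissible_coupling_def by meson
  show thesis
  proof (rule that[OF C(1,2)])
    fix w :: "'n \<Rightarrow> real \<Rightarrow> real \<Rightarrow> real" and i assume w: "\<And>j. w j \<in> C0_H10 L T \<inter> C1_L2 L T"
    have e0: "0 \<le> energy L T \<gamma> w t" for t
      unfolding energy_def by (intro sum_nonneg integral_nonneg_AE AE_I2) (simp add: less_imp_le[OF \<gamma>])
    have "(\<integral>\<^sup>+t. indicator {0<..<T} t * (\<integral>\<^sup>+x. indicator {0<..<L} x * ennreal ((coupling L p q w i t x)\<^sup>2) \<partial>lborel) \<partial>lborel)
      \<le> ennreal (C * (LINT t|lebesgue_on {0<..<T}. energy L T \<gamma> w t))"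
      by (rule order_trans[OF L2_L2_nn_integral[OF C(2)[OF w]] ennreal_leI[OF C(3)[OF w]]])
    also have "\<dots> = ennreal C * ennreal \<bar>LINT t|lebesgue_on {0<..<T}. energy L T \<gamma> w t\<bar>"
      using C(1) by (simp add: ennreal_mult integral_nonneg_AE e0)
    also have "\<dots> \<le> ennreal C * (\<integral>\<^sup>+t. ennreal \<bar>energy L T \<gamma> w t\<bar> \<partial>lebesgue_on {0<..<T})"
      by (intro mult_left_mono ennreal_norm_integral_le) simp
    also have "(\<integral>\<^sup>+t. ennreal \<bar>energy L T \<gamma> w t\<bar> \<partial>lebesgue_on {0<..<T}) = (\<integral>\<^sup>+t. indicator {0<..<T} t * ennreal (energy L T \<gamma> w t) \<partial>lborel)"
      by (subst nn_lebesgue_on) (simp_all add: abs_of_nonneg e0)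
    finally show "(\<integral>\<^sup>+t. indicator {0<..<T} t * (\<integral>\<^sup>+x. indicator {0<..<L} x * ennreal ((coupling L p q w i t x)\<^sup>2) \<partial>lborel) \<partial>lborel)
      \<le> ennreal C * (\<integral>\<^sup>+t. indicator {0<..<T} t * ennreal (energy L T \<gamma> w t) \<partial>lborel)" .
  qed
qed

text \<open>The size \<open>m\<close> of the weight is separated from the factors \<open>B1\<close>
  and \<open>B2\<close> that appear when it is differentiated. For the Carleman weight these are of
  order lam, so the square of \<open>u\<close> carries lam^2, which \<open>Zn_bound\<close>
  compensates.\<close>

lemma weighted_density:
  assumes u: "u \<in> C0_H10 L T \<inter> C1_L2 L T" and T: "0 < T" and \<beta>: "smooth \<beta>"
    and \<alpha>: "\<And>t. (\<alpha> has_real_derivative \<alpha>' t) (at t)" "continuous_on {0..T} \<alpha>'"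
    and t: "t \<in> {0..T}" and \<gamma>: "0 \<le> \<gamma>"
    and b: "\<And>x. x \<in> {0<..<L} \<Longrightarrow> \<bar>\<alpha> t * \<beta> x\<bar> \<le> m x" "\<And>x. x \<in> {0<..<L} \<Longrightarrow> \<bar>\<alpha> t * deriv \<beta> x\<bar> \<le> m x * B1"
      "\<And>x. x \<in> {0<..<L} \<Longrightarrow> \<bar>\<alpha>' t * \<beta> x\<bar> \<le> m x * B2"
  defines "w \<equiv> (\<lambda>t x. \<alpha> t * (\<beta> x * u t x))"
  shows "AE x in lebesgue_on {0<..<L}. (w t x)\<^sup>2 + \<gamma> * (dx L (w t) x)\<^sup>2 + (dt L T w t x)\<^sup>2
    \<le> (m x)\<^sup>2 * (2 * ((dt L T u t x)\<^sup>2 + \<gamma> * (dx L (u t) x)\<^sup>2) + (1 + 2 * \<gamma> * B1\<^sup>2 + 2 * B2\<^sup>2) * (u t x)\<^sup>2)"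
proof -
  have sq: "(p * a + q * b)\<^sup>2 \<le> 2 * (p\<^sup>2 * a\<^sup>2 + q\<^sup>2 * b\<^sup>2)" for p q a b :: real
  proof -
    have "0 \<le> (p * a - q * b)\<^sup>2" by simp
    moreover have "2 * (p\<^sup>2 * a\<^sup>2 + q\<^sup>2 * b\<^sup>2) = (p * a + q * b)\<^sup>2 + (p * a - q * b)\<^sup>2"
      by (simp add: power2_eq_square algebra_simps)
    ultimately show ?thesis by simp
  qed
  have mono: "p\<^sup>2 * a\<^sup>2 \<le> (M * B)\<^sup>2 * a\<^sup>2" if "\<bar>p\<bar> \<le> M * B" for p a M B :: real
    using that by (intro mult_right_mono) (auto intro: abs_le_square_iff[THEN iffD1] order_trans[OF _ abs_ge_self])
  note wc = weighted_class[OF u T \<beta> \<alpha>]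
  have d: "AE x in lebesgue_on {0<..<L}. dx L (w t) x = \<alpha> t * (\<beta> x * dx L (u t) x + deriv \<beta> x * u t x)"
    "AE x in lebesgue_on {0<..<L}. dt L T w t x = \<alpha>' t * (\<beta> x * u t x) + \<alpha> t * (\<beta> x * dt L T u t x)"
    unfolding w_def by (rule wc(2)[OF t] wc(3)[OF t])+
  have s: "AE x in lebesgue_on {0<..<L}. x \<in> {0<..<L}" by (simp add: AE_zext)
  show ?thesis using d s
  proof eventually_elim
    case (elim x)
    note bx = b(1)[OF elim(3)] b(2)[OF elim(3)] b(3)[OF elim(3)]
    have b1: "\<bar>\<alpha> t * \<beta> x\<bar> \<le> m x * 1" using bx by simp
    have 1: "(w t x)\<^sup>2 \<le> (m x)\<^sup>2 * (u t x)\<^sup>2"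
      using mono[OF b1, of "u t x"] by (simp add: w_def power_mult_distrib mult.assoc)
    have "(dx L (w t) x)\<^sup>2 = (\<alpha> t * \<beta> x * dx L (u t) x + \<alpha> t * deriv \<beta> x * u t x)\<^sup>2"
      unfolding elim(1) by (simp add: algebra_simps)
    also have "\<dots> \<le> 2 * ((\<alpha> t * \<beta> x)\<^sup>2 * (dx L (u t) x)\<^sup>2 + (\<alpha> t * deriv \<beta> x)\<^sup>2 * (u t x)\<^sup>2)" by (rule sq)
    also have "\<dots> \<le> 2 * ((m x * 1)\<^sup>2 * (dx L (u t) x)\<^sup>2 + (m x * B1)\<^sup>2 * (u t x)\<^sup>2)"
      by (intro mult_left_mono add_mono mono b1 bx) simp
    finally have 2: "(dx L (w t) x)\<^sup>2 \<le> 2 * ((m x)\<^sup>2 * (dx L (u t) x)\<^sup>2 + (m x)\<^sup>2 * B1\<^sup>2 * (u t x)\<^sup>2)"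
      by (simp add: power_mult_distrib)
    have "(dt L T w t x)\<^sup>2 = (\<alpha> t * \<beta> x * dt L T u t x + \<alpha>' t * \<beta> x * u t x)\<^sup>2"
      unfolding elim(2) by (simp add: algebra_simps)
    also have "\<dots> \<le> 2 * ((\<alpha> t * \<beta> x)\<^sup>2 * (dt L T u t x)\<^sup>2 + (\<alpha>' t * \<beta> x)\<^sup>2 * (u t x)\<^sup>2)" by (rule sq)
    also have "\<dots> \<le> 2 * ((m x * 1)\<^sup>2 * (dt L T u t x)\<^sup>2 + (m x * B2)\<^sup>2 * (u t x)\<^sup>2)"
      by (intro mult_left_mono add_mono mono b1 bx) simp
    finally have 3: "(dt L T w t x)\<^sup>2 \<le> 2 * ((m x)\<^sup>2 * (dt L T u t x)\<^sup>2 + (m x)\<^sup>2 * B2\<^sup>2 * (u t x)\<^sup>2)"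
      by (simp add: power_mult_distrib)
    have "(w t x)\<^sup>2 + \<gamma> * (dx L (w t) x)\<^sup>2 + (dt L T w t x)\<^sup>2 \<le> (m x)\<^sup>2 * (u t x)\<^sup>2
       + \<gamma> * (2 * ((m x)\<^sup>2 * (dx L (u t) x)\<^sup>2 + (m x)\<^sup>2 * B1\<^sup>2 * (u t x)\<^sup>2)) + 2 * ((m x)\<^sup>2 * (dt L T u t x)\<^sup>2 + (m x)\<^sup>2 * B2\<^sup>2 * (u t x)\<^sup>2)"
      by (intro add_mono 1 3 mult_left_mono 2 \<gamma>)
    also have "\<dots> = (m x)\<^sup>2 * (2 * ((dt L T u t x)\<^sup>2 + \<gamma> * (dx L (u t) x)\<^sup>2) + (1 + 2 * \<gamma> * B1\<^sup>2 + 2 * B2\<^sup>2) * (u t x)\<^sup>2)"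
      by (simp add: distrib_left distrib_right mult_ac)
    finally show ?case .
  qed
qed

text \<open>Only a derivative of the spatial factor obstructs commuting the weight with the
  coupling. The hypothesis bounds the coupling as a whole and gives no direct estimate of the sum of
  \<open>p i j t x * u j t x\<close>, so this commutator has to be eliminated, not
  estimated.\<close>

lemma weighted_coupling:
  fixes u :: "'n::finite \<Rightarrow> real \<Rightarrow> real \<Rightarrow> real"
  assumes u: "\<And>j. u j \<in> C0_H10 L T \<inter> C1_L2 L T" and T: "0 < T" and \<beta>: "smooth \<beta>"
    and \<alpha>: "\<And>t. (\<alpha> has_real_derivative \<alpha>' t) (at t)" "continuous_on {0..T} \<alpha>'"
    and t: "t \<in> {0..T}"
  shows "AE x in lebesgue_on {0<..<L}. coupling L p q (\<lambda>j t x. \<alpha> t * (\<beta> x * u j t x)) i t x =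
    \<alpha> t * \<beta> x * coupling L p q u i t x + \<alpha> t * deriv \<beta> x * (\<Sum>j\<in>UNIV. p i j t x * u j t x)"
proof -
  have "AE x in lebesgue_on {0<..<L}. \<forall>j. dx L (\<lambda>x. \<alpha> t * (\<beta> x * u j t x)) x = \<alpha> t * (\<beta> x * dx L (u j t) x + deriv \<beta> x * u j t x)"
    by (rule eventually_all_finite) (rule weighted_class(2)[OF u T \<beta> \<alpha> t])
  then show ?thesis
    by eventually_elim
      (simp add: coupling_def sum_distrib_left sum.distrib distrib_left mult_ac)
qed

lemma coupling_zero_AE:
  fixes u :: "'n::finite \<Rightarrow> real \<Rightarrow> real \<Rightarrow> real"
  assumes u: "\<And>j. u j t \<in> H1 L" and z: "\<And>j x. x \<in> {a<..<b} \<Longrightarrow> u j t x = 0" and ab: "0 \<le> a" "b \<le> L" "a < b"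
  shows "AE x in lebesgue_on {0<..<L}. x \<in> {a<..<b} \<longrightarrow> coupling L p q u i t x = 0"
proof -
  have "AE x in lebesgue_on {0<..<L}. \<forall>j. x \<in> {a<..<b} \<longrightarrow> dx L (u j t) x = 0"
    by (rule eventually_all_finite) (rule dx_zero_AE[OF u _ ab], rule z)
  then show ?thesis by eventually_elim (simp add: coupling_def z)
qed

lemma nn_indicator_iterate:
  fixes H :: "real \<times> real \<Rightarrow> real"
  assumes H: "H \<in> borel_measurable borel" "\<And>t x. t \<notin> {0<..<T} \<or> x \<notin> {0<..<L} \<Longrightarrow> H (t, x) = 0"
    and ae: "AE t in lebesgue_on {0<..<T}. AE x in lebesgue_on {0<..<L}. f t x = H (t, x)"
  shows "(\<integral>\<^sup>+z. ennreal ((H z)\<^sup>2) \<partial>lborel) \<le> (\<integral>\<^sup>+t. indicator {0<..<T} t * (\<integral>\<^sup>+x. indicator {0<..<L} x * ennreal ((f t x)\<^sup>2) \<partial>lborel) \<partial>lborel)"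
proof -
  note [measurable] = H(1)
  have ae': "AE t in lebesgue. t \<in> {0<..<T} \<longrightarrow> (AE x in lebesgue. x \<in> {0<..<L} \<longrightarrow> f t x = H (t, x))"
    using ae by (simp only: AE_zext)
  have "(\<integral>\<^sup>+z. ennreal ((H z)\<^sup>2) \<partial>lborel) = (\<integral>\<^sup>+t. (\<integral>\<^sup>+x. ennreal ((H (t, x))\<^sup>2) \<partial>lborel) \<partial>lborel)"
    by (rule nn_integral_lborel_pair[symmetric]) measurable
  also have "\<dots> = (\<integral>\<^sup>+t. (\<integral>\<^sup>+x. ennreal ((H (t, x))\<^sup>2) \<partial>lebesgue) \<partial>lebesgue)"
    by (simp only: nn_integral_completion)
  also have "\<dots> \<le> (\<integral>\<^sup>+t. indicator {0<..<T} t * (\<integral>\<^sup>+x. indicator {0<..<L} x * ennreal ((f t x)\<^sup>2) \<partial>lebesgue) \<partial>lebesgue)"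
  proof (rule nn_integral_mono_AE, use ae' in eventually_elim)
    case (elim t)
    show ?case
    proof (cases "t \<in> {0<..<T}")
      case True
      have "(\<integral>\<^sup>+x. ennreal ((H (t, x))\<^sup>2) \<partial>lebesgue) \<le> (\<integral>\<^sup>+x. indicator {0<..<L} x * ennreal ((f t x)\<^sup>2) \<partial>lebesgue)"
        by (rule nn_integral_mono_AE, use elim[rule_format, OF True] in eventually_elim)
          (use H(2) in \<open>auto split: split_indicator\<close>)
      then show ?thesis using True by simp
    next
      case False
      then have "H (t, x) = 0" for x using H(2) by blast
      then show ?thesis by simp
    qed
  qed
  finally show ?thesis by (simp only: nn_integral_completion)
qed

lemma coupling_borel:
  fixes \<gamma> :: "'n::finite \<Rightarrow> real"
  assumes adm: "admissible_coupling L \<gamma> p q" and T0: "0 < T" and \<gamma>: "\<And>i. 0 < \<gamma> i"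
  obtains C where "0 < C" "\<And>w i. (\<And>j. w j \<in> C0_H10 L T \<inter> C1_L2 L T) \<Longrightarrow> coupling L p q w i \<in> L2_L2 L T"
    "\<And>w i. (\<And>j. w j \<in> C0_H10 L T \<inter> C1_L2 L T) \<Longrightarrow>
      \<exists>H. H \<in> borel_measurable borel \<and> (AE t in lebesgue_on {0<..<T}. AE x in lebesgue_on {0<..<L}. coupling L p q w i t x = H (t, x)) \<and>
      (\<integral>\<^sup>+z. ennreal ((H z)\<^sup>2) \<partial>lborel) \<le> ennreal C * (\<integral>\<^sup>+t. indicator {0<..<T} t * ennreal (energy L T \<gamma> w t) \<partial>lborel)"
proof -
  obtain C where C: "0 < C" "\<And>w i. (\<And>j. w j \<in> C0_H10 L T \<inter> C1_L2 L T) \<Longrightarrow> coupling L p q w i \<in> L2_L2 L T"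
    "\<And>w i. (\<And>j. w j \<in> C0_H10 L T \<inter> C1_L2 L T) \<Longrightarrow>
      (\<integral>\<^sup>+t. indicator {0<..<T} t * (\<integral>\<^sup>+x. indicator {0<..<L} x * ennreal ((coupling L p q w i t x)\<^sup>2) \<partial>lborel) \<partial>lborel)
      \<le> ennreal C * (\<integral>\<^sup>+t. indicator {0<..<T} t * ennreal (energy L T \<gamma> w t) \<partial>lborel)"
    using coupling_bound[OF adm T0 \<gamma>] by blast
  show thesis
  proof (rule that[OF C(1,2)])
    fix w :: "'n \<Rightarrow> real \<Rightarrow> real \<Rightarrow> real" and i assume w: "\<And>j. w j \<in> C0_H10 L T \<inter> C1_L2 L T"
    show "\<exists>H. H \<in> borel_measurable borel \<and> (AE t in lebesgue_on {0<..<T}. AE x in lebesgue_on {0<..<L}. coupling L p q w i t x = H (t, x)) \<and>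
      (\<integral>\<^sup>+z. ennreal ((H z)\<^sup>2) \<partial>lborel) \<le> ennreal C * (\<integral>\<^sup>+t. indicator {0<..<T} t * ennreal (energy L T \<gamma> w t) \<partial>lborel)"
    proof (rule L2_L2_borel[OF C(2)[OF w], of "{}"])
      fix H assume H: "H \<in> borel_measurable borel" "\<And>t x. t \<notin> {0<..<T} \<or> x \<notin> {0<..<L} \<Longrightarrow> H (t, x) = 0"
        "AE t in lebesgue_on {0<..<T}. AE x in lebesgue_on {0<..<L}. coupling L p q w i t x = H (t, x)"
      have "(\<integral>\<^sup>+z. ennreal ((H z)\<^sup>2) \<partial>lborel) \<le> ennreal C * (\<integral>\<^sup>+t. indicator {0<..<T} t * ennreal (energy L T \<gamma> w t) \<partial>lborel)"
        by (rule order_trans[OF nn_indicator_iterate[OF H] C(3)[OF w]])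
      with H show ?thesis by blast
    qed auto
  qed
qed

text \<open>Absorption: summing over all components bounds the total by half of itself plus the
  remainders. Subtracting that half requires real numbers, hence the assumption that every
  \<open>X i\<close> is finite.\<close>

lemma sum_system_bound:
  fixes X :: "'n::finite \<Rightarrow> ennreal" and A :: "'n \<Rightarrow> real"
  assumes X: "\<And>i. X i \<le> (\<Sum>j\<in>UNIV. ennreal (A j) * X j) + ennreal R" and fin: "\<And>i. X i < \<infinity>"
    and A: "\<And>j. 0 \<le> A j" "real CARD('n) * (\<Sum>j\<in>UNIV. A j) \<le> 1 / 2" and R: "0 \<le> R"
  shows "X i \<le> ennreal (2 * real CARD('n) * R)"
proof -
  define y where "y i = enn2real (X i)" for i
  have Xy: "X i = ennreal (y i)" and y0: "0 \<le> y i" for i using fin[of i] by (auto simp: y_def less_top)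
  define S where "S = (\<Sum>i\<in>UNIV. y i)"
  have S0: "0 \<le> S" unfolding S_def by (intro sum_nonneg y0)
  have yS: "y i \<le> S" for i unfolding S_def by (rule member_le_sum) (auto simp: y0)
  have "y i \<le> (\<Sum>j\<in>UNIV. A j * y j) + R" for i
  proof -
    have "ennreal (y i) \<le> ennreal ((\<Sum>j\<in>UNIV. A j * y j) + R)"
      using X[of i] A y0 R by (simp add: Xy ennreal_mult[symmetric] sum_nonneg ennreal_plus)
    then show ?thesis using A y0 R by (subst (asm) ennreal_le_iff) (auto intro!: add_nonneg_nonneg sum_nonneg)
  qed
  moreover have "(\<Sum>j\<in>UNIV. A j * y j) \<le> (\<Sum>j\<in>UNIV. A j) * S"
    unfolding sum_distrib_right by (intro sum_mono mult_left_mono yS A)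
  ultimately have yi: "y i \<le> (\<Sum>j\<in>UNIV. A j) * S + R" for i using order_trans by (metis add_right_mono)
  have "S \<le> (\<Sum>i::'n\<in>UNIV. (\<Sum>j\<in>UNIV. A j) * S + R)" by (subst S_def) (intro sum_mono yi)
  also have "\<dots> = (real CARD('n) * (\<Sum>j\<in>UNIV. A j)) * S + real CARD('n) * R" by (simp add: algebra_simps)
  also have "\<dots> \<le> 1 / 2 * S + real CARD('n) * R" by (intro add_right_mono mult_right_mono A S0)
  finally have "S \<le> 2 * real CARD('n) * R" by simp
  then have "y i \<le> 2 * real CARD('n) * R" using yS[of i] by linarith
  then show ?thesis unfolding Xy by (rule ennreal_leI)
qed

subsection \<open>Vanishing for times near the middle\<close>

text \<open>Stated outside the locale: the components have different wave speeds, but their masses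
  must share one region and one weight to be comparable in a single system of inequalities.\<close>

definition carleman_mass :: "real \<Rightarrow> real \<Rightarrow> real \<Rightarrow> real \<Rightarrow> real \<Rightarrow> (real \<times> real \<Rightarrow> real) \<Rightarrow> real \<Rightarrow> ennreal" where
  "carleman_mass L T x0 \<kappa> M G lam = (\<integral>\<^sup>+z. indicator {z. snd z \<in> {0<..<L} \<and> psi x0 \<kappa> (T / 2) z < M} z *
     ennreal ((exp (- lam * psi x0 \<kappa> (T / 2) z))\<^sup>2 * (G z)\<^sup>2) \<partial>lborel)"

text \<open>Admits the Gaussian multiplied by sin (lam x) or cos (lam x). The factor lam (2 L + 1)
  collects the derivative of the Gaussian, at most 2 lam L, and that of the oscillation, at most
  lam.\<close>

definition carleman_profile :: "real \<Rightarrow> real \<Rightarrow> real \<Rightarrow> (real \<Rightarrow> real) \<Rightarrow> bool" where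
  "carleman_profile L x0 lam \<beta> \<longleftrightarrow> smooth \<beta> \<and> (\<forall>x. \<bar>\<beta> x\<bar> \<le> exp (- lam * (x - x0)\<^sup>2)) \<and>
     (\<forall>x\<in>{0<..<L}. \<bar>deriv \<beta> x\<bar> \<le> exp (- lam * (x - x0)\<^sup>2) * (lam * (2 * L + 1)))"

definition time_weight :: "real \<Rightarrow> real \<Rightarrow> real \<Rightarrow> real \<Rightarrow> real" where
  "time_weight T \<kappa> lam t = exp (- lam * (\<kappa> * (t - T / 2)\<^sup>2))"

lemma time_weight_deriv:
  "(time_weight T \<kappa> lam has_real_derivative - lam * (\<kappa> * (2 * (t - T / 2))) * time_weight T \<kappa> lam t) (at t)"
  unfolding time_weight_def[abs_def] by (auto intro!: derivative_eq_intros)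

lemma time_weight_deriv_cont: "continuous_on S (\<lambda>t. - lam * (\<kappa> * (2 * (t - T / 2))) * time_weight T \<kappa> lam t)"
  unfolding time_weight_def by (intro continuous_intros)

definition weighted_majorant :: "real \<Rightarrow> real \<Rightarrow> real \<Rightarrow> (real \<Rightarrow> real \<Rightarrow> real) \<Rightarrow> real \<Rightarrow> real \<Rightarrow> real \<Rightarrow> (real \<Rightarrow> ennreal) \<Rightarrow> bool" where
  "weighted_majorant L T \<gamma> u x0 \<kappa> lam B \<longleftrightarrow> B \<in> borel_measurable borel \<and>
    (\<forall>t\<in>{0..T}. \<forall>\<beta>. carleman_profile L x0 lam \<beta> \<longrightarrow> (\<integral>\<^sup>+x. indicator {0<..<L} x * ennreal
      ((time_weight T \<kappa> lam t * (\<beta> x * u t x))\<^sup>2 + \<gamma> * (dx L (\<lambda>x. time_weight T \<kappa> lam t * (\<beta> x * u t x)) x)\<^sup>2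
        + (dt L T (\<lambda>t x. time_weight T \<kappa> lam t * (\<beta> x * u t x)) t x)\<^sup>2) \<partial>lborel) \<le> B t)"

text \<open>The Carleman estimate in the form used for absorption. The mass comes with 1 / lam^2.
  The second term stems from the points outside {\<psi> < M}, where the squared weight is at most
  exp (- 2 lam M) and only a crude energy bound is known.\<close>

definition component_estimate ::
  "real \<Rightarrow> real \<Rightarrow> real \<Rightarrow> (real \<Rightarrow> real \<Rightarrow> real) \<Rightarrow> real \<Rightarrow> real \<Rightarrow> real \<Rightarrow> (real \<times> real \<Rightarrow> real) \<Rightarrow> real \<Rightarrow> real \<Rightarrow> bool" where
  "component_estimate L T \<gamma> u x0 \<kappa> M G A K \<longleftrightarrow> 0 \<le> A \<and> 0 \<le> K \<and>
    (\<forall>lam\<ge>1. \<exists>B. weighted_majorant L T \<gamma> u x0 \<kappa> lam B \<and> (\<integral>\<^sup>+t. indicator {0<..<T} t * B t \<partial>lborel)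
      \<le> ennreal (A / lam\<^sup>2) * carleman_mass L T x0 \<kappa> M G lam + ennreal (K * lam\<^sup>2 * exp (- 2 * lam * M)))"

lemma ennreal_linear_combination:
  assumes "0 \<le> p" "0 \<le> q" "0 \<le> r" "0 \<le> \<gamma>" "0 \<le> K"
  shows "ennreal 2 * ennreal p + ennreal (2 * \<gamma>) * ennreal q + ennreal K * ennreal r = ennreal (2 * (p + \<gamma> * q) + K * r)"
    and "ennreal 2 * ennreal p + ennreal K * ennreal r = ennreal (2 * p + K * r)"
  using assms by (simp_all add: ennreal_mult ennreal_plus distrib_left mult.assoc)

context wave_vanish
begin

lemma carleman_mass_eq: "carleman_mass L T x0 \<kappa> M G lam = (\<integral>\<^sup>+z. indicator D z * ennreal ((m lam z)\<^sup>2 * (G z)\<^sup>2) \<partial>lborel)"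
  by (simp add: carleman_mass_def D_def m_def \<psi>_def)

lemma density_measurable:
  assumes "t \<in> {0..T}"
  shows "(\<lambda>x. indicator D (t, x) * ennreal ((m lam (t, x))\<^sup>2 * ((zext L (dt L T u t) x)\<^sup>2 + \<gamma> * (zext L (dx L (u t)) x)\<^sup>2))) \<in> borel_measurable lebesgue"
    and "(\<lambda>x. indicator D (t, x) * ennreal ((m lam (t, x))\<^sup>2 * (zext L (u t) x)\<^sup>2)) \<in> borel_measurable lebesgue"
proof -
  have [measurable]: "zext L (dt L T u t) \<in> borel_measurable lebesgue" "zext L (dx L (u t)) \<in> borel_measurable lebesgue"
    "zext L (u t) \<in> borel_measurable lebesgue"
    using u_L2[OF assms] dx_u_L2[OF assms] dt_u_L2[OF assms] by (simp_all add: measurable_zext L2_def)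
  have "(\<lambda>x. m lam (t, x)) \<in> borel_measurable borel" "(\<lambda>x. indicator D (t, x) :: ennreal) \<in> borel_measurable borel" by measurable
  then have [measurable]: "(\<lambda>x. m lam (t, x)) \<in> borel_measurable lebesgue" "(\<lambda>x. indicator D (t, x) :: ennreal) \<in> borel_measurable lebesgue"
    by (auto intro: measurable_completion)
  show "(\<lambda>x. indicator D (t, x) * ennreal ((m lam (t, x))\<^sup>2 * ((zext L (dt L T u t) x)\<^sup>2 + \<gamma> * (zext L (dx L (u t)) x)\<^sup>2))) \<in> borel_measurable lebesgue"
    "(\<lambda>x. indicator D (t, x) * ennreal ((m lam (t, x))\<^sup>2 * (zext L (u t) x)\<^sup>2)) \<in> borel_measurable lebesgue"
    by measurable
qed

lemma En_zext: "En lam t = (\<integral>\<^sup>+x. indicator D (t, x) * ennreal ((m lam (t, x))\<^sup>2 * ((zext L (dt L T u t) x)\<^sup>2 + \<gamma> * (zext L (dx L (u t)) x)\<^sup>2)) \<partial>lebesgue)"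
  and Zn_zext: "Zn lam t = (\<integral>\<^sup>+x. indicator D (t, x) * ennreal ((m lam (t, x))\<^sup>2 * (zext L (u t) x)\<^sup>2) \<partial>lebesgue)"
  unfolding En_def Zn_def by (intro nn_integral_cong; simp add: zext_def D_def split: split_indicator)+

text \<open>Inside D the weighted energies \<open>En\<close> and \<open>Zn\<close> take over.
  Outside D the squared weight is bounded by its value on the boundary level M, and
  \<open>K1\<close> bounds the unweighted energy.\<close>

lemma weighted_energy:
  assumes lam: "1 \<le> lam" and \<beta>: "carleman_profile L x0 lam \<beta>" and t: "t \<in> {0..T}"
  defines "w \<equiv> (\<lambda>t x. time_weight T \<kappa> lam t * (\<beta> x * u t x))"
  defines "K0 \<equiv> 1 + 2 * \<gamma> * (2 * L + 1)\<^sup>2 + 2 * (\<kappa> * T)\<^sup>2"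
  assumes K1: "2 * ((norm (V t))\<^sup>2 + \<gamma> * (norm (X t))\<^sup>2) + K0 * (norm (U t))\<^sup>2 \<le> K1"
  shows "(\<integral>\<^sup>+x. indicator {0<..<L} x * ennreal ((w t x)\<^sup>2 + \<gamma> * (dx L (w t) x)\<^sup>2 + (dt L T w t x)\<^sup>2) \<partial>lborel)
    \<le> ennreal 2 * En lam t + ennreal (lam\<^sup>2 * K0) * Zn lam t + ennreal (K1 * lam\<^sup>2 * exp (- 2 * lam * M))"
proof -
  let ?m = "\<lambda>x. m lam (t, x)"
  let ?a = "zext L (u t)" and ?b = "zext L (dx L (u t))" and ?c = "zext L (dt L T u t)"
  have lam2: "1 \<le> lam\<^sup>2" using lam by simp
  have K00: "0 \<le> K0" using \<gamma>0 by (auto simp: K0_def intro!: add_nonneg_nonneg mult_nonneg_nonneg)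
  have bs: "smooth \<beta>" "\<And>x. \<bar>\<beta> x\<bar> \<le> exp (- lam * (x - x0)\<^sup>2)" "\<And>x. x \<in> {0<..<L} \<Longrightarrow> \<bar>deriv \<beta> x\<bar> \<le> exp (- lam * (x - x0)\<^sup>2) * (lam * (2 * L + 1))"
    using \<beta> by (auto simp: carleman_profile_def)
  have me: "time_weight T \<kappa> lam t * exp (- lam * (x - x0)\<^sup>2) = ?m x" for x
    by (simp add: m_def \<psi>_def psi_def time_weight_def exp_add[symmetric] algebra_simps)
  have tw0: "0 \<le> time_weight T \<kappa> lam t" by (simp add: time_weight_def)
  have b1: "\<bar>time_weight T \<kappa> lam t * \<beta> x\<bar> \<le> ?m x" for x
    unfolding me[symmetric] abs_mult abs_of_nonneg[OF tw0] by (intro mult_left_mono bs tw0)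
  have b2: "\<bar>time_weight T \<kappa> lam t * deriv \<beta> x\<bar> \<le> ?m x * (lam * (2 * L + 1))" if "x \<in> {0<..<L}" for x
    unfolding me[symmetric] abs_mult abs_of_nonneg[OF tw0] mult.assoc by (intro mult_left_mono bs(3)[OF that] tw0)
  have b3: "\<bar>- lam * (\<kappa> * (2 * (t - T / 2))) * time_weight T \<kappa> lam t * \<beta> x\<bar> \<le> ?m x * (lam * (\<kappa> * T))" for x
  proof -
    have "\<bar>2 * (t - T / 2)\<bar> \<le> T" using t by (auto simp: abs_le_iff)
    then have "\<bar>- lam * (\<kappa> * (2 * (t - T / 2)))\<bar> \<le> lam * (\<kappa> * T)"
      using lam \<kappa>0 by (simp add: abs_mult mult_left_mono)
    then have "\<bar>- lam * (\<kappa> * (2 * (t - T / 2)))\<bar> * \<bar>time_weight T \<kappa> lam t * \<beta> x\<bar> \<le> (lam * (\<kappa> * T)) * ?m x"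
      by (intro mult_mono b1) auto
    then show ?thesis by (simp add: abs_mult mult_ac)
  qed
  have wd: "AE x in lebesgue_on {0<..<L}. (w t x)\<^sup>2 + \<gamma> * (dx L (w t) x)\<^sup>2 + (dt L T w t x)\<^sup>2
    \<le> (?m x)\<^sup>2 * (2 * ((dt L T u t x)\<^sup>2 + \<gamma> * (dx L (u t) x)\<^sup>2) + (1 + 2 * \<gamma> * (lam * (2 * L + 1))\<^sup>2 + 2 * (lam * (\<kappa> * T))\<^sup>2) * (u t x)\<^sup>2)"
    unfolding w_def
    by (rule weighted_density[OF _ T0 bs(1) time_weight_deriv time_weight_deriv_cont t _ b1 b2 b3]) (use u0 u1 \<gamma>0 in auto)
  \<comment> \<open>As lam is at least 1, the summand 1 disappears into lam^2. The factor lam^2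
    produced by differentiating the weight is collected here, to be cancelled by
    \<open>Zn_bound\<close>.\<close>
  have kk: "1 + 2 * \<gamma> * (lam * (2 * L + 1))\<^sup>2 + 2 * (lam * (\<kappa> * T))\<^sup>2 \<le> lam\<^sup>2 * K0"
  proof -
    have "lam\<^sup>2 * K0 = lam\<^sup>2 + 2 * \<gamma> * (lam * (2 * L + 1))\<^sup>2 + 2 * (lam * (\<kappa> * T))\<^sup>2"
      by (simp only: K0_def power_mult_distrib) (simp only: distrib_left mult_1_right mult_ac)
    then show ?thesis using lam2 by simp
  qed
  have mM: "(?m x)\<^sup>2 \<le> exp (- 2 * lam * M)" if "x \<in> {0<..<L}" "(t, x) \<notin> D" for x
  proof -
    have "M \<le> \<psi> (t, x)" using that by (simp add: D_def)
    then have "lam * M \<le> lam * \<psi> (t, x)" using lam by (intro mult_left_mono) auto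
    then show ?thesis by (simp add: m_def power2_eq_square exp_add[symmetric])
  qed
  let ?f1 = "\<lambda>x. indicator D (t, x) * ennreal ((?m x)\<^sup>2 * ((?c x)\<^sup>2 + \<gamma> * (?b x)\<^sup>2))"
  let ?f2 = "\<lambda>x. indicator D (t, x) * ennreal ((?m x)\<^sup>2 * (?a x)\<^sup>2)"
  let ?f3 = "\<lambda>x. ennreal 2 * ennreal ((?c x)\<^sup>2) + ennreal (2 * \<gamma>) * ennreal ((?b x)\<^sup>2) + ennreal (lam\<^sup>2 * K0) * ennreal ((?a x)\<^sup>2)"
  have [measurable]: "?a \<in> borel_measurable lebesgue" "?b \<in> borel_measurable lebesgue" "?c \<in> borel_measurable lebesgue"
    using u_L2[OF t] dx_u_L2[OF t] dt_u_L2[OF t] by (simp_all add: measurable_zext L2_def)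
  note [measurable] = density_measurable[OF t]
  have sq: "ennreal ((zext L v x)\<^sup>2) = indicator {0<..<L} x * ennreal ((v x)\<^sup>2)" for v x by (simp add: zext_def)
  have n: "(\<integral>\<^sup>+x. ennreal ((zext L v x)\<^sup>2) \<partial>lebesgue) = ennreal ((norm (l2c L v))\<^sup>2)" if "v \<in> L2 {0<..<L}" for v
    using nn_integral_L2[OF that] by (simp only: sq nn_integral_completion)
  have "(\<integral>\<^sup>+x. indicator {0<..<L} x * ennreal ((w t x)\<^sup>2 + \<gamma> * (dx L (w t) x)\<^sup>2 + (dt L T w t x)\<^sup>2) \<partial>lborel)
      = (\<integral>\<^sup>+x. indicator {0<..<L} x * ennreal ((w t x)\<^sup>2 + \<gamma> * (dx L (w t) x)\<^sup>2 + (dt L T w t x)\<^sup>2) \<partial>lebesgue)"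
    by (simp add: nn_integral_completion)
  also have "\<dots> \<le> (\<integral>\<^sup>+x. ennreal 2 * ?f1 x + ennreal (lam\<^sup>2 * K0) * ?f2 x + ennreal (exp (- 2 * lam * M)) * ?f3 x \<partial>lebesgue)"
  proof (rule nn_integral_mono_AE, use wd[unfolded AE_zext] in eventually_elim)
    case (elim x)
    show ?case
    proof (cases "x \<in> {0<..<L}")
      case True
      define e where "e = (?c x)\<^sup>2 + \<gamma> * (?b x)\<^sup>2"
      define a where "a = (?a x)\<^sup>2"
      have e0: "0 \<le> e" "0 \<le> a" using \<gamma>0 by (simp_all add: e_def a_def)
      have z: "u t x = ?a x" "dx L (u t) x = ?b x" "dt L T u t x = ?c x" using True by (simp_all add: zext_def)
      have "(w t x)\<^sup>2 + \<gamma> * (dx L (w t) x)\<^sup>2 + (dt L T w t x)\<^sup>2 \<le> (?m x)\<^sup>2 * (2 * e + (1 + 2 * \<gamma> * (lam * (2 * L + 1))\<^sup>2 + 2 * (lam * (\<kappa> * T))\<^sup>2) * a)"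
        using elim[rule_format, OF True] unfolding z e_def a_def .
      also have "\<dots> \<le> (?m x)\<^sup>2 * (2 * e + (lam\<^sup>2 * K0) * a)"
        by (intro mult_left_mono add_left_mono mult_right_mono kk e0) auto
      finally have le: "(w t x)\<^sup>2 + \<gamma> * (dx L (w t) x)\<^sup>2 + (dt L T w t x)\<^sup>2 \<le> (?m x)\<^sup>2 * (2 * e + (lam\<^sup>2 * K0) * a)" .
      have f3: "?f3 x = ennreal (2 * e + (lam\<^sup>2 * K0) * a)"
        unfolding e_def a_def by (rule ennreal_linear_combination) (use \<gamma>0 K00 in auto)
      show ?thesis
      proof (cases "(t, x) \<in> D")
        case D: True
        have "ennreal ((w t x)\<^sup>2 + \<gamma> * (dx L (w t) x)\<^sup>2 + (dt L T w t x)\<^sup>2) \<le> ennreal (2 * ((?m x)\<^sup>2 * e) + (lam\<^sup>2 * K0) * ((?m x)\<^sup>2 * a))"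
          using le by (intro ennreal_leI) (simp add: algebra_simps)
        also have "\<dots> = ennreal 2 * ?f1 x + ennreal (lam\<^sup>2 * K0) * ?f2 x"
          unfolding e_def[symmetric] a_def[symmetric] using D e0 K00
          by (subst ennreal_linear_combination(2)[symmetric]) auto
        also have "\<dots> \<le> ennreal 2 * ?f1 x + ennreal (lam\<^sup>2 * K0) * ?f2 x + ennreal (exp (- 2 * lam * M)) * ?f3 x" by simp
        finally show ?thesis using True by simp
      next
        case D: False
        have "(w t x)\<^sup>2 + \<gamma> * (dx L (w t) x)\<^sup>2 + (dt L T w t x)\<^sup>2 \<le> exp (- 2 * lam * M) * (2 * e + (lam\<^sup>2 * K0) * a)"
          by (rule order_trans[OF le mult_right_mono[OF mM[OF True D]]]) (use e0 K00 in auto)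
        then have "ennreal ((w t x)\<^sup>2 + \<gamma> * (dx L (w t) x)\<^sup>2 + (dt L T w t x)\<^sup>2) \<le> ennreal (exp (- 2 * lam * M)) * ?f3 x"
          unfolding f3 using e0 K00 by (subst ennreal_mult[symmetric]) (auto intro: ennreal_leI)
        then show ?thesis using True D by simp
      qed
    qed simp
  qed
  also have "\<dots> = ennreal 2 * En lam t + ennreal (lam\<^sup>2 * K0) * Zn lam t + ennreal (exp (- 2 * lam * M)) * (\<integral>\<^sup>+x. ?f3 x \<partial>lebesgue)"
    unfolding En_zext Zn_zext by (simp add: nn_integral_add nn_integral_cmult)
  also have "(\<integral>\<^sup>+x. ?f3 x \<partial>lebesgue) = ennreal 2 * ennreal ((norm (V t))\<^sup>2) + ennreal (2 * \<gamma>) * ennreal ((norm (X t))\<^sup>2) + ennreal (lam\<^sup>2 * K0) * ennreal ((norm (U t))\<^sup>2)"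
    unfolding U_def V_def X_def n[OF u_L2[OF t], symmetric] n[OF dx_u_L2[OF t], symmetric] n[OF dt_u_L2[OF t], symmetric]
    by (simp add: nn_integral_add nn_integral_cmult)
  also have "\<dots> = ennreal (2 * ((norm (V t))\<^sup>2 + \<gamma> * (norm (X t))\<^sup>2) + lam\<^sup>2 * K0 * (norm (U t))\<^sup>2)"
    by (rule ennreal_linear_combination) (use \<gamma>0 K00 in auto)
  also have "\<dots> \<le> ennreal (K1 * lam\<^sup>2)"
  proof (rule ennreal_leI)
    have "2 * ((norm (V t))\<^sup>2 + \<gamma> * (norm (X t))\<^sup>2) * 1 \<le> 2 * ((norm (V t))\<^sup>2 + \<gamma> * (norm (X t))\<^sup>2) * lam\<^sup>2"
      using \<gamma>0 by (intro mult_left_mono lam2) auto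
    moreover have "(2 * ((norm (V t))\<^sup>2 + \<gamma> * (norm (X t))\<^sup>2) + K0 * (norm (U t))\<^sup>2) * lam\<^sup>2 \<le> K1 * lam\<^sup>2"
      by (intro mult_right_mono K1) auto
    ultimately show "2 * ((norm (V t))\<^sup>2 + \<gamma> * (norm (X t))\<^sup>2) + lam\<^sup>2 * K0 * (norm (U t))\<^sup>2 \<le> K1 * lam\<^sup>2"
      by (simp add: algebra_simps)
  qed
  finally have "(\<integral>\<^sup>+x. indicator {0<..<L} x * ennreal ((w t x)\<^sup>2 + \<gamma> * (dx L (w t) x)\<^sup>2 + (dt L T w t x)\<^sup>2) \<partial>lborel)
    \<le> ennreal 2 * En lam t + ennreal (lam\<^sup>2 * K0) * Zn lam t + ennreal (exp (- 2 * lam * M)) * ennreal (K1 * lam\<^sup>2)"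
    by (simp add: mult_left_mono add_left_mono)
  moreover have "ennreal (exp (- 2 * lam * M)) * ennreal (K1 * lam\<^sup>2) = ennreal (K1 * lam\<^sup>2 * exp (- 2 * lam * M))"
    by (subst ennreal_mult'[symmetric]) (auto simp: mult_ac)
  ultimately show ?thesis by simp
qed

lemma component_bound:
  "\<exists>A K. component_estimate L T \<gamma> u x0 \<kappa> M G A K"
proof -
  define K0 where "K0 = 1 + 2 * \<gamma> * (2 * L + 1)\<^sup>2 + 2 * (\<kappa> * T)\<^sup>2"
  have K00: "0 \<le> K0" using \<gamma>0 by (auto simp: K0_def intro!: add_nonneg_nonneg mult_nonneg_nonneg)
  have "continuous_on {0..T} (\<lambda>t. 2 * ((norm (V t))\<^sup>2 + \<gamma> * (norm (X t))\<^sup>2) + K0 * (norm (U t))\<^sup>2)"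
    by (intro continuous_intros U_cont V_cont X_cont)
  from continuous_attains_sup[OF compact_Icc _ this] T0
  obtain t1 where t1: "\<forall>t\<in>{0..T}. 2 * ((norm (V t))\<^sup>2 + \<gamma> * (norm (X t))\<^sup>2) + K0 * (norm (U t))\<^sup>2 \<le> 2 * ((norm (V t1))\<^sup>2 + \<gamma> * (norm (X t1))\<^sup>2) + K0 * (norm (U t1))\<^sup>2"
    by auto
  define K1 where "K1 = 2 * ((norm (V t1))\<^sup>2 + \<gamma> * (norm (X t1))\<^sup>2) + K0 * (norm (U t1))\<^sup>2"
  have K10: "0 \<le> K1" using \<gamma>0 K00 by (simp add: K1_def)
  \<comment> \<open>The 2 belongs to \<open>En\<close>. The fraction is K0 times the constant of
    \<open>Zn_bound\<close>, whose 1 / lam^2 has cancelled the lam^2 in front of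
    \<open>Zn\<close>.\<close>
  define c where "c = 2 + K0 / (4 * \<delta>\<^sup>2 * \<gamma>)"
  have c0: "0 \<le> c" using K00 \<gamma>0 by (simp add: c_def)
  have dg: "0 < \<delta>\<^sup>2 * \<gamma>" using \<delta>0 \<gamma>0 by simp
  show ?thesis unfolding component_estimate_def weighted_majorant_def
  proof (rule exI[of _ "c * (4 / (\<delta>\<^sup>2 * \<gamma>))"], rule exI[of _ "K1 * T"], intro conjI allI impI)
    show "0 \<le> c * (4 / (\<delta>\<^sup>2 * \<gamma>))" "0 \<le> K1 * T" using c0 K10 T0 dg by simp_all
    fix lam :: real assume lam: "1 \<le> lam"
    then have lam0: "0 < lam" by simp
    obtain B where B[measurable]: "B \<in> borel_measurable borel" and BE: "\<And>t. En lam t \<le> B t"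
      and Bi: "(\<integral>\<^sup>+t. B t \<partial>lborel) \<le> ennreal (4 / (lam * \<delta> * sqrt \<gamma>)\<^sup>2) * (\<integral>\<^sup>+z. indicator D z * ennreal ((m lam z)\<^sup>2 * (G z)\<^sup>2) \<partial>lborel)"
      using En_bound[OF lam0] by blast
    let ?r = "K1 * lam\<^sup>2 * exp (- 2 * lam * M)"
    have r0: "0 \<le> ?r" using K10 by simp
    have 1: "(\<integral>\<^sup>+x. indicator {0<..<L} x * ennreal
      ((time_weight T \<kappa> lam t * (\<beta> x * u t x))\<^sup>2 + \<gamma> * (dx L (\<lambda>x. time_weight T \<kappa> lam t * (\<beta> x * u t x)) x)\<^sup>2
        + (dt L T (\<lambda>t x. time_weight T \<kappa> lam t * (\<beta> x * u t x)) t x)\<^sup>2) \<partial>lborel) \<le> ennreal c * B t + ennreal ?r"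
      if t: "t \<in> {0..T}" and \<beta>: "carleman_profile L x0 lam \<beta>" for t \<beta>
    proof -
      have "(\<integral>\<^sup>+x. indicator {0<..<L} x * ennreal
      ((time_weight T \<kappa> lam t * (\<beta> x * u t x))\<^sup>2 + \<gamma> * (dx L (\<lambda>x. time_weight T \<kappa> lam t * (\<beta> x * u t x)) x)\<^sup>2
        + (dt L T (\<lambda>t x. time_weight T \<kappa> lam t * (\<beta> x * u t x)) t x)\<^sup>2) \<partial>lborel) \<le> ennreal 2 * En lam t + ennreal (lam\<^sup>2 * K0) * Zn lam t + ennreal ?r"
        unfolding K0_def by (rule weighted_energy[OF lam \<beta> t]) (use t1 t in \<open>auto simp: K1_def K0_def\<close>)
      also have "\<dots> \<le> ennreal 2 * En lam t + ennreal (lam\<^sup>2 * K0) * (ennreal (1 / (4 * lam\<^sup>2 * \<delta>\<^sup>2 * \<gamma>)) * En lam t) + ennreal ?r"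
        by (intro add_mono mult_left_mono Zn_bound lam0 t) auto
      also have "ennreal (lam\<^sup>2 * K0) * (ennreal (1 / (4 * lam\<^sup>2 * \<delta>\<^sup>2 * \<gamma>)) * En lam t) = ennreal (K0 / (4 * \<delta>\<^sup>2 * \<gamma>)) * En lam t"
        unfolding mult.assoc[symmetric] using K00 \<gamma>0 lam0 by (subst ennreal_mult[symmetric]) (auto simp: field_simps)
      also have "ennreal 2 * En lam t + ennreal (K0 / (4 * \<delta>\<^sup>2 * \<gamma>)) * En lam t = ennreal c * En lam t"
        unfolding c_def using K00 \<gamma>0 by (subst ennreal_plus) (auto simp: distrib_right)
      also have "ennreal c * En lam t + ennreal ?r \<le> ennreal c * B t + ennreal ?r"
        by (intro add_mono mult_left_mono BE) auto
      finally show ?thesis .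
    qed
    have 2: "(\<integral>\<^sup>+t. indicator {0<..<T} t * (ennreal c * B t + ennreal ?r) \<partial>lborel)
      \<le> ennreal (c * (4 / (\<delta>\<^sup>2 * \<gamma>)) / lam\<^sup>2) * carleman_mass L T x0 \<kappa> M G lam + ennreal (K1 * T * lam\<^sup>2 * exp (- 2 * lam * M))"
    proof -
      have "(\<integral>\<^sup>+t. indicator {0<..<T} t * (ennreal c * B t + ennreal ?r) \<partial>lborel) \<le> (\<integral>\<^sup>+t. ennreal c * B t + ennreal ?r * indicator {0<..<T} t \<partial>lborel)"
        by (intro nn_integral_mono) (auto split: split_indicator)
      also have "\<dots> = ennreal c * (\<integral>\<^sup>+t. B t \<partial>lborel) + ennreal ?r * ennreal T"
        using T0 by (simp add: nn_integral_add nn_integral_cmult nn_integral_cmult_indicator)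
      also have "\<dots> \<le> ennreal c * (ennreal (4 / (lam * \<delta> * sqrt \<gamma>)\<^sup>2) * carleman_mass L T x0 \<kappa> M G lam) + ennreal ?r * ennreal T"
        unfolding carleman_mass_eq by (intro add_mono mult_left_mono Bi) auto
      also have "ennreal c * (ennreal (4 / (lam * \<delta> * sqrt \<gamma>)\<^sup>2) * carleman_mass L T x0 \<kappa> M G lam) = ennreal (c * (4 / (\<delta>\<^sup>2 * \<gamma>)) / lam\<^sup>2) * carleman_mass L T x0 \<kappa> M G lam"
        unfolding mult.assoc[symmetric] using c0 \<gamma>0
        by (subst ennreal_mult[symmetric]) (auto simp: power_mult_distrib field_simps)
      also have "ennreal ?r * ennreal T = ennreal (K1 * T * lam\<^sup>2 * exp (- 2 * lam * M))"
        using r0 T0 by (subst ennreal_mult[symmetric]) (auto simp: mult_ac)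
      finally show ?thesis .
    qed
    let ?B = "\<lambda>t. ennreal c * B t + ennreal ?r"
    have 0: "?B \<in> borel_measurable borel" by measurable
    show "\<exists>B. (B \<in> borel_measurable borel \<and>
    (\<forall>t\<in>{0..T}. \<forall>\<beta>. carleman_profile L x0 lam \<beta> \<longrightarrow> (\<integral>\<^sup>+x. indicator {0<..<L} x * ennreal
      ((time_weight T \<kappa> lam t * (\<beta> x * u t x))\<^sup>2 + \<gamma> * (dx L (\<lambda>x. time_weight T \<kappa> lam t * (\<beta> x * u t x)) x)\<^sup>2
        + (dt L T (\<lambda>t x. time_weight T \<kappa> lam t * (\<beta> x * u t x)) t x)\<^sup>2) \<partial>lborel) \<le> B t)) \<and>
    (\<integral>\<^sup>+t. indicator {0<..<T} t * B t \<partial>lborel) \<le> ennreal (c * (4 / (\<delta>\<^sup>2 * \<gamma>)) / lam\<^sup>2) * carleman_mass L T x0 \<kappa> M G lam + ennreal (K1 * T * lam\<^sup>2 * exp (- 2 * lam * M))"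
      using 0 1 2 by (intro exI[of _ ?B]) simp
  qed
qed

text \<open>For times within \<epsilon> of T/2 the spatial part of \<psi> is at most L^2 and the
  temporal part at most L^2 / 2. So the full space section lies in D, M being 2 L^2, and the squared
  weight is at least exp (- 3 lam L^2). Removing the weight therefore costs exp (3 lam L^2).\<close>

lemma slab_bound:
  assumes M: "M = 2 * L\<^sup>2" and \<epsilon>: "\<epsilon> \<le> T / 4" "\<kappa> * \<epsilon>\<^sup>2 \<le> L\<^sup>2 / 2"
  shows "\<exists>K\<ge>0. \<forall>lam\<ge>1. (\<integral>\<^sup>+t. indicator {T / 2 - \<epsilon><..<T / 2 + \<epsilon>} t * ennreal ((norm (U t))\<^sup>2) \<partial>lborel)
    \<le> ennreal (K * exp (3 * lam * L\<^sup>2)) * carleman_mass L T x0 \<kappa> M G lam"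
proof (intro exI conjI allI impI)
  show "0 \<le> 1 / (4 * \<delta>\<^sup>2 * \<gamma>) * (4 / (\<delta>\<^sup>2 * \<gamma>))" using \<gamma>0 by simp
  fix lam :: real assume lam: "1 \<le> lam"
  then have lam0: "0 < lam" by simp
  obtain B where B[measurable]: "B \<in> borel_measurable borel" and BE: "\<And>t. En lam t \<le> B t"
    and Bi: "(\<integral>\<^sup>+t. B t \<partial>lborel) \<le> ennreal (4 / (lam * \<delta> * sqrt \<gamma>)\<^sup>2) * carleman_mass L T x0 \<kappa> M G lam"
    unfolding carleman_mass_eq using En_bound[OF lam0] by blast
  let ?e = "exp (3 * lam * L\<^sup>2)" and ?k = "1 / (4 * lam\<^sup>2 * \<delta>\<^sup>2 * \<gamma>)"
  have 1: "ennreal ((norm (U t))\<^sup>2) \<le> ennreal (?e * ?k) * B t" if tt: "t \<in> {T / 2 - \<epsilon><..<T / 2 + \<epsilon>}" for t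
  proof -
    have t: "t \<in> {0..T}" using tt \<epsilon> T0 by auto
    have "\<bar>t - T / 2\<bar> \<le> \<bar>\<epsilon>\<bar>" using tt by (auto simp: abs_le_iff abs_if)
    then have "(t - T / 2)\<^sup>2 \<le> \<epsilon>\<^sup>2" by (simp only: abs_le_square_iff)
    then have "\<kappa> * (t - T / 2)\<^sup>2 \<le> \<kappa> * \<epsilon>\<^sup>2" using \<kappa>0 by simp
    then have tk: "\<kappa> * (t - T / 2)\<^sup>2 \<le> L\<^sup>2 / 2" using \<epsilon> by linarith
    have pt: "indicator {0<..<L} x * ennreal ((u t x)\<^sup>2) \<le> ennreal ?e * (indicator D (t, x) * ennreal ((m lam (t, x))\<^sup>2 * (zext L (u t) x)\<^sup>2))" for x
    proof (cases "x \<in> {0<..<L}")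
      case True
      have "\<bar>x - x0\<bar> \<le> \<bar>L\<bar>" using True x0 \<delta>0 by (auto simp: abs_le_iff)
      then have "(x - x0)\<^sup>2 \<le> L\<^sup>2" by (simp only: abs_le_square_iff)
      then have p: "\<psi> (t, x) \<le> 3 * L\<^sup>2 / 2" using tk by (simp add: \<psi>_def psi_def)
      have "0 < L\<^sup>2" using L0 by simp
      then have "\<psi> (t, x) < M" using p unfolding M by linarith
      then have D: "(t, x) \<in> D" using True by (simp add: D_def)
      have "2 * (lam * \<psi> (t, x)) \<le> 3 * lam * L\<^sup>2" using mult_left_mono[OF p, of "2 * lam"] lam by simp
      then have "1 \<le> exp (3 * lam * L\<^sup>2 - 2 * (lam * \<psi> (t, x)))" by simp
      also have "\<dots> = ?e * (m lam (t, x))\<^sup>2" by (simp add: m_def power2_eq_square exp_add[symmetric])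
      finally have "1 * (u t x)\<^sup>2 \<le> (?e * (m lam (t, x))\<^sup>2) * (u t x)\<^sup>2" by (intro mult_right_mono) auto
      then have "ennreal ((u t x)\<^sup>2) \<le> ennreal ?e * ennreal ((m lam (t, x))\<^sup>2 * (u t x)\<^sup>2)"
        by (subst ennreal_mult[symmetric]) (auto intro: ennreal_leI simp: mult.assoc)
      then show ?thesis using True D by (simp add: zext_def)
    qed simp
    have "ennreal ((norm (U t))\<^sup>2) = (\<integral>\<^sup>+x. indicator {0<..<L} x * ennreal ((u t x)\<^sup>2) \<partial>lebesgue)"
      unfolding U_def nn_integral_L2[OF u_L2[OF t], symmetric] by (simp add: nn_integral_completion)
    also have "\<dots> \<le> (\<integral>\<^sup>+x. ennreal ?e * (indicator D (t, x) * ennreal ((m lam (t, x))\<^sup>2 * (zext L (u t) x)\<^sup>2)) \<partial>lebesgue)"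
      by (intro nn_integral_mono pt)
    also have "\<dots> = ennreal ?e * Zn lam t"
      unfolding Zn_zext by (rule nn_integral_cmult[OF density_measurable(2)[OF t]])
    also have "\<dots> \<le> ennreal ?e * (ennreal ?k * B t)"
      by (intro mult_left_mono order_trans[OF Zn_bound[OF lam0 t]] BE) auto
    also have "\<dots> = ennreal (?e * ?k) * B t"
      unfolding mult.assoc[symmetric] using \<gamma>0 by (subst ennreal_mult[symmetric]) auto
    finally show ?thesis .
  qed
  have "(\<integral>\<^sup>+t. indicator {T / 2 - \<epsilon><..<T / 2 + \<epsilon>} t * ennreal ((norm (U t))\<^sup>2) \<partial>lborel) \<le> (\<integral>\<^sup>+t. ennreal (?e * ?k) * B t \<partial>lborel)"
    using 1 by (intro nn_integral_mono) (auto split: split_indicator)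
  also have "\<dots> = ennreal (?e * ?k) * (\<integral>\<^sup>+t. B t \<partial>lborel)" by (rule nn_integral_cmult) simp
  also have "\<dots> \<le> ennreal (?e * ?k) * (ennreal (4 / (lam * \<delta> * sqrt \<gamma>)\<^sup>2) * carleman_mass L T x0 \<kappa> M G lam)"
    by (intro mult_left_mono Bi) auto
  also have "\<dots> = ennreal (?e * ?k * (4 / (lam * \<delta> * sqrt \<gamma>)\<^sup>2)) * carleman_mass L T x0 \<kappa> M G lam"
    unfolding mult.assoc[symmetric] using \<gamma>0 by (subst ennreal_mult[symmetric]) auto
  also have "\<dots> \<le> ennreal (1 / (4 * \<delta>\<^sup>2 * \<gamma>) * (4 / (\<delta>\<^sup>2 * \<gamma>)) * ?e) * carleman_mass L T x0 \<kappa> M G lam"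
  proof (intro mult_right_mono ennreal_leI)
    have l2: "1 \<le> lam\<^sup>2" using lam by simp
    have "?k \<le> 1 / (4 * \<delta>\<^sup>2 * \<gamma>)"
      using mult_right_mono[OF l2, of "4 * \<delta>\<^sup>2 * \<gamma>"] \<delta>0 \<gamma>0 lam0 by (intro divide_left_mono) (auto simp: mult_ac)
    moreover have "4 / (lam * \<delta> * sqrt \<gamma>)\<^sup>2 \<le> 4 / (\<delta>\<^sup>2 * \<gamma>)"
      using mult_right_mono[OF l2, of "\<delta>\<^sup>2 * \<gamma>"] \<delta>0 \<gamma>0 lam0 by (intro divide_left_mono) (auto simp: power_mult_distrib mult_ac)
    ultimately have "?k * (4 / (lam * \<delta> * sqrt \<gamma>)\<^sup>2) \<le> 1 / (4 * \<delta>\<^sup>2 * \<gamma>) * (4 / (\<delta>\<^sup>2 * \<gamma>))"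
      using \<gamma>0 by (intro mult_mono) auto
    from mult_right_mono[OF this, of ?e]
    show "?e * ?k * (4 / (lam * \<delta> * sqrt \<gamma>)\<^sup>2) \<le> 1 / (4 * \<delta>\<^sup>2 * \<gamma>) * (4 / (\<delta>\<^sup>2 * \<gamma>)) * ?e" by (simp add: mult_ac)
  qed simp
  finally show "(\<integral>\<^sup>+t. indicator {T / 2 - \<epsilon><..<T / 2 + \<epsilon>} t * ennreal ((norm (U t))\<^sup>2) \<partial>lborel)
    \<le> ennreal (1 / (4 * \<delta>\<^sup>2 * \<gamma>) * (4 / (\<delta>\<^sup>2 * \<gamma>)) * exp (3 * lam * L\<^sup>2)) * carleman_mass L T x0 \<kappa> M G lam" .
qed

end

section \<open>Recovering the weighted coupling from two oscillating weights\<close>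

lemma trig_combination:
  fixes a b s c k K :: real
  assumes sc: "s\<^sup>2 + c\<^sup>2 = 1" and k: "\<bar>k\<bar> \<le> K"
  shows "(s * a + c * b - k * (c * a - s * b))\<^sup>2 \<le> 2 * (1 + K\<^sup>2) * (a\<^sup>2 + b\<^sup>2)"
proof -
  define X where "X = s * a + c * b"
  define Y where "Y = c * a - s * b"
  \<comment> \<open>(X, Y) arises from (a, b) by an orthogonal map, so the sum of squares is
    preserved.\<close>
  have XY: "X\<^sup>2 + Y\<^sup>2 = a\<^sup>2 + b\<^sup>2"
  proof -
    have "X\<^sup>2 + Y\<^sup>2 = (s\<^sup>2 + c\<^sup>2) * (a\<^sup>2 + b\<^sup>2)" by (simp add: X_def Y_def power2_eq_square algebra_simps)
    then show ?thesis by (simp add: sc)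
  qed
  have X: "X\<^sup>2 \<le> a\<^sup>2 + b\<^sup>2" and Y: "Y\<^sup>2 \<le> a\<^sup>2 + b\<^sup>2"
    unfolding XY[symmetric] by simp_all
  have "\<bar>k\<bar> \<le> \<bar>K\<bar>" using k by simp
  then have k2: "k\<^sup>2 \<le> K\<^sup>2" by (simp only: abs_le_square_iff)
  have "(X - k * Y)\<^sup>2 + (X + k * Y)\<^sup>2 = 2 * X\<^sup>2 + 2 * (k\<^sup>2 * Y\<^sup>2)" by (simp add: power2_eq_square algebra_simps)
  then have "(X - k * Y)\<^sup>2 \<le> 2 * X\<^sup>2 + 2 * (k\<^sup>2 * Y\<^sup>2)" using zero_le_power2[of "X + k * Y"] by linarith
  also have "\<dots> \<le> 2 * (a\<^sup>2 + b\<^sup>2) + 2 * (K\<^sup>2 * (a\<^sup>2 + b\<^sup>2))"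
    by (intro add_mono mult_left_mono mult_mono X Y k2) auto
  finally show ?thesis unfolding X_def Y_def by (simp add: algebra_simps)
qed

text \<open>The two weighted couplings contain the wanted term f and the commutator P. Rotating by
  the phase lam x leaves P alone in the second component and f minus 2 y times that component in the
  first. The multiple 2 y, with y = x - x0, does not grow with lam: the oscillation has the same
  frequency as the decay rate of the Gaussian, so both derivatives carry the same factor
  \<open>l\<close>.\<close>

lemma trig_recombine:
  fixes a b s c y l E f P :: real
  assumes a: "a = \<tau> * (E * s) * f + \<tau> * (l * E * (c - 2 * y * s)) * P"
    and b: "b = \<tau> * (E * c) * f + \<tau> * (l * E * (- s - 2 * y * c)) * P" and sc: "s\<^sup>2 + c\<^sup>2 = 1"
  shows "\<tau> * E * f = s * a + c * b - (- 2 * y) * (c * a - s * b)"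
proof -
  have 1: "s * a + c * b = (\<tau> * E * f - 2 * y * (\<tau> * E * l * P)) * (s\<^sup>2 + c\<^sup>2)"
    unfolding a b by (simp add: power2_eq_square algebra_simps)
  have 2: "c * a - s * b = (\<tau> * E * l * P) * (s\<^sup>2 + c\<^sup>2)"
    unfolding a b by (simp add: power2_eq_square algebra_simps)
  show ?thesis unfolding 1 2 sc by simp
qed

lemma gauss_trig_deriv:
  fixes lam x0 :: real
  defines "e \<equiv> (\<lambda>x. exp (- lam * (x - x0)\<^sup>2))"
  shows "deriv (\<lambda>x. e x * sin (lam * x)) x = lam * e x * (cos (lam * x) - 2 * (x - x0) * sin (lam * x))"
    and "deriv (\<lambda>x. e x * cos (lam * x)) x = lam * e x * (- sin (lam * x) - 2 * (x - x0) * cos (lam * x))"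
  unfolding e_def
  by (rule DERIV_imp_deriv, (auto intro!: derivative_eq_intros simp: algebra_simps)[1])+

lemma carleman_profile_trig:
  assumes lam: "1 \<le> lam" and x0: "0 < x0" "x0 < L"
  shows "carleman_profile L x0 lam (\<lambda>x. exp (- lam * (x - x0)\<^sup>2) * sin (lam * x))"
    and "carleman_profile L x0 lam (\<lambda>x. exp (- lam * (x - x0)\<^sup>2) * cos (lam * x))"
proof -
  have "smooth (\<lambda>x. - lam * ((x - x0) * (x - x0)))"
    by (intro smooth_cmult smooth_mult smooth_diff smooth_ident smooth_const)
  then have e: "smooth (\<lambda>x. exp (- lam * (x - x0)\<^sup>2))"
    unfolding power2_eq_square by (rule smooth_exp)
  have b: "\<bar>lam * E * (p - 2 * (x - x0) * q)\<bar> \<le> E * (lam * (2 * L + 1))"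
    if "0 \<le> E" "\<bar>p\<bar> \<le> 1" "\<bar>q\<bar> \<le> 1" "x \<in> {0<..<L}" for E p q x
  proof -
    have "\<bar>x - x0\<bar> \<le> L" using that x0 by (auto simp: abs_le_iff)
    then have "\<bar>x - x0\<bar> * \<bar>q\<bar> \<le> L * 1" using that by (intro mult_mono) auto
    then have "\<bar>2 * (x - x0) * q\<bar> \<le> 2 * L" by (simp only: abs_mult)
    then have "\<bar>p - 2 * (x - x0) * q\<bar> \<le> 2 * L + 1" using that(2) by linarith
    then have "(lam * E) * \<bar>p - 2 * (x - x0) * q\<bar> \<le> (lam * E) * (2 * L + 1)" using lam that by (intro mult_left_mono) auto
    then show ?thesis using lam that by (simp add: abs_mult mult_ac)
  qed
  show "carleman_profile L x0 lam (\<lambda>x. exp (- lam * (x - x0)\<^sup>2) * sin (lam * x))"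
    unfolding carleman_profile_def gauss_trig_deriv
    by (intro conjI allI ballI smooth_mult e smooth_sin_cos b) (auto simp: abs_mult mult_left_le)
  show "carleman_profile L x0 lam (\<lambda>x. exp (- lam * (x - x0)\<^sup>2) * cos (lam * x))"
    unfolding carleman_profile_def gauss_trig_deriv
    by (intro conjI allI ballI smooth_mult e smooth_sin_cos b) (auto simp: abs_mult mult_left_le)
qed

text \<open>The constant depends on L only. This is what makes the detour through two weighted
  solutions harmless for large lam.\<close>

lemma carleman_recover:
  fixes u :: "'n::finite \<Rightarrow> real \<Rightarrow> real \<Rightarrow> real" and \<kappa> :: real
  assumes u: "\<And>j. u j \<in> C0_H10 L T \<inter> C1_L2 L T" and T: "0 < T" and lam: "1 \<le> lam" and x0: "0 < x0" "x0 < L" and t: "t \<in> {0..T}"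
  defines "w \<equiv> (\<lambda>\<beta> j t x. time_weight T \<kappa> lam t * (\<beta> x * u j t x))"
  shows "AE x in lebesgue_on {0<..<L}. (exp (- lam * psi x0 \<kappa> (T / 2) (t, x)))\<^sup>2 * (coupling L p q u i t x)\<^sup>2
    \<le> 2 * (1 + (2 * L)\<^sup>2) * ((coupling L p q (w (\<lambda>x. exp (- lam * (x - x0)\<^sup>2) * sin (lam * x))) i t x)\<^sup>2
      + (coupling L p q (w (\<lambda>x. exp (- lam * (x - x0)\<^sup>2) * cos (lam * x))) i t x)\<^sup>2)"
proof -
  define e where "e x = exp (- lam * (x - x0)\<^sup>2)" for x
  define P where "P x = (\<Sum>j\<in>UNIV. p i j t x * u j t x)" for x
  note pr = carleman_profile_trig[OF lam x0, folded e_def]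
  have sm: "smooth (\<lambda>x. e x * sin (lam * x))" "smooth (\<lambda>x. e x * cos (lam * x))"
    using pr by (simp_all add: carleman_profile_def)
  have d: "deriv (\<lambda>x. e x * sin (lam * x)) x = lam * e x * (cos (lam * x) - 2 * (x - x0) * sin (lam * x))"
    "deriv (\<lambda>x. e x * cos (lam * x)) x = lam * e x * (- sin (lam * x) - 2 * (x - x0) * cos (lam * x))" for x
    unfolding e_def by (rule gauss_trig_deriv)+
  have s: "AE x in lebesgue_on {0<..<L}. x \<in> {0<..<L}" by (simp add: AE_zext)
  have wc1: "AE x in lebesgue_on {0<..<L}. coupling L p q (\<lambda>j t x. time_weight T \<kappa> lam t * (e x * sin (lam * x) * u j t x)) i t x =
    time_weight T \<kappa> lam t * (e x * sin (lam * x)) * coupling L p q u i t x + time_weight T \<kappa> lam t * deriv (\<lambda>x. e x * sin (lam * x)) x * (\<Sum>j\<in>UNIV. p i j t x * u j t x)"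
    by (rule weighted_coupling[OF u T sm(1) time_weight_deriv time_weight_deriv_cont t])
  have wc2: "AE x in lebesgue_on {0<..<L}. coupling L p q (\<lambda>j t x. time_weight T \<kappa> lam t * (e x * cos (lam * x) * u j t x)) i t x =
    time_weight T \<kappa> lam t * (e x * cos (lam * x)) * coupling L p q u i t x + time_weight T \<kappa> lam t * deriv (\<lambda>x. e x * cos (lam * x)) x * (\<Sum>j\<in>UNIV. p i j t x * u j t x)"
    by (rule weighted_coupling[OF u T sm(2) time_weight_deriv time_weight_deriv_cont t])
  show ?thesis using wc1 wc2 s
    unfolding w_def e_def[symmetric] d P_def[symmetric]
  proof eventually_elim
    case (elim x)
    let ?\<tau> = "time_weight T \<kappa> lam t" and ?f = "coupling L p q u i t x"
    let ?s = "sin (lam * x)" and ?c = "cos (lam * x)"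
    let ?a = "coupling L p q (\<lambda>j t x. time_weight T \<kappa> lam t * (e x * sin (lam * x) * u j t x)) i t x"
    let ?b = "coupling L p q (\<lambda>j t x. time_weight T \<kappa> lam t * (e x * cos (lam * x) * u j t x)) i t x"
    have me: "exp (- lam * psi x0 \<kappa> (T / 2) (t, x)) = ?\<tau> * e x"
      by (simp add: psi_def time_weight_def e_def exp_add[symmetric] algebra_simps)
    have sc: "?s\<^sup>2 + ?c\<^sup>2 = 1" by simp
    have "?\<tau> * e x * ?f = ?s * ?a + ?c * ?b - (- 2 * (x - x0)) * (?c * ?a - ?s * ?b)"
      by (rule trig_recombine[OF _ _ sc]) (use elim(1,2) in \<open>simp_all only: mult.assoc\<close>)
    then have "(?\<tau> * e x)\<^sup>2 * ?f\<^sup>2 = (?s * ?a + ?c * ?b - (- 2 * (x - x0)) * (?c * ?a - ?s * ?b))\<^sup>2"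
      by (simp only: power_mult_distrib[symmetric])
    moreover have "(?s * ?a + ?c * ?b - (- 2 * (x - x0)) * (?c * ?a - ?s * ?b))\<^sup>2 \<le> 2 * (1 + (2 * L)\<^sup>2) * (?a\<^sup>2 + ?b\<^sup>2)"
    proof (rule trig_combination[OF sc])
      show "\<bar>- 2 * (x - x0)\<bar> \<le> 2 * L" using elim(3) x0 by (auto simp: abs_mult abs_le_iff)
    qed
    ultimately show ?case unfolding me by (simp only:)
  qed
qed

lemma nn_exp_limit:
  fixes I :: ennreal
  assumes I: "\<And>lam. lam0 \<le> lam \<Longrightarrow> I \<le> ennreal (Q * (lam\<^sup>2 * exp (- lam * c)))" and c: "0 < c"
  shows "I = 0"
proof -
  have "((\<lambda>lam::real. lam\<^sup>2 * exp (- lam * c)) \<longlongrightarrow> 0) at_top" using c by real_asymp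
  then have "((\<lambda>lam. ennreal (Q * (lam\<^sup>2 * exp (- lam * c)))) \<longlongrightarrow> ennreal (Q * 0)) at_top"
    by (intro tendsto_ennrealI tendsto_mult tendsto_const)
  then have "I \<le> ennreal (Q * 0)"
    by (rule tendsto_lowerbound) (use I in \<open>auto simp: eventually_at_top_linorder\<close>)
  then show ?thesis by simp
qed

text \<open>Supplies the finiteness needed to absorb masses; for nonnegative \<kappa> and lam the
  weight is at most 1.\<close>

lemma carleman_mass_finite:
  assumes "wave_component L T \<gamma> u G" and \<kappa>: "0 \<le> \<kappa>" and lam: "0 \<le> lam"
  shows "carleman_mass L T x0 \<kappa> M G lam < \<infinity>"
proof -
  interpret wave_component L T \<gamma> u G by fact
  have "carleman_mass L T x0 \<kappa> M G lam \<le> (\<integral>\<^sup>+z. ennreal ((G z)\<^sup>2) \<partial>lborel)"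
    unfolding carleman_mass_def
  proof (rule nn_integral_mono)
    fix z
    have p: "0 \<le> lam * psi x0 \<kappa> (T / 2) z" using \<kappa> lam by (simp add: psi_def)
    have "(exp (- lam * psi x0 \<kappa> (T / 2) z))\<^sup>2 \<le> 1" using p by (simp add: power_le_one)
    then have "(exp (- lam * psi x0 \<kappa> (T / 2) z))\<^sup>2 * (G z)\<^sup>2 \<le> 1 * (G z)\<^sup>2" by (rule mult_right_mono) simp
    then show "indicator {z. snd z \<in> {0<..<L} \<and> psi x0 \<kappa> (T / 2) z < M} z *
      ennreal ((exp (- lam * psi x0 \<kappa> (T / 2) z))\<^sup>2 * (G z)\<^sup>2) \<le> ennreal ((G z)\<^sup>2)"
      by (auto intro: ennreal_leI split: split_indicator)
  qed
  also have "\<dots> = (\<integral>\<^sup>+t. (\<integral>\<^sup>+x. ennreal ((G (t, x))\<^sup>2) \<partial>lborel) \<partial>lborel)"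
    by (rule nn_integral_lborel_pair[symmetric]) measurable
  also have "\<dots> = (\<integral>\<^sup>+t. ennreal (LINT x|lborel. (G (t, x))\<^sup>2) \<partial>lborel)"
    by (intro nn_integral_cong nn_integral_eq_integral G_sec) simp
  also have "\<dots> = ennreal (LINT t|lborel. LINT x|lborel. (G (t, x))\<^sup>2)"
    by (rule nn_integral_eq_integral[OF G_L2]) (simp add: integral_nonneg_AE)
  finally show ?thesis by (rule order.strict_trans1) simp
qed

lemma carleman_mass_le:
  fixes H1 H2 :: "real \<times> real \<Rightarrow> real"
  assumes [measurable]: "G \<in> borel_measurable borel" "H1 \<in> borel_measurable borel" "H2 \<in> borel_measurable borel"
    and z: "\<And>t x. t \<notin> {0<..<T} \<or> x \<notin> {0<..<L} \<Longrightarrow> G (t, x) = 0" and k: "0 \<le> k"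
    and le: "AE t in lebesgue_on {0<..<T}. AE x in lebesgue_on {0<..<L}.
      (exp (- lam * psi x0 \<kappa> (T / 2) (t, x)))\<^sup>2 * (G (t, x))\<^sup>2 \<le> k * ((H1 (t, x))\<^sup>2 + (H2 (t, x))\<^sup>2)"
  shows "carleman_mass L T x0 \<kappa> M G lam \<le> ennreal k * ((\<integral>\<^sup>+z. ennreal ((H1 z)\<^sup>2) \<partial>lborel) + (\<integral>\<^sup>+z. ennreal ((H2 z)\<^sup>2) \<partial>lborel))"
proof -
  let ?m = "\<lambda>z. exp (- lam * psi x0 \<kappa> (T / 2) z)"
  have "carleman_mass L T x0 \<kappa> M G lam \<le> (\<integral>\<^sup>+z. ennreal ((?m z)\<^sup>2 * (G z)\<^sup>2) \<partial>lborel)"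
    unfolding carleman_mass_def by (intro nn_integral_mono) (auto split: split_indicator)
  also have "\<dots> = (\<integral>\<^sup>+t. (\<integral>\<^sup>+x. ennreal ((?m (t, x))\<^sup>2 * (G (t, x))\<^sup>2) \<partial>lborel) \<partial>lborel)"
    by (rule nn_integral_lborel_pair[symmetric]) measurable
  also have "\<dots> = (\<integral>\<^sup>+t. (\<integral>\<^sup>+x. ennreal ((?m (t, x))\<^sup>2 * (G (t, x))\<^sup>2) \<partial>lebesgue) \<partial>lebesgue)"
    by (simp only: nn_integral_completion)
  also have "\<dots> \<le> (\<integral>\<^sup>+t. (\<integral>\<^sup>+x. ennreal k * (ennreal ((H1 (t, x))\<^sup>2) + ennreal ((H2 (t, x))\<^sup>2)) \<partial>lebesgue) \<partial>lebesgue)"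
  proof (rule nn_integral_mono_AE, use le[unfolded AE_zext] in eventually_elim)
    case (elim t)
    show ?case
    proof (cases "t \<in> {0<..<T}")
      case True
      show ?thesis
      proof (rule nn_integral_mono_AE, use elim[rule_format, OF True] in eventually_elim)
        case (elim x)
        show ?case
        proof (cases "x \<in> {0<..<L}")
          case True
          then have "ennreal ((?m (t, x))\<^sup>2 * (G (t, x))\<^sup>2) \<le> ennreal (k * ((H1 (t, x))\<^sup>2 + (H2 (t, x))\<^sup>2))"
            using elim by (intro ennreal_leI) blast
          then show ?thesis using k by (simp add: ennreal_mult ennreal_plus)
        qed (simp add: z)
      qed
    qed (simp add: z)
  qed
  also have "\<dots> = (\<integral>\<^sup>+t. (\<integral>\<^sup>+x. ennreal k * (ennreal ((H1 (t, x))\<^sup>2) + ennreal ((H2 (t, x))\<^sup>2)) \<partial>lborel) \<partial>lborel)"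
    by (simp only: nn_integral_completion)
  also have "\<dots> = (\<integral>\<^sup>+z. ennreal k * (ennreal ((H1 z)\<^sup>2) + ennreal ((H2 z)\<^sup>2)) \<partial>lborel)"
    by (rule nn_integral_lborel_pair) measurable
  also have "\<dots> = ennreal k * ((\<integral>\<^sup>+z. ennreal ((H1 z)\<^sup>2) \<partial>lborel) + (\<integral>\<^sup>+z. ennreal ((H2 z)\<^sup>2) \<partial>lborel))"
    by (simp add: nn_integral_add nn_integral_cmult)
  finally show ?thesis .
qed

text \<open>Bundles the conclusions of \<open>L2_L2_borel\<close>, so that versions for all
  components can be chosen at once.\<close>

definition square_integrable_version ::
  "real \<Rightarrow> real \<Rightarrow> (real \<times> real) set \<Rightarrow> (real \<Rightarrow> real \<Rightarrow> real) \<Rightarrow> (real \<times> real \<Rightarrow> real) \<Rightarrow> bool" where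
  "square_integrable_version L T N0 f G \<longleftrightarrow> G \<in> borel_measurable borel \<and>
    (\<forall>t x. t \<notin> {0<..<T} \<or> x \<notin> {0<..<L} \<longrightarrow> G (t, x) = 0) \<and>
    (\<forall>w. w \<in> N0 \<longrightarrow> G w = 0) \<and> (\<forall>t. integrable lborel (\<lambda>x. (G (t, x))\<^sup>2)) \<and>
    integrable lborel (\<lambda>t. LINT x|lborel. (G (t, x))\<^sup>2) \<and>
    (AE t in lebesgue_on {0<..<T}. AE x in lebesgue_on {0<..<L}. f t x = G (t, x))"

lemma square_integrable_versionD:
  assumes "square_integrable_version L T N0 f G"
  shows "G \<in> borel_measurable borel" "\<And>t x. t \<notin> {0<..<T} \<or> x \<notin> {0<..<L} \<Longrightarrow> G (t, x) = 0"
    "\<And>w. w \<in> N0 \<Longrightarrow> G w = 0" "\<And>t. integrable lborel (\<lambda>x. (G (t, x))\<^sup>2)"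
    "integrable lborel (\<lambda>t. LINT x|lborel. (G (t, x))\<^sup>2)"
    "AE t in lebesgue_on {0<..<T}. AE x in lebesgue_on {0<..<L}. f t x = G (t, x)"
  using assms unfolding square_integrable_version_def by blast+

lemma coupling_version:
  fixes u :: "'n::finite \<Rightarrow> real \<Rightarrow> real \<Rightarrow> real"
  assumes c: "coupling L p q u i \<in> L2_L2 L T" and N0: "open N0"
    and z: "\<And>t. t \<in> {0<..<T} \<Longrightarrow> AE x in lebesgue_on {0<..<L}. (t, x) \<in> N0 \<longrightarrow> coupling L p q u i t x = 0"
  shows "\<exists>G. square_integrable_version L T N0 (coupling L p q u i) G"
proof (rule L2_L2_borel[OF c borel_open[OF N0]])
  show "AE t in lebesgue_on {0<..<T}. AE x in lebesgue_on {0<..<L}. (t, x) \<in> N0 \<longrightarrow> coupling L p q u i t x = 0"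
    by (rule AE_I2) (use z in \<open>simp add: space_restrict_space\<close>)
qed (auto simp: square_integrable_version_def)

text \<open>A closed loop of estimates: the mass of each coupling is recovered from the couplings of
  two weighted solutions, these are bounded by weighted energies, and those again by the masses with
  a factor 1 / lam^2. What survives absorption is the exponentially small remainder.\<close>

lemma middle_vanishing:
  fixes u :: "'n::finite \<Rightarrow> real \<Rightarrow> real \<Rightarrow> real"
  assumes L: "0 < L" and T: "0 < T" and \<gamma>: "\<And>i. 0 < \<gamma> i" and adm: "admissible_coupling L \<gamma> p q"
    and sol: "weak_solution L T \<gamma> p q u0 u1 u"
    and x0: "0 < \<delta>" "0 < x0 - \<delta>" "x0 + \<delta> < L"
    and uz: "\<And>i t x. t \<in> {0..T} \<Longrightarrow> x \<in> {x0 - \<delta><..<x0 + \<delta>} \<Longrightarrow> u i t x = 0"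
    and \<kappa>: "0 < \<kappa>" "\<And>i. \<kappa> * T \<le> \<delta> * sqrt (\<gamma> i)" "2 * L\<^sup>2 \<le> \<kappa> * (T / 4)\<^sup>2" and TL: "\<And>i. L / sqrt (\<gamma> i) \<le> T / 4"
    and \<epsilon>: "\<epsilon> \<le> T / 4" "\<kappa> * \<epsilon>\<^sup>2 \<le> L\<^sup>2 / 2"
  shows "(\<integral>\<^sup>+t. indicator {T / 2 - \<epsilon><..<T / 2 + \<epsilon>} t * ennreal ((norm (l2c L (u i t)))\<^sup>2) \<partial>lborel) = 0"
proof -
  define M where "M = 2 * L\<^sup>2"
  have x0L: "0 < x0" "x0 < L" using x0 by linarith+
  have cl: "u j \<in> C0_H10 L T \<inter> C1_L2 L T" for j using sol unfolding weak_solution_def by blast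
  obtain C where C: "0 < C" "\<And>w i. (\<And>j. w j \<in> C0_H10 L T \<inter> C1_L2 L T) \<Longrightarrow> coupling L p q w i \<in> L2_L2 L T"
    "\<And>w i. (\<And>j. w j \<in> C0_H10 L T \<inter> C1_L2 L T) \<Longrightarrow>
      \<exists>H. H \<in> borel_measurable borel \<and> (AE t in lebesgue_on {0<..<T}. AE x in lebesgue_on {0<..<L}. coupling L p q w i t x = H (t, x)) \<and>
      (\<integral>\<^sup>+z. ennreal ((H z)\<^sup>2) \<partial>lborel) \<le> ennreal C * (\<integral>\<^sup>+t. indicator {0<..<T} t * ennreal (energy L T \<gamma> w t) \<partial>lborel)"
    using coupling_borel[OF adm T \<gamma>] by blast
  have "\<forall>i. \<exists>G. square_integrable_version L T (UNIV \<times> {x0 - \<delta><..<x0 + \<delta>}) (coupling L p q u i) G"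
  proof (rule allI, rule coupling_version[OF C(2)[of u, OF cl]])
    show "open (UNIV \<times> {x0 - \<delta><..<x0 + \<delta>} :: (real \<times> real) set)" by (intro open_Times) auto
    fix i t assume t: "t \<in> {0<..<T}"
    have "AE x in lebesgue_on {0<..<L}. x \<in> {x0 - \<delta><..<x0 + \<delta>} \<longrightarrow> coupling L p q u i t x = 0"
    proof (rule coupling_zero_AE)
      fix j show "u j t \<in> H1 L" using cl[of j] t by (intro C0_H10_H1[of "u j"]) auto
      fix x assume "x \<in> {x0 - \<delta><..<x0 + \<delta>}" then show "u j t x = 0" using t by (intro uz) auto
    qed (use x0 in auto)
    then show "AE x in lebesgue_on {0<..<L}. (t, x) \<in> UNIV \<times> {x0 - \<delta><..<x0 + \<delta>} \<longrightarrow> coupling L p q u i t x = 0" by simp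
  qed
  from choice[OF this] obtain G where "\<forall>i. square_integrable_version L T (UNIV \<times> {x0 - \<delta><..<x0 + \<delta>}) (coupling L p q u i) (G i)" ..
  then have "square_integrable_version L T (UNIV \<times> {x0 - \<delta><..<x0 + \<delta>}) (coupling L p q u i) (G i)" for i by simp
  note G = square_integrable_versionD[OF this]
  have wc: "wave_component L T (\<gamma> i) (u i) (G i)" for i
    by (rule weak_solution_component[OF L T \<gamma> sol G(1) G(2) G(4) G(5) G(6)])
  have wv: "wave_vanish L T (\<gamma> i) (u i) (G i) x0 \<delta> \<kappa> M" for i
    by (intro wave_vanish.intro wc wave_vanish_axioms.intro uz G(3))
      (use x0 \<kappa> TL in \<open>auto simp: M_def\<close>)
  let ?X = "\<lambda>lam i. carleman_mass L T x0 \<kappa> M (G i) lam"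
  have "\<forall>i. \<exists>z. component_estimate L T (\<gamma> i) (u i) x0 \<kappa> M (G i) (fst z) (snd z)"
    using wave_vanish.component_bound[OF wv] by simp
  from choice[OF this] obtain z where z: "\<forall>i. component_estimate L T (\<gamma> i) (u i) x0 \<kappa> M (G i) (fst (z i)) (snd (z i))" ..
  define A where "A i = fst (z i)" for i
  define K where "K i = snd (z i)" for i
  have AK: "component_estimate L T (\<gamma> i) (u i) x0 \<kappa> M (G i) (A i) (K i)" for i using z by (simp add: A_def K_def)
  have A0: "0 \<le> A i" and K0: "0 \<le> K i" for i using AK[of i] by (simp_all add: component_estimate_def)
  define r where "r lam = lam\<^sup>2 * exp (- 2 * lam * M)" for lam :: real
  have r0: "0 \<le> r lam" for lam by (simp add: r_def)
  \<comment> \<open>For one spatial profile: the coupling hypothesis, applied to the weighted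
    solutions on all of (0, T), followed by the Carleman estimate for every component.\<close>
  have H_ex: "\<exists>H. H \<in> borel_measurable borel \<and> (AE t in lebesgue_on {0<..<T}. AE x in lebesgue_on {0<..<L}.
       coupling L p q (\<lambda>j t x. time_weight T \<kappa> lam t * (\<beta> x * u j t x)) i t x = H (t, x)) \<and>
      (\<integral>\<^sup>+z. ennreal ((H z)\<^sup>2) \<partial>lborel) \<le> ennreal C * (\<Sum>j\<in>UNIV. ennreal (A j / lam\<^sup>2) * ?X lam j + ennreal (K j * r lam))"
    if lam: "1 \<le> lam" and \<beta>: "carleman_profile L x0 lam \<beta>" for lam \<beta> i
  proof -
    let ?w = "\<lambda>j t x. time_weight T \<kappa> lam t * (\<beta> x * u j t x)"
    have \<beta>s: "smooth \<beta>" using \<beta> by (simp add: carleman_profile_def)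
    have w: "?w j \<in> C0_H10 L T \<inter> C1_L2 L T" for j
      by (rule weighted_class(1)[OF cl T \<beta>s time_weight_deriv time_weight_deriv_cont])
    have "\<forall>j. \<exists>B. weighted_majorant L T (\<gamma> j) (u j) x0 \<kappa> lam B \<and>
      (\<integral>\<^sup>+t. indicator {0<..<T} t * B t \<partial>lborel) \<le> ennreal (A j / lam\<^sup>2) * ?X lam j + ennreal (K j * lam\<^sup>2 * exp (- 2 * lam * M))"
      using AK lam by (simp add: component_estimate_def)
    from choice[OF this] obtain B where B: "\<forall>j. weighted_majorant L T (\<gamma> j) (u j) x0 \<kappa> lam (B j) \<and>
      (\<integral>\<^sup>+t. indicator {0<..<T} t * B j t \<partial>lborel) \<le> ennreal (A j / lam\<^sup>2) * ?X lam j + ennreal (K j * lam\<^sup>2 * exp (- 2 * lam * M))" ..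
    have Bm[measurable]: "B j \<in> borel_measurable borel" for j using B by (simp add: weighted_majorant_def)
    have Bi: "(\<integral>\<^sup>+t. indicator {0<..<T} t * B j t \<partial>lborel) \<le> ennreal (A j / lam\<^sup>2) * ?X lam j + ennreal (K j * r lam)" for j
      using B by (simp add: r_def mult.assoc)
    have "(\<integral>\<^sup>+t. indicator {0<..<T} t * ennreal (energy L T \<gamma> ?w t) \<partial>lborel) \<le> (\<integral>\<^sup>+t. (\<Sum>j\<in>UNIV. indicator {0<..<T} t * B j t) \<partial>lborel)"
    proof (rule nn_integral_mono)
      fix t
      show "indicator {0<..<T} t * ennreal (energy L T \<gamma> ?w t) \<le> (\<Sum>j\<in>UNIV. indicator {0<..<T} t * B j t)"
      proof (cases "t \<in> {0<..<T}")
        case True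
        then have t: "t \<in> {0..T}" by simp
        have "ennreal (energy L T \<gamma> ?w t) \<le> (\<Sum>j\<in>UNIV. B j t)"
          by (rule order_trans[OF energy_nn[OF \<gamma>] sum_mono])
            (use B t \<beta> in \<open>simp add: weighted_majorant_def\<close>)
        then show ?thesis using True by simp
      qed simp
    qed
    also have "\<dots> = (\<Sum>j\<in>UNIV. \<integral>\<^sup>+t. indicator {0<..<T} t * B j t \<partial>lborel)"
      by (rule nn_integral_sum) measurable
    also have "\<dots> \<le> (\<Sum>j\<in>UNIV. ennreal (A j / lam\<^sup>2) * ?X lam j + ennreal (K j * r lam))" by (intro sum_mono Bi)
    finally have e: "(\<integral>\<^sup>+t. indicator {0<..<T} t * ennreal (energy L T \<gamma> ?w t) \<partial>lborel) \<le> (\<Sum>j\<in>UNIV. ennreal (A j / lam\<^sup>2) * ?X lam j + ennreal (K j * r lam))" .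
    from C(3)[of ?w i, OF w] obtain H where H: "H \<in> borel_measurable borel"
      "AE t in lebesgue_on {0<..<T}. AE x in lebesgue_on {0<..<L}. coupling L p q ?w i t x = H (t, x)"
      "(\<integral>\<^sup>+z. ennreal ((H z)\<^sup>2) \<partial>lborel) \<le> ennreal C * (\<integral>\<^sup>+t. indicator {0<..<T} t * ennreal (energy L T \<gamma> ?w t) \<partial>lborel)"
      by (elim exE conjE)
    show ?thesis by (rule exI[of _ H], intro conjI H order_trans[OF H(3)] mult_left_mono e) simp
  qed
  define k where "k = 2 * (1 + (2 * L)\<^sup>2)"
  have k0: "0 \<le> k" by (simp add: k_def)
  \<comment> \<open>The sine and the cosine profile satisfy the same bound, which explains the
    factor 2; k is the constant of \<open>carleman_recover\<close>.\<close>
  have X_le: "?X lam i \<le> (\<Sum>j\<in>UNIV. ennreal (2 * k * C * A j / lam\<^sup>2) * ?X lam j) + ennreal (2 * k * C * (\<Sum>j\<in>UNIV. K j) * r lam)"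
    if lam: "1 \<le> lam" for lam i
  proof -
    let ?S = "\<Sum>j\<in>UNIV. ennreal (A j / lam\<^sup>2) * ?X lam j + ennreal (K j * r lam)"
    let ?b1 = "\<lambda>x. exp (- lam * (x - x0)\<^sup>2) * sin (lam * x)" and ?b2 = "\<lambda>x. exp (- lam * (x - x0)\<^sup>2) * cos (lam * x)"
    obtain H1 where H1: "H1 \<in> borel_measurable borel" "AE t in lebesgue_on {0<..<T}. AE x in lebesgue_on {0<..<L}.
       coupling L p q (\<lambda>j t x. time_weight T \<kappa> lam t * (?b1 x * u j t x)) i t x = H1 (t, x)"
      "(\<integral>\<^sup>+z. ennreal ((H1 z)\<^sup>2) \<partial>lborel) \<le> ennreal C * ?S"
      using H_ex[OF lam carleman_profile_trig(1)[OF lam x0L], of i] by (elim exE conjE)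
    obtain H2 where H2: "H2 \<in> borel_measurable borel" "AE t in lebesgue_on {0<..<T}. AE x in lebesgue_on {0<..<L}.
       coupling L p q (\<lambda>j t x. time_weight T \<kappa> lam t * (?b2 x * u j t x)) i t x = H2 (t, x)"
      "(\<integral>\<^sup>+z. ennreal ((H2 z)\<^sup>2) \<partial>lborel) \<le> ennreal C * ?S"
      using H_ex[OF lam carleman_profile_trig(2)[OF lam x0L], of i] by (elim exE conjE)
    have st: "AE t in lebesgue_on {0<..<T}. t \<in> {0<..<T}" by (simp add: AE_zext)
    have "?X lam i \<le> ennreal k * ((\<integral>\<^sup>+z. ennreal ((H1 z)\<^sup>2) \<partial>lborel) + (\<integral>\<^sup>+z. ennreal ((H2 z)\<^sup>2) \<partial>lborel))"
    proof (rule carleman_mass_le[OF G(1) H1(1) H2(1) G(2) k0])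
      show "AE t in lebesgue_on {0<..<T}. AE x in lebesgue_on {0<..<L}.
        (exp (- lam * psi x0 \<kappa> (T / 2) (t, x)))\<^sup>2 * (G i (t, x))\<^sup>2 \<le> k * ((H1 (t, x))\<^sup>2 + (H2 (t, x))\<^sup>2)"
        using G(6)[of i] H1(2) H2(2) st
      proof eventually_elim
        case (elim t)
        then have t: "t \<in> {0..T}" by simp
        from elim(1-3) carleman_recover[where u=u and \<kappa>=\<kappa> and p=p and q=q and i=i, OF cl T lam x0L t] show ?case
        proof eventually_elim
          case (elim x)
          from elim(4) show ?case unfolding elim(1-3) k_def .
        qed
      qed
    qed
    also have "\<dots> \<le> ennreal k * (ennreal C * ?S + ennreal C * ?S)"
      by (intro mult_left_mono add_mono H1 H2) simp
    also have "\<dots> = ennreal (2 * k * C) * ?S"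
      using k0 C(1) by (simp add: ennreal_mult distrib_left mult_ac mult_2[symmetric])
    also have "\<dots> = (\<Sum>j\<in>UNIV. ennreal (2 * k * C * A j / lam\<^sup>2) * ?X lam j) + ennreal (2 * k * C * (\<Sum>j\<in>UNIV. K j) * r lam)"
    proof -
      have 1: "ennreal (2 * k * C) * (ennreal (A j / lam\<^sup>2) * ?X lam j) = ennreal (2 * k * C * A j / lam\<^sup>2) * ?X lam j" for j
        unfolding mult.assoc[symmetric] using k0 C(1) A0 by (subst ennreal_mult[symmetric]) auto
      have 2: "(\<Sum>j\<in>UNIV. ennreal (K j * r lam)) = ennreal ((\<Sum>j\<in>UNIV. K j) * r lam)"
        unfolding sum_distrib_right by (rule sum_ennreal) (use K0 r0 in auto)
      have 3: "ennreal (2 * k * C) * ennreal ((\<Sum>j\<in>UNIV. K j) * r lam) = ennreal (2 * k * C * (\<Sum>j\<in>UNIV. K j) * r lam)"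
        using k0 C(1) r0 K0 by (subst ennreal_mult[symmetric]) (auto intro!: mult_nonneg_nonneg sum_nonneg simp: mult.assoc)
      show ?thesis unfolding sum.distrib distrib_left sum_distrib_left 1 2 3 ..
    qed
    finally show ?thesis .
  qed
  define n where "n = real CARD('n)"
  have n1: "1 \<le> n" by (simp add: n_def Suc_leI)
  \<comment> \<open>Chosen so that n times the sum of the coefficients 2 k C A j / lam^2 is at most
    1/2; since lam is at least 1, a bound by lam is also one by lam^2.\<close>
  define lam0 where "lam0 = max 1 (4 * n * k * C * (\<Sum>j\<in>UNIV. A j))"
  have X_bound: "?X lam i \<le> ennreal (2 * n * (2 * k * C * (\<Sum>j\<in>UNIV. K j) * r lam))" if lam: "lam0 \<le> lam" for lam i
    unfolding n_def
  proof (rule sum_system_bound[OF X_le])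
    have l1: "1 \<le> lam" and l2: "4 * n * k * C * (\<Sum>j\<in>UNIV. A j) \<le> lam" using lam by (simp_all add: lam0_def)
    show "1 \<le> lam" by fact
    show "carleman_mass L T x0 \<kappa> M (G i) lam < \<infinity>" for i
      by (rule carleman_mass_finite[OF wc]) (use \<kappa> l1 in auto)
    show "0 \<le> 2 * k * C * A j / lam\<^sup>2" for j using k0 C(1) A0 by simp
    have "lam \<le> lam\<^sup>2" using l1 by (simp add: power2_eq_square)
    then have "4 * n * k * C * (\<Sum>j\<in>UNIV. A j) \<le> lam\<^sup>2" using l2 by linarith
    then have "4 * n * k * C * (\<Sum>j\<in>UNIV. A j) / lam\<^sup>2 \<le> 1" using l1 by simp
    moreover have "n * (\<Sum>j\<in>UNIV. 2 * k * C * A j / lam\<^sup>2) = (4 * n * k * C * (\<Sum>j\<in>UNIV. A j) / lam\<^sup>2) / 2"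
      by (simp add: sum_distrib_left sum_divide_distrib mult_ac)
    ultimately show "real CARD('n) * (\<Sum>j\<in>UNIV. 2 * k * C * A j / lam\<^sup>2) \<le> 1 / 2" unfolding n_def by (simp add: mult_ac)
    show "0 \<le> 2 * k * C * (\<Sum>j\<in>UNIV. K j) * r lam" using k0 C(1) K0 r0 by (auto intro!: mult_nonneg_nonneg sum_nonneg)
  qed
  obtain Q where Q: "0 \<le> Q" "\<And>lam. 1 \<le> lam \<Longrightarrow> (\<integral>\<^sup>+t. indicator {T / 2 - \<epsilon><..<T / 2 + \<epsilon>} t * ennreal ((norm (l2c L (u i t)))\<^sup>2) \<partial>lborel)
    \<le> ennreal (Q * exp (3 * lam * L\<^sup>2)) * ?X lam i"
    using wave_vanish.slab_bound[OF wv M_def \<epsilon>, of i, unfolded wave_component.U_def[OF wc]] by auto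
  let ?P = "Q * (2 * n * (2 * k * C * (\<Sum>j\<in>UNIV. K j)))"
  show ?thesis
  proof (rule nn_exp_limit)
    show "0 < L\<^sup>2" using L by simp
    fix lam assume lam: "lam0 \<le> lam"
    then have l1: "1 \<le> lam" by (simp add: lam0_def)
    have "(\<integral>\<^sup>+t. indicator {T / 2 - \<epsilon><..<T / 2 + \<epsilon>} t * ennreal ((norm (l2c L (u i t)))\<^sup>2) \<partial>lborel) \<le> ennreal (Q * exp (3 * lam * L\<^sup>2)) * ?X lam i"
      by (rule Q(2)[OF l1])
    also have "\<dots> \<le> ennreal (Q * exp (3 * lam * L\<^sup>2)) * ennreal (2 * n * (2 * k * C * (\<Sum>j\<in>UNIV. K j) * r lam))"
      by (intro mult_left_mono X_bound lam) simp
    also have "\<dots> = ennreal (Q * exp (3 * lam * L\<^sup>2) * (2 * n * (2 * k * C * (\<Sum>j\<in>UNIV. K j) * r lam)))"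
      using Q(1) k0 C(1) K0 r0 n1 by (subst ennreal_mult[symmetric]) (auto intro!: mult_nonneg_nonneg sum_nonneg)
    also have "Q * exp (3 * lam * L\<^sup>2) * (2 * n * (2 * k * C * (\<Sum>j\<in>UNIV. K j) * r lam)) = ?P * (lam\<^sup>2 * (exp (3 * lam * L\<^sup>2) * exp (- 2 * lam * M)))"
      by (simp add: r_def)
    \<comment> \<open>This is where M = 2 L^2 is used: the exponent 3 L^2 - 2 M is - L^2.\<close>
    also have "exp (3 * lam * L\<^sup>2) * exp (- 2 * lam * M) = exp (- lam * L\<^sup>2)"
      by (simp add: exp_add[symmetric] M_def algebra_simps)
    finally show "(\<integral>\<^sup>+t. indicator {T / 2 - \<epsilon><..<T / 2 + \<epsilon>} t * ennreal ((norm (l2c L (u i t)))\<^sup>2) \<partial>lborel) \<le> ennreal (?P * (lam\<^sup>2 * exp (- lam * L\<^sup>2)))" .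
  qed
qed

subsection \<open>Propagation in time\<close>

lemma nn_integral_hk:
  fixes f :: "real \<Rightarrow> real"
  assumes "f integrable_on {a..b}" "\<And>x. 0 \<le> f x"
  shows "ennreal (integral {a..b} f) = (\<integral>\<^sup>+x. indicator {a..b} x * ennreal (f x) \<partial>lborel)"
proof -
  have "(\<integral>\<^sup>+x. ennreal (indicator {a..b} x * f x) \<partial>lborel) = ennreal (integral {a..b} f)"
    using nn_integral_has_integral_lebesgue[OF _ integrable_integral[OF assms(1)]] assms(2) by simp
  moreover have "ennreal (indicator {a..b} x * f x) = indicator {a..b} x * ennreal (f x)" for x
    by (simp split: split_indicator)
  ultimately show ?thesis by simp
qed

text \<open>The temporal counterpart of \<open>Zn_bound\<close>: f is dominated by a primitive of g
  from t0, and g vanishes near t0. From the first time at which g may be nonzero, the weight falls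
  at rate at least 2 lam \<epsilon> away from t0, so \<open>exp_young\<close> on the time axis gains
  1 / (2 lam \<epsilon>)^2. The times before and after t0 contribute one such term each.\<close>

lemma time_hardy:
  fixes g :: "real \<Rightarrow> real" and f :: "real \<Rightarrow> ennreal"
  assumes g[measurable]: "g \<in> borel_measurable borel" and gz: "\<And>s. \<bar>s - t0\<bar> < \<epsilon> \<Longrightarrow> g s = 0" and lam: "0 < lam" and \<epsilon>: "0 < \<epsilon>"
    and f: "\<And>t. f t \<le> ennreal K * (\<integral>\<^sup>+s. indicator {min t0 t..max t0 t} s * ennreal \<bar>g s\<bar> \<partial>lborel)" and K: "0 \<le> K"
  shows "(\<integral>\<^sup>+t. ennreal ((exp (- lam * (t - t0)\<^sup>2))\<^sup>2) * (f t)\<^sup>2 \<partial>lborel)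
    \<le> ennreal (K\<^sup>2 / (2 * (lam * \<epsilon>)\<^sup>2)) * (\<integral>\<^sup>+t. ennreal ((exp (- lam * (t - t0)\<^sup>2))\<^sup>2 * (g t)\<^sup>2) \<partial>lborel)"
proof -
  define \<alpha> where "\<alpha> t = exp (- lam * (t - t0)\<^sup>2)" for t
  define \<mu> where "\<mu> = 2 * lam * \<epsilon>"
  have \<mu>: "0 < \<mu>" using lam \<epsilon> by (simp add: \<mu>_def)
  define H where "H s = ennreal (\<alpha> s * \<bar>g s\<bar>)" for s
  have [measurable]: "\<alpha> \<in> borel_measurable borel" unfolding \<alpha>_def[abs_def] by measurable
  have H[measurable]: "H \<in> borel_measurable borel" unfolding H_def[abs_def] by measurable
  define W where "W \<sigma> t = (\<integral>\<^sup>+r. indicator {0..} r * ennreal (exp (- \<mu> * r)) * H (t + r *\<^sub>R \<sigma>) \<partial>lborel)" for \<sigma> t :: real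
  have W[measurable]: "W \<sigma> \<in> borel_measurable borel" for \<sigma> unfolding W_def[abs_def] by measurable
  have HH: "(H s)\<^sup>2 = ennreal ((\<alpha> s)\<^sup>2 * (g s)\<^sup>2)" for s
    by (simp add: H_def \<alpha>_def ennreal_power power_mult_distrib)
  have WY: "(\<integral>\<^sup>+t. (W \<sigma> t)\<^sup>2 \<partial>lborel) \<le> ennreal (1 / \<mu>\<^sup>2) * (\<integral>\<^sup>+t. ennreal ((\<alpha> t)\<^sup>2 * (g t)\<^sup>2) \<partial>lborel)" for \<sigma> :: real
    using exp_young[OF H \<mu>, of \<sigma>] unfolding W_def HH .
  have main: "ennreal (\<alpha> t) * (\<integral>\<^sup>+s. indicator {min t0 t..max t0 t} s * ennreal \<bar>g s\<bar> \<partial>lborel) \<le> W \<sigma> t"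
    if \<sigma>: "\<sigma> = 1 \<and> t < t0 \<or> \<sigma> = - 1 \<and> t0 \<le> t" for \<sigma> t :: real
  proof -
    have "(\<integral>\<^sup>+s. indicator {min t0 t..max t0 t} s * ennreal \<bar>g s\<bar> \<partial>lborel) = (\<integral>\<^sup>+r. indicator {min t0 t..max t0 t} (t + \<sigma> * r) * ennreal \<bar>g (t + \<sigma> * r)\<bar> \<partial>lborel)"
      by (subst nn_integral_real_affine[where c = \<sigma> and t = t]) (use \<sigma> in \<open>auto, measurable\<close>)
    then have "ennreal (\<alpha> t) * (\<integral>\<^sup>+s. indicator {min t0 t..max t0 t} s * ennreal \<bar>g s\<bar> \<partial>lborel)
      = (\<integral>\<^sup>+r. ennreal (\<alpha> t) * (indicator {min t0 t..max t0 t} (t + \<sigma> * r) * ennreal \<bar>g (t + \<sigma> * r)\<bar>) \<partial>lborel)"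
      by (simp add: nn_integral_cmult)
    also have "\<dots> \<le> W \<sigma> t" unfolding W_def
    proof (rule nn_integral_mono)
      fix r
      show "ennreal (\<alpha> t) * (indicator {min t0 t..max t0 t} (t + \<sigma> * r) * ennreal \<bar>g (t + \<sigma> * r)\<bar>)
        \<le> indicator {0..} r * ennreal (exp (- \<mu> * r)) * H (t + r *\<^sub>R \<sigma>)"
      proof (cases "t + \<sigma> * r \<in> {min t0 t..max t0 t} \<and> g (t + \<sigma> * r) \<noteq> 0")
        case True
        define s where "s = t + \<sigma> * r"
        have s: "s \<in> {min t0 t..max t0 t}" "\<epsilon> \<le> \<bar>s - t0\<bar>" proof -
          show "s \<in> {min t0 t..max t0 t}" using True by (simp add: s_def)
          show "\<epsilon> \<le> \<bar>s - t0\<bar>" by (rule leI) (use True gz[of s] in \<open>auto simp: s_def\<close>)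
        qed
        have r: "0 \<le> r" using \<sigma> s(1) by (auto simp: s_def)
        have "\<mu> * r \<le> lam * ((t - t0)\<^sup>2 - (s - t0)\<^sup>2)"
        proof -
          have e: "(t - t0)\<^sup>2 - (s - t0)\<^sup>2 = r * (- \<sigma> * ((t - t0) + (s - t0)))"
            by (simp add: s_def power2_eq_square algebra_simps)
          \<comment> \<open>t and s lie on the same side of t0, t at least as far from it as s, and
            s at distance at least \<epsilon>.\<close>
          have "2 * \<epsilon> \<le> - \<sigma> * ((t - t0) + (s - t0))" using \<sigma> s r by (auto simp: s_def)
          then have "r * (2 * \<epsilon>) \<le> r * (- \<sigma> * ((t - t0) + (s - t0)))" using r by (rule mult_left_mono)
          from mult_left_mono[OF this less_imp_le[OF lam]]
          have "lam * (r * (2 * \<epsilon>)) \<le> lam * ((t - t0)\<^sup>2 - (s - t0)\<^sup>2)" unfolding e .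
          then show ?thesis by (simp add: \<mu>_def mult_ac)
        qed
        then have "\<alpha> t \<le> exp (- \<mu> * r) * \<alpha> s" by (simp add: \<alpha>_def exp_add[symmetric] algebra_simps)
        then have "\<alpha> t * \<bar>g s\<bar> \<le> (exp (- \<mu> * r) * \<alpha> s) * \<bar>g s\<bar>" by (rule mult_right_mono) simp
        then have "ennreal (\<alpha> t * \<bar>g s\<bar>) \<le> ennreal (exp (- \<mu> * r)) * H s"
          unfolding H_def by (subst ennreal_mult[symmetric]) (auto simp: \<alpha>_def mult.assoc intro: ennreal_leI)
        moreover have "t + r *\<^sub>R \<sigma> = s" by (simp add: s_def mult.commute)
        ultimately show ?thesis using True r by (simp add: s_def[symmetric] ennreal_mult \<alpha>_def)
      next
        case False
        then have z: "ennreal (\<alpha> t) * (indicator {min t0 t..max t0 t} (t + \<sigma> * r) * ennreal \<bar>g (t + \<sigma> * r)\<bar>) = 0" by auto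
        show ?thesis unfolding z by simp
      qed
    qed
    finally show ?thesis .
  qed
  have pt: "ennreal ((\<alpha> t)\<^sup>2) * (f t)\<^sup>2 \<le> ennreal (K\<^sup>2) * ((W 1 t)\<^sup>2 + (W (- 1) t)\<^sup>2)" for t
  proof -
    obtain \<sigma> :: real where \<sigma>: "\<sigma> = 1 \<and> t < t0 \<or> \<sigma> = - 1 \<and> t0 \<le> (t::real)" by (cases "t < t0") auto
    have "ennreal (\<alpha> t) * f t \<le> ennreal (\<alpha> t) * (ennreal K * (\<integral>\<^sup>+s. indicator {min t0 t..max t0 t} s * ennreal \<bar>g s\<bar> \<partial>lborel))"
      by (intro mult_left_mono f) simp
    also have "\<dots> = ennreal K * (ennreal (\<alpha> t) * (\<integral>\<^sup>+s. indicator {min t0 t..max t0 t} s * ennreal \<bar>g s\<bar> \<partial>lborel))" by (simp add: mult_ac)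
    also have "\<dots> \<le> ennreal K * W \<sigma> t" by (intro mult_left_mono main \<sigma>) simp
    finally have "(ennreal (\<alpha> t) * f t)\<^sup>2 \<le> (ennreal K * W \<sigma> t)\<^sup>2" by (rule power_mono) simp
    moreover have "(ennreal (\<alpha> t))\<^sup>2 = ennreal ((\<alpha> t)\<^sup>2)" "(ennreal K)\<^sup>2 = ennreal (K\<^sup>2)"
      using K by (simp_all add: ennreal_power \<alpha>_def)
    ultimately have "ennreal ((\<alpha> t)\<^sup>2) * (f t)\<^sup>2 \<le> ennreal (K\<^sup>2) * (W \<sigma> t)\<^sup>2" by (simp only: power_mult_distrib)
    also have "\<dots> \<le> ennreal (K\<^sup>2) * ((W 1 t)\<^sup>2 + (W (- 1) t)\<^sup>2)" using \<sigma> by (intro mult_left_mono) auto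
    finally show ?thesis .
  qed
  have "(\<integral>\<^sup>+t. ennreal ((\<alpha> t)\<^sup>2) * (f t)\<^sup>2 \<partial>lborel) \<le> (\<integral>\<^sup>+t. ennreal (K\<^sup>2) * ((W 1 t)\<^sup>2 + (W (- 1) t)\<^sup>2) \<partial>lborel)"
    by (intro nn_integral_mono pt)
  also have "\<dots> = ennreal (K\<^sup>2) * ((\<integral>\<^sup>+t. (W 1 t)\<^sup>2 \<partial>lborel) + (\<integral>\<^sup>+t. (W (- 1) t)\<^sup>2 \<partial>lborel))"
    by (simp add: nn_integral_cmult nn_integral_add)
  also have "\<dots> \<le> ennreal (K\<^sup>2) * (ennreal (1 / \<mu>\<^sup>2) * (\<integral>\<^sup>+t. ennreal ((\<alpha> t)\<^sup>2 * (g t)\<^sup>2) \<partial>lborel) + ennreal (1 / \<mu>\<^sup>2) * (\<integral>\<^sup>+t. ennreal ((\<alpha> t)\<^sup>2 * (g t)\<^sup>2) \<partial>lborel))"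
    by (intro mult_left_mono add_mono WY) simp
  also have "\<dots> = (ennreal (K\<^sup>2) * (ennreal (1 / \<mu>\<^sup>2) + ennreal (1 / \<mu>\<^sup>2))) * (\<integral>\<^sup>+t. ennreal ((\<alpha> t)\<^sup>2 * (g t)\<^sup>2) \<partial>lborel)"
    by (simp add: distrib_left distrib_right mult_ac)
  also have "ennreal (K\<^sup>2) * (ennreal (1 / \<mu>\<^sup>2) + ennreal (1 / \<mu>\<^sup>2)) = ennreal (K\<^sup>2 * (1 / \<mu>\<^sup>2 + 1 / \<mu>\<^sup>2))"
  proof -
    have h: "ennreal (1 / \<mu>\<^sup>2) + ennreal (1 / \<mu>\<^sup>2) = ennreal (1 / \<mu>\<^sup>2 + 1 / \<mu>\<^sup>2)"
      by (rule ennreal_plus[symmetric]) simp_all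
    show ?thesis unfolding h by (rule ennreal_mult[symmetric]) simp_all
  qed
  also have "K\<^sup>2 * (1 / \<mu>\<^sup>2 + 1 / \<mu>\<^sup>2) = K\<^sup>2 / (2 * (lam * \<epsilon>)\<^sup>2)"
    using lam \<epsilon> by (simp add: \<mu>_def power_mult_distrib field_simps)
  finally show ?thesis unfolding \<alpha>_def .
qed

lemma l2c_zero: "l2c L (\<lambda>x. 0) = 0"
  using l2c_scaleR[of "\<lambda>x. 0" L 0] by (simp add: L2_zero)

lemma dx_zero:
  assumes "v \<in> H1 L" "l2c L v = 0"
  shows "l2c L (dx L v) = 0"
proof -
  have v: "v \<in> L2 {0<..<L}" by (rule H1_L2[OF assms(1)])
  have "is_weak_deriv L v (\<lambda>x. 0)"
    unfolding is_weak_deriv_l2[OF v] by (simp add: assms(2) l2c_zero L2_zero)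
  from l2c_dx[OF this v] show ?thesis by (simp add: l2c_zero)
qed

context wave_component
begin

definition "E t = (norm (V t))\<^sup>2 + \<gamma> * (norm (X t))\<^sup>2"

lemma E_nonneg: "0 \<le> E t" using \<gamma>0 by (simp add: E_def)

lemma E_cont: "continuous_on {0..T} E"
  unfolding E_def[abs_def] by (intro continuous_intros V_cont X_cont)

lemma V_le_E: "norm (V t) \<le> sqrt (E t)"
  using \<gamma>0 by (intro real_le_rsqrt) (simp add: E_def)

lemma vanishing_interval:
  assumes Uz: "\<And>t. t \<in> {a<..<b} \<Longrightarrow> U t = 0" and ab: "0 \<le> a" "b \<le> T" and t: "t \<in> {a<..<b}"
  shows "V t = 0" "X t = 0"
proof -
  have t': "t \<in> {0..T}" "t \<in> interior {0..T}" using ab t by auto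
  have "(U has_vector_derivative V t) (at t)"
    using U_deriv[OF t'(1)] unfolding at_within_interior[OF t'(2)] .
  moreover have "(U has_vector_derivative 0) (at t)"
    by (rule has_vector_derivative_transform_within_open[OF has_vector_derivative_const[of 0], of "{a<..<b}"])
      (use t Uz in auto)
  ultimately show "V t = 0" by (rule vector_derivative_unique_at)
  show "X t = 0" using dx_zero[OF u_H1[OF t'(1)]] Uz[OF t] by (simp add: X_def U_def)
qed

text \<open>At the time m of maximal energy the energy inequality reads E m <= 2 sqrt (E m) times
  the integral of |F|, and one root can be divided out. The zero may sit at either end, so both time
  directions are covered.\<close>

lemma energy_from_zero:
  assumes ab: "0 < a" "a \<le> b" "b < T" and c: "c = a \<or> c = b" and Ec: "E c = 0" and s: "s \<in> {a..b}"
  shows "sqrt (E s) \<le> 2 * integral {a..b} (\<lambda>r. norm (F r))"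
proof -
  have sub: "{a..b} \<subseteq> {0..T}" using ab by auto
  have Fi: "(\<lambda>r. norm (F r)) integrable_on {a'..b'}" if "{a'..b'} \<subseteq> {0..T}" for a' b'
    by (rule integrable_on_subinterval[OF norm_F_integrable that])
  have J0: "0 \<le> integral {a..b} (\<lambda>r. norm (F r))" by (rule integral_nonneg[OF Fi[OF sub]]) simp
  have "continuous_on {a..b} E" by (rule continuous_on_subset[OF E_cont sub])
  from continuous_attains_sup[OF compact_Icc _ this] ab
  obtain m where m: "m \<in> {a..b}" "\<forall>r\<in>{a..b}. E r \<le> E m" by auto
  have VS: "norm (V r) \<le> sqrt (E m)" if "r \<in> {a..b}" for r
    using order_trans[OF V_le_E real_sqrt_le_mono] m that by blast
  have mono: "integral {a'..b'} (\<lambda>r. norm (F r)) \<le> integral {a..b} (\<lambda>r. norm (F r))" if "a \<le> a'" "b' \<le> b" for a' b'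
    using that sub by (intro integral_subset_le Fi) auto
  have inc: "E m \<le> 2 * sqrt (E m) * integral {a..b} (\<lambda>r. norm (F r))"
  proof -
    consider "m = c" | "c < m" | "m < c" by linarith
    then show ?thesis
    proof cases
      case 1 then show ?thesis using Ec J0 by simp
    next
      case 2
      have "\<bar>E m - E c\<bar> \<le> 2 * sqrt (E m) * integral {c..m} (\<lambda>r. norm (F r))"
        unfolding E_def by (rule component_energy_increment) (use 2 c m ab VS in \<open>auto simp: E_def[symmetric]\<close>)
      also have "\<dots> \<le> 2 * sqrt (E m) * integral {a..b} (\<lambda>r. norm (F r))"
        using c m ab E_nonneg by (intro mult_left_mono mono) auto
      finally show ?thesis using Ec by simp
    next
      case 3
      have "\<bar>E c - E m\<bar> \<le> 2 * sqrt (E m) * integral {m..c} (\<lambda>r. norm (F r))"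
        unfolding E_def by (rule component_energy_increment) (use 3 c m ab VS in \<open>auto simp: E_def[symmetric]\<close>)
      also have "\<dots> \<le> 2 * sqrt (E m) * integral {a..b} (\<lambda>r. norm (F r))"
        using c m ab E_nonneg by (intro mult_left_mono mono) auto
      finally show ?thesis using Ec by simp
    qed
  qed
  have "sqrt (E m) \<le> 2 * integral {a..b} (\<lambda>r. norm (F r))"
  proof (cases "E m = 0")
    case True then show ?thesis using J0 by simp
  next
    case False
    then have p: "0 < sqrt (E m)" using E_nonneg[of m] by simp
    have "sqrt (E m) * sqrt (E m) \<le> sqrt (E m) * (2 * integral {a..b} (\<lambda>r. norm (F r)))"
      using inc E_nonneg[of m] by (simp add: mult_ac)
    then show ?thesis using p by (simp only: mult_le_cancel_left_pos)
  qed
  moreover have "sqrt (E s) \<le> sqrt (E m)" using m s by (intro real_sqrt_le_mono) auto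
  ultimately show ?thesis by linarith
qed

text \<open>Pairing with the vector \<open>U s\<close> itself reduces the statement to the scalar
  fundamental theorem; one factor |U s| then cancels.\<close>

lemma position_from_zero:
  assumes ab: "0 \<le> a" "a \<le> b" "b \<le> T" and c: "c = a \<and> s = b \<or> c = b \<and> s = a" and Uc: "U c = 0"
  shows "norm (U s) \<le> integral {a..b} (\<lambda>r. norm (V r))"
proof -
  have sub: "{a..b} \<subseteq> {0..T}" using ab by auto
  have Vi: "(\<lambda>r. norm (V r)) integrable_on {a..b}"
    by (intro integrable_continuous_interval continuous_intros continuous_on_subset[OF V_cont sub])
  have fi: "((\<lambda>r. inner (V r) (U s)) has_integral (inner (U b) (U s) - inner (U a) (U s))) {a..b}"
  proof (rule fundamental_theorem_of_calculus[OF ab(2)])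
    fix x assume x: "x \<in> {a..b}"
    have "(U has_vector_derivative V x) (at x within {a..b})"
      using U_deriv[of x] x sub by (auto intro: has_vector_derivative_within_subset)
    from bounded_linear.has_vector_derivative[OF bounded_linear_inner_left this, of "U s"]
    show "((\<lambda>r. inner (U r) (U s)) has_vector_derivative inner (V x) (U s)) (at x within {a..b})" .
  qed
  have "(norm (U s))\<^sup>2 = \<bar>inner (U b) (U s) - inner (U a) (U s)\<bar>"
    using c Uc by (auto simp: power2_norm_eq_inner)
  also have "\<dots> = norm (integral {a..b} (\<lambda>r. inner (V r) (U s)))" using integral_unique[OF fi] by simp
  also have "\<dots> \<le> integral {a..b} (\<lambda>r. norm (V r) * norm (U s))"
    by (rule integral_norm_bound_integral[OF has_integral_integrable[OF fi]])
      (use Vi in \<open>auto intro: integrable_on_mult_left Cauchy_Schwarz_ineq2\<close>)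
  also have "\<dots> = norm (U s) * integral {a..b} (\<lambda>r. norm (V r))" by (simp add: mult.commute)
  finally have le: "norm (U s) * norm (U s) \<le> norm (U s) * integral {a..b} (\<lambda>r. norm (V r))" by (simp add: power2_eq_square)
  show ?thesis
  proof (cases "U s = 0")
    case True then show ?thesis using integral_nonneg[OF Vi] by simp
  next
    case False then show ?thesis using le by simp
  qed
qed

text \<open>The energy is one time integration away from the source, the position two. Each
  integration gains a factor of order 1 / (lam \<epsilon>)^2 in the squares, hence the fourth power
  for U, which carries lam^2 in the energy of the weighted solution.\<close>

lemma hardy_bounds:
  assumes \<epsilon>: "0 < \<epsilon>" "\<epsilon> \<le> T / 2" and lam: "0 < lam"
    and Uz: "\<And>t. t \<in> {T / 2 - \<epsilon><..<T / 2 + \<epsilon>} \<Longrightarrow> U t = 0"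
    and Gz: "\<And>t x. t \<in> {T / 2 - \<epsilon><..<T / 2 + \<epsilon>} \<Longrightarrow> G (t, x) = 0"
  defines "\<alpha> \<equiv> time_weight T 1 lam"
  shows "(\<integral>\<^sup>+t. ennreal (indicator {0<..<T} t * ((\<alpha> t)\<^sup>2 * E t)) \<partial>lborel)
      \<le> ennreal (2 / (lam * \<epsilon>)\<^sup>2) * (\<integral>\<^sup>+t. ennreal ((\<alpha> t)\<^sup>2 * (norm (F t))\<^sup>2) \<partial>lborel)"
    and "(\<integral>\<^sup>+t. ennreal (indicator {0<..<T} t * ((\<alpha> t)\<^sup>2 * (norm (U t))\<^sup>2)) \<partial>lborel)
      \<le> ennreal (1 / (lam * \<epsilon>) ^ 4) * (\<integral>\<^sup>+t. ennreal ((\<alpha> t)\<^sup>2 * (norm (F t))\<^sup>2) \<partial>lborel)"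
proof -
  have \<alpha>e: "\<alpha> t = exp (- lam * (t - T / 2)\<^sup>2)" for t by (simp add: \<alpha>_def time_weight_def)
  have ab: "0 \<le> T / 2 - \<epsilon>" "T / 2 + \<epsilon> \<le> T" using \<epsilon> by simp_all
  have vz: "V t = 0" "X t = 0" if "t \<in> {T / 2 - \<epsilon><..<T / 2 + \<epsilon>}" for t
    by (rule vanishing_interval[OF _ ab that], rule Uz, assumption)+
  have mid: "T / 2 \<in> {T / 2 - \<epsilon><..<T / 2 + \<epsilon>}" using \<epsilon> by simp
  have mem: "t \<in> {T / 2 - \<epsilon><..<T / 2 + \<epsilon>}" if "\<bar>t - T / 2\<bar> < \<epsilon>" for t using that by (auto simp: abs_less_iff)
  have E0: "E (T / 2) = 0" using vz[OF mid] by (simp add: E_def)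
  have Fz: "norm (F t) = 0" if "\<bar>t - T / 2\<bar> < \<epsilon>" for t
  proof -
    have "(norm (F t))\<^sup>2 = 0" unfolding norm_F using Gz[OF mem[OF that]] by simp
    then show ?thesis by simp
  qed
  define f1 where "f1 t = ennreal (indicator {0<..<T} t * sqrt (E t))" for t
  have f1: "f1 t \<le> ennreal 2 * (\<integral>\<^sup>+s. indicator {min (T / 2) t..max (T / 2) t} s * ennreal \<bar>norm (F s)\<bar> \<partial>lborel)" for t
  proof (cases "t \<in> {0<..<T}")
    case True
    let ?a = "min (T / 2) t" and ?b = "max (T / 2) t"
    have "sqrt (E t) \<le> 2 * integral {?a..?b} (\<lambda>r. norm (F r))"
      by (rule energy_from_zero[where c = "T / 2"]) (use True T0 E0 in auto)
    then have "f1 t \<le> ennreal (2 * integral {?a..?b} (\<lambda>r. norm (F r)))"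
      using True by (simp add: f1_def ennreal_leI)
    also have "\<dots> = ennreal 2 * ennreal (integral {?a..?b} (\<lambda>r. norm (F r)))" by (rule ennreal_mult') simp
    also have "ennreal (integral {?a..?b} (\<lambda>r. norm (F r))) = (\<integral>\<^sup>+s. indicator {?a..?b} s * ennreal (norm (F s)) \<partial>lborel)"
      by (rule nn_integral_hk[OF integrable_on_subinterval[OF norm_F_integrable]]) (use True T0 in auto)
    finally show ?thesis by simp
  qed (simp add: f1_def)
  define g2 where "g2 t = indicator {0<..<T} t * norm (V t)" for t
  have "continuous_on {0<..<T} (\<lambda>t. norm (V t))"
    by (intro continuous_intros continuous_on_subset[OF V_cont]) auto
  from borel_measurable_continuous_on_indicator[OF _ this]
  have g2m: "g2 \<in> borel_measurable borel" unfolding g2_def[abs_def] by simp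
  define f2 where "f2 t = ennreal (indicator {0<..<T} t * norm (U t))" for t
  have f2: "f2 t \<le> ennreal 1 * (\<integral>\<^sup>+s. indicator {min (T / 2) t..max (T / 2) t} s * ennreal \<bar>g2 s\<bar> \<partial>lborel)" for t
  proof (cases "t \<in> {0<..<T}")
    case True
    let ?a = "min (T / 2) t" and ?b = "max (T / 2) t"
    have sub: "{?a..?b} \<subseteq> {0<..<T}" using True T0 by auto
    have Vi: "(\<lambda>r. norm (V r)) integrable_on {?a..?b}"
      by (intro integrable_continuous_interval continuous_intros continuous_on_subset[OF V_cont]) (use sub in auto)
    have "norm (U t) \<le> integral {?a..?b} (\<lambda>r. norm (V r))"
      by (rule position_from_zero[where c = "T / 2"]) (use True T0 Uz[OF mid] in \<open>auto simp: min_def max_def\<close>)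
    then have "f2 t \<le> ennreal (integral {?a..?b} (\<lambda>r. norm (V r)))"
      using True by (simp add: f2_def ennreal_leI)
    also have "\<dots> = (\<integral>\<^sup>+s. indicator {?a..?b} s * ennreal (norm (V s)) \<partial>lborel)"
      by (rule nn_integral_hk[OF Vi]) simp
    also have "\<dots> = (\<integral>\<^sup>+s. indicator {?a..?b} s * ennreal \<bar>g2 s\<bar> \<partial>lborel)"
      by (intro nn_integral_cong) (use sub in \<open>auto simp: g2_def split: split_indicator\<close>)
    finally show ?thesis by simp
  qed (simp add: f2_def)
  have g2z: "g2 s = 0" if "\<bar>s - T / 2\<bar> < \<epsilon>" for s using vz(1)[OF mem[OF that]] by (simp add: g2_def)
  have h1: "(\<integral>\<^sup>+t. ennreal (indicator {0<..<T} t * ((\<alpha> t)\<^sup>2 * E t)) \<partial>lborel)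
      \<le> ennreal (2\<^sup>2 / (2 * (lam * \<epsilon>)\<^sup>2)) * (\<integral>\<^sup>+t. ennreal ((\<alpha> t)\<^sup>2 * (norm (F t))\<^sup>2) \<partial>lborel)"
  proof -
    have "ennreal (indicator {0<..<T} t * ((\<alpha> t)\<^sup>2 * E t)) = ennreal ((\<alpha> t)\<^sup>2) * (f1 t)\<^sup>2" for t
      using E_nonneg[of t] by (simp add: f1_def ennreal_power ennreal_mult[symmetric] split: split_indicator)
    then show ?thesis using time_hardy[OF norm_F_measurable Fz lam \<epsilon>(1) f1] unfolding \<alpha>e by simp
  qed
  then show "(\<integral>\<^sup>+t. ennreal (indicator {0<..<T} t * ((\<alpha> t)\<^sup>2 * E t)) \<partial>lborel)
      \<le> ennreal (2 / (lam * \<epsilon>)\<^sup>2) * (\<integral>\<^sup>+t. ennreal ((\<alpha> t)\<^sup>2 * (norm (F t))\<^sup>2) \<partial>lborel)" by simp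
  have "(\<integral>\<^sup>+t. ennreal (indicator {0<..<T} t * ((\<alpha> t)\<^sup>2 * (norm (U t))\<^sup>2)) \<partial>lborel) = (\<integral>\<^sup>+t. ennreal ((\<alpha> t)\<^sup>2) * (f2 t)\<^sup>2 \<partial>lborel)"
    by (intro nn_integral_cong) (simp add: f2_def ennreal_power ennreal_mult[symmetric] split: split_indicator)
  also have "\<dots> \<le> ennreal (1\<^sup>2 / (2 * (lam * \<epsilon>)\<^sup>2)) * (\<integral>\<^sup>+t. ennreal ((\<alpha> t)\<^sup>2 * (g2 t)\<^sup>2) \<partial>lborel)"
    using time_hardy[OF g2m g2z lam \<epsilon>(1) f2] unfolding \<alpha>e by simp
  also have "\<dots> \<le> ennreal (1\<^sup>2 / (2 * (lam * \<epsilon>)\<^sup>2)) * (\<integral>\<^sup>+t. ennreal (indicator {0<..<T} t * ((\<alpha> t)\<^sup>2 * E t)) \<partial>lborel)"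
    using \<gamma>0 by (intro mult_left_mono nn_integral_mono ennreal_leI)
      (auto simp: g2_def E_def intro!: mult_left_mono split: split_indicator)
  also have "\<dots> \<le> ennreal (1\<^sup>2 / (2 * (lam * \<epsilon>)\<^sup>2)) * (ennreal (2\<^sup>2 / (2 * (lam * \<epsilon>)\<^sup>2)) * (\<integral>\<^sup>+t. ennreal ((\<alpha> t)\<^sup>2 * (norm (F t))\<^sup>2) \<partial>lborel))"
    by (intro mult_left_mono h1) simp
  also have "\<dots> = ennreal (1 / (lam * \<epsilon>) ^ 4) * (\<integral>\<^sup>+t. ennreal ((\<alpha> t)\<^sup>2 * (norm (F t))\<^sup>2) \<partial>lborel)"
  proof -
    have "1\<^sup>2 / (2 * y\<^sup>2) * (2\<^sup>2 / (2 * y\<^sup>2)) = 1 / y ^ 4" for y :: real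
      by (cases "y = 0") (simp_all add: power2_eq_square power4_eq_xxxx)
    moreover have "ennreal (1\<^sup>2 / (2 * (lam * \<epsilon>)\<^sup>2)) * ennreal (2\<^sup>2 / (2 * (lam * \<epsilon>)\<^sup>2)) = ennreal (1\<^sup>2 / (2 * (lam * \<epsilon>)\<^sup>2) * (2\<^sup>2 / (2 * (lam * \<epsilon>)\<^sup>2)))"
      by (rule ennreal_mult[symmetric]) simp_all
    ultimately show ?thesis by (simp only: mult.assoc[symmetric])
  qed
  finally show "(\<integral>\<^sup>+t. ennreal (indicator {0<..<T} t * ((\<alpha> t)\<^sup>2 * (norm (U t))\<^sup>2)) \<partial>lborel)
      \<le> ennreal (1 / (lam * \<epsilon>) ^ 4) * (\<integral>\<^sup>+t. ennreal ((\<alpha> t)\<^sup>2 * (norm (F t))\<^sup>2) \<partial>lborel)" .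
qed

end

lemma l2c_zero_AE:
  assumes "v \<in> L2 {0<..<L}" "l2c L v = 0"
  shows "AE x in lebesgue_on {0<..<L}. v x = 0"
  using l2c_eq_iff[OF assms(1) L2_zero] assms(2) by (simp add: l2c_zero)

lemma integral_square_l2c:
  assumes "v \<in> L2 {0<..<L}"
  shows "integrable (lebesgue_on {0<..<L}) (\<lambda>x. (v x)\<^sup>2)" "(LINT x|lebesgue_on {0<..<L}. (v x)\<^sup>2) = (norm (l2c L v))\<^sup>2"
proof -
  show "integrable (lebesgue_on {0<..<L}) (\<lambda>x. (v x)\<^sup>2)" using assms by (simp add: L2_def)
  show "(LINT x|lebesgue_on {0<..<L}. (v x)\<^sup>2) = (norm (l2c L v))\<^sup>2"
    unfolding power2_norm_eq_inner inner_l2c[OF assms assms] L2_inner_def by (simp add: power2_eq_square)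
qed

context wave_component
begin

text \<open>The spatial weight is the constant 1, kept visible to match
  \<open>weighted_class\<close>. Its derivative is 0, so multiplication by this weight commutes with
  the coupling and there is nothing to recombine.\<close>

lemma flat_weighted_energy:
  assumes t: "t \<in> {0..T}" and lam: "0 \<le> lam"
  defines "w \<equiv> (\<lambda>t x. time_weight T 1 lam t * (1 * u t x))"
  shows "(\<integral>\<^sup>+x. indicator {0<..<L} x * ennreal ((w t x)\<^sup>2 + \<gamma> * (dx L (w t) x)\<^sup>2 + (dt L T w t x)\<^sup>2) \<partial>lborel)
    \<le> ennreal ((time_weight T 1 lam t)\<^sup>2 * (2 * E t + (1 + 2 * (lam * T)\<^sup>2) * (norm (U t))\<^sup>2))"
proof -
  let ?\<alpha> = "time_weight T 1 lam t"
  let ?f = "\<lambda>x. ?\<alpha>\<^sup>2 * (2 * ((dt L T u t x)\<^sup>2 + \<gamma> * (dx L (u t) x)\<^sup>2) + (1 + 2 * \<gamma> * 0\<^sup>2 + 2 * (lam * T)\<^sup>2) * (u t x)\<^sup>2)"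
  have b3: "\<bar>- lam * (1 * (2 * (t - T / 2))) * ?\<alpha> * 1\<bar> \<le> ?\<alpha> * (lam * T)"
  proof -
    have "\<bar>2 * (t - T / 2)\<bar> \<le> T" using t by (auto simp: abs_le_iff)
    then have "lam * \<bar>2 * (t - T / 2)\<bar> \<le> lam * T" using lam by (rule mult_left_mono)
    then have "(lam * \<bar>2 * (t - T / 2)\<bar>) * ?\<alpha> \<le> (lam * T) * ?\<alpha>" by (rule mult_right_mono) (simp add: time_weight_def)
    moreover have "0 \<le> ?\<alpha>" by (simp add: time_weight_def)
    ultimately show ?thesis using lam by (simp only: abs_mult abs_minus abs_of_nonneg mult_1 mult_1_right abs_one) (simp add: mult_ac)
  qed
  have wd: "AE x in lebesgue_on {0<..<L}. (w t x)\<^sup>2 + \<gamma> * (dx L (w t) x)\<^sup>2 + (dt L T w t x)\<^sup>2 \<le> ?f x"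
    unfolding w_def
    by (rule weighted_density[OF _ T0 smooth_const time_weight_deriv time_weight_deriv_cont t _ _ _ b3])
      (use u0 u1 \<gamma>0 in \<open>auto simp: time_weight_def\<close>)
  note I = integral_square_l2c[OF u_L2[OF t]] integral_square_l2c[OF dx_u_L2[OF t]] integral_square_l2c[OF dt_u_L2[OF t]]
  have "(\<integral>\<^sup>+x. indicator {0<..<L} x * ennreal ((w t x)\<^sup>2 + \<gamma> * (dx L (w t) x)\<^sup>2 + (dt L T w t x)\<^sup>2) \<partial>lborel)
    = (\<integral>\<^sup>+x. ennreal ((w t x)\<^sup>2 + \<gamma> * (dx L (w t) x)\<^sup>2 + (dt L T w t x)\<^sup>2) \<partial>lebesgue_on {0<..<L})"
    by (simp add: nn_lebesgue_on)
  also have "\<dots> \<le> (\<integral>\<^sup>+x. ennreal (?f x) \<partial>lebesgue_on {0<..<L})"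
    by (rule nn_integral_mono_AE, use wd in eventually_elim) (rule ennreal_leI)
  also have "\<dots> = ennreal (LINT x|lebesgue_on {0<..<L}. ?f x)"
    by (rule nn_integral_eq_integral) (use I \<gamma>0 in auto)
  also have "(LINT x|lebesgue_on {0<..<L}. ?f x) = ?\<alpha>\<^sup>2 * (2 * E t + (1 + 2 * (lam * T)\<^sup>2) * (norm (U t))\<^sup>2)"
    using I by (simp add: E_def U_def V_def X_def)
  finally show ?thesis .
qed

lemma weighted_square_measurable:
  "(\<lambda>t. ennreal (indicator {0<..<T} t * ((time_weight T 1 lam t)\<^sup>2 * E t))) \<in> borel_measurable borel"
  "(\<lambda>t. ennreal (indicator {0<..<T} t * ((time_weight T 1 lam t)\<^sup>2 * (norm (U t))\<^sup>2))) \<in> borel_measurable borel"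
proof -
  have a: "continuous_on {0<..<T} (time_weight T 1 lam)" unfolding time_weight_def[abs_def] by (intro continuous_intros)
  have "continuous_on {0<..<T} (\<lambda>t. (time_weight T 1 lam t)\<^sup>2 * E t)"
    by (intro continuous_intros a continuous_on_subset[OF E_cont]) auto
  from borel_measurable_continuous_on_indicator[OF _ this]
  show "(\<lambda>t. ennreal (indicator {0<..<T} t * ((time_weight T 1 lam t)\<^sup>2 * E t))) \<in> borel_measurable borel" by simp
  have "continuous_on {0<..<T} (\<lambda>t. (time_weight T 1 lam t)\<^sup>2 * (norm (U t))\<^sup>2)"
    by (intro continuous_intros a continuous_on_subset[OF U_cont]) auto
  from borel_measurable_continuous_on_indicator[OF _ this]
  show "(\<lambda>t. ennreal (indicator {0<..<T} t * ((time_weight T 1 lam t)\<^sup>2 * (norm (U t))\<^sup>2))) \<in> borel_measurable borel" by simp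
qed

lemma weighted_source_finite:
  assumes "0 \<le> lam"
  shows "(\<integral>\<^sup>+t. ennreal ((time_weight T 1 lam t)\<^sup>2 * (norm (F t))\<^sup>2) \<partial>lborel) < \<infinity>"
proof -
  have "(time_weight T 1 lam t)\<^sup>2 \<le> 1" for t
    using assms by (simp add: time_weight_def power_le_one)
  then have "(\<integral>\<^sup>+t. ennreal ((time_weight T 1 lam t)\<^sup>2 * (norm (F t))\<^sup>2) \<partial>lborel) \<le> (\<integral>\<^sup>+t. ennreal ((norm (F t))\<^sup>2) \<partial>lborel)"
    by (intro nn_integral_mono ennreal_leI mult_left_le_one_le) auto
  also have "\<dots> = ennreal (LINT t|lborel. (norm (F t))\<^sup>2)"
    by (rule nn_integral_eq_integral) (simp_all add: norm_F G_L2 integral_nonneg_AE)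
  finally show ?thesis by (rule order.strict_trans1) simp
qed

lemma weighted_source_section:
  assumes ae: "AE x in lebesgue_on {0<..<L}. c x = \<alpha> * G (t, x)"
  shows "ennreal (\<alpha>\<^sup>2 * (norm (F t))\<^sup>2) \<le> (\<integral>\<^sup>+x. indicator {0<..<L} x * ennreal ((c x)\<^sup>2) \<partial>lborel)"
proof -
  have "ennreal (\<alpha>\<^sup>2 * (norm (F t))\<^sup>2) = ennreal (LINT x|lborel. \<alpha>\<^sup>2 * (G (t, x))\<^sup>2)" by (simp add: norm_F)
  also have "\<dots> = (\<integral>\<^sup>+x. ennreal (\<alpha>\<^sup>2 * (G (t, x))\<^sup>2) \<partial>lborel)"
    by (rule nn_integral_eq_integral[symmetric]) (simp_all add: G_sec)
  also have "\<dots> = (\<integral>\<^sup>+x. ennreal (\<alpha>\<^sup>2 * (G (t, x))\<^sup>2) \<partial>lebesgue)" by (simp add: nn_integral_completion)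
  also have "\<dots> \<le> (\<integral>\<^sup>+x. indicator {0<..<L} x * ennreal ((c x)\<^sup>2) \<partial>lebesgue)"
  proof (rule nn_integral_mono_AE, use ae[unfolded AE_zext] in eventually_elim)
    case (elim x)
    show ?case
    proof (cases "x \<in> {0<..<L}")
      case True then show ?thesis using elim by (simp add: power_mult_distrib)
    next
      case False then show ?thesis using G_zero[of t x] by simp
    qed
  qed
  finally show ?thesis by (simp only: nn_integral_completion)
qed

end

text \<open>The solution vanishes in a full slab around T/2, so the weighted estimate holds on all
  of (0, T) without cutoff and leaves no remainder. A single sufficiently large lam is therefore
  enough, and no limit is taken.\<close>

lemma slab_vanishing_spreads:
  fixes u :: "'n::finite \<Rightarrow> real \<Rightarrow> real \<Rightarrow> real"
  assumes L: "0 < L" and T: "0 < T" and \<gamma>: "\<And>i. 0 < \<gamma> i" and adm: "admissible_coupling L \<gamma> p q"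
    and sol: "weak_solution L T \<gamma> p q u0 u1 u" and \<epsilon>: "0 < \<epsilon>" "\<epsilon> \<le> T / 2"
    and Uz: "\<And>i t. t \<in> {T / 2 - \<epsilon><..<T / 2 + \<epsilon>} \<Longrightarrow> l2c L (u i t) = 0"
    and t: "t \<in> {0..T}" and x: "x \<in> {0..L}"
  shows "u i t x = 0"
proof -
  have cl: "u j \<in> C0_H10 L T \<inter> C1_L2 L T" for j using sol unfolding weak_solution_def by blast
  have H1: "u j t \<in> H1 L" if "t \<in> {0..T}" for j t using cl[of j] that by (intro C0_H10_H1[of "u j"]) auto
  obtain C where C: "0 < C" "\<And>w i. (\<And>j. w j \<in> C0_H10 L T \<inter> C1_L2 L T) \<Longrightarrow> coupling L p q w i \<in> L2_L2 L T"
    "\<And>w i. (\<And>j. w j \<in> C0_H10 L T \<inter> C1_L2 L T) \<Longrightarrow>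
      (\<integral>\<^sup>+t. indicator {0<..<T} t * (\<integral>\<^sup>+x. indicator {0<..<L} x * ennreal ((coupling L p q w i t x)\<^sup>2) \<partial>lborel) \<partial>lborel)
      \<le> ennreal C * (\<integral>\<^sup>+t. indicator {0<..<T} t * ennreal (energy L T \<gamma> w t) \<partial>lborel)"
    using coupling_bound[OF adm T \<gamma>] by blast
  let ?N = "{T / 2 - \<epsilon><..<T / 2 + \<epsilon>} \<times> (UNIV :: real set)"
  have "\<forall>i. \<exists>G. square_integrable_version L T ?N (coupling L p q u i) G"
  proof (rule allI, rule coupling_version[OF C(2)[of u, OF cl]])
    show "open ?N" by (intro open_Times) auto
    fix i t assume t: "t \<in> {0<..<T}"
    show "AE x in lebesgue_on {0<..<L}. (t, x) \<in> ?N \<longrightarrow> coupling L p q u i t x = 0"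
    proof (cases "t \<in> {T / 2 - \<epsilon><..<T / 2 + \<epsilon>}")
      case True
      have t': "t \<in> {0..T}" using t by simp
      have "AE x in lebesgue_on {0<..<L}. \<forall>j. u j t x = 0"
        by (rule eventually_all_finite) (rule l2c_zero_AE[OF H1_L2[OF H1[OF t']] Uz[OF True]])
      moreover have "AE x in lebesgue_on {0<..<L}. \<forall>j. dx L (u j t) x = 0"
        by (rule eventually_all_finite) (rule l2c_zero_AE[OF dx_L2[OF H1[OF t']] dx_zero[OF H1[OF t'] Uz[OF True]]])
      ultimately show ?thesis by eventually_elim (simp add: coupling_def)
    qed auto
  qed
  from choice[OF this] obtain G where "\<forall>i. square_integrable_version L T ?N (coupling L p q u i) (G i)" ..
  then have "square_integrable_version L T ?N (coupling L p q u i) (G i)" for i by simp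
  note G = square_integrable_versionD[OF this]
  have wc: "wave_component L T (\<gamma> i) (u i) (G i)" for i
    by (rule weak_solution_component[OF L T \<gamma> sol G(1) G(2) G(4) G(5) G(6)])
  let ?U = "\<lambda>i. wave_component.U L (u i)" and ?E = "\<lambda>i. wave_component.E L T (\<gamma> i) (u i)" and ?F = "\<lambda>i. wave_component.F L (G i)"
  have U: "?U i t = l2c L (u i t)" for i t by (rule wave_component.U_def[OF wc])
  define n where "n = real CARD('n)"
  have n1: "1 \<le> n" by (simp add: n_def Suc_leI)
  \<comment> \<open>C times the sum of the two contributions with lam^2 factored out: 2 times 2 /
    (lam \<epsilon>)^2 from the energy, and 1 + 2 (lam T)^2 times 1 / (lam \<epsilon>)^4 from the
    position.\<close>
  define A where "A = C * (4 / \<epsilon>\<^sup>2 + (1 + 2 * T\<^sup>2) / \<epsilon> ^ 4)"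
  have A0: "0 \<le> A" using C(1) \<epsilon> by (simp add: A_def)
  \<comment> \<open>One factor n comes from the sum of the n equal coefficients A / lam^2, the other
    from summing the inequalities over the components.\<close>
  define lam where "lam = max 1 (2 * n * n * A)"
  have l1: "1 \<le> lam" and l2: "2 * n * n * A \<le> lam" by (simp_all add: lam_def)
  have l0: "0 < lam" "0 \<le> lam" using l1 by simp_all
  have lsq: "lam \<le> lam\<^sup>2" "1 \<le> lam\<^sup>2"
    using mult_left_mono[OF l1 l0(2)] one_le_power[OF l1, of 2] by (simp_all only: power2_eq_square mult_1_right)
  let ?\<alpha> = "time_weight T 1 lam"
  define \<Phi> where "\<Phi> i = (\<integral>\<^sup>+t. ennreal ((?\<alpha> t)\<^sup>2 * (norm (?F i t))\<^sup>2) \<partial>lborel)" for i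
  have hb: "(\<integral>\<^sup>+t. ennreal (indicator {0<..<T} t * ((?\<alpha> t)\<^sup>2 * ?E i t)) \<partial>lborel) \<le> ennreal (2 / (lam * \<epsilon>)\<^sup>2) * \<Phi> i"
    "(\<integral>\<^sup>+t. ennreal (indicator {0<..<T} t * ((?\<alpha> t)\<^sup>2 * (norm (?U i t))\<^sup>2)) \<partial>lborel) \<le> ennreal (1 / (lam * \<epsilon>) ^ 4) * \<Phi> i" for i
    unfolding \<Phi>_def by (rule wave_component.hardy_bounds[OF wc \<epsilon> l0(1)], simp add: U Uz, rule G(3), simp)+
  let ?w = "\<lambda>j t x. ?\<alpha> t * (1 * u j t x)"
  have w: "?w j \<in> C0_H10 L T \<inter> C1_L2 L T" for j
    by (rule weighted_class(1)[OF cl T smooth_const time_weight_deriv time_weight_deriv_cont])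
  have en: "(\<integral>\<^sup>+t. indicator {0<..<T} t * ennreal (energy L T \<gamma> ?w t) \<partial>lborel) \<le> (\<Sum>j\<in>UNIV. ennreal (A / C / lam\<^sup>2) * \<Phi> j)"
  proof -
    let ?k = "1 + 2 * (lam * T)\<^sup>2"
    let ?g = "\<lambda>j t. ennreal 2 * ennreal (indicator {0<..<T} t * ((?\<alpha> t)\<^sup>2 * ?E j t)) + ennreal ?k * ennreal (indicator {0<..<T} t * ((?\<alpha> t)\<^sup>2 * (norm (?U j t))\<^sup>2))"
    note [measurable] = wave_component.weighted_square_measurable[OF wc]
    have "(\<integral>\<^sup>+t. indicator {0<..<T} t * ennreal (energy L T \<gamma> ?w t) \<partial>lborel) \<le> (\<integral>\<^sup>+t. (\<Sum>j\<in>UNIV. ?g j t) \<partial>lborel)"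
    proof (rule nn_integral_mono)
      fix t
      show "indicator {0<..<T} t * ennreal (energy L T \<gamma> ?w t) \<le> (\<Sum>j\<in>UNIV. ?g j t)"
      proof (cases "t \<in> {0<..<T}")
        case True
        then have t: "t \<in> {0..T}" by simp
        have "ennreal (energy L T \<gamma> ?w t) \<le> (\<Sum>j\<in>UNIV. ennreal ((?\<alpha> t)\<^sup>2 * (2 * ?E j t + ?k * (norm (?U j t))\<^sup>2)))"
          by (rule order_trans[OF energy_nn[OF \<gamma>] sum_mono]) (rule wave_component.flat_weighted_energy[OF wc t l0(2)])
        also have "\<dots> = (\<Sum>j\<in>UNIV. ?g j t)"
        proof (rule sum.cong[OF refl])
          fix j
          have e0: "0 \<le> (?\<alpha> t)\<^sup>2 * ?E j t" using wave_component.E_nonneg[OF wc, of j t] by simp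
          have "(?\<alpha> t)\<^sup>2 * (2 * ?E j t + ?k * (norm (?U j t))\<^sup>2) = 2 * ((?\<alpha> t)\<^sup>2 * ?E j t) + ?k * ((?\<alpha> t)\<^sup>2 * (norm (?U j t))\<^sup>2)"
            by (simp only: distrib_left mult_ac)
          moreover have "ennreal 2 * ennreal ((?\<alpha> t)\<^sup>2 * ?E j t) + ennreal ?k * ennreal ((?\<alpha> t)\<^sup>2 * (norm (?U j t))\<^sup>2)
            = ennreal (2 * ((?\<alpha> t)\<^sup>2 * ?E j t) + ?k * ((?\<alpha> t)\<^sup>2 * (norm (?U j t))\<^sup>2))"
            by (rule ennreal_linear_combination(2)[OF e0 order_refl _ order_refl]) auto
          ultimately show "ennreal ((?\<alpha> t)\<^sup>2 * (2 * ?E j t + ?k * (norm (?U j t))\<^sup>2)) = ?g j t"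
            using True by (simp only: indicator_simps mult_1)
        qed
        finally show ?thesis using True by simp
      qed simp
    qed
    also have "\<dots> = (\<Sum>j\<in>UNIV. \<integral>\<^sup>+t. ?g j t \<partial>lborel)" by (rule nn_integral_sum) measurable
    also have "\<dots> = (\<Sum>j\<in>UNIV. ennreal 2 * (\<integral>\<^sup>+t. ennreal (indicator {0<..<T} t * ((?\<alpha> t)\<^sup>2 * ?E j t)) \<partial>lborel)
       + ennreal ?k * (\<integral>\<^sup>+t. ennreal (indicator {0<..<T} t * ((?\<alpha> t)\<^sup>2 * (norm (?U j t))\<^sup>2)) \<partial>lborel))"
    proof (rule sum.cong[OF refl])
      fix j
      have m: "(\<lambda>t. ennreal (indicator {0<..<T} t * ((?\<alpha> t)\<^sup>2 * ?E j t))) \<in> borel_measurable lborel"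
        "(\<lambda>t. ennreal (indicator {0<..<T} t * ((?\<alpha> t)\<^sup>2 * (norm (?U j t))\<^sup>2))) \<in> borel_measurable lborel"
        using wave_component.weighted_square_measurable[OF wc] by simp_all
      have "(\<integral>\<^sup>+t. ?g j t \<partial>lborel) = (\<integral>\<^sup>+t. ennreal 2 * ennreal (indicator {0<..<T} t * ((?\<alpha> t)\<^sup>2 * ?E j t)) \<partial>lborel)
        + (\<integral>\<^sup>+t. ennreal ?k * ennreal (indicator {0<..<T} t * ((?\<alpha> t)\<^sup>2 * (norm (?U j t))\<^sup>2)) \<partial>lborel)"
        by (rule nn_integral_add) (intro borel_measurable_times_ennreal m borel_measurable_const)+
      then show "(\<integral>\<^sup>+t. ?g j t \<partial>lborel) = ennreal 2 * (\<integral>\<^sup>+t. ennreal (indicator {0<..<T} t * ((?\<alpha> t)\<^sup>2 * ?E j t)) \<partial>lborel)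
        + ennreal ?k * (\<integral>\<^sup>+t. ennreal (indicator {0<..<T} t * ((?\<alpha> t)\<^sup>2 * (norm (?U j t))\<^sup>2)) \<partial>lborel)"
        by (simp only: nn_integral_cmult[OF m(1)] nn_integral_cmult[OF m(2)])
    qed
    also have "\<dots> \<le> (\<Sum>j\<in>UNIV. ennreal 2 * (ennreal (2 / (lam * \<epsilon>)\<^sup>2) * \<Phi> j) + ennreal ?k * (ennreal (1 / (lam * \<epsilon>) ^ 4) * \<Phi> j))"
      by (intro sum_mono add_mono mult_left_mono hb) simp_all
    also have "\<dots> \<le> (\<Sum>j\<in>UNIV. ennreal (A / C / lam\<^sup>2) * \<Phi> j)"
    proof (rule sum_mono)
      fix j
      have "ennreal 2 * (ennreal (2 / (lam * \<epsilon>)\<^sup>2) * \<Phi> j) + ennreal ?k * (ennreal (1 / (lam * \<epsilon>) ^ 4) * \<Phi> j)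
        = (ennreal 2 * ennreal (2 / (lam * \<epsilon>)\<^sup>2) + ennreal ?k * ennreal (1 / (lam * \<epsilon>) ^ 4)) * \<Phi> j"
        by (simp only: distrib_right mult.assoc)
      also have "ennreal 2 * ennreal (2 / (lam * \<epsilon>)\<^sup>2) + ennreal ?k * ennreal (1 / (lam * \<epsilon>) ^ 4) = ennreal (2 * (2 / (lam * \<epsilon>)\<^sup>2) + ?k * (1 / (lam * \<epsilon>) ^ 4))"
        by (rule ennreal_linear_combination(2)[OF _ order_refl _ order_refl]) auto
      also have "\<dots> * \<Phi> j \<le> ennreal (A / C / lam\<^sup>2) * \<Phi> j"
      proof (intro mult_right_mono ennreal_leI)
        have "?k \<le> lam\<^sup>2 * (1 + 2 * T\<^sup>2)" using lsq by (simp add: power_mult_distrib distrib_left)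
        then have "?k * (1 / (lam * \<epsilon>) ^ 4) \<le> (lam\<^sup>2 * (1 + 2 * T\<^sup>2)) * (1 / (lam * \<epsilon>) ^ 4)" by (rule mult_right_mono) simp
        also have "\<dots> = (1 + 2 * T\<^sup>2) / \<epsilon> ^ 4 / lam\<^sup>2"
          using l0 \<epsilon> by (simp add: power_mult_distrib power2_eq_square power4_eq_xxxx field_simps)
        finally have "2 * (2 / (lam * \<epsilon>)\<^sup>2) + ?k * (1 / (lam * \<epsilon>) ^ 4) \<le> 4 / \<epsilon>\<^sup>2 / lam\<^sup>2 + (1 + 2 * T\<^sup>2) / \<epsilon> ^ 4 / lam\<^sup>2"
          by (simp add: power_mult_distrib mult_ac)
        also have "\<dots> = A / C / lam\<^sup>2" using C(1) by (simp add: A_def add_divide_distrib)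
        finally show "2 * (2 / (lam * \<epsilon>)\<^sup>2) + ?k * (1 / (lam * \<epsilon>) ^ 4) \<le> A / C / lam\<^sup>2" .
      qed simp
      finally show "ennreal 2 * (ennreal (2 / (lam * \<epsilon>)\<^sup>2) * \<Phi> j) + ennreal ?k * (ennreal (1 / (lam * \<epsilon>) ^ 4) * \<Phi> j) \<le> ennreal (A / C / lam\<^sup>2) * \<Phi> j" .
    qed
    finally show ?thesis .
  qed
  have src: "\<Phi> i \<le> (\<integral>\<^sup>+t. indicator {0<..<T} t * (\<integral>\<^sup>+x. indicator {0<..<L} x * ennreal ((coupling L p q ?w i t x)\<^sup>2) \<partial>lborel) \<partial>lborel)" for i
  proof -
    have "\<Phi> i = (\<integral>\<^sup>+t. ennreal ((?\<alpha> t)\<^sup>2 * (norm (?F i t))\<^sup>2) \<partial>lebesgue)" by (simp add: \<Phi>_def nn_integral_completion)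
    also have "\<dots> \<le> (\<integral>\<^sup>+t. indicator {0<..<T} t * (\<integral>\<^sup>+x. indicator {0<..<L} x * ennreal ((coupling L p q ?w i t x)\<^sup>2) \<partial>lborel) \<partial>lebesgue)"
    proof (rule nn_integral_mono_AE, use G(6)[of i, unfolded AE_zext[where L = T]] in eventually_elim)
      case (elim t)
      show ?case
      proof (cases "t \<in> {0<..<T}")
        case True
        then have t: "t \<in> {0..T}" by simp
        have "AE x in lebesgue_on {0<..<L}. coupling L p q ?w i t x =
          ?\<alpha> t * 1 * coupling L p q u i t x + ?\<alpha> t * deriv (\<lambda>x. 1) x * (\<Sum>j\<in>UNIV. p i j t x * u j t x)"
          by (rule weighted_coupling[OF cl T smooth_const time_weight_deriv time_weight_deriv_cont t])
        with elim[rule_format, OF True] have "AE x in lebesgue_on {0<..<L}. coupling L p q ?w i t x = ?\<alpha> t * G i (t, x)"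
          by eventually_elim simp
        from wave_component.weighted_source_section[OF wc this] show ?thesis using True by simp
      next
        case False
        then have "(norm (?F i t))\<^sup>2 = 0" unfolding wave_component.norm_F[OF wc] using G(2)[of t] by simp
        then show ?thesis by simp
      qed
    qed
    finally show ?thesis by (simp only: nn_integral_completion)
  qed
  \<comment> \<open>Absorption with remainder 0 forces the weighted sources to vanish.\<close>
  have "\<Phi> i \<le> ennreal (2 * real CARD('n) * 0)" for i
  proof (rule sum_system_bound[where A = "\<lambda>j. A / lam\<^sup>2"])
    fix i
    have "\<Phi> i \<le> ennreal C * (\<Sum>j\<in>UNIV. ennreal (A / C / lam\<^sup>2) * \<Phi> j)"
      by (rule order_trans[OF order_trans[OF src C(3)[of ?w, OF w]] mult_left_mono[OF en]]) simp
    also have "\<dots> = (\<Sum>j\<in>UNIV. ennreal (A / lam\<^sup>2) * \<Phi> j)"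
      unfolding sum_distrib_left mult.assoc[symmetric]
      using C(1) A0 by (subst ennreal_mult[symmetric]) auto
    finally show "\<Phi> i \<le> (\<Sum>j\<in>UNIV. ennreal (A / lam\<^sup>2) * \<Phi> j) + ennreal 0" by simp
    show "\<Phi> i < \<infinity>" unfolding \<Phi>_def by (rule wave_component.weighted_source_finite[OF wc l0(2)])
    show "0 \<le> A / lam\<^sup>2" using A0 by simp
    have "2 * n * n * A \<le> lam\<^sup>2" using l2 lsq by linarith
    then have "2 * n * n * A / lam\<^sup>2 \<le> 1" using l0 by simp
    then show "real CARD('n) * (\<Sum>j::'n\<in>UNIV. A / lam\<^sup>2) \<le> 1 / 2" by (simp add: n_def[symmetric] mult_ac)
  qed simp
  then have \<Phi>0: "\<Phi> i = 0" by simp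
  have "(\<integral>\<^sup>+t. indicator {0<..<T} t * ennreal ((?\<alpha> t)\<^sup>2 * (norm (?U i t))\<^sup>2) \<partial>lborel) = 0"
  proof -
    have "(\<integral>\<^sup>+t. indicator {0<..<T} t * ennreal ((?\<alpha> t)\<^sup>2 * (norm (?U i t))\<^sup>2) \<partial>lborel)
      = (\<integral>\<^sup>+t. ennreal (indicator {0<..<T} t * ((?\<alpha> t)\<^sup>2 * (norm (?U i t))\<^sup>2)) \<partial>lborel)"
      by (intro nn_integral_cong) (simp split: split_indicator)
    then show ?thesis using hb(2)[of i] \<Phi>0 by simp
  qed
  moreover have "continuous_on {0..T} (\<lambda>t. (?\<alpha> t)\<^sup>2 * (norm (?U i t))\<^sup>2)"
    unfolding time_weight_def by (intro continuous_intros wave_component.U_cont[OF wc])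
  ultimately have "\<forall>t\<in>{0..T}. (?\<alpha> t)\<^sup>2 * (norm (?U i t))\<^sup>2 = 0"
    by (intro nn_zero_continuous[OF T]) auto
  \<comment> \<open>The weight is positive. As \<open>H10\<close> consists of continuous
    representatives, vanishing almost everywhere then extends to every point of [0, L].\<close>
  then have "l2c L (u i t) = 0" using t by (auto simp: time_weight_def U)
  from l2c_zero_AE[OF H1_L2[OF H1[OF t]] this]
  have "AE x in lborel. x \<in> {0<..<L} \<longrightarrow> u i t x = 0" unfolding AE_zext by (simp add: AE_completion_iff)
  moreover have "continuous_on {0..L} (u i t)"
    using cl[of i] t C0_H10_H10[of "u i" L T t] by (simp add: H10_def)
  ultimately have "\<forall>x\<in>{0..L}. u i t x = 0" by (intro ae_zero_continuous[OF L])
  then show ?thesis using x by blast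
qed

theorem theorem3p2:
  fixes L :: real and \<gamma> :: "'n::finite \<Rightarrow> real"
    and p q :: "'n \<Rightarrow> 'n \<Rightarrow> real \<Rightarrow> real \<Rightarrow> real" and I :: "real set"
  assumes "L > 0" and "\<And>i. \<gamma> i > 0"
    and "admissible_coupling L \<gamma> p q"
    and "open I" and "is_interval I" and "I \<inter> {0..L} \<noteq> {}"
  shows "\<exists>T0>0. \<forall>T\<ge>T0. \<forall>u u0 u1.
    weak_solution L T \<gamma> p q u0 u1 u \<longrightarrow>
    (\<forall>i. \<forall>t\<in>{0..T}. \<forall>x\<in>I \<inter> {0..L}. u i t x = 0) \<longrightarrow>
    (\<forall>i. \<forall>t\<in>{0..T}. \<forall>x\<in>{0..L}. u i t x = 0)"
proof -
  \<comment> \<open>An open set meeting the closure of (0, L) meets (0, L); this covers the case in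
    which I reaches [0, L] only near an endpoint.\<close>
  have "I \<inter> closure {0<..<L} \<noteq> {}" using assms(1,6) by simp
  then have "I \<inter> {0<..<L} \<noteq> {}" using open_Int_closure_eq_empty[OF assms(4)] by blast
  then obtain x0 where "x0 \<in> I \<inter> {0<..<L}" by blast
  moreover have "open (I \<inter> {0<..<L})" using assms(4) by (intro open_Int) auto
  ultimately obtain \<delta> where \<delta>: "0 < \<delta>" and sub: "cball x0 \<delta> \<subseteq> I \<inter> {0<..<L}"
    using open_contains_cball by blast
  have mem: "x \<in> I \<and> 0 < x \<and> x < L" if "x0 - \<delta> \<le> x" "x \<le> x0 + \<delta>" for x
  proof -
    have "x \<in> cball x0 \<delta>" using that by (auto simp: dist_real_def)
    then show ?thesis using sub by auto
  qed
  have x0: "0 < x0 - \<delta>" "x0 + \<delta> < L" using mem[of "x0 - \<delta>"] mem[of "x0 + \<delta>"] \<delta> by auto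
  have \<delta>L: "\<delta> \<le> L" using x0 \<delta> by linarith
  \<comment> \<open>The smallest wave speed; one weight has to suit all components.\<close>
  define c where "c = Min (range (\<lambda>i. sqrt (\<gamma> i)))"
  have c: "c \<le> sqrt (\<gamma> i)" for i unfolding c_def by (rule Min_le) auto
  have c0: "0 < c" unfolding c_def using assms(2) by (subst Min_gr_iff) auto
  \<comment> \<open>With \<kappa> T = \<delta> c, the requirement 2 L^2 <= \<kappa> (T / 4)^2 reads
    T >= 32 L^2 / (\<delta> c). As \<delta> is at most L, this also keeps every crossing time below
    T / 4.\<close>
  show ?thesis
  proof (intro exI[of _ "32 * L\<^sup>2 / (\<delta> * c)"] conjI allI impI)
    show "0 < 32 * L\<^sup>2 / (\<delta> * c)" using assms(1) \<delta> c0 by simp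
    fix T u u0 u1
    assume TT: "32 * L\<^sup>2 / (\<delta> * c) \<le> T" and sol: "weak_solution L T \<gamma> p q u0 u1 u"
      and uz: "\<forall>i. \<forall>t\<in>{0..T}. \<forall>x\<in>I \<inter> {0..L}. u i t x = 0"
    have "0 < 32 * L\<^sup>2 / (\<delta> * c)" using assms(1) \<delta> c0 by simp
    then have T: "0 < T" using TT by linarith
    have Tc: "32 * L\<^sup>2 \<le> T * (\<delta> * c)" using TT \<delta> c0 by (simp add: pos_divide_le_eq)
    define \<kappa> where "\<kappa> = \<delta> * c / T"
    have \<kappa>0: "0 < \<kappa>" using \<delta> c0 T by (simp add: \<kappa>_def)
    have \<kappa>T: "\<kappa> * T = \<delta> * c" using T by (simp add: \<kappa>_def)
    \<comment> \<open>Half the width of the slab; the second entry is where \<kappa> \<epsilon>^2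
      reaches L^2 / 2.\<close>
    define \<epsilon> where "\<epsilon> = min (T / 4) (L / sqrt (2 * \<kappa>))"
    have \<epsilon>: "0 < \<epsilon>" "\<epsilon> \<le> T / 4" using T assms(1) \<kappa>0 by (simp add: \<epsilon>_def, simp only: \<epsilon>_def min.cobounded1)
    have "\<epsilon>\<^sup>2 \<le> (L / sqrt (2 * \<kappa>))\<^sup>2" using \<epsilon>(1) by (intro power_mono) (simp_all add: \<epsilon>_def)
    then have "\<kappa> * \<epsilon>\<^sup>2 \<le> \<kappa> * (L / sqrt (2 * \<kappa>))\<^sup>2" using \<kappa>0 by simp
    also have "\<dots> = L\<^sup>2 / 2" using \<kappa>0 by (simp add: power_divide)
    finally have \<kappa>\<epsilon>: "\<kappa> * \<epsilon>\<^sup>2 \<le> L\<^sup>2 / 2" .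
    have h1: "\<kappa> * T \<le> \<delta> * sqrt (\<gamma> i)" for i using c[of i] \<delta> by (simp add: \<kappa>T)
    have h2: "2 * L\<^sup>2 \<le> \<kappa> * (T / 4)\<^sup>2"
    proof -
      have "\<kappa> * (T / 4)\<^sup>2 = (\<kappa> * T) * T / 16" by (simp add: power_divide power2_eq_square)
      then have e: "\<kappa> * (T / 4)\<^sup>2 = \<delta> * c * T / 16" by (simp only: \<kappa>T)
      show ?thesis unfolding e using Tc by (simp add: mult_ac)
    qed
    have h3: "L / sqrt (\<gamma> i) \<le> T / 4" for i
    proof -
      have "32 * L * L \<le> T * c * L"
      proof -
        have "32 * L * L \<le> (T * c) * \<delta>" using Tc by (simp add: power2_eq_square mult_ac)
        also have "\<dots> \<le> (T * c) * L" using T c0 by (intro mult_left_mono \<delta>L) auto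
        finally show ?thesis .
      qed
      then have "32 * L \<le> T * c" using assms(1) by simp
      also have "\<dots> \<le> T * sqrt (\<gamma> i)" using T c by simp
      finally have "4 * L \<le> T * sqrt (\<gamma> i)" using assms(1) by linarith
      then show ?thesis using assms(2)[of i] by (simp add: field_simps)
    qed
    have z: "(\<integral>\<^sup>+t. indicator {T / 2 - \<epsilon><..<T / 2 + \<epsilon>} t * ennreal ((norm (l2c L (u i t)))\<^sup>2) \<partial>lborel) = 0" for i
    proof (rule middle_vanishing[OF assms(1) T assms(2) assms(3) sol \<delta> x0 _ \<kappa>0 h1 h2 h3 \<epsilon>(2) \<kappa>\<epsilon>])
      fix i t x assume "t \<in> {0..T}" "x \<in> {x0 - \<delta><..<x0 + \<delta>}"
      then show "u i t x = 0" using uz mem[of x] by auto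
    qed
    have U0: "l2c L (u i t) = 0" if t: "t \<in> {T / 2 - \<epsilon><..<T / 2 + \<epsilon>}" for i t
    proof -
      have "u i \<in> C0_H10 L T" using sol unfolding weak_solution_def by blast
      then have "continuous_on {0..T} (\<lambda>t. l2c L (u i t))" by (rule C0_H10_continuous)
      then have "continuous_on {T / 2 - \<epsilon>..T / 2 + \<epsilon>} (\<lambda>t. (norm (l2c L (u i t)))\<^sup>2)"
        using \<epsilon> T by (intro continuous_intros) (auto elim: continuous_on_subset)
      then have "\<forall>t\<in>{T / 2 - \<epsilon>..T / 2 + \<epsilon>}. (norm (l2c L (u i t)))\<^sup>2 = 0"
        by (intro nn_zero_continuous z) (use \<epsilon> in auto)
      then show ?thesis using t by simp
    qed
    fix i :: 'n
    show "\<forall>t\<in>{0..T}. \<forall>x\<in>{0..L}. u i t x = 0"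
      using slab_vanishing_spreads[OF assms(1) T assms(2) assms(3) sol \<epsilon>(1) _ U0] \<epsilon> T by auto
  qed
qed

end
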